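(* Let $\hat R_{VV}=\tau_{VV}\circ\tilde f^{1/2}\circ\Theta\circ\tilde f^{1/2}\colon V\otimes V\to V\otimes V$ be the $U_q(\mathfrak{osp}(V))$-module isomorphism given by the universal $R$-matrix, for the first fundamental $U_q(\mathfrak{osp}(V))$-module $V$ (all defined in the context). Then $\hat R_{VV}=\tau_{VV}\circ R_0$ and $\hat R_{VV}^{-1}=\tau_{VV}\circ R_\infty$, where $$R_0=\mathrm{I}+(q^{-1/2}-q^{1/2})\sum_{i=1}^N(-1)^{\bar i}E_{ii}\otimes\Big(q^{-(\varepsilon_i,\varepsilon_i)/2}E_{ii}-q^{(\varepsilon_i,\varepsilon_i)/2}E_{i'i'}\Big)+(q^{-1}-q)\sum_{i<j}(-1)^{\bar j}E_{ij}\otimes\Big(E_{ji}-(-1)^{\bar j(\bar i+\bar j)}\vartheta_i\vartheta_j q^{(\rho,\varepsilon_i-\varepsilon_j)}E_{i'j'}\Big)$$ and $$R_\infty=\mathrm{I}+(q^{1/2}-q^{-1/2})\sum_{i=1}^N(-1)^{\bar i}E_{ii}\otimes\Big(q^{(\varepsilon_i,\varepsilon_i)/2}E_{ii}-q^{-(\varepsilon_i,\varepsilon_i)/2}E_{i'i'}\Big)+(q-q^{-1})\sum_{i>j}(-1)^{\bar j}E_{ij}\otimes\Big(E_{ji}-(-1)^{\bar j(\bar i+\bar j)}\vartheta_i\vartheta_j q^{(\rho,\varepsilon_i-\varepsilon_j)}E_{i'j'}\Big).$$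
   Context: **Setup.** Fix integers $m,n\ge0$ with $n$ even, $N=m+n>2$, $s=\lfloor N/2\rfloor$, and $i'=N+1-i$ for $1\le i\le N$. Let $K=\mathbb C(q^{1/2})$. $V$ is a superspace over $K$ with homogeneous basis $v_1,\dots,v_N$, $m$ of them even and $n$ odd; $\bar i\in\{0,1\}$ is the parity of $v_i$, and $\bar i=\overline{i'}$ for all $i$ (otherwise parities are arbitrary). Fix signs $\vartheta_i\in\{\pm1\}$ with $\vartheta_i=1$ if $\bar i=0$ and $\vartheta_i=-\vartheta_{i'}$ if $\bar i=1$. $E_{ij}$ are the matrix units, of parity $\bar i+\bar j$; $\mathrm I$ is the identity. Tensor products are graded: $(x\otimes y)(x'\otimes y')=(-1)^{|y||x'|}xx'\otimes yy'$ and $(X\otimes Y)(v\otimes w)=(-1)^{|Y||v|}Xv\otimes Yw$. $\tau(x\otimes y)=(-1)^{|x||y|}y\otimes x$, and $\tau_{VV}$ is $\tau$ on $V\otimes V$. Put $X_{ij}=E_{ij}-(-1)^{\bar i(\bar i+\bar j)}\vartheta_i\vartheta_jE_{j'i'}$. **Roots.** $\varepsilon_1,\dots,\varepsilon_s$ are linearly independent with $(\varepsilon_i,\varepsilon_j)=\delta_{ij}(-1)^{\bar i}$ for $i,j\le s$; $\varepsilon_{i'}=-\varepsilon_i$ and $\varepsilon_{s+1}=0$ if $N$ is odd. Positive roots: $\Phi^+=\{\varepsilon_a-\varepsilon_b: a<b<a'\}\cup\{2\varepsilon_a:\bar a=1,a\le s\}$, where $\varepsilon_a-\varepsilon_b$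 has parity $\bar a+\bar b$ and $2\varepsilon_a$ is even. $\rho$ is half the sum of the even positive roots minus half the sum of the odd positive roots. **Simple roots and matrices.** For $1\le i\le s$ if $m$ is odd, and for $1\le i<s$ if $m$ is even: $\alpha_i=\varepsilon_i-\varepsilon_{i+1}$, $\mathsf e_i=X_{i,i+1}$, $\mathsf f_i=(-1)^{\bar i}X_{i+1,i}$, $\mathsf h_i=(-1)^{\bar i}X_{ii}-(-1)^{\overline{i+1}}X_{i+1,i+1}$. If $m$ is even and $\bar s=0$: $\alpha_s=\varepsilon_{s-1}+\varepsilon_s$, $\mathsf e_s=X_{s-1,s+1}$, $\mathsf f_s=(-1)^{\overline{s-1}}X_{s+1,s-1}$, $\mathsf h_s=(-1)^{\overline{s-1}}X_{s-1,s-1}-(-1)^{\overline{s+1}}X_{s+1,s+1}$. If $m$ is even and $\bar s=1$: $\alpha_s=2\varepsilon_s$, $\mathsf e_s=E_{s,s+1}$, $\mathsf f_s=-2E_{s+1,s}$, $\mathsf h_s=-2X_{ss}$. Put $a_{ij}=(\alpha_i,\alpha_j)$. **Algebra.** $U_q(\mathfrak{osp}(V))$ is the $K$-superalgebra generated by $e_i,f_i,q^{\pm h_i/2}$ ($1\le i\le s$), $|e_i|=|f_i|$ the parity of $\alpha_i$, $|q^{\pm h_i/2}|=0$, with relations: the $q^{\pm h_i/2}$ commute, $q^{\pm h_i/2}q^{\mp h_i/2}=1$, $q^{h_i/2}e_jq^{-h_i/2}=q^{a_{ij}/2}e_j$, $q^{h_i/2}f_jq^{-h_i/2}=q^{-a_{ij}/2}f_j$,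 $e_if_j-(-1)^{|e_i||f_j|}f_je_i=\delta_{ij}\frac{q^{h_i}-q^{-h_i}}{q-q^{-1}}$, and Yamane's (standard and higher order) $q$-Serre relations. The latter can be described as follows: for words $\mathbf i,\mathbf j$ of length $d$ put $B(\mathbf i,\mathbf j)=\sum_{\sigma\in S_d}\prod_{k<l,\,\sigma(k)>\sigma(l)}\big((-1)^{|e_{j_k}||e_{j_l}|}q^{-(\alpha_{j_k},\alpha_{j_l})}\big)\prod_{p}\delta_{i_p,j_{\sigma^{-1}(p)}}$; one imposes $\sum_{\mathbf j}c_{\mathbf j}e_{j_1}\cdots e_{j_d}=0$ and $\sum_{\mathbf j}c_{\mathbf j}f_{j_1}\cdots f_{j_d}=0$ whenever $\sum_{\mathbf j}c_{\mathbf j}B(\mathbf i,\mathbf j)=0$ for all $\mathbf i$. Grading: $\deg e_i=\alpha_i$, $\deg f_i=-\alpha_i$, $\deg q^{\pm h_i/2}=0$. The coproduct defining tensor product modules: $\Delta(e_i)=q^{h_i/2}\otimes e_i+e_i\otimes q^{-h_i/2}$, $\Delta(f_i)=q^{h_i/2}\otimes f_i+f_i\otimes q^{-h_i/2}$, $\Delta(q^{\pm h_i/2})=q^{\pm h_i/2}\otimes q^{\pm h_i/2}$. **Module $V$.** $\varrho(e_i)=\mathsf e_i$, $\varrho(f_i)=\kappa_i\mathsf f_i$, $\varrho(q^{\pm h_i/2})=q^{\pm\mathsf h_i/2}$ (for diagonal $D=\mathrm{diag}(d_k)$, $q^D=\mathrm{diag}(q^{d_k})$), where $\kappa_i=\frac{q+q^{-1}}2$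 if $m$ is even, $\bar s=1$, $i=s$, and $\kappa_i=1$ otherwise. The vector $v_j$ has weight $\varepsilon_j$. **Universal intertwiner.** $U^+,U^-$ are the subalgebras generated by the $e_i$, resp. $f_i$; $U^\ge,U^\le$ those generated by these together with all $q^{\pm h_i/2}$. Let $\Delta^J(e_i)=q^{h_i}\otimes e_i+e_i\otimes1$, $\Delta^J(f_i)=1\otimes f_i+f_i\otimes q^{-h_i}$, $\Delta^J(q^{\pm h_i/2})=q^{\pm h_i/2}\otimes q^{\pm h_i/2}$, $\Delta^{J,\mathrm{op}}=\tau\circ\Delta^J$. There is a unique bilinear pairing $(\cdot,\cdot)_J\colon U^\le\times U^\ge\to\mathbb C(q^{1/4})$ with $(yy',x)_J=(y\otimes y',\Delta^J(x))_J$, $(y,xx')_J=(\Delta^{J,\mathrm{op}}(y),x\otimes x')_J$, where $(y\otimes y',x\otimes x')_J=(-1)^{|y'||x|}(y,x)_J(y',x')_J$, and $(f_i,q^{\pm h_j/2})_J=0=(q^{\pm h_j/2},e_i)_J$, $(f_i,e_j)_J=\frac{\delta_{ij}(-1)^{|f_i||e_j|}}{q^{-1}-q}$, $(q^{h_i/2},q^{h_j/2})_J=q^{-a_{ij}/4}$ (bialgebra pairing, so $(1,1)_J=1$). It is non-degenerate on $U^-_{-\mu}\times U^+_\mu$ for each $\mu$. With $\{x_i^\mu\},\{y_i^\mu\}$ dual bases of $U^+_\mu,U^-_{-\mu}$, put $\Theta=1+\sum_{\mu>0}\sum_ix_i^\mu\otimes y_i^\mu$ (finitely many terms act nontrivially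 on $V\otimes V$). $\tilde f^{1/2}(w_1\otimes w_2)=q^{-(\nu,\mu)/2}w_1\otimes w_2$ for $w_1,w_2$ of weights $\nu,\mu$. The map $\hat R_{VV}=\tau_{VV}\circ\tilde f^{1/2}\circ\Theta\circ\tilde f^{1/2}$ is a $U_q(\mathfrak{osp}(V))$-module isomorphism. *)

theory Defs
  imports
    "HOL-Computational_Algebra.Polynomial"
    "HOL-Computational_Algebra.Fraction_Field"
    "HOL-Combinatorics.Permutations"
    "HOL-Algebra.QuotRing"
    "HOL-Algebra.Embedded_Algebras"
    "HOL-Library.Poly_Mapping"
    "HOL-Library.Function_Algebras"
begin

section \<open>Scalars\<close>

text \<open>\<open>K\<close> is the field of rational functions in the variable \<open>q^(1/2)\<close>, and \<open>L\<close> the field of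
  rational functions in the variable \<open>q^(1/4)\<close>. They are the same Isabelle type with two different
  readings of the variable; the inclusion of the first field in the second is \<open>K_to_L\<close>, which
  substitutes the square of the variable.\<close>

type_synonym K = "complex poly fract"
type_synonym L = "complex poly fract"

lift_definition K_to_L :: "K \<Rightarrow> L"
  is "\<lambda>(a, b). (pcompose a [:0, 0, 1:], pcompose b [:0, 0, 1:])"
proof -
  fix x y :: "complex poly \<times> complex poly"
  assume xy: "fractrel x y"
  have nz: "pcompose p [:0, 0, 1:] \<noteq> 0" if "p \<noteq> 0" for p :: "complex poly"
    using that pcompose_eq_0[of p "[:0, 0, 1:]"] by auto
  have "pcompose (fst x * snd y) [:0, 0, 1:] = pcompose (fst y * snd x) [:0, 0, 1:]"
    using xy by simp
  then show "fractrel (case x of (a, b) \<Rightarrow> (pcompose a [:0, 0, 1:], pcompose b [:0, 0, 1:]))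
      (case y of (a, b) \<Rightarrow> (pcompose a [:0, 0, 1:], pcompose b [:0, 0, 1:]))"
    using xy nz by (simp add: case_prod_unfold pcompose_mult)
qed

text \<open>\<open>qpow r\<close> is \<open>q^r\<close> in \<open>K\<close>, used only when \<open>2 * r\<close> is an integer; \<open>qpowL r\<close> is \<open>q^r\<close> in \<open>L\<close>, used
  only when \<open>4 * r\<close> is an integer.\<close>

definition qpow :: "rat \<Rightarrow> K" where
  "qpow r = Fract [:0, 1:] 1 powi \<lfloor>2 * r\<rfloor>"

definition qpowL :: "rat \<Rightarrow> L" where
  "qpowL r = Fract [:0, 1:] 1 powi \<lfloor>4 * r\<rfloor>"


section \<open>Matrices\<close>

text \<open>A linear operator on a space with basis indexed by a finite set \<open>I\<close> is given by its matrix, a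
  function vanishing outside \<open>I \<times> I\<close>: the operator \<open>A\<close> maps the \<open>j\<close>-th basis vector to the sum of
  the \<open>A i j\<close> times the \<open>i\<close>-th one. Sums of matrices are the pointwise sums of functions.\<close>

type_synonym ('i, 'a) matr = "'i \<Rightarrow> 'i \<Rightarrow> 'a"

definition mmult :: "'i set \<Rightarrow> ('i, 'a::semiring_0) matr \<Rightarrow> ('i, 'a) matr \<Rightarrow> ('i, 'a) matr" where
  "mmult I A B = (\<lambda>i j. \<Sum>k\<in>I. A i k * B k j)"

definition mone :: "'i set \<Rightarrow> ('i, 'a::zero_neq_one) matr" where
  "mone I = (\<lambda>i j. if i = j \<and> i \<in> I then 1 else 0)"

definition msmult :: "'a::times \<Rightarrow> ('i, 'a) matr \<Rightarrow> ('i, 'a) matr" (infixr \<open>*\<^sub>m\<close> 75) where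
  "c *\<^sub>m A = (\<lambda>i j. c * A i j)"

definition munit :: "'i \<Rightarrow> 'i \<Rightarrow> ('i, 'a::zero_neq_one) matr" where
  "munit i j = (\<lambda>k l. if k = i \<and> l = j then 1 else 0)"

definition of_int_matr :: "('i, int) matr \<Rightarrow> ('i, K) matr" where
  "of_int_matr A = (\<lambda>i j. of_int (A i j))"


section \<open>Free algebras\<close>

text \<open>With concatenation of words as the addition of the monoid of words, the type
  \<open>'a list \<Rightarrow>\<^sub>0 K\<close> with its convolution product is the free algebra on \<open>'a\<close>.\<close>

instantiation list :: (type) monoid_add
begin

definition zero_list :: "'a list" where "zero_list = []"
definition plus_list :: "'a list \<Rightarrow> 'a list \<Rightarrow> 'a list" where "plus_list = append"

instance
  by standard (simp_all add: zero_list_def plus_list_def)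

end

text \<open>\<open>Gk i\<close> and \<open>Gki i\<close> are the generators \<open>q^(h_i/2)\<close> and \<open>q^(-h_i/2)\<close>.\<close>

datatype gen = Ge nat | Gf nat | Gk nat | Gki nat

type_synonym free = "gen list \<Rightarrow>\<^sub>0 K"

text \<open>Elements of the tensor square of the free algebra, in the basis of pairs of words; its graded
  product is \<open>tmult\<close> below.\<close>

type_synonym free2 = "(gen list \<times> gen list) \<Rightarrow>\<^sub>0 K"

definition lin_ext :: "('w \<Rightarrow> ('v \<Rightarrow>\<^sub>0 K)) \<Rightarrow> ('w \<Rightarrow>\<^sub>0 K) \<Rightarrow> ('v \<Rightarrow>\<^sub>0 K)" where
  "lin_ext \<phi> a = (\<Sum>w\<in>Poly_Mapping.keys a. Poly_Mapping.map ((*) (Poly_Mapping.lookup a w)) (\<phi> w))"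

definition gen1 :: "gen \<Rightarrow> free" where
  "gen1 g = Poly_Mapping.single [g] 1"

definition const :: "K \<Rightarrow> free" where
  "const c = Poly_Mapping.single [] c"

definition tensor :: "free \<Rightarrow> free \<Rightarrow> free2" where
  "tensor a b = (\<Sum>w\<in>Poly_Mapping.keys a. \<Sum>z\<in>Poly_Mapping.keys b.
     Poly_Mapping.single (w, z) (Poly_Mapping.lookup a w * Poly_Mapping.lookup b z))"

text \<open>Linear combinations of the words in the letters \<open>S\<close>.\<close>

definition free_on :: "gen set \<Rightarrow> free set" where
  "free_on S = {a. Poly_Mapping.keys a \<subseteq> lists S}"


section \<open>The quantum superalgebra\<close>

text \<open>\<open>m\<close> and \<open>n\<close> are the even and odd dimensions, \<open>par i\<close> is the parity of the basis vector \<open>v_i\<close>,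
  and \<open>th i\<close> is the sign \<open>\<vartheta>_i\<close>.\<close>

locale osp =
  fixes m n :: nat
    and par :: "nat \<Rightarrow> nat"
    and th :: "nat \<Rightarrow> int"
  assumes even_n: "even n"
    and dim_gt_2: "m + n > 2"
    and par_01: "i \<in> {1..m + n} \<Longrightarrow> par i \<in> {0, 1}"
    and card_even: "card {i \<in> {1..m + n}. par i = 0} = m"
    and card_odd: "card {i \<in> {1..m + n}. par i = 1} = n"
    and par_sym: "i \<in> {1..m + n} \<Longrightarrow> par (m + n + 1 - i) = par i"
    and th_sign: "i \<in> {1..m + n} \<Longrightarrow> th i \<in> {1, -1}"
    and th_even: "i \<in> {1..m + n} \<Longrightarrow> par i = 0 \<Longrightarrow> th i = 1"
    and th_odd: "i \<in> {1..m + n} \<Longrightarrow> par i = 1 \<Longrightarrow> th i = - th (m + n + 1 - i)"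
begin

definition N :: nat where "N = m + n"

definition s :: nat where "s = N div 2"

definition prime :: "nat \<Rightarrow> nat" where "prime i = N + 1 - i"

definition X :: "nat \<Rightarrow> nat \<Rightarrow> (nat, int) matr" where
  "X i j = munit i j
     - ((-1) ^ (par i * (par i + par j)) * th i * th j) *\<^sub>m munit (prime j) (prime i)"


subsection \<open>Roots\<close>

text \<open>A weight is given by its coordinates with respect to \<open>eps 1, \<dots>, eps s\<close>.\<close>

type_synonym weight = "nat \<Rightarrow> rat"

definition unit_wt :: "nat \<Rightarrow> weight" where
  "unit_wt i = (\<lambda>k. if k = i then 1 else 0)"

definition eps :: "nat \<Rightarrow> weight" where
  "eps i = (if i \<in> {1..s} then unit_wt i
            else if prime i \<in> {1..s} then - unit_wt (prime i)
            else 0)"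

definition form :: "weight \<Rightarrow> weight \<Rightarrow> rat" where
  "form x y = (\<Sum>k=1..s. (-1) ^ par k * x k * y k)"

definition even_pos_roots :: "weight set" where
  "even_pos_roots =
     {eps a - eps b | a b. 1 \<le> a \<and> a < b \<and> b < prime a \<and> even (par a + par b)}
     \<union> {eps a + eps a | a. a \<in> {1..s} \<and> par a = 1}"

definition odd_pos_roots :: "weight set" where
  "odd_pos_roots =
     {eps a - eps b | a b. 1 \<le> a \<and> a < b \<and> b < prime a \<and> odd (par a + par b)}"

definition rho :: weight where
  "rho = (\<lambda>k. (\<Sum>\<beta>\<in>even_pos_roots. \<beta> k) / 2 - (\<Sum>\<beta>\<in>odd_pos_roots. \<beta> k) / 2)"

definition alpha :: "nat \<Rightarrow> weight" where
  "alpha i =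
     (if i < s \<or> odd m then eps i - eps (i + 1)
      else if par s = 0 then eps (s - 1) + eps s
      else eps s + eps s)"

definition alpha_par :: "nat \<Rightarrow> nat" where
  "alpha_par i =
     (if i < s \<or> odd m then (par i + par (i + 1)) mod 2
      else if par s = 0 then (par (s - 1) + par s) mod 2
      else 0)"

definition e_mat :: "nat \<Rightarrow> (nat, int) matr" where
  "e_mat i =
     (if i < s \<or> odd m then X i (i + 1)
      else if par s = 0 then X (s - 1) (s + 1)
      else munit s (s + 1))"

definition f_mat :: "nat \<Rightarrow> (nat, int) matr" where
  "f_mat i =
     (if i < s \<or> odd m then (-1) ^ par i *\<^sub>m X (i + 1) i
      else if par s = 0 then (-1) ^ par (s - 1) *\<^sub>m X (s + 1) (s - 1)
      else (-2) *\<^sub>m munit (s + 1) s)"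

definition h_mat :: "nat \<Rightarrow> (nat, int) matr" where
  "h_mat i =
     (if i < s \<or> odd m
      then (-1) ^ par i *\<^sub>m X i i - (-1) ^ par (i + 1) *\<^sub>m X (i + 1) (i + 1)
      else if par s = 0
      then (-1) ^ par (s - 1) *\<^sub>m X (s - 1) (s - 1) - (-1) ^ par (s + 1) *\<^sub>m X (s + 1) (s + 1)
      else (-2) *\<^sub>m X s s)"

definition cartan :: "nat \<Rightarrow> nat \<Rightarrow> rat" where
  "cartan i j = form (alpha i) (alpha j)"


subsection \<open>The free superalgebra and its degrees\<close>

primrec gen_par :: "gen \<Rightarrow> nat" where
  "gen_par (Ge i) = alpha_par i"
| "gen_par (Gf i) = alpha_par i"
| "gen_par (Gk i) = 0"
| "gen_par (Gki i) = 0"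

primrec gen_deg :: "gen \<Rightarrow> weight" where
  "gen_deg (Ge i) = alpha i"
| "gen_deg (Gf i) = - alpha i"
| "gen_deg (Gk i) = 0"
| "gen_deg (Gki i) = 0"

definition word_par :: "gen list \<Rightarrow> nat" where
  "word_par w = sum_list (map gen_par w)"

definition word_deg :: "gen list \<Rightarrow> weight" where
  "word_deg w = sum_list (map gen_deg w)"

definition gens_e :: "gen set" where "gens_e = Ge ` {1..s}"
definition gens_f :: "gen set" where "gens_f = Gf ` {1..s}"
definition gens_k :: "gen set" where "gens_k = Gk ` {1..s} \<union> Gki ` {1..s}"

definition free_ring :: "free ring" where
  "free_ring = \<lparr>carrier = free_on (gens_e \<union> gens_f \<union> gens_k),
     monoid.mult = (*), one = 1, zero = 0, add = (+)\<rparr>"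

definition tmult :: "free2 \<Rightarrow> free2 \<Rightarrow> free2" where
  "tmult S T = (\<Sum>(w, w')\<in>Poly_Mapping.keys S. \<Sum>(z, z')\<in>Poly_Mapping.keys T.
     Poly_Mapping.single (w @ z, w' @ z')
       ((-1) ^ (word_par w' * word_par z)
        * Poly_Mapping.lookup S (w, w') * Poly_Mapping.lookup T (z, z')))"

definition tflip :: "free2 \<Rightarrow> free2" where
  "tflip = lin_ext (\<lambda>(w, w'). Poly_Mapping.single (w', w) ((-1) ^ (word_par w * word_par w')))"


subsection \<open>Relations\<close>

text \<open>Words of length \<open>d\<close> are lists, hence indexed from \<open>0\<close>.\<close>

definition serre_form :: "nat list \<Rightarrow> nat list \<Rightarrow> K" where
  "serre_form is js =
     (\<Sum>\<sigma>\<in>{\<sigma>. \<sigma> permutes {..<length js}}.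
        (\<Prod>(k, l)\<in>{(k, l). k < l \<and> l < length js \<and> \<sigma> k > \<sigma> l}.
           (-1) ^ (alpha_par (js ! k) * alpha_par (js ! l)) * qpow (- cartan (js ! k) (js ! l)))
        * (\<Prod>p<length js. if is ! p = js ! (inv_into UNIV \<sigma> p) then 1 else 0))"

definition index_words :: "nat \<Rightarrow> nat list set" where
  "index_words d = {is. length is = d \<and> set is \<subseteq> {1..s}}"

definition serre_relations :: "(nat \<Rightarrow> gen) \<Rightarrow> free set" where
  "serre_relations g =
     {\<Sum>js\<in>index_words d. Poly_Mapping.single (map g js) (c js) | d c.
        \<forall>is\<in>index_words d. (\<Sum>js\<in>index_words d. c js * serre_form is js) = 0}"

text \<open>Each relation \<open>a = b\<close> is represented by the element \<open>a - b\<close>.\<close>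

definition relations :: "free set" where
  "relations =
     {gen1 x * gen1 y - gen1 y * gen1 x | x y. x \<in> gens_k \<and> y \<in> gens_k}
   \<union> {gen1 (Gk i) * gen1 (Gki i) - 1 | i. i \<in> {1..s}}
   \<union> {gen1 (Gki i) * gen1 (Gk i) - 1 | i. i \<in> {1..s}}
   \<union> {gen1 (Gk i) * gen1 (Ge j) * gen1 (Gki i) - const (qpow (cartan i j / 2)) * gen1 (Ge j)
       | i j. i \<in> {1..s} \<and> j \<in> {1..s}}
   \<union> {gen1 (Gk i) * gen1 (Gf j) * gen1 (Gki i) - const (qpow (- cartan i j / 2)) * gen1 (Gf j)
       | i j. i \<in> {1..s} \<and> j \<in> {1..s}}
   \<union> {gen1 (Ge i) * gen1 (Gf j)
        - const ((-1) ^ (alpha_par i * alpha_par j)) * gen1 (Gf j) * gen1 (Ge i)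
        - (if i = j
           then const (1 / (qpow 1 - qpow (-1)))
                  * (gen1 (Gk i) * gen1 (Gk i) - gen1 (Gki i) * gen1 (Gki i))
           else 0)
       | i j. i \<in> {1..s} \<and> j \<in> {1..s}}
   \<union> serre_relations Ge
   \<union> serre_relations Gf"

definition rel_ideal :: "free set" where
  "rel_ideal = genideal free_ring relations"

definition Uq :: "free set ring" where
  "Uq = free_ring Quot rel_ideal"

definition cls :: "free \<Rightarrow> free set" where
  "cls a = a_r_coset free_ring rel_ideal a"

text \<open>The base field inside \<open>Uq\<close>; it gives the vector space structure.\<close>

definition scalars :: "free set set" where
  "scalars = range (\<lambda>c. cls (const c))"

definition U_le :: "free set set" where "U_le = cls ` free_on (gens_f \<union> gens_k)"
definition U_ge :: "free set set" where "U_ge = cls ` free_on (gens_e \<union> gens_k)"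

text \<open>Homogeneous components of the subalgebras generated by the \<open>e_i\<close> and by the \<open>f_i\<close>.\<close>

definition U_plus_wt :: "weight \<Rightarrow> free set set" where
  "U_plus_wt \<mu> = cls ` {a \<in> free_on gens_e. \<forall>w\<in>Poly_Mapping.keys a. word_deg w = \<mu>}"

definition U_minus_wt :: "weight \<Rightarrow> free set set" where
  "U_minus_wt \<mu> = cls ` {a \<in> free_on gens_f. \<forall>w\<in>Poly_Mapping.keys a. word_deg w = \<mu>}"


subsection \<open>The pairing\<close>

primrec DeltaJ_gen :: "gen \<Rightarrow> free2" where
  "DeltaJ_gen (Ge i) = tensor (gen1 (Gk i) * gen1 (Gk i)) (gen1 (Ge i)) + tensor (gen1 (Ge i)) 1"
| "DeltaJ_gen (Gf i) = tensor 1 (gen1 (Gf i)) + tensor (gen1 (Gf i)) (gen1 (Gki i) * gen1 (Gki i))"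
| "DeltaJ_gen (Gk i) = tensor (gen1 (Gk i)) (gen1 (Gk i))"
| "DeltaJ_gen (Gki i) = tensor (gen1 (Gki i)) (gen1 (Gki i))"

primrec DeltaJ_word :: "gen list \<Rightarrow> free2" where
  "DeltaJ_word [] = tensor 1 1"
| "DeltaJ_word (g # w) = tmult (DeltaJ_gen g) (DeltaJ_word w)"

text \<open>The lift to free algebras of the coproduct. Below it is applied to representatives of
  elements of \<open>Uq\<close>, and a pairing of classes is extended to tensors of representatives.\<close>

definition DeltaJ :: "free \<Rightarrow> free2" where
  "DeltaJ = lin_ext DeltaJ_word"

definition pair2 :: "(free set \<Rightarrow> free set \<Rightarrow> L) \<Rightarrow> free2 \<Rightarrow> free2 \<Rightarrow> L" where
  "pair2 P S T = (\<Sum>(w, w')\<in>Poly_Mapping.keys S. \<Sum>(z, z')\<in>Poly_Mapping.keys T.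
     K_to_L (Poly_Mapping.lookup S (w, w') * Poly_Mapping.lookup T (z, z'))
     * (-1) ^ (word_par w' * word_par z)
     * P (cls (Poly_Mapping.single w 1)) (cls (Poly_Mapping.single z 1))
     * P (cls (Poly_Mapping.single w' 1)) (cls (Poly_Mapping.single z' 1)))"

definition J_bilinear :: "(free set \<Rightarrow> free set \<Rightarrow> L) \<Rightarrow> bool" where
  "J_bilinear P \<longleftrightarrow>
     (\<forall>y\<in>U_le. \<forall>y'\<in>U_le. \<forall>x\<in>U_ge. P (y \<oplus>\<^bsub>Uq\<^esub> y') x = P y x + P y' x)
   \<and> (\<forall>y\<in>U_le. \<forall>x\<in>U_ge. \<forall>x'\<in>U_ge. P y (x \<oplus>\<^bsub>Uq\<^esub> x') = P y x + P y x')
   \<and> (\<forall>y\<in>U_le. \<forall>x\<in>U_ge. \<forall>c.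
        P (cls (const c) \<otimes>\<^bsub>Uq\<^esub> y) x = K_to_L c * P y x
      \<and> P y (cls (const c) \<otimes>\<^bsub>Uq\<^esub> x) = K_to_L c * P y x)"

definition J_pairing :: "(free set \<Rightarrow> free set \<Rightarrow> L) \<Rightarrow> bool" where
  "J_pairing P \<longleftrightarrow>
     J_bilinear P
   \<and> (\<forall>b\<in>free_on (gens_f \<union> gens_k). \<forall>b'\<in>free_on (gens_f \<union> gens_k). \<forall>a\<in>free_on (gens_e \<union> gens_k).
        P (cls b \<otimes>\<^bsub>Uq\<^esub> cls b') (cls a) = pair2 P (tensor b b') (DeltaJ a))
   \<and> (\<forall>b\<in>free_on (gens_f \<union> gens_k). \<forall>a\<in>free_on (gens_e \<union> gens_k). \<forall>a'\<in>free_on (gens_e \<union> gens_k).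
        P (cls b) (cls a \<otimes>\<^bsub>Uq\<^esub> cls a') = pair2 P (tflip (DeltaJ b)) (tensor a a'))
   \<and> P \<one>\<^bsub>Uq\<^esub> \<one>\<^bsub>Uq\<^esub> = 1
   \<and> (\<forall>i\<in>{1..s}. \<forall>k\<in>gens_k.
        P (cls (gen1 (Gf i))) (cls (gen1 k)) = 0 \<and> P (cls (gen1 k)) (cls (gen1 (Ge i))) = 0)
   \<and> (\<forall>i\<in>{1..s}. \<forall>j\<in>{1..s}.
        P (cls (gen1 (Gf i))) (cls (gen1 (Ge j)))
          = (if i = j then (-1) ^ (alpha_par i * alpha_par j) / (qpowL (-1) - qpowL 1) else 0)
      \<and> P (cls (gen1 (Gk i))) (cls (gen1 (Gk j))) = qpowL (- cartan i j / 4))"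

definition pos_root_lattice :: "weight set" where
  "pos_root_lattice = {\<lambda>k. \<Sum>i=1..s. of_nat (c i) * alpha i k | c :: nat \<Rightarrow> nat. True}"

text \<open>\<open>xs \<mu>\<close> and \<open>ys \<mu>\<close> are dual bases of the components of degrees \<open>\<mu>\<close> and \<open>- \<mu>\<close>.\<close>

definition dual_bases ::
  "(free set \<Rightarrow> free set \<Rightarrow> L) \<Rightarrow> (weight \<Rightarrow> free set list) \<Rightarrow> (weight \<Rightarrow> free set list) \<Rightarrow> bool" where
  "dual_bases P xs ys \<longleftrightarrow>
     (\<forall>\<mu>\<in>pos_root_lattice - {0}.
        ring.independent Uq scalars (xs \<mu>) \<and> ring.Span Uq scalars (xs \<mu>) = U_plus_wt \<mu>
      \<and> ring.independent Uq scalars (ys \<mu>) \<and> ring.Span Uq scalars (ys \<mu>) = U_minus_wt (- \<mu>)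
      \<and> length (xs \<mu>) = length (ys \<mu>)
      \<and> (\<forall>i<length (ys \<mu>). \<forall>j<length (xs \<mu>).
           P (ys \<mu> ! i) (xs \<mu> ! j) = (if i = j then 1 else 0)))"


subsection \<open>Operators on the module and on its tensor square\<close>

definition ind :: "nat set" where "ind = {1..N}"

definition ind2 :: "(nat \<times> nat) set" where "ind2 = ind \<times> ind"

definition kappa :: "nat \<Rightarrow> K" where
  "kappa i = (if even m \<and> par s = 1 \<and> i = s then (qpow 1 + qpow (-1)) / 2 else 1)"

definition qdiag :: "(nat \<Rightarrow> rat) \<Rightarrow> (nat, K) matr" where
  "qdiag d = (\<lambda>k l. if k = l \<and> k \<in> ind then qpow (d k) else 0)"

primrec rep_gen :: "gen \<Rightarrow> (nat, K) matr" where
  "rep_gen (Ge i) = of_int_matr (e_mat i)"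
| "rep_gen (Gf i) = kappa i *\<^sub>m of_int_matr (f_mat i)"
| "rep_gen (Gk i) = qdiag (\<lambda>k. of_int (h_mat i k k) / 2)"
| "rep_gen (Gki i) = qdiag (\<lambda>k. - of_int (h_mat i k k) / 2)"

primrec rep_word :: "gen list \<Rightarrow> (nat, K) matr" where
  "rep_word [] = mone ind"
| "rep_word (g # w) = mmult ind (rep_gen g) (rep_word w)"

definition rep_free :: "free \<Rightarrow> (nat, K) matr" where
  "rep_free a = (\<Sum>w\<in>Poly_Mapping.keys a. Poly_Mapping.lookup a w *\<^sub>m rep_word w)"

text \<open>The action of a class does not depend on the representative, since the matrices of the
  generators satisfy the defining relations.\<close>

definition rep :: "free set \<Rightarrow> (nat, K) matr" where
  "rep u = rep_free (SOME a. a \<in> u)"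

text \<open>The operator \<open>A \<otimes> B\<close> in the basis \<open>v_i \<otimes> v_j\<close>. The coefficient of \<open>B\<close> at \<open>(j, l)\<close> belongs to the
  matrix unit of parity \<open>par j + par l\<close>, which gives the sign when it passes \<open>v_k\<close>.\<close>

definition mtensor :: "(nat, K) matr \<Rightarrow> (nat, K) matr \<Rightarrow> (nat \<times> nat, K) matr" where
  "mtensor A B = (\<lambda>(i, j) (k, l). (-1) ^ ((par j + par l) * par k) * A i k * B j l)"

definition tau :: "(nat \<times> nat, K) matr" where
  "tau = (\<lambda>(i, j) (k, l).
     if (k, l) \<in> ind2 \<and> i = l \<and> j = k then (-1) ^ (par k * par l) else 0)"

definition f_half :: "(nat \<times> nat, K) matr" where
  "f_half = (\<lambda>(i, j) (k, l).
     if (k, l) \<in> ind2 \<and> i = k \<and> j = l then qpow (- form (eps k) (eps l) / 2) else 0)"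

definition Theta_wt ::
  "(weight \<Rightarrow> free set list) \<Rightarrow> (weight \<Rightarrow> free set list) \<Rightarrow> weight \<Rightarrow> (nat \<times> nat, K) matr" where
  "Theta_wt xs ys \<mu> = (\<Sum>i<length (xs \<mu>). mtensor (rep (xs \<mu> ! i)) (rep (ys \<mu> ! i)))"

text \<open>The action of \<open>\<Theta>\<close>; only finitely many degrees contribute.\<close>

definition Theta ::
  "(weight \<Rightarrow> free set list) \<Rightarrow> (weight \<Rightarrow> free set list) \<Rightarrow> (nat \<times> nat, K) matr" where
  "Theta xs ys = mone ind2
     + (\<Sum>\<mu>\<in>{\<mu> \<in> pos_root_lattice - {0}. Theta_wt xs ys \<mu> \<noteq> 0}. Theta_wt xs ys \<mu>)"

definition comp2 ::
  "(nat \<times> nat, K) matr \<Rightarrow> (nat \<times> nat, K) matr \<Rightarrow> (nat \<times> nat, K) matr" where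
  "comp2 = mmult ind2"

definition R_hat ::
  "(weight \<Rightarrow> free set list) \<Rightarrow> (weight \<Rightarrow> free set list) \<Rightarrow> (nat \<times> nat, K) matr" where
  "R_hat xs ys = comp2 tau (comp2 f_half (comp2 (Theta xs ys) f_half))"


subsection \<open>The explicit matrices\<close>

definition R_zero :: "(nat \<times> nat, K) matr" where
  "R_zero = mone ind2
     + (qpow (-1/2) - qpow (1/2)) *\<^sub>m
         (\<Sum>i\<in>{1..N}. (-1) ^ par i *\<^sub>m mtensor (munit i i)
            (qpow (- form (eps i) (eps i) / 2) *\<^sub>m munit i i
             - qpow (form (eps i) (eps i) / 2) *\<^sub>m munit (prime i) (prime i)))
     + (qpow (-1) - qpow 1) *\<^sub>m
         (\<Sum>(i, j)\<in>{(i, j). i \<in> {1..N} \<and> j \<in> {1..N} \<and> i < j}.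
            (-1) ^ par j *\<^sub>m mtensor (munit i j)
              (munit j i
               - ((-1) ^ (par j * (par i + par j)) * of_int (th i) * of_int (th j)
                  * qpow (form rho (eps i - eps j))) *\<^sub>m munit (prime i) (prime j)))"

definition R_infinity :: "(nat \<times> nat, K) matr" where
  "R_infinity = mone ind2
     + (qpow (1/2) - qpow (-1/2)) *\<^sub>m
         (\<Sum>i\<in>{1..N}. (-1) ^ par i *\<^sub>m mtensor (munit i i)
            (qpow (form (eps i) (eps i) / 2) *\<^sub>m munit i i
             - qpow (- form (eps i) (eps i) / 2) *\<^sub>m munit (prime i) (prime i)))
     + (qpow 1 - qpow (-1)) *\<^sub>m
         (\<Sum>(i, j)\<in>{(i, j). i \<in> {1..N} \<and> j \<in> {1..N} \<and> i > j}.
            (-1) ^ par j *\<^sub>m mtensor (munit i j)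
              (munit j i
               - ((-1) ^ (par j * (par i + par j)) * of_int (th i) * of_int (th j)
                  * qpow (form rho (eps i - eps j))) *\<^sub>m munit (prime i) (prime j)))"

end

end

theory Submission
  imports Defs
begin

text \<open>
  Let \<open>x = q\<^sup>1\<^sup>/\<^sup>2\<close>. Both \<open>f_half \<Theta> f_half\<close> and \<open>R_zero\<close> satisfy
  \<open>D \<Delta>(f_i) = G_i D\<close>, where \<open>\<Delta>(f_i)\<close> is the action of \<open>f_i\<close> on the tensor square and \<open>G_i\<close> is
  the same operator with \<open>x\<close> replaced by \<open>x\<^sup>-\<^sup>1\<close>. For \<open>\<Theta>\<close> this comes from the pairing: left and right
  multiplication by \<open>f_i\<close> are adjoint to the two skew derivations that describe the commutator of
  \<open>f_i\<close> with \<open>U\<^sup>+\<close>. For \<open>R_zero\<close> it is a direct computation with matrix entries. Both operators also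
  have the same diagonal values on all \<open>v_1 \<otimes> v_w\<close>. As every \<open>v_k\<close> is reached from \<open>v_1\<close> by the
  \<open>f_i\<close>, a solution \<open>D\<close> of these equations which vanishes on all \<open>v_1 \<otimes> v_w\<close> is zero, so the two
  operators agree.

  The direct computation is valid for every nonzero \<open>x\<close>, and the same uniqueness argument shows that
  replacing \<open>x\<close> by \<open>x\<^sup>-\<^sup>1\<close> inverts \<open>R_zero\<close>. The result is \<open>R_infinity\<close> conjugated by \<open>\<tau>\<close>.

  That the classes act on \<open>V\<close> at all requires the matrices to satisfy every relation of the algebra.
  For the Serre relations, commuting an element of the radical of the form with the opposite
  generators yields elements of the radical of smaller length, and induction applies.
\<close>

section \<open>Scalars\<close>

text \<open>Only the f_i enter, because only the first tensor factor has to be generated: in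
  \<Delta>(f_i)(v_c \<otimes> v_d) the summand with f_i in the second leg stays over v_c, where an
  induction on c already knows the operator. The induction starts because terms of positive degree
  in \<Theta> kill v_1. Three obstacles shape the proof. The order condition i < j in
  \<open>R_zero\<close> must be compared before and after an application of f_i; since f_i joins
  neighbouring indices, the difference of two comparisons is a Kronecker delta, and only the fork of
  type D needs another order. The terms with E_{i'j'} form a rank one operator up to that order
  condition: its column part is a vector and its row part a linear form on V \<otimes> V, both
  killed by f_i because 2 (\<rho>, \<alpha>_i) = (\<alpha>_i, \<alpha>_i). Finally, the pairing has
  values in the larger field and is given on classes, while operators have entries in
  \<open>K\<close> and derivatives are taken of representatives; expansion coefficients in dual
  bases therefore have to be identified with pairings and recognised as images under
  \<open>K_to_L\<close>.\<close>

lemma K_to_L_Fract: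
  assumes "b \<noteq> 0"
  shows "K_to_L (Fract a b) = Fract (pcompose a [:0, 0, 1:]) (pcompose b [:0, 0, 1:])"
proof -
  have "pcompose b [:0, 0, 1:] \<noteq> 0"
    using assms pcompose_eq_0[of b "[:0, 0, 1:]"] by auto
  with assms show ?thesis
    by (auto simp: Fract.abs_eq K_to_L.abs_eq fractrel_def)
qed

lemma pcompose_sq_nz: "b \<noteq> 0 \<Longrightarrow> pcompose (b::complex poly) [:0, 0, 1:] \<noteq> 0"
  using pcompose_eq_0[of b "[:0, 0, 1:]"] by auto

lemma K_to_L_0 [simp]: "K_to_L 0 = 0"
  unfolding Zero_fract_def by (subst K_to_L_Fract) (auto simp: pcompose_1 simp flip: Zero_fract_def)

lemma K_to_L_1 [simp]: "K_to_L 1 = 1"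
  unfolding One_fract_def by (subst K_to_L_Fract) (auto simp: pcompose_1)

lemma K_to_L_mult [simp]: "K_to_L (a * b) = K_to_L a * K_to_L b"
  by (cases a, cases b) (simp add: K_to_L_Fract pcompose_sq_nz pcompose_mult)

lemma K_to_L_add [simp]: "K_to_L (a + b) = K_to_L a + K_to_L b"
  by (cases a, cases b) (simp add: K_to_L_Fract pcompose_sq_nz pcompose_mult pcompose_add)

lemma K_to_L_eq_0_iff [simp]: "K_to_L a = 0 \<longleftrightarrow> a = 0"
proof
  assume "K_to_L a = 0"
  show "a = 0"
  proof (rule ccontr)
    assume "a \<noteq> 0"
    then have "K_to_L a * K_to_L (1 / a) = 1"
      by (simp flip: K_to_L_mult)
    with \<open>K_to_L a = 0\<close> show False by simp
  qed
qed simp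

lemma K_to_L_minus [simp]: "K_to_L (- a) = - K_to_L a"
  using K_to_L_add[of a "- a"] by (simp add: eq_neg_iff_add_eq_0 add.commute)

lemma K_to_L_diff [simp]: "K_to_L (a - b) = K_to_L a - K_to_L b"
  using K_to_L_add[of a "- b"] by simp

lemma K_to_L_eq_iff [simp]: "K_to_L a = K_to_L b \<longleftrightarrow> a = b"
  using K_to_L_eq_0_iff[of "a - b"] by simp

lemma K_to_L_power [simp]: "K_to_L (a ^ n) = K_to_L a ^ n"
  by (induction n) auto

lemma K_to_L_inverse [simp]: "K_to_L (inverse a) = inverse (K_to_L a)"
proof (cases "a = 0")
  case False
  then have "K_to_L a * K_to_L (inverse a) = 1"
    by (simp flip: K_to_L_mult)
  then show ?thesis by (metis inverse_unique)
qed simp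

lemma K_to_L_divide [simp]: "K_to_L (a / b) = K_to_L a / K_to_L b"
  by (simp add: divide_inverse)

lemma K_to_L_powi [simp]: "K_to_L (a powi n) = K_to_L a powi n"
  by (cases "n \<ge> 0") (auto simp: power_int_def)

text \<open>One element with two readings: q^(1/2) in \<open>K\<close> and q^(1/4) in
  \<open>L\<close>. A power of q that is \<open>xq powi (2 * k)\<close> in \<open>K\<close> thus
  appears as \<open>xq powi (4 * k)\<close> in the pairing.\<close>

definition xq :: K where "xq = Fract [:0, 1:] 1"

lemma xq_nz [simp]: "xq \<noteq> 0"
  unfolding xq_def Zero_fract_def by (subst eq_fract) auto

lemma K_to_L_xq: "K_to_L xq = xq ^ 2"
  unfolding xq_def by (subst K_to_L_Fract) (auto simp: power2_eq_square pcompose_pCons pcompose_1)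

lemma qpow_eq: "2 * r = of_int n \<Longrightarrow> qpow r = xq powi n"
  by (simp add: qpow_def xq_def)

lemma qpowL_eq: "4 * r = of_int n \<Longrightarrow> qpowL r = xq powi n"
  by (simp add: qpowL_def xq_def)

lemma K_to_L_xq_powi: "K_to_L (xq powi n) = xq powi (2 * n)"
  by (simp add: K_to_L_xq power_int_mult)

text \<open>The variable is not a root of unity, by comparison of degrees. The denominators q -
  q^(-1) and the factor q + q^(-1) in \<open>kappa\<close> are nonzero for this reason.\<close>

lemma xq_power_neq_1:
  assumes "n > 0"
  shows "xq ^ n \<noteq> 1"
proof
  assume "xq ^ n = 1"
  moreover have "xq ^ n = Fract (Polynomial.monom 1 n) 1"
    unfolding xq_def by (induction n) (auto simp: One_fract_def monom_Suc)
  ultimately have "Polynomial.monom 1 n = (1 :: complex poly)"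
    by (simp add: One_fract_def eq_fract)
  then have "degree (Polynomial.monom (1::complex) n) = degree (1 :: complex poly)" by simp
  with assms show False by (simp add: degree_monom_eq)
qed

lemma xq_diff_nz: "xq powi (- 2) - xq powi 2 \<noteq> 0"
proof
  assume "xq powi (- 2) - xq powi 2 = 0"
  then have "xq powi (- 2) * xq ^ 2 = xq ^ 2 * xq ^ 2"
    by simp
  then have "xq ^ 4 = 1"
    by (simp add: power_int_minus flip: power_add)
  with xq_power_neq_1[of 4] show False by simp
qed

section \<open>Matrices\<close>

text \<open>Matrices are total functions, but \<open>mmult I\<close> sums over \<open>I\<close>
  only; \<open>mone I\<close> acts as a unit exactly on matrices with this support.\<close>

definition msupp :: "'i set \<Rightarrow> ('i, 'a::zero) matr \<Rightarrow> bool" where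
  "msupp I A \<longleftrightarrow> (\<forall>i j. A i j \<noteq> 0 \<longrightarrow> i \<in> I \<and> j \<in> I)"

lemma msuppD: "msupp I A \<Longrightarrow> i \<notin> I \<or> j \<notin> I \<Longrightarrow> A i j = 0"
  unfolding msupp_def by blast

lemma mmult_assoc:
  assumes "finite I"
  shows "mmult I (mmult I A B) C = mmult I A (mmult I B (C :: ('i, 'a::semiring_0) matr))"
proof (intro ext)
  fix i j
  have "mmult I (mmult I A B) C i j = (\<Sum>k\<in>I. \<Sum>l\<in>I. A i l * B l k * C k j)"
    by (simp add: mmult_def sum_distrib_right)
  also have "\<dots> = (\<Sum>l\<in>I. \<Sum>k\<in>I. A i l * B l k * C k j)"
    by (rule sum.swap)
  also have "\<dots> = mmult I A (mmult I B C) i j"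
    by (simp add: mmult_def sum_distrib_left mult.assoc)
  finally show "mmult I (mmult I A B) C i j = mmult I A (mmult I B C) i j" .
qed

lemma mmult_add_left: "mmult I (A + B) C = mmult I A C + mmult I B C"
  by (intro ext) (simp add: mmult_def distrib_right sum.distrib)

lemma mmult_add_right: "mmult I A (B + C) = mmult I A B + mmult I A C"
  by (intro ext) (simp add: mmult_def distrib_left sum.distrib)

lemma mmult_diff_left: "mmult I (A - B) (C :: ('i, 'a::ring) matr) = mmult I A C - mmult I B C"
  by (intro ext) (simp add: mmult_def left_diff_distrib sum_subtractf)

lemma mmult_diff_right: "mmult I A (B - C) = mmult I A B - mmult I A (C :: ('i, 'a::ring) matr)"
  by (intro ext) (simp add: mmult_def right_diff_distrib sum_subtractf)

lemma mmult_zero [simp]: "mmult I 0 A = 0" "mmult I A 0 = 0"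
  by (auto simp: mmult_def fun_eq_iff)

lemma sum_matr_apply: "(\<Sum>x\<in>A. f x) i j = (\<Sum>x\<in>A. f x i j)"
  for f :: "'b \<Rightarrow> ('i, 'a::comm_monoid_add) matr"
  by (induction A rule: infinite_finite_induct) auto

lemma mmult_sum_left: "mmult I (\<Sum>x\<in>A. f x) C = (\<Sum>x\<in>A. mmult I (f x) C)"
proof (intro ext)
  fix i j
  show "mmult I (\<Sum>x\<in>A. f x) C i j = (\<Sum>x\<in>A. mmult I (f x) C) i j"
    unfolding mmult_def sum_matr_apply sum_distrib_right by (rule sum.swap)
qed

lemma mmult_sum_right: "mmult I C (\<Sum>x\<in>A. f x) = (\<Sum>x\<in>A. mmult I C (f x))"
proof (intro ext)
  fix i j
  show "mmult I C (\<Sum>x\<in>A. f x) i j = (\<Sum>x\<in>A. mmult I C (f x)) i j"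
    unfolding mmult_def sum_matr_apply sum_distrib_left by (rule sum.swap)
qed

lemma msmult_apply [simp]: "(c *\<^sub>m A) i j = c * A i j"
  by (simp add: msmult_def)

lemma mmult_smult_left: "mmult I (c *\<^sub>m A) B = c *\<^sub>m mmult I A (B :: ('i, 'a::semiring_0) matr)"
  by (intro ext) (simp add: mmult_def sum_distrib_left mult.assoc)

lemma mmult_smult_right:
  "mmult I A (c *\<^sub>m B) = c *\<^sub>m mmult I A (B :: ('i, 'a::comm_semiring_0) matr)"
  by (intro ext) (simp add: mmult_def sum_distrib_left mult.left_commute)

lemma mmult_mone_left [simp]:
  fixes A :: "('i, 'a::semiring_1) matr"
  assumes "finite I" "msupp I A"
  shows "mmult I (mone I) A = A"
proof (intro ext)
  fix i j
  have "mmult I (mone I) A i j = (\<Sum>k\<in>I. if k = i then A i j else 0)"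
    unfolding mmult_def mone_def by (intro sum.cong) auto
  also have "\<dots> = A i j"
    using assms by (auto simp: msupp_def)
  finally show "mmult I (mone I) A i j = A i j" .
qed

lemma mmult_mone_right [simp]:
  fixes A :: "('i, 'a::semiring_1) matr"
  assumes "finite I" "msupp I A"
  shows "mmult I A (mone I) = A"
proof (intro ext)
  fix i j
  have "mmult I A (mone I) i j = (\<Sum>k\<in>I. if k = j then A i j else 0)"
    unfolding mmult_def mone_def by (intro sum.cong) auto
  also have "\<dots> = A i j"
    using assms by (auto simp: msupp_def)
  finally show "mmult I A (mone I) i j = A i j" .
qed

lemma msupp_mone [simp]: "msupp I (mone I)"
  by (auto simp: msupp_def mone_def split: if_splits)

lemma msupp_mmult [simp]:
  assumes "msupp I A" "msupp I B"
  shows "msupp I (mmult I A B)"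
proof -
  have "mmult I A B i j = 0" if "i \<notin> I \<or> j \<notin> I" for i j
    using that msuppD[OF assms(1)] msuppD[OF assms(2)] unfolding mmult_def
    by (intro sum.neutral) auto
  then show ?thesis unfolding msupp_def by blast
qed

lemma msupp_zero [simp]: "msupp I 0"
  by (simp add: msupp_def)

lemma msupp_add [simp]: "msupp I A \<Longrightarrow> msupp I B \<Longrightarrow> msupp I (A + B :: ('i, 'a::monoid_add) matr)"
  unfolding msupp_def by (simp add: plus_fun_def) (metis add_0)

lemma msupp_diff [simp]: "msupp I A \<Longrightarrow> msupp I B \<Longrightarrow> msupp I (A - B :: ('i, 'a::group_add) matr)"
  unfolding msupp_def by (simp add: fun_diff_def) (metis)

lemma msupp_smult [simp]: "msupp I A \<Longrightarrow> msupp I (c *\<^sub>m A :: ('i, 'a::mult_zero) matr)"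
  unfolding msupp_def by (metis msmult_apply mult_zero_right)

lemma msupp_sum:
  "(\<And>x. x \<in> S \<Longrightarrow> msupp I (f x)) \<Longrightarrow> msupp I (\<Sum>x\<in>S. f x :: ('i, 'a::comm_monoid_add) matr)"
  unfolding msupp_def sum_matr_apply by (metis (mono_tags, lifting) sum.neutral)

lemma two_neq_0_K: "(2 :: K) \<noteq> 0"
proof -
  have "(1 :: K) + 1 = Fract 2 1"
    unfolding One_fract_def by simp
  then have *: "(2 :: K) = Fract 2 1"
    by (simp only: one_add_one)
  show ?thesis unfolding * Zero_fract_def by (simp add: eq_fract)
qed

section \<open>Indices and weights\<close>

context osp
begin

lemma N_cases: "N = 2 * s \<or> N = 2 * s + 1"
  unfolding s_def by presburger

lemma odd_m_iff: "odd m \<longleftrightarrow> N = 2 * s + 1"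
  using even_n unfolding s_def N_def by presburger

lemma s_ge_1: "1 \<le> s" and s_gt_1: "even m \<Longrightarrow> 2 \<le> s"
  using dim_gt_2 even_n unfolding s_def N_def by presburger+

lemma finite_ind [simp]: "finite ind" "finite ind2"
  by (auto simp: ind_def ind2_def)

lemma prime_ind [simp]: "a \<in> ind \<Longrightarrow> prime a \<in> ind"
  by (auto simp: ind_def prime_def)

lemma prime_prime [simp]: "a \<in> ind \<Longrightarrow> prime (prime a) = a"
  by (auto simp: ind_def prime_def)

lemma prime_eq_iff: "a \<in> ind \<Longrightarrow> b \<in> ind \<Longrightarrow> prime a = b \<longleftrightarrow> a = prime b"
  by (auto simp: ind_def prime_def)

lemma prime_inj [simp]: "a \<in> ind \<Longrightarrow> b \<in> ind \<Longrightarrow> prime a = prime b \<longleftrightarrow> a = b"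
  by (auto simp: ind_def prime_def)

lemma par_cases: "a \<in> ind \<Longrightarrow> par a = 0 \<or> par a = 1"
  using par_01[of a] by (auto simp: ind_def N_def)

lemma par_prime [simp]: "a \<in> ind \<Longrightarrow> par (prime a) = par a"
  using par_sym[of a] by (auto simp: ind_def N_def prime_def)

lemma th_cases: "a \<in> ind \<Longrightarrow> th a = 1 \<or> th a = -1"
  using th_sign[of a] by (auto simp: ind_def N_def)

lemma th_sq [simp]: "a \<in> ind \<Longrightarrow> th a * th a = 1"
  using th_cases[of a] by auto

lemma th_prime: "a \<in> ind \<Longrightarrow> th (prime a) = (-1) ^ par a * th a"
proof -
  assume a: "a \<in> ind"
  then have a': "a \<in> {1..m + n}" "prime a \<in> {1..m + n}" "prime a = m + n + 1 - a"
    by (auto simp: ind_def N_def prime_def)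
  from a a' show ?thesis
    using par_cases[of a] th_odd[of a] th_even[of a] th_even[of "prime a"] par_prime[of a]
    by auto
qed

text \<open>An odd index fixed by \<open>prime\<close> would satisfy
  \<open>th a = - th a\<close>.\<close>

lemma par_self_dual: "a \<in> ind \<Longrightarrow> prime a = a \<Longrightarrow> par a = 0"
  using th_prime[of a] th_cases[of a] par_cases[of a] by auto

definition sgn_par :: "nat \<Rightarrow> int" where "sgn_par a = (-1) ^ par a"

lemma sgn_par_cases: "a \<in> ind \<Longrightarrow> sgn_par a = 1 \<or> sgn_par a = -1"
  using par_cases[of a] by (auto simp: sgn_par_def)

text \<open>The value (eps a, eps b) as an integer, so that it can be an exponent of
  \<open>powi\<close>. The first case is the middle index for odd \<open>N\<close>, whose weight is
  zero.\<close>

definition ee :: "nat \<Rightarrow> nat \<Rightarrow> int" where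
  "ee a b = (if a = prime a then 0 else if a = b then sgn_par a
             else if b = prime a then - sgn_par a else 0)"

lemma eps_apply:
  assumes "b \<in> ind" "k \<in> {1..s}"
  shows "eps b k = of_bool (b = k) - of_bool (b = prime k)"
  using assms N_cases by (auto simp: eps_def unit_wt_def ind_def prime_def)

lemma le_s_ind: "k \<in> {1..s} \<Longrightarrow> k \<in> ind"
  using N_cases by (auto simp: ind_def)

lemma form_eps: "form (eps a) (eps b) = of_int (ee a b)" if "a \<in> ind" "b \<in> ind"
proof -
  have "form (eps a) (eps b) = (\<Sum>k\<in>{1..s}. (-1) ^ par k *
      (of_bool (a = k) - of_bool (a = prime k)) * (of_bool (b = k) - of_bool (b = prime k)))"
    unfolding form_def using that by (intro sum.cong) (auto simp: eps_apply)
  also have "\<dots> = (\<Sum>k\<in>{1..s}. (if k = a then (-1) ^ par a * (of_bool (b = a) - of_bool (b = prime a)) else 0)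
       - (if k = prime a then (-1) ^ par a * (of_bool (b = prime a) - of_bool (b = a)) else 0))"
    using that le_s_ind by (intro sum.cong) (auto simp: prime_eq_iff)
  also have "\<dots> = of_int (ee a b)"
    unfolding sum_subtractf using that N_cases
    by (auto simp: ee_def sgn_par_def ind_def prime_def)
  finally show ?thesis .
qed

lemma form_diff_left: "form (x - y) w = form x w - form y w"
  by (simp add: form_def algebra_simps sum_subtractf)

lemma form_diff_right: "form w (x - y) = form w x - form w y"
  by (simp add: form_def algebra_simps sum_subtractf)

lemma ee_sym: "a \<in> ind \<Longrightarrow> b \<in> ind \<Longrightarrow> ee a b = ee b a"
  by (auto simp: ee_def sgn_par_def prime_eq_iff)

lemma ee_prime_left [simp]: "a \<in> ind \<Longrightarrow> b \<in> ind \<Longrightarrow> ee (prime a) b = - ee a b"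
  by (auto simp: ee_def sgn_par_def prime_eq_iff)

lemma ee_prime_right [simp]: "a \<in> ind \<Longrightarrow> b \<in> ind \<Longrightarrow> ee a (prime b) = - ee a b"
  by (auto simp: ee_def sgn_par_def prime_eq_iff)

text \<open>Every simple root is \<open>eps p - eps r\<close> for a pair of indices, and every generator is a multiple
  of \<open>X p r\<close> or \<open>X r p\<close>; this treats the types of the last node uniformly.\<close>

definition pp :: "nat \<Rightarrow> nat" where
  "pp i = (if i < s \<or> odd m then i else if par s = 0 then s - 1 else s)"

definition rr :: "nat \<Rightarrow> nat" where
  "rr i = (if i < s \<or> odd m then i + 1 else s + 1)"

text \<open>\<open>chain\<close> covers all nodes joining consecutive indices, including the last
  one for odd \<open>N\<close>; \<open>D\<close> and \<open>C\<close> are the last node for even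
  \<open>N\<close>, according to the parity of \<open>v_s\<close>.\<close>

lemma pp_rr_cases:
  assumes "i \<in> {1..s}"
  obtains (chain) "i < s \<or> odd m" "i < s \<or> N = 2 * s + 1" "1 \<le> i" "i \<le> s" "pp i = i" "rr i = i + 1"
    | (D) "i = s" "even m" "par s = 0" "pp i = s - 1" "rr i = s + 1" "N = 2 * s" "2 \<le> s"
    | (C) "i = s" "even m" "par s = 1" "pp i = s" "rr i = s + 1" "N = 2 * s" "2 \<le> s"
proof (cases "i < s \<or> odd m")
  case True
  then show ?thesis using assms odd_m_iff chain by (auto simp: pp_def rr_def)
next
  case False
  then have *: "i = s" "even m" "N = 2 * s" "2 \<le> s"
    using assms odd_m_iff s_gt_1 N_cases by auto
  have "par s = 0 \<or> par s = 1"
    using assms par_cases le_s_ind * by auto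
  then show ?thesis using * D C by (auto simp: pp_def rr_def)
qed

lemma pp_rr_ind [simp]:
  assumes "i \<in> {1..s}"
  shows "pp i \<in> ind" "rr i \<in> ind"
  using assms N_cases by (cases rule: pp_rr_cases; force simp: ind_def)+

lemma pp_neq_rr [simp]: "i \<in> {1..s} \<Longrightarrow> pp i \<noteq> rr i" "i \<in> {1..s} \<Longrightarrow> rr i \<noteq> pp i"
  by (erule pp_rr_cases; simp)+

lemma pp_not_self_dual [simp]:
  assumes "i \<in> {1..s}"
  shows "pp i \<noteq> prime (pp i)" "prime (pp i) \<noteq> pp i"
  using assms N_cases by (cases rule: pp_rr_cases; force simp: prime_def)+

lemma alpha_eq: "i \<in> {1..s} \<Longrightarrow> alpha i = eps (pp i) - eps (rr i)"
proof (erule pp_rr_cases)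
  assume "i = s" "even m" "par s = 0" "pp i = s - 1" "rr i = s + 1" "N = 2 * s" "2 \<le> s"
  then show ?thesis
    by (auto simp: alpha_def eps_def prime_def fun_eq_iff)
next
  assume "i = s" "even m" "par s = 1" "pp i = s" "rr i = s + 1" "N = 2 * s" "2 \<le> s"
  then show ?thesis
    by (auto simp: alpha_def eps_def prime_def fun_eq_iff)
qed (simp add: alpha_def)

lemma par_s_dual: "N = 2 * s \<Longrightarrow> par (Suc s) = par s"
  using par_prime[of s] le_s_ind[of s] s_ge_1 by (simp add: prime_def)

lemma alpha_par_eq: "i \<in> {1..s} \<Longrightarrow> alpha_par i = (par (pp i) + par (rr i)) mod 2"
  by (erule pp_rr_cases) (auto simp: alpha_par_def par_s_dual)

text \<open>The integer (alpha i, eps a). It is also the eigenvalue of h_i on v_a, so q^(h_i/2) acts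
  there by \<open>xq powi hh i a\<close>.\<close>

definition hh :: "nat \<Rightarrow> nat \<Rightarrow> int" where
  "hh i a = ee (pp i) a - ee (rr i) a"

lemma form_alpha_eps: "i \<in> {1..s} \<Longrightarrow> a \<in> ind \<Longrightarrow> form (alpha i) (eps a) = of_int (hh i a)"
  by (simp add: alpha_eq form_diff_left form_eps hh_def)

lemma hh_prime [simp]: "i \<in> {1..s} \<Longrightarrow> a \<in> ind \<Longrightarrow> hh i (prime a) = - hh i a"
  by (simp add: hh_def)

lemma cartan_eq: "i \<in> {1..s} \<Longrightarrow> j \<in> {1..s} \<Longrightarrow> cartan i j = of_int (hh i (pp j) - hh i (rr j))"
  by (simp add: cartan_def alpha_eq[of j] form_diff_right form_alpha_eps)

definition cart :: "nat \<Rightarrow> nat \<Rightarrow> int" where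
  "cart i j = hh i (pp j) - hh i (rr j)"

lemma cartan_cart: "i \<in> {1..s} \<Longrightarrow> j \<in> {1..s} \<Longrightarrow> cartan i j = of_int (cart i j)"
  by (simp add: cartan_eq cart_def)

lemma cart_sym: "i \<in> {1..s} \<Longrightarrow> j \<in> {1..s} \<Longrightarrow> cart i j = cart j i"
  unfolding cart_def hh_def using ee_sym pp_rr_ind by simp

lemma munit_apply: "munit i j a c = of_bool (a = i \<and> c = j)"
  by (simp add: munit_def)

lemma X_apply: "X i j a c = of_bool (a = i \<and> c = j)
   - (-1) ^ (par i * (par i + par j)) * th i * th j * of_bool (a = prime j \<and> c = prime i)"
  by (simp add: X_def munit_apply)

lemma h_mat_eq: "i \<in> {1..s} \<Longrightarrow> a \<in> ind \<Longrightarrow> h_mat i a a = hh i a"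
proof -
  have X: "X j j a a = of_bool (a = j) - of_bool (a = prime j)" if "j \<in> ind" "a \<in> ind" for j
    using that by (simp add: X_apply mult.assoc)
  have XX: "(-1) ^ par j * X j j a a = ee j a" if "j \<in> ind" "a \<in> ind" for j
    using that par_self_dual[of j] by (auto simp: X ee_def sgn_par_def)
  assume i: "i \<in> {1..s}" and a: "a \<in> ind"
  from i have "h_mat i a a = (-1) ^ par (pp i) * X (pp i) (pp i) a a - (-1) ^ par (rr i) * X (rr i) (rr i) a a"
  proof (cases rule: pp_rr_cases)
    case C
    \<comment> \<open>This identity turns -2 X_ss into the difference formula valid for the other
      nodes.\<close>
    have "X (Suc s) (Suc s) a a = - X s s a a"
      using C le_s_ind[of s] X[of s] X[of "Suc s"] a i by (auto simp: ind_def prime_def)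
    with C show ?thesis
      by (simp add: h_mat_def par_s_dual)
  qed (auto simp: h_mat_def)
  also have "\<dots> = hh i a"
    using i a by (simp add: hh_def XX)
  finally show ?thesis .
qed

text \<open>For the long root the two matrix units in \<open>X s (s + 1)\<close> coincide, so this
  matrix is twice e_s. The lowering matrix -2 E_{s+1,s} already equals
  \<open>(-1) ^ par s *\<^sub>m X (s + 1) s\<close> and needs no such correction.\<close>

definition e_scale :: "nat \<Rightarrow> K" where
  "e_scale i = (if even m \<and> par s = 1 \<and> i = s then 1 / 2 else 1)"

text \<open>\<open>om i\<close> and \<open>om' i\<close> are the coefficients of the second matrix
  unit in \<open>X (rr i) (pp i)\<close> and \<open>X (pp i) (rr i)\<close>; both are signs.\<close>

definition om :: "nat \<Rightarrow> K" where
  "om i = - ((-1) ^ (par (rr i) * (par (pp i) + par (rr i))) * of_int (th (pp i) * th (rr i)))"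

definition om' :: "nat \<Rightarrow> K" where
  "om' i = - ((-1) ^ (par (pp i) * (par (pp i) + par (rr i))) * of_int (th (pp i) * th (rr i)))"

definition Ff :: "nat \<Rightarrow> nat \<Rightarrow> nat \<Rightarrow> K" where
  "Ff i a c = kappa i * (-1) ^ par (pp i) *
     (of_bool (a = rr i \<and> c = pp i) + om i * of_bool (a = prime (pp i) \<and> c = prime (rr i)))"

definition Ef :: "nat \<Rightarrow> nat \<Rightarrow> nat \<Rightarrow> K" where
  "Ef i a c = e_scale i *
     (of_bool (a = pp i \<and> c = rr i) + om' i * of_bool (a = prime (rr i) \<and> c = prime (pp i)))"

lemma rep_Gf: "i \<in> {1..s} \<Longrightarrow> rep_gen (Gf i) = Ff i"
proof (erule pp_rr_cases)
  assume "i = s" "even m" "par s = 1" "pp i = s" "rr i = s + 1" "N = 2 * s" "2 \<le> s"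
  moreover have "th (Suc s) = - th s"
    using calculation th_prime[of s] le_s_ind[of s] by (simp add: prime_def)
  moreover have "th s = 1 \<or> th s = -1"
    using calculation th_cases[of s] le_s_ind[of s] by simp
  ultimately show ?thesis
    by (auto simp: Ff_def f_mat_def of_int_matr_def om_def munit_apply prime_def par_s_dual fun_eq_iff)
qed (auto simp: Ff_def f_mat_def of_int_matr_def om_def X_apply fun_eq_iff algebra_simps)

lemma rep_Ge: "i \<in> {1..s} \<Longrightarrow> rep_gen (Ge i) = Ef i"
proof (erule pp_rr_cases)
  assume "i = s" "even m" "par s = 1" "pp i = s" "rr i = s + 1" "N = 2 * s" "2 \<le> s"
  moreover have "th (Suc s) = - th s"
    using calculation th_prime[of s] le_s_ind[of s] by (simp add: prime_def)
  moreover have "th s = 1 \<or> th s = -1"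
    using calculation th_cases[of s] le_s_ind[of s] by simp
  ultimately show ?thesis
    by (auto simp: Ef_def e_mat_def of_int_matr_def om'_def munit_apply prime_def par_s_dual e_scale_def two_neq_0_K fun_eq_iff)
qed (auto simp: Ef_def e_mat_def of_int_matr_def om'_def X_apply fun_eq_iff e_scale_def algebra_simps)

lemma Ff_cases:
  assumes "Ff i a c \<noteq> 0"
  obtains "a = rr i" "c = pp i" | "a = prime (pp i)" "c = prime (rr i)"
  using assms by (auto simp: Ff_def of_bool_def split: if_splits)

lemma Ef_cases:
  assumes "Ef i a c \<noteq> 0"
  obtains "a = pp i" "c = rr i" | "a = prime (rr i)" "c = prime (pp i)"
  using assms by (auto simp: Ef_def of_bool_def split: if_splits)

lemma msupp_Ff: "i \<in> {1..s} \<Longrightarrow> msupp ind (Ff i)"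
  unfolding msupp_def by (auto elim!: Ff_cases)

lemma msupp_Ef: "i \<in> {1..s} \<Longrightarrow> msupp ind (Ef i)"
  unfolding msupp_def by (auto elim!: Ef_cases)

text \<open>A nonzero entry of f_i lowers the weight by \<open>alpha i\<close>; this is that
  statement paired with \<open>eps a\<close>.\<close>

lemma ee_Ff: "i \<in> {1..s} \<Longrightarrow> Ff i b d \<noteq> 0 \<Longrightarrow> a \<in> ind \<Longrightarrow> ee a b = ee a d - hh i a"
  using ee_sym by (auto elim!: Ff_cases simp: hh_def)

end

section \<open>The vector \<open>\<rho>\<close>\<close>

context osp
begin

text \<open>The conditions a < b < a' force a \<le> s, hence this dependent sum.\<close>

definition root_pairs :: "(nat \<times> nat) set" where
  "root_pairs = (SIGMA a:{1..s}. {a<..<prime a})"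

lemma root_pairs_iff: "(a, b) \<in> root_pairs \<longleftrightarrow> 1 \<le> a \<and> a < b \<and> b < prime a"
  using N_cases by (auto simp: root_pairs_def prime_def)

lemma root_pairsD:
  assumes "(a, b) \<in> root_pairs"
  shows "a \<in> {1..s}" "a \<in> ind" "b \<in> ind" "a \<noteq> b" "b \<noteq> prime a" "prime b \<noteq> a" "a < b" "a < prime b" "b < prime a"
  using assms N_cases by (auto simp: root_pairs_def prime_def ind_def)

lemma root_coord:
  assumes "(a, b) \<in> root_pairs" "k \<in> {1..s}"
  shows "(eps a - eps b) k = of_bool (a = k) - of_bool (b = k) + of_bool (b = prime k)"
  using assms root_pairsD[OF assms(1)] le_s_ind N_cases
  by (auto simp: eps_apply prime_def)

text \<open>The form separates the indices: only the middle index pairs to zero with itself, and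
  replacing an index by its dual changes the sign.\<close>

lemma eps_inj:
  assumes "a \<in> ind" "b \<in> ind" "eps a = eps b"
  shows "a = b"
proof -
  have "ee k a = ee k b" if "k \<in> ind" for k
    using assms that form_eps[of k a] form_eps[of k b] by simp
  from this[of a] this[of b] assms show ?thesis
    using sgn_par_cases[of a] sgn_par_cases[of b] N_cases
    by (auto simp: ee_def prime_def ind_def split: if_splits)
qed

lemma inj_roots: "inj_on (\<lambda>(a, b). eps a - eps b) root_pairs"
proof (rule inj_onI, clarify)
  fix a b c d
  assume ab: "(a, b) \<in> root_pairs" and cd: "(c, d) \<in> root_pairs" and eq: "eps a - eps b = eps c - eps d"
  note D = root_pairsD[OF ab] root_pairsD[OF cd]
  have "(eps a - eps b) a = (eps c - eps d) a" "(eps a - eps b) c = (eps c - eps d) c"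
    by (simp_all add: eq)
  \<comment> \<open>If a and c differed, the two coordinates would give d = a' and b = c', and the
    inequalities in \<open>root_pairs\<close> would yield both c < a and a < c.\<close>
  then have "a = c"
    using D root_coord[OF ab, of a] root_coord[OF cd, of a] root_coord[OF ab, of c] root_coord[OF cd, of c]
    by (auto simp: of_bool_def prime_def split: if_splits)
  moreover from this have "eps b = eps d"
    using eq by simp
  ultimately show "a = c \<and> b = d"
    using D eps_inj by blast
qed

lemma finite_root_pairs [simp]: "finite root_pairs"
  by (simp add: root_pairs_def)

text \<open>Even and odd roots combine into one sum with sign \<open>sgn_par a * sgn_par b\<close>.
  For a < k the roots eps a - eps k and eps a + eps k cancel in coordinate k, so only a = k remains.
  The summand \<open>1 - sgn_par k\<close> is the long root 2 eps k, present for odd k.\<close>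

lemma rho_coord:
  assumes k: "k \<in> {1..s}"
  shows "2 * rho k = of_int (sgn_par k * (\<Sum>b\<in>{k<..<prime k}. sgn_par b) + (1 - sgn_par k))"
proof -
  let ?r = "\<lambda>(a, b). eps a - eps b"
  let ?ev = "{(a, b) \<in> root_pairs. even (par a + par b)}"
  let ?od = "{(a, b) \<in> root_pairs. odd (par a + par b)}"
  let ?D = "(\<lambda>a. eps a + eps a) ` {a \<in> {1..s}. par a = 1}"
  have ev: "even_pos_roots = ?r ` ?ev \<union> ?D"
    unfolding even_pos_roots_def by (auto simp: root_pairs_iff image_iff)
  have od: "odd_pos_roots = ?r ` ?od"
    unfolding odd_pos_roots_def by (auto simp: root_pairs_iff image_iff)
  have disj: "?r ` ?ev \<inter> ?D = {}"
  proof -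
    \<comment> \<open>A coordinate equal to 2 requires b = a', which is excluded from
      \<open>root_pairs\<close>; hence no long root is counted twice.\<close>
    have False if ab: "(a, b) \<in> root_pairs" and c: "c \<in> {1..s}" and eq: "eps a - eps b = eps c + eps c" for a b c
    proof -
      have "c \<noteq> prime c" using c N_cases by (auto simp: prime_def)
      then have "eps c c = 1" using eps_apply[OF le_s_ind[OF c] c] by simp
      then have "(eps a - eps b) c = 2" using eq unfolding plus_fun_apply by simp
      then have "a = c" "b = prime c"
        unfolding root_coord[OF ab c] by (auto simp: of_bool_def split: if_splits)
      with root_pairsD(5)[OF ab] show False by simp
    qed
    then show ?thesis by (fastforce simp: disjoint_iff)
  qed
  have injD: "inj_on (\<lambda>a. eps a + eps a) {a \<in> {1..s}. par a = 1}"
  proof (rule inj_onI)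
    fix a b assume *: "a \<in> {a \<in> {1..s}. par a = 1}" "b \<in> {a \<in> {1..s}. par a = 1}" "eps a + eps a = eps b + eps b"
    then have "eps a k = eps b k" for k
      using fun_cong[OF *(3), of k] unfolding plus_fun_apply by linarith
    then show "a = b" using * eps_inj le_s_ind by blast
  qed
  have e: "eps a k = of_bool (a = k)" if "a \<in> {1..s}" for a
    using that k le_s_ind[OF that] N_cases by (auto simp: eps_apply prime_def)
  have "(\<Sum>\<beta>\<in>?D. \<beta> k) = (\<Sum>a\<in>{a \<in> {1..s}. par a = 1}. (eps a + eps a) k)"
    by (subst sum.reindex[OF injD]) (simp only: o_def)
  also have "\<dots> = (\<Sum>a\<in>{a \<in> {1..s}. par a = 1}. if a = k then 2 else 0)"
    unfolding plus_fun_apply by (intro sum.cong) (auto simp: e)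
  also have "\<dots> = of_int (1 - sgn_par k)"
    using k par_cases[of k] le_s_ind[of k] by (auto simp: sgn_par_def)
  finally have sD: "(\<Sum>\<beta>\<in>?D. \<beta> k) = of_int (1 - sgn_par k)" .
  have img: "(\<Sum>\<beta>\<in>?r ` S. \<beta> k) = (\<Sum>(a, b)\<in>S. (eps a - eps b) k)" if "S \<subseteq> root_pairs" for S
    by (subst sum.reindex[OF inj_on_subset[OF inj_roots that]]) (simp add: case_prod_unfold)
  have fin: "finite ?ev" "finite ?od" by (auto intro: finite_subset[OF _ finite_root_pairs])
  have "2 * rho k = ((\<Sum>(a, b)\<in>?ev. (eps a - eps b) k) - (\<Sum>(a, b)\<in>?od. (eps a - eps b) k))
      + of_int (1 - sgn_par k)"
  proof -
    have "(\<Sum>\<beta>\<in>even_pos_roots. \<beta> k) = (\<Sum>(a, b)\<in>?ev. (eps a - eps b) k) + of_int (1 - sgn_par k)"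
    proof -
      have "(\<Sum>\<beta>\<in>even_pos_roots. \<beta> k) = (\<Sum>\<beta>\<in>?r ` ?ev. \<beta> k) + (\<Sum>\<beta>\<in>?D. \<beta> k)"
        unfolding ev by (rule sum.union_disjoint[OF _ _ disj]) (use fin in \<open>auto intro: finite_imageI\<close>)
      also have "(\<Sum>\<beta>\<in>?r ` ?ev. \<beta> k) = (\<Sum>(a, b)\<in>?ev. (eps a - eps b) k)"
        by (rule img) blast
      finally show ?thesis unfolding sD .
    qed
    moreover have "(\<Sum>\<beta>\<in>odd_pos_roots. \<beta> k) = (\<Sum>(a, b)\<in>?od. (eps a - eps b) k)"
      unfolding od by (rule img) blast
    ultimately show ?thesis by (simp add: rho_def)
  qed
  also have "(\<Sum>(a, b)\<in>?ev. (eps a - eps b) k) - (\<Sum>(a, b)\<in>?od. (eps a - eps b) k)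
      = (\<Sum>(a, b)\<in>root_pairs. of_int (sgn_par a * sgn_par b) * (eps a - eps b) k)"
  proof -
    let ?g = "\<lambda>(a, b). of_int (sgn_par a * sgn_par b) * (eps a - eps b) k"
    have sg: "sgn_par a * sgn_par b = (-1) ^ (par a + par b)" for a b
      by (simp add: sgn_par_def power_add)
    have "sum ?g (?ev \<union> ?od) = sum ?g ?ev + sum ?g ?od"
      by (rule sum.union_disjoint) (use fin in auto)
    moreover have "?ev \<union> ?od = root_pairs" by auto
    moreover have "sum ?g ?ev = (\<Sum>(a, b)\<in>?ev. (eps a - eps b) k)"
      by (intro sum.cong) (auto simp: sg)
    moreover have "sum ?g ?od = - (\<Sum>(a, b)\<in>?od. (eps a - eps b) k)"
      unfolding sum_negf[symmetric] by (intro sum.cong) (auto simp: sg)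
    ultimately show ?thesis by simp
  qed
  also have "(\<Sum>(a, b)\<in>root_pairs. of_int (sgn_par a * sgn_par b) * (eps a - eps b) k)
      = (\<Sum>a\<in>{1..s}. \<Sum>b\<in>{a<..<prime a}. of_int (sgn_par a * sgn_par b) * (eps a - eps b) k)"
    unfolding root_pairs_def by (subst sum.Sigma) auto
  also have "\<dots> = (\<Sum>a\<in>{1..s}. if a = k then of_int (sgn_par k * (\<Sum>b\<in>{k<..<prime k}. sgn_par b)) else 0)"
  proof (intro sum.cong refl)
    fix a assume a: "a \<in> {1..s}"
    have "(\<Sum>b\<in>{a<..<prime a}. of_int (sgn_par a * sgn_par b) * (eps a - eps b) k)
      = (\<Sum>b\<in>{a<..<prime a}. of_int (sgn_par a * sgn_par b) * of_bool (a = k)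
          - (if b = k then of_int (sgn_par a * sgn_par k) else 0)
          + (if b = prime k then of_int (sgn_par a * sgn_par k) else 0))"
      using a k le_s_ind[OF k] root_coord[of a _ k]
      by (intro sum.cong) (auto simp: root_pairs_iff sgn_par_def)
    \<comment> \<open>For a different from k, the range contains k if and only if it contains k', so
      the two extra terms cancel; for a = k it contains neither.\<close>
    also have "\<dots> = (\<Sum>b\<in>{a<..<prime a}. of_int (sgn_par a * sgn_par b) * of_bool (a = k))"
      using a k N_cases by (auto simp: sum.distrib sum_subtractf prime_def)
    finally show "(\<Sum>b\<in>{a<..<prime a}. of_int (sgn_par a * sgn_par b) * (eps a - eps b) k)
      = (if a = k then of_int (sgn_par k * (\<Sum>b\<in>{k<..<prime k}. sgn_par b)) else 0)"
      by (auto simp: sum_distrib_left)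
  qed
  finally show ?thesis using k by simp
qed

text \<open>Twice (rho, eps a), an integer; thus q^((rho, eps a)) is
  \<open>xq powi rh a\<close>.\<close>

definition rh :: "nat \<Rightarrow> int" where
  "rh a = (if a \<le> s then (\<Sum>b\<in>{a<..<prime a}. sgn_par b) + sgn_par a - 1
           else if prime a \<le> s then - ((\<Sum>b\<in>{prime a<..<a}. sgn_par b) + sgn_par a - 1)
           else 0)"

lemma form_rho_eps: "a \<in> ind \<Longrightarrow> 2 * form rho (eps a) = of_int (rh a)"
proof -
  assume a: "a \<in> ind"
  have le: "2 * form rho (eps a) = of_int (rh a)" if "a \<in> {1..s}" for a
  proof -
    have "2 * form rho (eps a) = (\<Sum>k\<in>{1..s}. if k = a then of_int (sgn_par a) * (2 * rho a) else 0)"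
      unfolding form_def sum_distrib_left using that le_s_ind N_cases
      by (intro sum.cong) (auto simp: eps_apply sgn_par_def prime_def)
    also have "\<dots> = of_int (rh a)"
      using that le_s_ind[OF that] sgn_par_cases[of a]
      by (auto simp: rho_coord rh_def)
    finally show ?thesis .
  qed
  consider "a \<in> {1..s}" | "prime a \<in> {1..s}" "\<not> a \<le> s" | "\<not> a \<le> s" "\<not> prime a \<le> s" "prime a = a"
    using a N_cases by (force simp: ind_def prime_def)
  then show ?thesis
  proof cases
    case 2
    then have "eps a = - eps (prime a)"
      by (auto simp: eps_def fun_eq_iff)
    then have "form rho (eps a) = - form rho (eps (prime a))"
      by (simp add: form_def sum_negf)
    moreover have "rh a = - rh (prime a)"
      using 2 a by (simp add: rh_def) (simp add: sgn_par_def)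
    ultimately show ?thesis using le[OF 2(1)] by simp
  next
    case 3
    then have "eps a = 0" using a by (auto simp: eps_def)
    with 3 show ?thesis by (simp add: rh_def form_def)
  qed (use le in auto)
qed

lemma rh_prime [simp]:
  assumes "a \<in> ind"
  shows "rh (prime a) = - rh a"
proof -
  have "eps (prime a) = - eps a"
    using assms N_cases by (auto simp: eps_def fun_eq_iff ind_def prime_def unit_wt_def)
  then have "form rho (eps (prime a)) = - form rho (eps a)"
    by (simp add: form_def sum_negf)
  then have "(of_int (rh (prime a)) :: rat) = of_int (- rh a)"
    using form_rho_eps[of a] form_rho_eps[of "prime a"] assms by simp
  then show ?thesis by (simp only: of_int_eq_iff)
qed

text \<open>The interval between a and a' exceeds that for a + 1 by a + 1 and its dual, which have
  equal parity.\<close>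

lemma rh_step:
  assumes "a < s"
    and "1 \<le> a"
  shows "rh a - rh (a + 1) = sgn_par a + sgn_par (a + 1)"
proof -
  have "{a<..<prime a} = insert (a + 1) (insert (prime (a + 1)) {a + 1<..<prime (a + 1)})"
    using assms N_cases by (auto simp: prime_def)
  moreover have "a + 1 \<noteq> prime (a + 1)" "a + 1 \<in> ind"
    using assms N_cases by (auto simp: prime_def ind_def)
  ultimately show ?thesis
    using assms by (simp add: rh_def) (simp add: sgn_par_def)
qed

lemma rh_last: "N = 2 * s \<Longrightarrow> rh s = sgn_par s - 1" "N = 2 * s + 1 \<Longrightarrow> rh s = sgn_par s"
proof -
  assume N: "N = 2 * s"
  then have "{s<..<prime s} = {}" by (auto simp: prime_def)
  then show "rh s = sgn_par s - 1" by (simp add: rh_def)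
next
  assume N: "N = 2 * s + 1"
  then have "{s<..<prime s} = {s + 1}" by (auto simp: prime_def)
  moreover have "sgn_par (s + 1) = 1"
    using par_self_dual[of "s + 1"] N by (simp add: ind_def prime_def sgn_par_def)
  ultimately show "rh s = sgn_par s" by (simp add: rh_def)
qed

text \<open>The identity 2 (rho, \<alpha>) = (\<alpha>, \<alpha>) for simple roots \<alpha>, which
  makes the powers of q at the terms E_{i'j'} compatible with f_i.\<close>

lemma rh_simple: "i \<in> {1..s} \<Longrightarrow> rh (pp i) - rh (rr i) = hh i (pp i) - hh i (rr i)"
proof -
  assume i: "i \<in> {1..s}"
  then show ?thesis
  proof (cases rule: pp_rr_cases)
    case chain
    show ?thesis
    proof (cases "i < s")
      case True
      then have "ee i i = sgn_par i" "ee (i+1) (i+1) = sgn_par (i+1)" "ee i (i+1) = 0" "ee (i+1) i = 0"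
        using N_cases chain by (auto simp: ee_def prime_def)
      with True chain show ?thesis
        using rh_step[of i] by (simp add: hh_def)
    next
      case False
      then have *: "i = s" "N = 2 * s + 1" using chain by auto
      then have "ee s s = sgn_par s" "ee (s+1) (s+1) = 0" "ee s (s+1) = 0" "ee (s+1) s = 0"
        using chain by (auto simp: ee_def prime_def)
      with * chain show ?thesis
        using rh_last(2) by (simp add: hh_def rh_def prime_def)
    qed
  next
    case D
    then have "rh (s + 1) = - rh s"
      using rh_prime[of s] le_s_ind[of s] i by (simp add: prime_def)
    moreover have "rh (s - 1) - rh s = sgn_par (s - 1) + sgn_par s"
      using rh_step[of "s - 1"] D by simp
    moreover have "rh s = 0" using D rh_last by (simp add: sgn_par_def)
    moreover have "ee (s-1) (s-1) = sgn_par (s-1)" "ee (s+1) (s+1) = sgn_par s" "ee (s-1) (s+1) = 0" "ee (s+1) (s-1) = 0"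
      using D by (auto simp: ee_def prime_def sgn_par_def par_s_dual)
    ultimately show ?thesis using D by (simp add: hh_def)
  next
    case C
    then have "rh (s + 1) = - rh s"
      using rh_prime[of s] le_s_ind[of s] i by (simp add: prime_def)
    moreover have "rh s = - 2" using C rh_last by (simp add: sgn_par_def)
    moreover have "ee s s = -1" "ee (s+1) (s+1) = -1" "ee s (s+1) = 1" "ee (s+1) s = 1"
      using C by (auto simp: ee_def prime_def sgn_par_def par_s_dual)
    ultimately show ?thesis using C by (simp add: hh_def)
  qed
qed

end

section \<open>The explicit matrix intertwines the coproduct and its opposite\<close>

context osp
begin

text \<open>The coefficient of a term E_ij \<otimes> E_{i'j'} factors into \<open>gq\<close> of the
  row index and \<open>gp\<close> of the column index. All grading signs are put into
  \<open>gp\<close>.\<close>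

definition gq :: "K \<Rightarrow> nat \<Rightarrow> K" where
  "gq x a = of_int (th a) * x powi rh a"

definition gp :: "K \<Rightarrow> nat \<Rightarrow> K" where
  "gp x a = (-1) ^ par a * of_int (th a) * x powi (- rh a)"

text \<open>The entries of \<open>R_zero\<close> with a free scalar x in place of q^(1/2). Its
  diagonal sum collapses to a single power of x, and the signs of the graded tensor product are
  already evaluated.\<close>

definition Rx :: "K \<Rightarrow> (nat \<times> nat, K) matr" where
  "Rx x = (\<lambda>(a, b) (c, d). if (a, b) \<in> ind2 \<and> (c, d) \<in> ind2 then
     of_bool (a = c \<and> b = d) * x powi (- 2 * ee a b)
     + (x powi (- 2) - x powi 2) * of_bool (a < c)
       * (of_bool (a = d \<and> b = c) * (-1) ^ (par a * par c)
          - of_bool (b = prime a \<and> d = prime c) * gq x a * gp x c)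
     else 0)"

text \<open>The matrix of q^(h_i/2) \<otimes> f_i + f_i \<otimes> q^(-h_i/2). At
  \<open>inverse x\<close> it is the conjugate of this operator by the graded flip.
  \<open>Ff i\<close> keeps the fixed scalar \<open>kappa i\<close> when x varies, which is harmless
  because the intertwining relation is linear in \<open>Ff i\<close>.\<close>

definition Dl :: "nat \<Rightarrow> K \<Rightarrow> (nat \<times> nat, K) matr" where
  "Dl i x = (\<lambda>(a, b) (c, d). if (a, b) \<in> ind2 \<and> (c, d) \<in> ind2 then
     of_bool (b = d) * Ff i a c * x powi (- hh i d)
     + of_bool (a = c) * x powi hh i c * (-1) ^ ((par b + par d) * par c) * Ff i b d else 0)"

text \<open>The coefficient of \<open>Rx\<close> at the pair \<open>s, s + 1\<close> vanishes in type D, so the order of these two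
  indices is immaterial there; for the last node it has to be the reverse one in order that the
  generators still connect neighbours.\<close>

definition ky :: "nat \<Rightarrow> nat \<Rightarrow> nat" where
  "ky i a = (if even m \<and> par s = 0 \<and> i = s
             then (if a = s then s + 1 else if a = s + 1 then s else a) else a)"

lemma ky_inj [simp]: "ky i a = ky i b \<longleftrightarrow> a = b"
  by (auto simp: ky_def)

lemma ky_Ff:
  assumes i: "i \<in> {1..s}" and "Ff i b c \<noteq> 0"
  shows "ky i b = ky i c + 1"
proof -
  have *: "b = rr i \<and> c = pp i \<or> b = prime (pp i) \<and> c = prime (rr i)"
    using assms(2) by (auto elim: Ff_cases)
  from i show ?thesis
  proof (cases rule: pp_rr_cases)
    case chain
    then have "ky i = (\<lambda>a. a)" by (auto simp: ky_def)
    moreover have "i < N" using chain N_cases by auto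
    ultimately show ?thesis using * chain by (auto simp: prime_def)
  next
    case D
    then have "ky i = (\<lambda>a. if a = s then s + 1 else if a = s + 1 then s else a)"
      by (auto simp: ky_def)
    with * D show ?thesis by (auto simp: prime_def)
  next
    case C
    then have "ky i = (\<lambda>a. a)" by (auto simp: ky_def)
    with * C show ?thesis by (auto simp: prime_def)
  qed
qed

text \<open>In the order \<open>ky i\<close> the index b directly follows c, so lying below b means
  lying below c or being c. Differences of comparisons thereby become Kronecker deltas.\<close>

lemma klt_succ:
  assumes "i \<in> {1..s}" "Ff i b c \<noteq> 0"
  shows "of_bool (ky i a < ky i b) = (of_bool (ky i a < ky i c) + of_bool (a = c) :: K)"
    and "of_bool (ky i c < ky i a) = (of_bool (ky i b < ky i a) + of_bool (a = b) :: K)"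
  using ky_Ff[OF assms] ky_inj[of i a c] ky_inj[of i a b] by (auto simp: of_bool_def simp del: ky_inj)

lemma rh_s_D: "even m \<Longrightarrow> par s = 0 \<Longrightarrow> rh s = 0 \<and> rh (s + 1) = 0"
  using rh_last(1) odd_m_iff N_cases rh_prime[of s] le_s_ind[of s] s_ge_1
  by (auto simp: sgn_par_def prime_def)

lemma Rx_ky:
  assumes "a \<in> ind" "b \<in> ind" "c \<in> ind" "d \<in> ind"
  shows "Rx x (a, b) (c, d) = of_bool (a = c \<and> b = d) * x powi (- 2 * ee a b)
     + (x powi (- 2) - x powi 2) * of_bool (ky i a < ky i c)
       * (of_bool (a = d \<and> b = c) * (-1) ^ (par a * par c)
          - of_bool (b = prime a \<and> d = prime c) * gq x a * gp x c)"
proof (cases "even m \<and> par s = 0 \<and> i = s \<and> (a = s \<and> c = s + 1 \<or> a = s + 1 \<and> c = s)")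
  case True
  then have N: "N = 2 * s" using odd_m_iff N_cases by auto
  with True have p: "prime a = c" "prime c = a" "par a = 0" "par c = 0"
    using par_s_dual by (auto simp: prime_def)
  then have th: "th a = 1" "th c = 1"
    using assms th_even[of a] th_even[of c] by (auto simp: ind_def N_def)
  have "rh a = 0" "rh c = 0" using True rh_s_D by auto
  \<comment> \<open>As c = a', the flip condition and the dual condition agree, and both
    coefficients are 1.\<close>
  with p th have "of_bool (a = d \<and> b = c) * (-1) ^ (par a * par c)
          - of_bool (b = prime a \<and> d = prime c) * gq x a * gp x c = 0"
    by (auto simp: gq_def gp_def)
  then show ?thesis using assms by (simp add: Rx_def ind2_def)
next
  case False
  then have "ky i a < ky i c \<longleftrightarrow> a < c"
    by (auto simp: ky_def)
  then show ?thesis using assms by (simp add: Rx_def ind2_def)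
qed

section \<open>Sums over one tensor index\<close>

lemma sum_ind_delta:
  assumes "a \<in> ind"
  shows "(\<Sum>e\<in>ind. of_bool (e = a) * f e) = (f a :: K)" "(\<Sum>e\<in>ind. of_bool (a = e) * f e) = (f a :: K)"
proof -
  have "(\<Sum>e\<in>ind. of_bool (e = a) * f e) = (\<Sum>e\<in>ind. if e = a then f e else 0)"
    by (intro sum.cong) auto
  also have "\<dots> = f a" using assms by simp
  finally show *: "(\<Sum>e\<in>ind. of_bool (e = a) * f e) = f a" .
  then show "(\<Sum>e\<in>ind. of_bool (a = e) * f e) = f a"
    by (simp add: eq_commute[of a])
qed

lemma sum_ind2: "(\<Sum>k\<in>ind2. f k) = (\<Sum>e\<in>ind. \<Sum>g\<in>ind. f (e, g))"
  by (simp add: ind2_def sum.cartesian_product)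

lemma mmult_Dl_right:
  assumes "c \<in> ind" "d \<in> ind"
  shows "mmult ind2 A (Dl i x) p (c, d) =
     (\<Sum>e\<in>ind. A p (e, d) * (Ff i e c * x powi (- hh i d)))
   + (\<Sum>g\<in>ind. A p (c, g) * (x powi hh i c * (-1) ^ ((par g + par d) * par c) * Ff i g d))"
proof -
  have "mmult ind2 A (Dl i x) p (c, d) = (\<Sum>e\<in>ind. \<Sum>g\<in>ind.
      of_bool (g = d) * (A p (e, g) * (Ff i e c * x powi (- hh i d)))
    + of_bool (e = c) * (A p (e, g) * (x powi hh i c * (-1) ^ ((par g + par d) * par c) * Ff i g d)))"
    unfolding mmult_def sum_ind2 using assms
    by (intro sum.cong) (auto simp: Dl_def ind2_def algebra_simps)
  also have "\<dots> = (\<Sum>e\<in>ind. A p (e, d) * (Ff i e c * x powi (- hh i d)))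
    + (\<Sum>g\<in>ind. \<Sum>e\<in>ind. of_bool (e = c) * (A p (e, g) * (x powi hh i c * (-1) ^ ((par g + par d) * par c) * Ff i g d)))"
    unfolding sum.distrib using assms by (simp only: sum_ind_delta sum.swap[of _ ind ind])
  finally show ?thesis using assms by (simp only: sum_ind_delta)
qed

lemma mmult_Dl_left:
  assumes "a \<in> ind" "b \<in> ind"
  shows "mmult ind2 (Dl i x) A (a, b) p =
     (\<Sum>e\<in>ind. Ff i a e * x powi (- hh i b) * A (e, b) p)
   + (\<Sum>g\<in>ind. x powi hh i a * (-1) ^ ((par b + par g) * par a) * Ff i b g * A (a, g) p)"
proof -
  have "mmult ind2 (Dl i x) A (a, b) p = (\<Sum>e\<in>ind. \<Sum>g\<in>ind.
      of_bool (g = b) * (Ff i a e * x powi (- hh i b) * A (e, g) p)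
    + of_bool (e = a) * (x powi hh i a * (-1) ^ ((par b + par g) * par a) * Ff i b g * A (e, g) p))"
    unfolding mmult_def sum_ind2 using assms
    by (intro sum.cong) (auto simp: Dl_def ind2_def algebra_simps)
  also have "\<dots> = (\<Sum>e\<in>ind. Ff i a e * x powi (- hh i b) * A (e, b) p)
    + (\<Sum>g\<in>ind. \<Sum>e\<in>ind. of_bool (e = a) * (x powi hh i a * (-1) ^ ((par b + par g) * par a) * Ff i b g * A (e, g) p))"
    unfolding sum.distrib using assms by (simp only: sum_ind_delta sum.swap[of _ ind ind])
  finally show ?thesis using assms by (simp only: sum_ind_delta)
qed

text \<open>Once three of the four indices of \<open>Rx\<close> are fixed, the fourth carries three
  Kronecker terms: diagonal, flip and dual.\<close>

lemma sum_three:
  assumes "u \<in> ind" "v \<in> ind" "w \<in> ind"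
    and "\<And>e. e \<in> ind \<Longrightarrow> A e = of_bool (e = u) * p e + of_bool (e = v) * q e - of_bool (e = w) * r e"
  shows "(\<Sum>e\<in>ind. A e * f e) = p u * f u + q v * f v - r w * (f w :: K)"
proof -
  have "(\<Sum>e\<in>ind. A e * f e) = (\<Sum>e\<in>ind. of_bool (e = u) * (p e * f e) + of_bool (e = v) * (q e * f e)
      - of_bool (e = w) * (r e * f e))"
    by (intro sum.cong) (simp_all add: assms(4) algebra_simps)
  also have "\<dots> = p u * f u + q v * f v - r w * f w"
    unfolding sum.distrib sum_subtractf using assms(1-3) by (simp only: sum_ind_delta)
  finally show ?thesis .
qed

abbreviation (input) zz :: "K \<Rightarrow> K" where "zz x \<equiv> x powi (- 2) - x powi 2"

abbreviation klt :: "nat \<Rightarrow> nat \<Rightarrow> nat \<Rightarrow> K" where "klt i a c \<equiv> of_bool (ky i a < ky i c)"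

lemma sum_Rx:
  assumes "a \<in> ind" "b \<in> ind" "c \<in> ind" "d \<in> ind"
  shows
    "(\<Sum>e\<in>ind. Rx x (a, b) (e, d) * f e) = of_bool (b = d) * x powi (- 2 * ee a b) * f a
      + zz x * klt i a b * of_bool (a = d) * (-1) ^ (par a * par b) * f b
      - zz x * klt i a (prime d) * of_bool (b = prime a) * gq x a * gp x (prime d) * f (prime d)"
    "(\<Sum>g\<in>ind. Rx x (a, b) (c, g) * f g) = of_bool (a = c) * x powi (- 2 * ee a b) * f b
      + zz x * klt i a c * of_bool (b = c) * (-1) ^ (par a * par c) * f a
      - zz x * klt i a c * of_bool (b = prime a) * gq x a * gp x c * f (prime c)"
    "(\<Sum>e\<in>ind. Rx x (e, b) (c, d) * f e) = of_bool (b = d) * x powi (- 2 * ee c b) * f c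
      + zz x * klt i d c * of_bool (b = c) * (-1) ^ (par d * par c) * f d
      - zz x * klt i (prime b) c * of_bool (d = prime c) * gq x (prime b) * gp x c * f (prime b)"
    "(\<Sum>g\<in>ind. Rx x (a, g) (c, d) * f g) = of_bool (a = c) * x powi (- 2 * ee a d) * f d
      + zz x * klt i a c * of_bool (a = d) * (-1) ^ (par a * par c) * f c
      - zz x * klt i a c * of_bool (d = prime c) * gq x a * gp x c * f (prime a)"
proof -
  show "(\<Sum>e\<in>ind. Rx x (a, b) (e, d) * f e) = of_bool (b = d) * x powi (- 2 * ee a b) * f a
      + zz x * klt i a b * of_bool (a = d) * (-1) ^ (par a * par b) * f b
      - zz x * klt i a (prime d) * of_bool (b = prime a) * gq x a * gp x (prime d) * f (prime d)"
    by (rule sum_three[where p = "\<lambda>e. of_bool (b = d) * x powi (- 2 * ee a b)"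
        and q = "\<lambda>e. zz x * klt i a e * of_bool (a = d) * (-1) ^ (par a * par e)"
        and r = "\<lambda>e. zz x * klt i a e * of_bool (b = prime a) * gq x a * gp x e"])
      (use assms in \<open>auto simp: Rx_ky[where i = i] prime_eq_iff of_bool_def algebra_simps\<close>)
  show "(\<Sum>g\<in>ind. Rx x (a, b) (c, g) * f g) = of_bool (a = c) * x powi (- 2 * ee a b) * f b
      + zz x * klt i a c * of_bool (b = c) * (-1) ^ (par a * par c) * f a
      - zz x * klt i a c * of_bool (b = prime a) * gq x a * gp x c * f (prime c)"
    by (rule sum_three[where p = "\<lambda>g. of_bool (a = c) * x powi (- 2 * ee a b)"
        and q = "\<lambda>g. zz x * klt i a c * of_bool (b = c) * (-1) ^ (par a * par c)"
        and r = "\<lambda>g. zz x * klt i a c * of_bool (b = prime a) * gq x a * gp x c"])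
      (use assms in \<open>auto simp: Rx_ky[where i = i] prime_eq_iff of_bool_def algebra_simps\<close>)
  show "(\<Sum>e\<in>ind. Rx x (e, b) (c, d) * f e) = of_bool (b = d) * x powi (- 2 * ee c b) * f c
      + zz x * klt i d c * of_bool (b = c) * (-1) ^ (par d * par c) * f d
      - zz x * klt i (prime b) c * of_bool (d = prime c) * gq x (prime b) * gp x c * f (prime b)"
    by (rule sum_three[where p = "\<lambda>e. of_bool (b = d) * x powi (- 2 * ee e b)"
        and q = "\<lambda>e. zz x * klt i e c * of_bool (b = c) * (-1) ^ (par e * par c)"
        and r = "\<lambda>e. zz x * klt i e c * of_bool (d = prime c) * gq x e * gp x c"])
      (use assms in \<open>auto simp: Rx_ky[where i = i] prime_eq_iff of_bool_def algebra_simps\<close>)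
  show "(\<Sum>g\<in>ind. Rx x (a, g) (c, d) * f g) = of_bool (a = c) * x powi (- 2 * ee a d) * f d
      + zz x * klt i a c * of_bool (a = d) * (-1) ^ (par a * par c) * f c
      - zz x * klt i a c * of_bool (d = prime c) * gq x a * gp x c * f (prime a)"
    by (rule sum_three[where p = "\<lambda>g. of_bool (a = c) * x powi (- 2 * ee a g)"
        and q = "\<lambda>g. zz x * klt i a c * of_bool (a = d) * (-1) ^ (par a * par c)"
        and r = "\<lambda>g. zz x * klt i a c * of_bool (d = prime c) * gq x a * gp x c"])
      (use assms in \<open>auto simp: Rx_ky[where i = i] prime_eq_iff of_bool_def algebra_simps\<close>)
qed

end

context osp
begin

section \<open>The invariant form, the invariant vector and the intertwining relation\<close>

lemma powi_merge: "(x :: K) \<noteq> 0 \<Longrightarrow> x powi k * x powi l = x powi (k + l)"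
  by (simp add: power_int_add)

lemma th_K [simp]: "a \<in> ind \<Longrightarrow> of_int (th a) * of_int (th a) = (1 :: K)"
  by (metis th_sq of_int_1 of_int_mult)

lemma gq_gp: "x \<noteq> 0 \<Longrightarrow> a \<in> ind \<Longrightarrow> gq x a * gp x a = (-1) ^ par a"
proof -
  assume x: "x \<noteq> 0" and a: "a \<in> ind"
  have "gq x a * gp x a = (of_int (th a) * of_int (th a)) * (x powi rh a * x powi (- rh a)) * (-1) ^ par a"
    by (simp add: gq_def gp_def mult_ac)
  then show ?thesis using x a by (simp add: powi_merge)
qed

lemma th_prime_K: "a \<in> ind \<Longrightarrow> of_int (th (prime a)) = ((-1) ^ par a * of_int (th a) :: K)"
  by (simp add: th_prime)

text \<open>The linear form taking the value \<open>gp x c\<close> on v_c \<otimes> v_{c'} and 0 on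
  the other basis vectors vanishes after \<open>Dl i x\<close>: it is the invariant form on V. On
  the two nonzero entries of f_i this reduces to \<open>rh_simple\<close> and a comparison of
  signs.\<close>

lemma gp_Ff:
  assumes x: "x \<noteq> 0" and i: "i \<in> {1..s}" and c: "c \<in> ind" and d: "d \<in> ind"
  shows "gp x (prime d) * x powi (- hh i d) * Ff i (prime d) c
       = - (gp x c * x powi hh i c * (-1) ^ ((par c + par d) * par c) * Ff i (prime c) d)"
proof -
  let ?p = "pp i" and ?r = "rr i"
  have pr: "?p \<in> ind" "?r \<in> ind" using i by auto
  define k where "k = kappa i * (-1) ^ par ?p"
  have e1: "gp x ?r * x powi hh i ?r = - (gp x ?p * x powi hh i ?p * (-1) ^ ((par ?p + par ?r) * par ?p) * om i)"
  proof -
    have h: "hh i ?r - rh ?r = hh i ?p - rh ?p" using rh_simple[OF i] by simp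
    have "gp x ?r * x powi hh i ?r = (-1) ^ par ?r * of_int (th ?r) * x powi (hh i ?r - rh ?r)"
      using x by (simp add: gp_def mult.assoc powi_merge)
    moreover have "gp x ?p * x powi hh i ?p = (-1) ^ par ?p * of_int (th ?p) * x powi (hh i ?p - rh ?p)"
      using x by (simp add: gp_def mult.assoc powi_merge)
    moreover have "(-1) ^ par ?r * of_int (th ?r) =
       - ((-1) ^ par ?p * of_int (th ?p) * (-1) ^ ((par ?p + par ?r) * par ?p) * om i :: K)"
      using par_cases[OF pr(1)] par_cases[OF pr(2)] th_cases[OF pr(1)] th_cases[OF pr(2)]
      by (auto simp: om_def)
    ultimately show ?thesis by (simp add: h)
  qed
  have e2: "om i * (gp x (prime ?p) * x powi (- hh i ?p))
       = - (gp x (prime ?r) * x powi (- hh i ?r) * (-1) ^ ((par ?r + par ?p) * par ?r))"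
  proof -
    have h: "rh ?p - hh i ?p = rh ?r - hh i ?r" using rh_simple[OF i] by simp
    let ?e = "(-1 :: K) ^ ((par ?r + par ?p) * par ?r)"
    have r: "gp x (prime ?r) * x powi (- hh i ?r) = of_int (th ?r) * x powi (rh ?r - hh i ?r)"
      using x pr by (simp add: gp_def mult_ac powi_merge th_prime_K flip: power_add)
    have p: "gp x (prime ?p) * x powi (- hh i ?p) = of_int (th ?p) * x powi (rh ?p - hh i ?p)"
      using x pr by (simp add: gp_def mult_ac powi_merge th_prime_K flip: power_add)
    have o: "om i * of_int (th ?p) = - (of_int (th ?r) * ?e)"
      using par_cases[OF pr(1)] par_cases[OF pr(2)] th_cases[OF pr(1)] th_cases[OF pr(2)]
      by (auto simp: om_def)
    have "om i * (gp x (prime ?p) * x powi (- hh i ?p)) = (om i * of_int (th ?p)) * x powi (rh ?r - hh i ?r)"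
      unfolding p h by (simp only: mult.assoc)
    also have "\<dots> = - (of_int (th ?r) * x powi (rh ?r - hh i ?r) * ?e)"
      unfolding o by (simp add: mult_ac)
    finally show ?thesis unfolding r .
  qed
  have F1: "Ff i (prime d) c = k * (of_bool (prime d = ?r \<and> c = ?p) + om i * of_bool (prime d = prime ?p \<and> c = prime ?r))"
    by (simp_all add: Ff_def k_def)
  have swap: "prime c = ?r \<and> d = ?p \<longleftrightarrow> prime d = prime ?p \<and> c = prime ?r"
    "prime c = prime ?p \<and> d = prime ?r \<longleftrightarrow> prime d = ?r \<and> c = ?p"
    using c d pr prime_prime prime_inj by metis+
  have F2: "Ff i (prime c) d = k * (of_bool (prime d = prime ?p \<and> c = prime ?r) + om i * of_bool (prime d = ?r \<and> c = ?p))"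
    unfolding Ff_def k_def swap ..
  have A: "of_bool (prime d = ?r \<and> c = ?p) * (gp x (prime d) * x powi (- hh i d))
     = - (of_bool (prime d = ?r \<and> c = ?p) * (gp x c * x powi hh i c * (-1) ^ ((par c + par d) * par c) * om i))"
  proof (cases "prime d = ?r \<and> c = ?p")
    case True
    then have "d = prime ?r" using d prime_prime by metis
    with True e1 pr i show ?thesis by simp
  next
    case False
    then show ?thesis by auto
  qed
  have B: "of_bool (prime d = prime ?p \<and> c = prime ?r) * (om i * (gp x (prime d) * x powi (- hh i d)))
     = - (of_bool (prime d = prime ?p \<and> c = prime ?r) * (gp x c * x powi hh i c * (-1) ^ ((par c + par d) * par c)))"
  proof (cases "prime d = prime ?p \<and> c = prime ?r")
    case True
    then have "d = ?p" using d pr prime_inj by blast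
    with True e2 pr i show ?thesis by simp
  next
    case False
    then show ?thesis by auto
  qed
  have "gp x (prime d) * x powi (- hh i d) * Ff i (prime d) c
     = k * (of_bool (prime d = ?r \<and> c = ?p) * (gp x (prime d) * x powi (- hh i d))
          + of_bool (prime d = prime ?p \<and> c = prime ?r) * (om i * (gp x (prime d) * x powi (- hh i d))))"
    unfolding F1 by (simp add: algebra_simps)
  also have "\<dots> = - (gp x c * x powi hh i c * (-1) ^ ((par c + par d) * par c) * Ff i (prime c) d)"
    unfolding A B F2 by (simp add: algebra_simps)
  finally show ?thesis .
qed

text \<open>Dually, the vector with coordinates \<open>gq x a\<close> at v_a \<otimes> v_{a'} is
  killed by \<open>Dl i (inverse x)\<close>. It follows from \<open>gp_Ff\<close>, since
  \<open>gq x a * gp x a\<close> is a sign.\<close>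

lemma gq_Ff:
  assumes x: "x \<noteq> 0" and i: "i \<in> {1..s}" and a: "a \<in> ind" and b: "b \<in> ind"
  shows "gq x (prime b) * x powi hh i b * Ff i a (prime b)
       = - (gq x a * x powi (- hh i a) * (-1) ^ ((par b + par a) * par a) * Ff i b (prime a))"
proof -
  have g: "gp x a * x powi hh i a * Ff i a (prime b)
    = - (gp x (prime b) * x powi (- hh i b) * (-1) ^ ((par a + par b) * par b) * Ff i b (prime a))"
    using gp_Ff[OF x i, of "prime b" "prime a"] a b i by (simp add: add.commute)
  \<comment> \<open>Multiplying the instance \<open>g\<close> of \<open>gp_Ff\<close> by this factor
    turns each \<open>gp\<close> into a sign, leaves one \<open>gq\<close> on either side and
    exchanges the two powers of x.\<close>
  define A where "A = gq x a * gq x (prime b) * x powi (hh i b - hh i a)"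
  have "(-1) ^ par a * (gq x (prime b) * x powi hh i b * Ff i a (prime b)) = A * (gp x a * x powi hh i a * Ff i a (prime b))"
  proof -
    have "A * (gp x a * x powi hh i a * Ff i a (prime b))
      = (gq x a * gp x a) * (gq x (prime b) * (x powi (hh i b - hh i a) * x powi hh i a) * Ff i a (prime b))"
      by (simp add: A_def mult_ac)
    then show ?thesis using x a by (auto simp: gq_gp powi_merge)
  qed
  also have "\<dots> = - ((gq x (prime b) * gp x (prime b)) * (gq x a * (x powi (hh i b - hh i a) * x powi (- hh i b)) * (-1) ^ ((par a + par b) * par b) * Ff i b (prime a)))"
    unfolding g by (simp add: A_def mult_ac)
  also have "\<dots> = - ((-1) ^ par b * (gq x a * x powi (- hh i a) * (-1) ^ ((par a + par b) * par b) * Ff i b (prime a)))"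
    using x b by (simp add: gq_gp powi_merge)
  finally have "(-1) ^ par a * (gq x (prime b) * x powi hh i b * Ff i a (prime b))
    = - ((-1) ^ par b * (gq x a * x powi (- hh i a) * (-1) ^ ((par a + par b) * par b) * Ff i b (prime a)))" .
  moreover define L where "L = gq x (prime b) * x powi hh i b * Ff i a (prime b)"
  moreover define R where "R = gq x a * x powi (- hh i a) * Ff i b (prime a)"
  ultimately have "(-1) ^ par a * L = - ((-1) ^ par b * ((-1) ^ ((par a + par b) * par b) * R))"
    by (simp add: mult_ac)
  then have "L = - ((-1) ^ ((par b + par a) * par a) * R)"
    using par_cases[OF a] par_cases[OF b] by (auto simp: eq_neg_iff_add_eq_0 neg_eq_iff_add_eq_0)
  then show ?thesis by (simp add: L_def R_def mult_ac)
qed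

text \<open>The two delta terms correct a diagonal entry to its inverse. For the middle index they
  cancel each other.\<close>

lemma diag_key:
  assumes x: "x \<noteq> 0" and a: "a \<in> ind" and b: "b \<in> ind"
  shows "x powi (- 2 * ee a b) - zz x * (-1) ^ par a * of_bool (a = b) + zz x * (-1) ^ par a * of_bool (b = prime a)
    = x powi (2 * ee a b)"
  using par_cases[OF a] by (auto simp: ee_def sgn_par_def)

lemma msupp_Rx: "msupp ind2 (Rx x)"
proof -
  have "Rx x p q = 0" if "\<not> (p \<in> ind2 \<and> q \<in> ind2)" for p q
    using that unfolding Rx_def by (cases p; cases q; simp only: prod.case; intro if_not_P)
  then show ?thesis unfolding msupp_def by blast
qed

lemma msupp_Dl: "msupp ind2 (Dl i x)"
proof -
  have "Dl i x p q = 0" if "\<not> (p \<in> ind2 \<and> q \<in> ind2)" for p q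
    using that unfolding Dl_def by (cases p; cases q; simp only: prod.case; intro if_not_P)
  then show ?thesis unfolding msupp_def by blast
qed

lemma comb: "t = A * l * w \<Longrightarrow> t' = A * l' * w' \<Longrightarrow> w = - w' \<Longrightarrow> t + t' = A * (l - l') * (w :: K)"
  by (simp add: algebra_simps)

text \<open>The flip terms differ by comparisons that collapse to deltas; the dual terms collapse by
  the invariance of \<open>gp\<close> and \<open>gq\<close>. All that survives has a = c and a
  common factor f_i in the second leg, and balances by \<open>diag_key\<close>.\<close>

theorem Rx_comm:
  assumes x: "x \<noteq> 0" and i: "i \<in> {1..s}"
  shows "mmult ind2 (Rx x) (Dl i x) = mmult ind2 (Dl i (inverse x)) (Rx x)"
proof (intro ext, clarify)
  fix a b c d
  show "mmult ind2 (Rx x) (Dl i x) (a, b) (c, d) = mmult ind2 (Dl i (inverse x)) (Rx x) (a, b) (c, d)"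
  proof (cases "a \<in> ind \<and> b \<in> ind \<and> c \<in> ind \<and> d \<in> ind")
    case False
    then have "(a, b) \<notin> ind2 \<or> (c, d) \<notin> ind2" by (auto simp: ind2_def)
    then have "mmult ind2 (Rx x) (Dl i x) (a, b) (c, d) = 0" "mmult ind2 (Dl i (inverse x)) (Rx x) (a, b) (c, d) = 0"
      by (intro msuppD msupp_mmult msupp_Rx msupp_Dl; simp)+
    then show ?thesis by simp
  next
    case True
    then have abcd: "a \<in> ind" "b \<in> ind" "c \<in> ind" "d \<in> ind" by auto
    let ?z = "zz x" and ?h = "hh i" and ?F = "Ff i" and ?l = "klt i"
    let ?s = "\<lambda>u v w. (-1 :: K) ^ ((par u + par v) * par w)"
    \<comment> \<open>In each of the families T and U, numbers 1 and 2 belong to the diagonal part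
      of \<open>Rx\<close>, 3 and 4 to the flip, 5 and 6 to the dual part. Odd numbers have f_i in
      the first leg, even ones in the second.\<close>
    define T1 where "T1 = of_bool (b = d) * x powi (- 2 * ee a b) * (?F a c * x powi (- ?h d))"
    define T2 where "T2 = of_bool (a = c) * x powi (- 2 * ee a b) * (x powi ?h c * ?s b d c * ?F b d)"
    define T3 where "T3 = ?z * ?l a b * of_bool (a = d) * (-1) ^ (par a * par b) * (?F b c * x powi (- ?h d))"
    define T4 where "T4 = ?z * ?l a c * of_bool (b = c) * (-1) ^ (par a * par c) * (x powi ?h c * ?s a d c * ?F a d)"
    define T5 where "T5 = ?z * ?l a (prime d) * of_bool (b = prime a) * gq x a * gp x (prime d) * (?F (prime d) c * x powi (- ?h d))"
    define T6 where "T6 = ?z * ?l a c * of_bool (b = prime a) * gq x a * gp x c * (x powi ?h c * ?s c d c * ?F (prime c) d)"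
    have L: "mmult ind2 (Rx x) (Dl i x) (a, b) (c, d) = (T1 + T3 - T5) + (T2 + T4 - T6)"
      unfolding mmult_Dl_right[OF abcd(3,4)] sum_Rx(1)[where i = i, OF abcd] sum_Rx(2)[where i = i, OF abcd]
      using abcd by (simp add: T1_def T2_def T3_def T4_def T5_def T6_def)
    define U1 where "U1 = of_bool (b = d) * x powi (- 2 * ee c b) * (?F a c * x powi ?h b)"
    define U2 where "U2 = of_bool (a = c) * x powi (- 2 * ee a d) * (x powi (- ?h a) * ?s b d a * ?F b d)"
    define U3 where "U3 = ?z * ?l d c * of_bool (b = c) * (-1) ^ (par d * par c) * (?F a d * x powi ?h b)"
    define U4 where "U4 = ?z * ?l a c * of_bool (a = d) * (-1) ^ (par a * par c) * (x powi (- ?h a) * ?s b c a * ?F b c)"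
    define U5 where "U5 = ?z * ?l (prime b) c * of_bool (d = prime c) * gq x (prime b) * gp x c * (?F a (prime b) * x powi ?h b)"
    define U6 where "U6 = ?z * ?l a c * of_bool (d = prime c) * gq x a * gp x c * (x powi (- ?h a) * ?s b a a * ?F b (prime a))"
    have inv: "inverse x powi k = x powi (- k)" for k
      by (simp add: power_int_minus power_int_inverse)
    have R: "mmult ind2 (Dl i (inverse x)) (Rx x) (a, b) (c, d) = (U1 + U3 - U5) + (U2 + U4 - U6)"
    proof -
      have "mmult ind2 (Dl i (inverse x)) (Rx x) (a, b) (c, d)
        = (\<Sum>e\<in>ind. Rx x (e, b) (c, d) * (?F a e * x powi ?h b))
        + (\<Sum>g\<in>ind. Rx x (a, g) (c, d) * (x powi (- ?h a) * ?s b g a * ?F b g))"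
        unfolding mmult_Dl_left[OF abcd(1,2)] inv by (simp add: mult.commute)
      then show ?thesis
        unfolding sum_Rx(3)[where i = i, OF abcd] sum_Rx(4)[where i = i, OF abcd]
        using abcd by (simp add: U1_def U2_def U3_def U4_def U5_def U6_def)
    qed
    have c1: "T1 = U1"
    proof (cases "?F a c = 0 \<or> b \<noteq> d")
      case False
      then have "ee a b = ee c b - ?h b"
        using ee_Ff[OF i, of a c b] ee_sym abcd by simp
      with False x show ?thesis by (simp add: T1_def U1_def powi_merge)
    qed (auto simp: T1_def U1_def)
    \<comment> \<open>The flip exchanges the legs, so \<open>T3\<close> is to be matched with
      \<open>U4\<close>, and below \<open>T4\<close> with \<open>U3\<close>.\<close>
    have c2: "T3 - U4 = of_bool (a = d \<and> a = c) * (?z * x powi (- ?h a) * (-1) ^ (par a * par b) * ?F b c)"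
    proof (cases "?F b c = 0 \<or> a \<noteq> d")
      case False
      have sg: "(-1) ^ (par a * par c) * ?s b c a = ((-1) ^ (par a * par b) :: K)"
        using par_cases[OF abcd(1)] par_cases[OF abcd(2)] par_cases[OF abcd(3)] par_cases[OF abcd(4)] by auto
      let ?W = "?z * x powi (- ?h a) * (-1) ^ (par a * par b) * ?F b c"
      have "T3 = ?l a b * ?W" using False by (simp add: T3_def)
      moreover have "U4 = ?l a c * (?z * x powi (- ?h a) * ((-1) ^ (par a * par c) * ?s b c a) * ?F b c)"
        using False by (simp add: U4_def)
      ultimately have "T3 - U4 = (?l a b - ?l a c) * ?W"
        unfolding sg by (simp only: left_diff_distrib)
      then show ?thesis
        using False klt_succ(1)[OF i, of b c a] by (simp add: of_bool_conj)
    qed (auto simp: T3_def U4_def)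
    have c3: "T4 - U3 = - (of_bool (a = b \<and> a = c) * (?z * x powi ?h a * (-1) ^ (par a * par d) * ?F a d))"
    proof (cases "?F a d = 0 \<or> b \<noteq> c")
      case False
      have sg: "(-1) ^ (par a * par c) * ?s a d c = ((-1) ^ (par d * par c) :: K)"
        using par_cases[OF abcd(1)] par_cases[OF abcd(2)] par_cases[OF abcd(3)] par_cases[OF abcd(4)] by auto
      let ?W = "?z * x powi ?h c * (-1) ^ (par d * par c) * ?F a d"
      have "U3 = ?l d c * ?W" using False by (simp add: U3_def)
      moreover have "T4 = ?l a c * (?z * x powi ?h c * ((-1) ^ (par a * par c) * ?s a d c) * ?F a d)"
        using False by (simp add: T4_def)
      ultimately have "T4 - U3 = (?l a c - ?l d c) * ?W"
        unfolding sg by (simp only: left_diff_distrib)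
      then show ?thesis
        using False klt_succ(2)[OF i, of a d c] by (auto simp: of_bool_conj mult.commute)
    qed (auto simp: T4_def U3_def)
    \<comment> \<open>By invariance the two dual terms have opposite values up to their comparisons,
      so the difference of the comparisons factors out.\<close>
    have c4: "T5 + T6 = - (of_bool (b = prime a \<and> a = c) * (?z * (-1) ^ par a * x powi ?h a * ?s b d a * ?F b d))"
    proof -
      have g: "gp x (prime d) * (?F (prime d) c * x powi (- ?h d)) = - (gp x c * (x powi ?h c * ?s c d c * ?F (prime c) d))"
        using gp_Ff[OF x i abcd(3,4)] by (simp add: mult_ac)
      have "T5 + T6 = ?z * of_bool (b = prime a) * gq x a * (?l a (prime d) - ?l a c) * (gp x (prime d) * (?F (prime d) c * x powi (- ?h d)))"
      proof (rule comb[OF _ _ g])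
        show "T5 = ?z * of_bool (b = prime a) * gq x a * ?l a (prime d) * (gp x (prime d) * (?F (prime d) c * x powi (- ?h d)))"
          by (simp add: T5_def mult_ac)
        show "T6 = ?z * of_bool (b = prime a) * gq x a * ?l a c * (gp x c * (x powi ?h c * ?s c d c * ?F (prime c) d))"
          by (simp add: T6_def mult_ac)
      qed
      also have "\<dots> = ?z * of_bool (b = prime a) * gq x a * of_bool (a = c) * (gp x (prime d) * (?F (prime d) c * x powi (- ?h d)))"
        using klt_succ(1)[OF i, of "prime d" c a] by (cases "?F (prime d) c = 0") auto
      also have "\<dots> = - (of_bool (b = prime a \<and> a = c) * (?z * (gq x a * gp x a) * x powi ?h a * ?s b d a * ?F b d))"
        unfolding g using abcd by (auto simp: of_bool_def mult_ac)
      also have "\<dots> = - (of_bool (b = prime a \<and> a = c) * (?z * (-1) ^ par a * x powi ?h a * ?s b d a * ?F b d))"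
        unfolding gq_gp[OF x abcd(1)] ..
      finally show ?thesis .
    qed
    have c5: "U5 + U6 = - (of_bool (d = prime a \<and> a = c) * (?z * (-1) ^ par a * x powi (- ?h a) * ?s b d a * ?F b d))"
    proof -
      let ?Y = "gq x a * (x powi (- ?h a) * ?s b a a * ?F b (prime a))"
      have g: "gq x (prime b) * (?F a (prime b) * x powi ?h b) = - ?Y"
        using gq_Ff[OF x i abcd(1,2)] by (simp add: mult_ac)
      have "U5 = ?z * of_bool (d = prime c) * gp x c * ?l (prime b) c * (gq x (prime b) * (?F a (prime b) * x powi ?h b))"
        by (simp add: U5_def mult_ac)
      moreover have "U6 = ?z * of_bool (d = prime c) * gp x c * ?l a c * ?Y"
        by (simp add: U6_def mult_ac)
      ultimately have "U5 + U6 = ?z * of_bool (d = prime c) * gp x c * (?l (prime b) c - ?l a c) * (gq x (prime b) * (?F a (prime b) * x powi ?h b))"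
        by (rule comb[OF _ _ g])
      also have "\<dots> = ?z * of_bool (d = prime c) * gp x c * of_bool (c = a) * (gq x (prime b) * (?F a (prime b) * x powi ?h b))"
        using klt_succ(2)[OF i, of a "prime b" c] by (cases "?F a (prime b) = 0") auto
      also have "\<dots> = - (of_bool (d = prime a \<and> a = c) * (?z * (gq x a * gp x a) * x powi (- ?h a) * ?s b d a * ?F b d))"
        unfolding g using abcd by (auto simp: of_bool_def mult_ac)
      also have "\<dots> = - (of_bool (d = prime a \<and> a = c) * (?z * (-1) ^ par a * x powi (- ?h a) * ?s b d a * ?F b d))"
        unfolding gq_gp[OF x abcd(1)] ..
      finally show ?thesis .
    qed
    have c6: "T2 + (T3 - U4) + (T4 - U3) - (T5 + T6) = U2 - (U5 + U6)"
    proof (cases "a = c \<and> ?F b d \<noteq> 0")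
      case False
      then show ?thesis unfolding c2 c3 c4 c5 T2_def U2_def by (auto simp: of_bool_def)
    next
      case True
      then have h: "ee a b = ee a d - ?h a"
        using ee_Ff[OF i, of b d a] abcd by simp
      have sb: "a = d \<Longrightarrow> (-1) ^ (par a * par b) = (?s b d a * (-1) ^ par a :: K)"
        using par_cases[of a] par_cases[of b] abcd by auto
      have sd: "a = b \<Longrightarrow> (-1) ^ (par a * par d) = (?s b d a * (-1) ^ par a :: K)"
        using par_cases[of a] par_cases[of d] abcd by auto
      define k k' where "k = x powi ?h a" and "k' = x powi (- ?h a)"
      define q q' where "q = x powi (- 2 * ee a b)" and "q' = x powi (- 2 * ee a d)"
      define z e f S where "z = ?z" and "e = (-1 :: K) ^ par a" and "f = ?F b d" and "S = ?s b d a"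
      \<comment> \<open>The brackets are the left sides of \<open>diag_key\<close> at (a, b) and (a,
        d); the weight shift \<open>h\<close> makes the resulting powers of x equal.\<close>
      have "T2 + (T3 - U4) + (T4 - U3) - (T5 + T6) - (U2 - (U5 + U6))
        = ?s b d a * ?F b d * (x powi ?h a * (x powi (- 2 * ee a b) - ?z * (-1) ^ par a * of_bool (a = b) + ?z * (-1) ^ par a * of_bool (b = prime a))
           - x powi (- ?h a) * (x powi (- 2 * ee a d) - ?z * (-1) ^ par a * of_bool (a = d) + ?z * (-1) ^ par a * of_bool (d = prime a)))"
      proof -
        have 2: "T2 = q * (k * S * f)" "U2 = q' * (k' * S * f)"
          using True by (simp_all add: T2_def U2_def k_def k'_def q_def q'_def S_def f_def)
        have 3: "T3 - U4 = of_bool (a = d) * (z * k' * (S * e) * f)"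
          unfolding c2 using True sb by (auto simp: k'_def z_def S_def e_def f_def)
        have 4: "T4 - U3 = - (of_bool (a = b) * (z * k * (S * e) * f))"
          unfolding c3 using True sd by (auto simp: k_def z_def S_def e_def f_def)
        have 5: "T5 + T6 = - (of_bool (b = prime a) * (z * e * k * S * f))"
          unfolding c4 using True by (auto simp: k_def z_def S_def e_def f_def)
        have 6: "U5 + U6 = - (of_bool (d = prime a) * (z * e * k' * S * f))"
          unfolding c5 using True by (auto simp: k'_def z_def S_def e_def f_def)
        show ?thesis
          unfolding 2 3 4 5 6
          unfolding k_def[symmetric] k'_def[symmetric] q_def[symmetric] q'_def[symmetric]
            z_def[symmetric] e_def[symmetric] f_def[symmetric] S_def[symmetric]
          by (simp only: algebra_simps add_minus_cancel minus_add_cancel right_minus add_0_right)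
      qed
      also have "\<dots> = 0"
        unfolding diag_key[OF x abcd(1,2)] diag_key[OF x abcd(1,4)] using x by (simp add: powi_merge h)
      finally show ?thesis by simp
    qed
    have "(T1 + T3 - T5) + (T2 + T4 - T6) - ((U1 + U3 - U5) + (U2 + U4 - U6))
      = (T1 - U1) + ((T2 + (T3 - U4) + (T4 - U3) - (T5 + T6)) - (U2 - (U5 + U6)))"
      by (simp add: algebra_simps)
    also have "\<dots> = 0" using c1 c6 by simp
    finally show ?thesis unfolding L R by (simp only: right_minus_eq)
  qed
qed

end

section \<open>Uniqueness of the intertwiner and the inverse matrix\<close>

context osp
begin

section \<open>Nonzero entries, cyclic vectors and uniqueness\<close>

lemma qpow_1: "qpow 1 = xq powi 2" "qpow (-1) = xq powi (-2)" "qpow (1/2) = xq" "qpow (-1/2) = xq powi (-1)"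
  using qpow_eq[of 1 2] qpow_eq[of "-1" "-2"] qpow_eq[of "1/2" 1] qpow_eq[of "-1/2" "-1"]
  by simp_all

lemma kappa_nz: "kappa i \<noteq> 0"
proof -
  have "xq powi 2 + xq powi (-2) \<noteq> 0"
  proof
    assume "xq powi 2 + xq powi (-2) = 0"
    then have "(xq powi 2 + xq powi (-2)) * xq powi 2 = 0" by simp
    then have "xq ^ 4 = -1"
      by (simp add: distrib_right power_int_minus eq_neg_iff_add_eq_0 flip: power_add)
    then have "(xq ^ 4) ^ 2 = (-1) ^ 2" by (simp only:)
    then have "xq ^ 8 = 1" by (simp flip: power_mult)
    with xq_power_neq_1[of 8] show False by simp
  qed
  then show ?thesis by (simp add: kappa_def qpow_1 two_neq_0_K)
qed

lemma e_scale_nz: "e_scale i \<noteq> 0"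
  by (simp add: e_scale_def two_neq_0_K)

lemma om_cases: "i \<in> {1..s} \<Longrightarrow> om i = 1 \<or> om i = -1" "i \<in> {1..s} \<Longrightarrow> om' i = 1 \<or> om' i = -1"
  using th_cases[of "pp i"] th_cases[of "rr i"] par_cases[of "pp i"] par_cases[of "rr i"]
  by (auto simp: om_def om'_def)

text \<open>Only at the last node of type C do the two matrix units coincide; there both
  coefficients are +1, so nothing cancels.\<close>

lemma om_self: "i \<in> {1..s} \<Longrightarrow> rr i = prime (pp i) \<Longrightarrow> om i = 1 \<and> om' i = 1"
proof -
  assume i: "i \<in> {1..s}" and r: "rr i = prime (pp i)"
  then have "par (pp i) = 1" "N = 2 * s" "pp i = s"
    using N_cases by (cases rule: pp_rr_cases; force simp: prime_def)+
  then show ?thesis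
    using i r th_prime[of "pp i"] th_cases[of "pp i"] pp_rr_ind[OF i] unfolding om_def om'_def r
    by auto
qed

lemma one_plus_om_nz: "i \<in> {1..s} \<Longrightarrow> 1 + om i * of_bool (rr i = prime (pp i)) \<noteq> 0"
  "i \<in> {1..s} \<Longrightarrow> of_bool (rr i = prime (pp i)) + om i \<noteq> 0"
  "i \<in> {1..s} \<Longrightarrow> 1 + om' i * of_bool (rr i = prime (pp i)) \<noteq> 0"
  "i \<in> {1..s} \<Longrightarrow> of_bool (rr i = prime (pp i)) + om' i \<noteq> 0"
  using om_self[of i] om_cases[of i] two_neq_0_K by auto

lemma prime_swap: "i \<in> {1..s} \<Longrightarrow> pp i = prime (rr i) \<longleftrightarrow> rr i = prime (pp i)"
  "i \<in> {1..s} \<Longrightarrow> prime (rr i) = pp i \<longleftrightarrow> rr i = prime (pp i)"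
  "i \<in> {1..s} \<Longrightarrow> prime (pp i) = rr i \<longleftrightarrow> rr i = prime (pp i)"
  using pp_rr_ind prime_prime by metis+

lemma Ff_col:
  assumes i: "i \<in> {1..s}"
  shows "Ff i (rr i) (pp i) \<noteq> 0" "e \<noteq> rr i \<Longrightarrow> Ff i e (pp i) = 0"
    "Ff i (prime (pp i)) (prime (rr i)) \<noteq> 0" "e \<noteq> prime (pp i) \<Longrightarrow> Ff i e (prime (rr i)) = 0"
  using one_plus_om_nz(1,2)[OF i] kappa_nz[of i] prime_swap[OF i] i
  by (auto simp: Ff_def of_bool_def split: if_splits)

lemma Ef_col:
  assumes i: "i \<in> {1..s}"
  shows "Ef i (pp i) (rr i) \<noteq> 0" "e \<noteq> pp i \<Longrightarrow> Ef i e (rr i) = 0"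
    "Ef i (prime (rr i)) (prime (pp i)) \<noteq> 0" "e \<noteq> prime (rr i) \<Longrightarrow> Ef i e (prime (pp i)) = 0"
  using one_plus_om_nz(3,4)[OF i] e_scale_nz[of i] prime_swap[OF i] i
  by (auto simp: Ef_def of_bool_def split: if_splits)

text \<open>Indices up to s + 1 are reached along pp i -> rr i, the later ones along the dual step
  (rr i)' -> (pp i)'. Node s reaches s + 1 in every type, from s - 1 in type D and from s
  otherwise.\<close>

lemma Ff_reach:
  assumes c: "c \<in> ind" "c \<noteq> 1"
  shows "\<exists>i\<in>{1..s}. \<exists>c'\<in>ind. c' < c \<and> Ff i c c' \<noteq> 0 \<and> (\<forall>e. e \<noteq> c \<longrightarrow> Ff i e c' = 0)"
proof -
  have up: ?thesis if "i \<in> {1..s}" "rr i = c" "pp i < c" for i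
    using that Ff_col(1,2)[OF that(1)] pp_rr_ind[OF that(1)] by blast
  have down: ?thesis if "i \<in> {1..s}" "prime (pp i) = c" "prime (rr i) < c" for i
    using that Ff_col(3,4)[OF that(1)] pp_rr_ind[OF that(1)] prime_ind by blast
  consider "c \<le> s" | "c = s + 1" | "c \<ge> s + 2" "c \<le> N" using c by (force simp: ind_def)
  then show ?thesis
  proof cases
    case 1
    with c have "c - 1 \<in> {1..s}" "pp (c - 1) = c - 1" "rr (c - 1) = c" "c - 1 < c"
      by (auto simp: pp_def rr_def ind_def)
    with up[of "c - 1"] show ?thesis by simp
  next
    case 2
    then have "rr s = c" "pp s < c" "s \<in> {1..s}" using s_ge_1 by (auto simp: pp_def rr_def)
    with up[of s] show ?thesis by simp
  next
    case 3
    then have "prime c < s \<or> odd m" "prime c \<in> {1..s}"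
      using N_cases odd_m_iff by (auto simp: prime_def)
    then have "pp (prime c) = prime c" "rr (prime c) = prime c + 1" by (auto simp: pp_def rr_def)
    moreover from this have "prime (pp (prime c)) = c" "prime (rr (prime c)) < c"
      using c 3 by (auto simp: prime_def)
    ultimately show ?thesis using down[of "prime c"] \<open>prime c \<in> {1..s}\<close> by simp
  qed
qed

text \<open>The mirror image for e_i. The delicate index is s for even \<open>m\<close>: in type D
  it is reached from s + 2 by the dual step of node s, in type C from s + 1.\<close>

lemma Ef_reach:
  assumes c: "c \<in> ind" "c \<noteq> N"
  shows "\<exists>i\<in>{1..s}. \<exists>c'\<in>ind. c < c' \<and> Ef i c c' \<noteq> 0 \<and> (\<forall>e. e \<noteq> c \<longrightarrow> Ef i e c' = 0)"
proof -
  have up: ?thesis if "i \<in> {1..s}" "pp i = c" "c < rr i" for i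
    using that Ef_col(1,2)[OF that(1)] pp_rr_ind[OF that(1)] by blast
  have down: ?thesis if "i \<in> {1..s}" "prime (rr i) = c" "c < prime (pp i)" for i
    using that Ef_col(3,4)[OF that(1)] pp_rr_ind[OF that(1)] prime_ind by blast
  consider "c < s \<or> c = s \<and> odd m" | "c = s" "even m" | "c \<ge> s + 1" "c < N" using c by (force simp: ind_def)
  then show ?thesis
  proof cases
    case 1
    with c have "c \<in> {1..s}" "pp c = c" "c < rr c"
      by (auto simp: pp_def rr_def ind_def)
    with up[of c] show ?thesis by simp
  next
    case 2
    then have "s \<in> {1..s}" "N = 2 * s" using s_ge_1 N_cases odd_m_iff by auto
    from this(1) show ?thesis
    proof (cases rule: pp_rr_cases)
      case D
      then have "prime (rr s) = c" "c < prime (pp s)" using 2 by (auto simp: prime_def)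
      with down[of s] \<open>s \<in> {1..s}\<close> show ?thesis by simp
    next
      case C
      then have "pp s = c" "c < rr s" using 2 by auto
      with up[of s] \<open>s \<in> {1..s}\<close> show ?thesis by simp
    qed (use 2 in auto)
  next
    case 3
    then have *: "N - c < s \<or> odd m" "N - c \<in> {1..s}"
      using N_cases odd_m_iff by auto
    then have "pp (N - c) = N - c" "rr (N - c) = N - c + 1" by (auto simp: pp_def rr_def)
    moreover from this have "prime (rr (N - c)) = c" "c < prime (pp (N - c))"
      using 3 by (auto simp: prime_def)
    ultimately show ?thesis using down[of "N - c"] *(2) by simp
  qed
qed

text \<open>Induction on the first index c: for c' below c the vector \<Delta>(f_i)(v_{c'} \<otimes>
  v_d) is a nonzero multiple of v_c \<otimes> v_d plus terms over v_{c'}, where D vanishes. The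
  family \<open>G\<close> is arbitrary, which serves both uses below.\<close>

lemma intertwiner_eq_0:
  assumes x: "x \<noteq> 0" and D: "msupp ind2 D"
    and rel: "\<And>i. i \<in> {1..s} \<Longrightarrow> mmult ind2 D (Dl i x) = mmult ind2 (G i) D"
    and hw: "\<And>p w. w \<in> ind \<Longrightarrow> D p (1, w) = 0"
  shows "D = 0"
proof -
  have col: "\<forall>p. \<forall>d\<in>ind. D p (c, d) = 0" if "c \<in> ind" for c
    using that
  proof (induction c rule: less_induct)
    case (less c)
    show ?case
    proof (cases "c = 1")
      case False
      from Ff_reach[OF less.prems False] obtain i c' where i: "i \<in> {1..s}" and c': "c' \<in> ind" "c' < c"
        and F: "Ff i c c' \<noteq> 0" "\<And>e. e \<noteq> c \<Longrightarrow> Ff i e c' = 0" by blast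
      have IH: "D p (c', d) = 0" if "d \<in> ind" for p d
        using less.IH[OF c'(2,1)] that by blast
      show ?thesis
      proof (intro allI ballI)
        fix p d assume d: "d \<in> ind"
        have "mmult ind2 (G i) D p (c', d) = 0"
          unfolding mmult_def using IH[OF d] by simp
        then have "0 = mmult ind2 D (Dl i x) p (c', d)"
          using rel[OF i] by simp
        also have "\<dots> = (\<Sum>e\<in>ind. D p (e, d) * (Ff i e c' * x powi (- hh i d)))"
          unfolding mmult_Dl_right[OF c'(1) d] using IH by simp
        also have "\<dots> = (\<Sum>e\<in>ind. of_bool (e = c) * (D p (e, d) * (Ff i e c' * x powi (- hh i d))))"
          using F(2) by (intro sum.cong) auto
        also have "\<dots> = D p (c, d) * (Ff i c c' * x powi (- hh i d))"
          using less.prems by (simp only: sum_ind_delta)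
        finally show "D p (c, d) = 0" using F(1) x by simp
      qed
    qed (use hw in auto)
  qed
  show ?thesis
  proof (intro ext)
    fix p k :: "nat \<times> nat"
    show "D p k = 0 p k"
      using col[of "fst k"] msuppD[OF D, of p k] by (cases k) (auto simp: ind2_def)
  qed
qed

text \<open>No index precedes 1, so only the diagonal part contributes.\<close>

lemma Rx_first_col:
  "w \<in> ind \<Longrightarrow> Rx x p (1, w) = of_bool (p = (1, w)) * x powi (- 2 * ee 1 w)"
  by (cases p) (auto simp: Rx_def ind2_def ind_def)

lemma Rx_inverse:
  assumes x: "x \<noteq> 0"
  shows "mmult ind2 (Rx (inverse x)) (Rx x) = mone ind2"
proof -
  let ?R = "Rx x" and ?S = "Rx (inverse x)"
  have ix: "inverse x \<noteq> 0" using x by simp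
  have inv: "inverse x powi k = x powi (- k)" for k
    by (simp add: power_int_minus power_int_inverse)
  define D where "D = mmult ind2 ?S ?R - mone ind2"
  have "D = 0"
  proof (rule intertwiner_eq_0[OF x])
    show "msupp ind2 D" unfolding D_def by (simp add: msupp_Rx)
    fix i assume i: "i \<in> {1..s}"
    have "mmult ind2 (mmult ind2 ?S ?R) (Dl i x) = mmult ind2 ?S (mmult ind2 (Dl i (inverse x)) ?R)"
      by (simp add: mmult_assoc Rx_comm[OF x i])
    also have "\<dots> = mmult ind2 (mmult ind2 (Dl i x) ?S) ?R"
      using Rx_comm[OF ix i] by (simp add: mmult_assoc[symmetric])
    finally show "mmult ind2 D (Dl i x) = mmult ind2 (Dl i x) D"
      by (simp add: D_def mmult_diff_left mmult_diff_right msupp_Dl mmult_assoc)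
  next
    fix p w assume w: "w \<in> ind"
    have one: "1 \<in> ind" using dim_gt_2 by (simp add: ind_def N_def)
    have "mmult ind2 ?S ?R p (1, w) = (\<Sum>k\<in>ind2. if k = (1, w) then ?S p k * x powi (- 2 * ee 1 w) else 0)"
      unfolding mmult_def Rx_first_col[OF w] by (intro sum.cong) auto
    also have "\<dots> = ?S p (1, w) * x powi (- 2 * ee 1 w)"
      using w one by (simp add: ind2_def)
    also have "\<dots> = mone ind2 p (1, w)"
      unfolding Rx_first_col[OF w] inv using x w one by (auto simp: mone_def ind2_def powi_merge)
    finally show "D p (1, w) = 0" by (simp add: D_def)
  qed
  then show ?thesis unfolding D_def by simp
qed

section \<open>Entries of the explicit matrices\<close>

lemma sum_mtensor_munit:
  assumes "finite S"
  shows "(\<Sum>(i, j)\<in>S. C i j *\<^sub>m mtensor (munit i j) (B i j)) (a, b) (c, d)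
     = of_bool ((a, c) \<in> S) * C a c * (-1) ^ ((par b + par d) * par c) * B a c b d"
proof -
  have "(\<Sum>(i, j)\<in>S. C i j *\<^sub>m mtensor (munit i j) (B i j)) (a, b) (c, d)
    = (\<Sum>k\<in>S. if k = (a, c) then C a c * (-1) ^ ((par b + par d) * par c) * B a c b d else 0)"
    unfolding sum_matr_apply by (intro sum.cong) (auto simp: mtensor_def munit_apply)
  then show ?thesis using assms by simp
qed

lemma sum_mtensor_munit_diag:
  "(\<Sum>i\<in>{1..N}. C i *\<^sub>m mtensor (munit i i) (B i)) (a, b) (c, d)
     = of_bool (a = c \<and> a \<in> ind) * C a * (-1) ^ ((par b + par d) * par c) * B a b d"
proof -
  have "(\<Sum>i\<in>{1..N}. C i *\<^sub>m mtensor (munit i i) (B i)) (a, b) (c, d)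
    = (\<Sum>i\<in>{1..N}. if i = a then of_bool (a = c) * C a * (-1) ^ ((par b + par d) * par c) * B a b d else 0)"
    unfolding sum_matr_apply by (intro sum.cong) (auto simp: mtensor_def munit_apply)
  then show ?thesis by (auto simp: ind_def)
qed

lemma qpow_ee: "a \<in> ind \<Longrightarrow> qpow (- form (eps a) (eps a) / 2) = xq powi (- ee a a)"
  "a \<in> ind \<Longrightarrow> qpow (form (eps a) (eps a) / 2) = xq powi (ee a a)"
  by (rule qpow_eq; simp add: form_eps)+

lemma qpow_rho: "a \<in> ind \<Longrightarrow> b \<in> ind \<Longrightarrow> qpow (form rho (eps a - eps b)) = xq powi (rh a - rh b)"
  by (rule qpow_eq) (simp add: form_diff_right right_diff_distrib form_rho_eps)

lemma gq_gp_qpow: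
  assumes "a \<in> ind" "c \<in> ind"
  shows "gq xq a * gp xq c = of_int (th a) * ((-1) ^ par c * of_int (th c)) * qpow (form rho (eps a - eps c))"
proof -
  have "gq xq a * gp xq c = of_int (th a) * ((-1) ^ par c * of_int (th c)) * (xq powi rh a * xq powi (- rh c))"
    by (simp add: gq_def gp_def mult_ac)
  also have "xq powi rh a * xq powi (- rh c) = xq powi (rh a - rh c)"
    by (simp only: powi_merge[OF xq_nz] diff_conv_add_uminus)
  finally show ?thesis unfolding qpow_rho[OF assms] .
qed

lemma finite_pairs: "finite {(i, j). i \<in> {1..N} \<and> j \<in> {1..N} \<and> Q i j}"
  by (rule finite_subset[of _ "{1..N} \<times> {1..N}"]) auto

text \<open>For a not self-dual the three possible values of (eps a, eps b) belong to b = a, b = a'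
  and all other b. For the middle index the two Kronecker terms cancel.\<close>

lemma diag_entry:
  assumes x: "(x :: K) \<noteq> 0" and a: "a \<in> ind" and b: "b \<in> ind"
  shows "1 + (x powi (-1) - x) * ((-1) ^ par a * (of_bool (b = a) * x powi (- ee a a) - of_bool (b = prime a) * x powi ee a a))
     = x powi (- 2 * ee a b)"
proof -
  have xy: "x * inverse x = 1" "inverse x * x = 1" using x by simp_all
  have p: "x powi (- 2) = inverse x * inverse x"
    by (simp add: power_int_minus power2_eq_square)
  show ?thesis
  proof (cases "a = prime a")
    case False
    have 1: "ee a a = 1 \<or> ee a a = - 1" "ee a a = (-1) ^ par a"
      using False par_cases[OF a] by (auto simp: ee_def sgn_par_def)
    consider "b = a" | "b = prime a" | "b \<noteq> a" "b \<noteq> prime a" by blast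
    then show ?thesis
    proof cases
      case 1
      then have "ee a b = (-1) ^ par a" "ee a a = (-1) ^ par a" using False by (auto simp: ee_def sgn_par_def)
      then show ?thesis using par_cases[OF a] 1 False
        by (elim disjE) (simp_all add: p xy left_diff_distrib power2_eq_square)
    next
      case 2
      then have "ee a b = - ((-1) ^ par a)" "ee a a = (-1) ^ par a" using False by (auto simp: ee_def sgn_par_def)
      then show ?thesis using par_cases[OF a] 2 False
        by (elim disjE) (simp_all add: p xy left_diff_distrib power2_eq_square)
    next
      case 3
      then have "ee a b = 0" using False by (auto simp: ee_def)
      then show ?thesis using 3 by simp
    qed
  qed (auto simp: ee_def)
qed

text \<open>On the support of each Kronecker term the prefactor (-1)^j, the sign of the graded
  tensor product and the sign in the coefficient combine to the short sign used in
  \<open>Rx\<close>.\<close>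

lemma offdiag_entry:
  assumes "a \<in> ind" "b \<in> ind" "c \<in> ind" "d \<in> ind"
  shows "(-1) ^ par c * (-1) ^ ((par b + par d) * par c) * (of_bool (b = c \<and> d = a)
       - ((-1) ^ (par c * (par a + par c)) * of_int (th a) * of_int (th c) * y) * of_bool (b = prime a \<and> d = prime c))
    = of_bool (a = d \<and> b = c) * (-1) ^ (par a * par c)
      - of_bool (b = prime a \<and> d = prime c) * (of_int (th a) * ((-1) ^ par c * of_int (th c)) * (y :: K))"
proof -
  have 1: "b = c \<and> d = a \<Longrightarrow> (-1) ^ par c * (-1) ^ ((par b + par d) * par c) = ((-1) ^ (par a * par c) :: K)"
    using par_cases[OF assms(1)] par_cases[OF assms(3)] by auto
  have 2: "b = prime a \<and> d = prime c \<Longrightarrow> (-1) ^ par c * (-1) ^ ((par b + par d) * par c) * (-1) ^ (par c * (par a + par c)) = ((-1) ^ par c :: K)"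
    using par_cases[OF assms(1)] par_cases[OF assms(3)] assms by auto
  show ?thesis
    unfolding right_diff_distrib
    by (rule arg_cong2[where f = "(-)"]) (use 1 2 in \<open>auto simp: of_bool_def\<close>)
qed

lemma msupp_mtensor: "msupp ind A \<Longrightarrow> msupp ind B \<Longrightarrow> msupp ind2 (mtensor A B)"
  unfolding msupp_def mtensor_def ind2_def by fastforce

lemma msupp_munit: "i \<in> I \<Longrightarrow> j \<in> I \<Longrightarrow> msupp I (munit i j :: ('i, 'a::zero_neq_one) matr)"
  by (auto simp: msupp_def munit_def split: if_splits)

lemma msupp_R_zero: "msupp ind2 R_zero"
  unfolding R_zero_def case_prod_unfold ind_def[symmetric]
  by (intro msupp_add msupp_smult msupp_sum msupp_mtensor msupp_munit msupp_diff msupp_mone) auto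

lemma R_zero_eq: "R_zero = Rx xq"
proof (intro ext, clarify)
  fix a b c d
  show "R_zero (a, b) (c, d) = Rx xq (a, b) (c, d)"
  proof (cases "a \<in> ind \<and> b \<in> ind \<and> c \<in> ind \<and> d \<in> ind")
    case False
    then have "\<not> ((a, b) \<in> ind2 \<and> (c, d) \<in> ind2)" by (auto simp: ind2_def)
    then have "Rx xq (a, b) (c, d) = 0" "R_zero (a, b) (c, d) = 0"
      using msuppD[OF msupp_Rx] msuppD[OF msupp_R_zero] by blast+
    then show ?thesis by simp
  next
    case True
    then have abcd: "a \<in> ind" "b \<in> ind" "c \<in> ind" "d \<in> ind" by auto
    show ?thesis
    proof -
      have mem: "(a, c) \<in> {(i, j). i \<in> {1..N} \<and> j \<in> {1..N} \<and> i < j} \<longleftrightarrow> a < c"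
        using abcd by (auto simp: ind_def)
      have Rx: "Rx xq (a, b) (c, d) = of_bool (a = c \<and> b = d) * xq powi (- 2 * ee a b)
         + (xq powi (- 2) - xq powi 2) * of_bool (a < c)
           * (of_bool (a = d \<and> b = c) * (-1) ^ (par a * par c)
              - of_bool (b = prime a \<and> d = prime c) * gq xq a * gp xq c)"
        using abcd by (simp add: Rx_def ind2_def)
      have d: "mone ind2 (a, b) (c, d) + (qpow (-1/2) - qpow (1/2)) * (of_bool (a = c \<and> a \<in> ind) * (-1) ^ par a * (-1) ^ ((par b + par d) * par c)
          * (qpow (- form (eps a) (eps a) / 2) *\<^sub>m munit a a - qpow (form (eps a) (eps a) / 2) *\<^sub>m munit (prime a) (prime a)) b d)
          = of_bool (a = c \<and> b = d) * xq powi (- 2 * ee a b)"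
        unfolding qpow_ee[OF abcd(1)] qpow_1 diag_entry[OF xq_nz abcd(1,2), symmetric]
        using abcd by (cases "a = c"; cases "b = d") (auto simp: mone_def ind2_def munit_apply)
      have o: "(-1) ^ par c * (-1) ^ ((par b + par d) * par c) * (munit c a
               - ((-1) ^ (par c * (par a + par c)) * of_int (th a) * of_int (th c)
                  * qpow (form rho (eps a - eps c))) *\<^sub>m munit (prime a) (prime c)) b d
          = of_bool (a = d \<and> b = c) * (-1) ^ (par a * par c)
            - of_bool (b = prime a \<and> d = prime c) * gq xq a * gp xq c"
        unfolding minus_apply msmult_apply munit_apply offdiag_entry[OF abcd] gq_gp_qpow[OF abcd(1,3)]
          mult.assoc[of "of_bool _" "gq xq a"] ..
      define S1 where "S1 = (\<Sum>i\<in>{1..N}. (-1) ^ par i *\<^sub>m mtensor (munit i i)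
            (qpow (- form (eps i) (eps i) / 2) *\<^sub>m munit i i
             - qpow (form (eps i) (eps i) / 2) *\<^sub>m munit (prime i) (prime i)))"
      define S2 where "S2 = (\<Sum>(i, j)\<in>{(i, j). i \<in> {1..N} \<and> j \<in> {1..N} \<and> i < j}.
            (-1) ^ par j *\<^sub>m mtensor (munit i j)
              (munit j i
               - ((-1) ^ (par j * (par i + par j)) * of_int (th i) * of_int (th j)
                  * qpow (form rho (eps i - eps j))) *\<^sub>m munit (prime i) (prime j)))"
      have "R_zero = mone ind2 + (qpow (-1/2) - qpow (1/2)) *\<^sub>m S1 + (qpow (-1) - qpow 1) *\<^sub>m S2"
        unfolding R_zero_def S1_def S2_def ..
      then have "R_zero (a, b) (c, d) = mone ind2 (a, b) (c, d) + (qpow (-1/2) - qpow (1/2)) * S1 (a, b) (c, d)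
          + (qpow (-1) - qpow 1) * S2 (a, b) (c, d)"
        by (simp only: plus_fun_apply msmult_apply)
      also have "\<dots> = Rx xq (a, b) (c, d)"
        unfolding S1_def S2_def sum_mtensor_munit[OF finite_pairs] sum_mtensor_munit_diag d mem Rx unfolding qpow_1
        using arg_cong[OF o, of "\<lambda>t. (xq powi (- 2) - xq powi 2) * (of_bool (a < c) * t)"]
        by (simp only: mult.assoc)
      finally show ?thesis .
    qed
  qed
qed

section \<open>Conjugation by the graded flip\<close>

lemma tau_mult_left:
  assumes "a \<in> ind" "b \<in> ind"
  shows "mmult ind2 tau A (a, b) q = (-1) ^ (par a * par b) * A (b, a) q"
proof -
  have "mmult ind2 tau A (a, b) q = (\<Sum>k\<in>ind2. if k = (b, a) then (-1) ^ (par a * par b) * A (b, a) q else 0)"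
    unfolding mmult_def by (intro sum.cong) (auto simp: tau_def ind2_def mult.commute split: if_splits)
  then show ?thesis using assms by (simp add: ind2_def)
qed

lemma tau_mult_right:
  assumes "c \<in> ind" "d \<in> ind"
  shows "mmult ind2 A tau p (c, d) = (-1) ^ (par c * par d) * A p (d, c)"
proof -
  have "mmult ind2 A tau p (c, d) = (\<Sum>k\<in>ind2. if k = (d, c) then (-1) ^ (par c * par d) * A p (d, c) else 0)"
    unfolding mmult_def using assms by (intro sum.cong) (auto simp: tau_def ind2_def split: if_splits)
  then show ?thesis using assms by (simp add: ind2_def)
qed

lemma msupp_tau: "msupp ind2 tau"
  unfolding msupp_def tau_def ind2_def by (auto split: if_splits)

lemma tau_tau: "mmult ind2 tau tau = mone ind2"
proof (intro ext, clarify)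
  fix a b c d
  show "mmult ind2 tau tau (a, b) (c, d) = mone ind2 (a, b) (c, d)"
  proof (cases "(a, b) \<in> ind2")
    case True
    then have "a \<in> ind" "b \<in> ind" by (auto simp: ind2_def)
    then show ?thesis
      unfolding tau_mult_left[OF \<open>a \<in> ind\<close> \<open>b \<in> ind\<close>]
      using par_cases[of a] par_cases[of b] by (auto simp: tau_def mone_def ind2_def)
  next
    case False
    then have "mmult ind2 tau tau (a, b) (c, d) = 0"
      by (intro msuppD[OF msupp_mmult[OF msupp_tau msupp_tau]]) simp
    with False show ?thesis by (auto simp: mone_def)
  qed
qed

lemma msupp_R_infinity: "msupp ind2 R_infinity"
  unfolding R_infinity_def case_prod_unfold ind_def[symmetric]
  by (intro msupp_add msupp_smult msupp_sum msupp_mtensor msupp_munit msupp_diff msupp_mone) auto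

text \<open>The diagonal part is \<open>diag_entry\<close> at \<open>inverse xq\<close>; the rest is
  that of \<open>R_zero\<close> with the opposite order and the opposite scalar in front.\<close>

lemma R_infinity_entry:
  assumes abcd: "a \<in> ind" "b \<in> ind" "c \<in> ind" "d \<in> ind"
  shows "R_infinity (a, b) (c, d) = of_bool (a = c \<and> b = d) * xq powi (2 * ee a b)
     - (xq powi (- 2) - xq powi 2) * of_bool (c < a)
       * (of_bool (a = d \<and> b = c) * (-1) ^ (par a * par c)
          - of_bool (b = prime a \<and> d = prime c) * gq xq a * gp xq c)"
proof -
  have inv: "inverse xq powi k = xq powi (- k)" for k
    by (simp add: power_int_minus power_int_inverse)
  have di: "1 + (xq - xq powi (-1)) * ((-1) ^ par a * (of_bool (b = a) * xq powi (ee a a) - of_bool (b = prime a) * xq powi (- ee a a)))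
     = xq powi (2 * ee a b)"
  proof -
    have E: "inverse xq powi (-1) = xq" "inverse xq powi (- ee a a) = xq powi ee a a"
      "inverse xq powi (ee a a) = xq powi (- ee a a)" "inverse xq powi (- 2 * ee a b) = xq powi (2 * ee a b)"
      by (simp_all add: inv)
    have E': "xq powi (-1) = inverse xq" by simp
    have "inverse xq \<noteq> 0" by simp
    from diag_entry[OF this abcd(1,2), unfolded E] show ?thesis unfolding E' .
  qed
  have mem: "(a, c) \<in> {(i, j). i \<in> {1..N} \<and> j \<in> {1..N} \<and> j < i} \<longleftrightarrow> c < a"
    using abcd by (auto simp: ind_def)
  have d: "mone ind2 (a, b) (c, d) + (qpow (1/2) - qpow (-1/2)) * (of_bool (a = c \<and> a \<in> ind) * (-1) ^ par a * (-1) ^ ((par b + par d) * par c)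
      * (qpow (form (eps a) (eps a) / 2) *\<^sub>m munit a a - qpow (- form (eps a) (eps a) / 2) *\<^sub>m munit (prime a) (prime a)) b d)
      = of_bool (a = c \<and> b = d) * xq powi (2 * ee a b)"
    unfolding qpow_ee[OF abcd(1)] qpow_1 di[symmetric]
    using abcd by (cases "a = c"; cases "b = d") (auto simp: mone_def ind2_def munit_apply)
  have o: "(-1) ^ par c * (-1) ^ ((par b + par d) * par c) * (munit c a
           - ((-1) ^ (par c * (par a + par c)) * of_int (th a) * of_int (th c)
              * qpow (form rho (eps a - eps c))) *\<^sub>m munit (prime a) (prime c)) b d
      = of_bool (a = d \<and> b = c) * (-1) ^ (par a * par c)
        - of_bool (b = prime a \<and> d = prime c) * gq xq a * gp xq c"
    unfolding minus_apply msmult_apply munit_apply offdiag_entry[OF abcd] gq_gp_qpow[OF abcd(1,3)]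
          mult.assoc[of "of_bool _" "gq xq a"] ..
  have "R_infinity (a, b) (c, d) = of_bool (a = c \<and> b = d) * xq powi (2 * ee a b)
     + (xq powi 2 - xq powi (- 2)) * (of_bool (c < a)
       * (of_bool (a = d \<and> b = c) * (-1) ^ (par a * par c)
          - of_bool (b = prime a \<and> d = prime c) * gq xq a * gp xq c))"
  proof -
    define S1 where "S1 = (\<Sum>i\<in>{1..N}. (-1) ^ par i *\<^sub>m mtensor (munit i i)
          (qpow (form (eps i) (eps i) / 2) *\<^sub>m munit i i
           - qpow (- form (eps i) (eps i) / 2) *\<^sub>m munit (prime i) (prime i)))"
    define S2 where "S2 = (\<Sum>(i, j)\<in>{(i, j). i \<in> {1..N} \<and> j \<in> {1..N} \<and> j < i}.
          (-1) ^ par j *\<^sub>m mtensor (munit i j)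
            (munit j i
             - ((-1) ^ (par j * (par i + par j)) * of_int (th i) * of_int (th j)
                * qpow (form rho (eps i - eps j))) *\<^sub>m munit (prime i) (prime j)))"
    have "R_infinity = mone ind2 + (qpow (1/2) - qpow (-1/2)) *\<^sub>m S1 + (qpow 1 - qpow (-1)) *\<^sub>m S2"
      unfolding R_infinity_def S1_def S2_def ..
    then have "R_infinity (a, b) (c, d) = mone ind2 (a, b) (c, d) + (qpow (1/2) - qpow (-1/2)) * S1 (a, b) (c, d)
        + (qpow 1 - qpow (-1)) * S2 (a, b) (c, d)"
      by (simp only: plus_fun_apply msmult_apply)
    then show ?thesis
      unfolding S1_def S2_def sum_mtensor_munit[OF finite_pairs] sum_mtensor_munit_diag d mem unfolding qpow_1
      using arg_cong[OF o, of "\<lambda>t. (xq powi 2 - xq powi (- 2)) * (of_bool (c < a) * t)"]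
      by (simp only: mult.assoc)
  qed
  then show ?thesis by (simp add: algebra_simps)
qed

text \<open>The flip exchanges rows (a, b) and (b, a). On the dual terms \<open>prime\<close>
  reverses the order of indices and negates \<open>rh\<close>, so the condition c < b becomes a < d
  and the power of q is inverted. On the flip terms a = c and b = d.\<close>

lemma tau_R_infinity: "mmult ind2 tau R_infinity = mmult ind2 (Rx (inverse xq)) tau"
proof (intro ext, clarify)
  fix a b c d
  show "mmult ind2 tau R_infinity (a, b) (c, d) = mmult ind2 (Rx (inverse xq)) tau (a, b) (c, d)"
  proof (cases "a \<in> ind \<and> b \<in> ind \<and> c \<in> ind \<and> d \<in> ind")
    case False
    then have "\<not> ((a, b) \<in> ind2 \<and> (c, d) \<in> ind2)" by (auto simp: ind2_def)
    then have "mmult ind2 tau R_infinity (a, b) (c, d) = 0" "mmult ind2 (Rx (inverse xq)) tau (a, b) (c, d) = 0"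
      using msuppD[OF msupp_mmult[OF msupp_tau msupp_R_infinity]] msuppD[OF msupp_mmult[OF msupp_Rx msupp_tau]]
      by blast+
    then show ?thesis by simp
  next
    case True
    then have abcd: "a \<in> ind" "b \<in> ind" "c \<in> ind" "d \<in> ind" by auto
    have inv: "inverse xq powi k = xq powi (- k)" for k
      by (simp add: power_int_minus power_int_inverse)
    have lt: "b = prime a \<and> c = prime d \<Longrightarrow> c < b \<longleftrightarrow> a < d"
      using abcd by (auto simp: prime_def ind_def)
    define z where "z = xq powi (- 2) - xq powi 2"
    have "(-1) ^ (par a * par b) * R_infinity (b, a) (c, d) =
       of_bool (a = d \<and> b = c) * (-1) ^ (par a * par b) * xq powi (2 * ee a b)
       - z * (of_bool (c < b \<and> a = c \<and> b = d) * ((-1) ^ (par a * par b) * (-1) ^ (par b * par c))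
          - of_bool (c < b \<and> a = prime b \<and> d = prime c) * ((-1) ^ (par a * par b) * (gq xq b * gp xq c)))"
      unfolding R_infinity_entry[OF abcd(2,1,3,4)] z_def[symmetric]
      using abcd ee_sym[of a b] by (auto simp: of_bool_def algebra_simps)
    also have "\<dots> = of_bool (a = d \<and> b = c) * (-1) ^ (par c * par d) * xq powi (2 * ee a b)
       - z * (of_bool (a < d \<and> a = c \<and> b = d) * ((-1) ^ (par c * par d) * (-1) ^ (par a * par d))
          - of_bool (a < d \<and> b = prime a \<and> c = prime d) * ((-1) ^ (par c * par d) * (gq (inverse xq) a * gp (inverse xq) d)))"
    proof -
      have 1: "of_bool (a = d \<and> b = c) * (-1) ^ (par a * par b) * xq powi (2 * ee a b)
        = of_bool (a = d \<and> b = c) * (-1) ^ (par c * par d) * xq powi (2 * ee a b)"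
        by (auto simp: of_bool_def mult.commute)
      have 2: "of_bool (c < b \<and> a = c \<and> b = d) * ((-1) ^ (par a * par b) * (-1) ^ (par b * par c))
        = (of_bool (a < d \<and> a = c \<and> b = d) * ((-1) ^ (par c * par d) * (-1) ^ (par a * par d)) :: K)"
        by (auto simp: of_bool_def mult.commute)
      have 3: "of_bool (c < b \<and> a = prime b \<and> d = prime c) * ((-1) ^ (par a * par b) * (gq xq b * gp xq c))
        = of_bool (a < d \<and> b = prime a \<and> c = prime d) * ((-1) ^ (par c * par d) * (gq (inverse xq) a * gp (inverse xq) d))"
      proof (cases "b = prime a \<and> c = prime d")
        case True
        have 4: "(-1) ^ (par a * par b) * (gq xq b * gp xq c) = (-1) ^ (par c * par d) * (gq (inverse xq) a * gp (inverse xq) d)"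
          using True abcd par_cases[OF abcd(1)] par_cases[OF abcd(4)]
          by (auto simp: gq_def gp_def inv th_prime_K)
        have 5: "a = prime b \<and> d = prime c" using True abcd by simp
        have 6: "c < b \<longleftrightarrow> a < d" using lt True by blast
        show ?thesis unfolding 4 using 5 6 True by (simp only: simp_thms)
      next
        case False
        then have "\<not> (a = prime b \<and> d = prime c)" using abcd by auto
        with False show ?thesis by (auto simp: of_bool_def)
      qed
      show ?thesis unfolding 1 2 3 ..
    qed
    also have "\<dots> = (-1) ^ (par c * par d) * Rx (inverse xq) (a, b) (d, c)"
    proof -
      have z: "inverse xq powi - 2 - inverse xq powi 2 = - z" unfolding inv z_def by simp
      show ?thesis
        unfolding Rx_def prod.case z using abcd
        by (simp add: ind2_def inv of_bool_conj algebra_simps)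
    qed
    finally show ?thesis
      unfolding tau_mult_left[OF abcd(1,2)] tau_mult_right[OF abcd(3,4)] .
  qed
qed

lemma tau_R_inverse:
  "mmult ind2 (mmult ind2 tau R_zero) (mmult ind2 tau R_infinity) = mone ind2"
  "mmult ind2 (mmult ind2 tau R_infinity) (mmult ind2 tau R_zero) = mone ind2"
proof -
  have i1: "mmult ind2 (Rx xq) (Rx (inverse xq)) = mone ind2"
    using Rx_inverse[of "inverse xq"] by simp
  have i2: "mmult ind2 (Rx (inverse xq)) (Rx xq) = mone ind2"
    using Rx_inverse[of xq] by simp
  have "mmult ind2 (mmult ind2 tau R_zero) (mmult ind2 tau R_infinity)
    = mmult ind2 tau (mmult ind2 (mmult ind2 (Rx xq) (Rx (inverse xq))) tau)"
    unfolding tau_R_infinity R_zero_eq by (simp add: mmult_assoc)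
  then show "mmult ind2 (mmult ind2 tau R_zero) (mmult ind2 tau R_infinity) = mone ind2"
    unfolding i1 by (simp add: msupp_tau tau_tau)
  have "mmult ind2 (mmult ind2 tau R_infinity) (mmult ind2 tau R_zero)
    = mmult ind2 (Rx (inverse xq)) (mmult ind2 (mmult ind2 tau tau) (Rx xq))"
    unfolding tau_R_infinity R_zero_eq by (simp add: mmult_assoc)
  then show "mmult ind2 (mmult ind2 tau R_infinity) (mmult ind2 tau R_zero) = mone ind2"
    unfolding tau_tau using i2 by (simp add: msupp_Rx)
qed

end

section \<open>Linear extension\<close>

text \<open>The coefficient map is a parameter so that one linear extension \<open>lx\<close> serves
  matrix entries over \<open>K\<close> (identity) and the pairing over \<open>L\<close>
  (\<open>K_to_L\<close>).\<close>

definition scalar_hom :: "(K \<Rightarrow> 'b::comm_ring_1) \<Rightarrow> bool" where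
  "scalar_hom h \<longleftrightarrow> h 0 = 0 \<and> h 1 = 1 \<and> (\<forall>a b. h (a + b) = h a + h b) \<and> (\<forall>a b. h (a * b) = h a * h b)"

lemma scalar_hom_id: "scalar_hom (\<lambda>c. c)"
  by (simp add: scalar_hom_def)

lemma scalar_hom_K_to_L: "scalar_hom K_to_L"
  by (simp add: scalar_hom_def)

definition lx :: "(K \<Rightarrow> 'b::comm_ring_1) \<Rightarrow> ('w \<Rightarrow> 'b) \<Rightarrow> ('w \<Rightarrow>\<^sub>0 K) \<Rightarrow> 'b" where
  "lx h \<phi> a = (\<Sum>w\<in>Poly_Mapping.keys a. h (Poly_Mapping.lookup a w) * \<phi> w)"

lemma lx_superset:
  assumes "scalar_hom h" "finite S" "Poly_Mapping.keys a \<subseteq> S"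
  shows "lx h \<phi> a = (\<Sum>w\<in>S. h (Poly_Mapping.lookup a w) * \<phi> w)"
  unfolding lx_def using assms
  by (intro sum.mono_neutral_left) (auto simp: scalar_hom_def in_keys_iff)

lemma lx_add: "scalar_hom h \<Longrightarrow> lx h \<phi> (a + b) = lx h \<phi> a + lx h \<phi> b"
proof -
  assume h: "scalar_hom h"
  let ?S = "Poly_Mapping.keys a \<union> Poly_Mapping.keys b"
  have "lx h \<phi> (a + b) = (\<Sum>w\<in>?S. h (Poly_Mapping.lookup (a + b) w) * \<phi> w)"
    by (rule lx_superset[OF h]) (auto simp: Poly_Mapping.keys_add)
  also have "\<dots> = (\<Sum>w\<in>?S. h (Poly_Mapping.lookup a w) * \<phi> w) + (\<Sum>w\<in>?S. h (Poly_Mapping.lookup b w) * \<phi> w)"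
    using h by (simp add: lookup_add scalar_hom_def distrib_right sum.distrib)
  also have "\<dots> = lx h \<phi> a + lx h \<phi> b"
    by (intro arg_cong2[where f = "(+)"]; rule lx_superset[OF h, symmetric]) auto
  finally show ?thesis .
qed

lemma lx_zero [simp]: "lx h \<phi> 0 = 0"
  by (simp add: lx_def)

lemma lx_single: "scalar_hom h \<Longrightarrow> lx h \<phi> (Poly_Mapping.single w c) = h c * \<phi> w"
  by (simp add: lx_def scalar_hom_def)

lemma lx_sum: "scalar_hom h \<Longrightarrow> lx h \<phi> (sum f A) = (\<Sum>x\<in>A. lx h \<phi> (f x))"
  by (induction A rule: infinite_finite_induct) (auto simp: lx_add)

lemma lx_uminus: "scalar_hom h \<Longrightarrow> lx h \<phi> (- a) = - lx h \<phi> a"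
  using lx_add[of h \<phi> a "- a"] by (simp add: eq_neg_iff_add_eq_0 add.commute)

lemma lx_diff: "scalar_hom h \<Longrightarrow> lx h \<phi> (a - b) = lx h \<phi> a - lx h \<phi> b"
  using lx_add[of h \<phi> a "- b"] by (simp add: lx_uminus)

lemma sum_singles: "(\<Sum>w\<in>Poly_Mapping.keys a. Poly_Mapping.single w (Poly_Mapping.lookup a w)) = a"
proof (rule poly_mapping_eqI)
  fix k
  show "Poly_Mapping.lookup (\<Sum>w\<in>Poly_Mapping.keys a. Poly_Mapping.single w (Poly_Mapping.lookup a w)) k
      = Poly_Mapping.lookup a k"
    by (simp add: lookup_sum lookup_single when_def in_keys_iff)
qed

lemma lx_mult:
  fixes a b :: free
  assumes h: "scalar_hom h"
  shows "lx h \<phi> (a * b) = lx h (\<lambda>u. lx h (\<lambda>v. \<phi> (u @ v)) b) a"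
proof -
  have "a * b = (\<Sum>u\<in>Poly_Mapping.keys a. \<Sum>v\<in>Poly_Mapping.keys b.
      Poly_Mapping.single (u @ v) (Poly_Mapping.lookup a u * Poly_Mapping.lookup b v))"
    by (subst (1) sum_singles[of a, symmetric], subst (1) sum_singles[of b, symmetric])
      (simp only: sum_product mult_single plus_list_def)
  then have "lx h \<phi> (a * b) = (\<Sum>u\<in>Poly_Mapping.keys a. \<Sum>v\<in>Poly_Mapping.keys b.
      h (Poly_Mapping.lookup a u) * h (Poly_Mapping.lookup b v) * \<phi> (u @ v))"
    using h by (simp add: lx_sum[OF h] lx_single[OF h]) (simp add: scalar_hom_def)
  then show ?thesis by (simp add: lx_def sum_distrib_left mult.assoc)
qed

lemma lx_lin_ext:
  assumes h: "scalar_hom h"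
  shows "lx h \<phi> (lin_ext \<psi> a) = lx h (\<lambda>w. lx h \<phi> (\<psi> w)) a"
proof -
  have "lx h \<phi> (Poly_Mapping.map ((*) c) b) = h c * lx h \<phi> b" for c b
  proof -
    have "lx h \<phi> (Poly_Mapping.map ((*) c) b)
       = (\<Sum>w\<in>Poly_Mapping.keys b. h (Poly_Mapping.lookup (Poly_Mapping.map ((*) c) b) w) * \<phi> w)"
      by (rule lx_superset[OF h]) (auto simp: in_keys_iff Poly_Mapping.map.rep_eq when_def)
    then show ?thesis
      using h by (simp add: Poly_Mapping.map.rep_eq when_def lx_def scalar_hom_def sum_distrib_left mult.assoc in_keys_iff)
  qed
  then show ?thesis unfolding lin_ext_def lx_sum[OF h] by (simp add: lx_def[of h _ a])
qed

lemma lx_cong: "(\<And>w. w \<in> Poly_Mapping.keys a \<Longrightarrow> \<phi> w = \<psi> w) \<Longrightarrow> lx h \<phi> a = lx h \<psi> a"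
  by (simp add: lx_def)

lemma lx_add_fun: "lx h (\<lambda>w. \<phi> w + \<psi> w) a = lx h \<phi> a + lx h \<psi> a"
  by (simp add: lx_def distrib_left sum.distrib)

lemma lx_diff_fun: "lx h (\<lambda>w. \<phi> w - \<psi> w) a = lx h \<phi> a - lx h \<psi> a"
  by (simp add: lx_def right_diff_distrib sum_subtractf)

lemma lx_scale_fun: "lx h (\<lambda>w. c * \<phi> w) a = c * lx h \<phi> a"
  by (simp add: lx_def sum_distrib_left mult.left_commute)

lemma lx_sum_fun: "lx h (\<lambda>w. \<Sum>x\<in>A. \<phi> x w) a = (\<Sum>x\<in>A. lx h (\<phi> x) a)"
  unfolding lx_def sum_distrib_left by (rule sum.swap)

lemma lx_zero_fun [simp]: "lx h (\<lambda>w. 0) a = 0"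
  by (simp add: lx_def)

section \<open>The matrices of the generators satisfy the defining relations\<close>

context osp
begin

text \<open>The matrix of q^(k h_i / 2); in particular \<open>Kd i 2\<close> is q^(h_i).\<close>

definition Kd :: "nat \<Rightarrow> int \<Rightarrow> (nat, K) matr" where
  "Kd i k = (\<lambda>a c. if a = c \<and> a \<in> ind then xq powi (k * hh i a) else 0)"

lemma rep_Gk: "i \<in> {1..s} \<Longrightarrow> rep_gen (Gk i) = Kd i 1" "i \<in> {1..s} \<Longrightarrow> rep_gen (Gki i) = Kd i (-1)"
  by (auto simp: qdiag_def Kd_def h_mat_eq fun_eq_iff intro!: qpow_eq)

lemma msupp_Kd: "msupp ind (Kd i k)"
  by (auto simp: msupp_def Kd_def split: if_splits)

lemma mmult_Kd_left: "a \<in> ind \<Longrightarrow> mmult ind (Kd i k) A a c = xq powi (k * hh i a) * A a c"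
proof -
  assume "a \<in> ind"
  have "mmult ind (Kd i k) A a c = (\<Sum>l\<in>ind. if l = a then xq powi (k * hh i a) * A a c else 0)"
    unfolding mmult_def Kd_def by (intro sum.cong) auto
  then show ?thesis using \<open>a \<in> ind\<close> by simp
qed

lemma mmult_Kd_right: "c \<in> ind \<Longrightarrow> mmult ind A (Kd i k) a c = A a c * xq powi (k * hh i c)"
proof -
  assume "c \<in> ind"
  have "mmult ind A (Kd i k) a c = (\<Sum>l\<in>ind. if l = c then A a c * xq powi (k * hh i c) else 0)"
    unfolding mmult_def Kd_def by (intro sum.cong) auto
  then show ?thesis using \<open>c \<in> ind\<close> by simp
qed

lemma Kd_mult: "mmult ind (Kd i k) (Kd i l) = Kd i (k + l)"
proof (intro ext)
  fix a c
  show "mmult ind (Kd i k) (Kd i l) a c = Kd i (k + l) a c"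
  proof (cases "a \<in> ind")
    case True
    then show ?thesis by (simp add: mmult_Kd_left) (simp add: Kd_def powi_merge distrib_right)
  next
    case False
    then have "mmult ind (Kd i k) (Kd i l) a c = 0"
      by (intro msuppD[OF msupp_mmult[OF msupp_Kd msupp_Kd]]) simp
    with False show ?thesis by (simp add: Kd_def)
  qed
qed

lemma Kd_0: "Kd i 0 = mone ind"
  by (auto simp: Kd_def mone_def fun_eq_iff)

lemma Kd_commute: "mmult ind (Kd i k) (Kd j l) = mmult ind (Kd j l) (Kd i k)"
proof (intro ext)
  fix a c
  show "mmult ind (Kd i k) (Kd j l) a c = mmult ind (Kd j l) (Kd i k) a c"
  proof (cases "a \<in> ind")
    case True
    then show ?thesis by (simp add: mmult_Kd_left) (simp add: Kd_def)
  next
    case False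
    then have "mmult ind (Kd i k) (Kd j l) a c = 0" "mmult ind (Kd j l) (Kd i k) a c = 0"
      using msuppD[OF msupp_mmult[OF msupp_Kd msupp_Kd]] by blast+
    then show ?thesis by simp
  qed
qed

lemma hh_Ff: "i \<in> {1..s} \<Longrightarrow> j \<in> {1..s} \<Longrightarrow> Ff i a c \<noteq> 0 \<Longrightarrow> hh j a = hh j c - cart j i"
  by (auto elim!: Ff_cases simp: cart_def)

lemma hh_Ef: "i \<in> {1..s} \<Longrightarrow> j \<in> {1..s} \<Longrightarrow> Ef i a c \<noteq> 0 \<Longrightarrow> hh j a = hh j c + cart j i"
  by (auto elim!: Ef_cases simp: cart_def)

lemma Kd_Ff:
  assumes "i \<in> {1..s}" "j \<in> {1..s}"
  shows "mmult ind (Kd j k) (Ff i) = xq powi (- k * cart j i) *\<^sub>m mmult ind (Ff i) (Kd j k)"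
proof (intro ext)
  fix a c
  note S = msuppD[OF msupp_mmult[OF msupp_Kd msupp_Ff[OF assms(1)]]] msuppD[OF msupp_mmult[OF msupp_Ff[OF assms(1)] msupp_Kd]]
  show "mmult ind (Kd j k) (Ff i) a c = (xq powi (- k * cart j i) *\<^sub>m mmult ind (Ff i) (Kd j k)) a c"
  proof (cases "a \<in> ind \<and> c \<in> ind")
    case True
    show ?thesis
    proof (cases "Ff i a c = 0")
      case False
      have "xq powi (k * hh j a) = xq powi (- k * cart j i) * xq powi (k * hh j c)"
        unfolding powi_merge[OF xq_nz] hh_Ff[OF assms False] by (simp add: algebra_simps)
      then show ?thesis using True by (simp add: mmult_Kd_left mmult_Kd_right)
    qed (use True in \<open>simp add: mmult_Kd_left mmult_Kd_right\<close>)
  next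
    case False
    then have "mmult ind (Kd j k) (Ff i) a c = 0" "mmult ind (Ff i) (Kd j k) a c = 0" using S by blast+
    then show ?thesis by simp
  qed
qed

lemma Kd_Ef:
  assumes "i \<in> {1..s}" "j \<in> {1..s}"
  shows "mmult ind (Kd j k) (Ef i) = xq powi (k * cart j i) *\<^sub>m mmult ind (Ef i) (Kd j k)"
proof (intro ext)
  fix a c
  note S = msuppD[OF msupp_mmult[OF msupp_Kd msupp_Ef[OF assms(1)]]] msuppD[OF msupp_mmult[OF msupp_Ef[OF assms(1)] msupp_Kd]]
  show "mmult ind (Kd j k) (Ef i) a c = (xq powi (k * cart j i) *\<^sub>m mmult ind (Ef i) (Kd j k)) a c"
  proof (cases "a \<in> ind \<and> c \<in> ind")
    case True
    show ?thesis
    proof (cases "Ef i a c = 0")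
      case False
      have "xq powi (k * hh j a) = xq powi (k * cart j i) * xq powi (k * hh j c)"
        unfolding powi_merge[OF xq_nz] hh_Ef[OF assms False] by (simp add: algebra_simps)
      then show ?thesis using True by (simp add: mmult_Kd_left mmult_Kd_right)
    qed (use True in \<open>simp add: mmult_Kd_left mmult_Kd_right\<close>)
  next
    case False
    then have "mmult ind (Kd j k) (Ef i) a c = 0" "mmult ind (Ef i) (Kd j k) a c = 0" using S by blast+
    then show ?thesis by simp
  qed
qed

section \<open>Commutators of raising and lowering matrices\<close>

definition qdiff :: K where "qdiff = xq powi 2 - xq powi (-2)"

lemma qdiff_nz: "qdiff \<noteq> 0"
  using xq_diff_nz unfolding qdiff_def by simp

text \<open>This happens only at the fork of type D, for the nodes s - 1 and s, whose other indices
  s and s + 1 are dual and even.\<close>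

lemma pp_eq_pp:
  assumes "i \<in> {1..s}" "j \<in> {1..s}" "i \<noteq> j" "pp i = pp j"
  shows "rr i = prime (rr j)" "par (rr i) = 0" "par (rr j) = 0"
proof -
  have *: "rr i = prime (rr j) \<and> par (rr i) = 0 \<and> par (rr j) = 0" if "i \<in> {1..s}" "j \<in> {1..s}" "i < j" "pp i = pp j" for i j
  proof -
    have i: "i < s" "pp i = i" "rr i = i + 1" using that by (auto simp: pp_def rr_def)
    from that(2) show ?thesis
      by (cases rule: pp_rr_cases) (use that i par_s_dual in \<open>auto simp: prime_def\<close>)
  qed
  have "rr i = prime (rr j) \<longleftrightarrow> rr j = prime (rr i)"
    using assms pp_rr_ind prime_prime by metis
  then show "rr i = prime (rr j)" "par (rr i) = 0" "par (rr j) = 0"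
    using *[of i j] *[of j i] assms by (metis linorder_neqE_nat)+
qed

lemma rr_neq_rr: "i \<in> {1..s} \<Longrightarrow> j \<in> {1..s} \<Longrightarrow> i \<noteq> j \<Longrightarrow> rr i \<noteq> rr j"
  by (auto simp: rr_def split: if_splits)

lemma rr_neq_prime_pp:
  assumes "i \<in> {1..s}" "j \<in> {1..s}" "i \<noteq> j"
  shows "rr i \<noteq> prime (pp j)"
  using assms N_cases odd_m_iff by (auto simp: pp_def rr_def prime_def split: if_splits)

lemma mmult_Ef_left:
  assumes "i \<in> {1..s}"
  shows "mmult ind (Ef i) A a c = e_scale i * (of_bool (a = pp i) * A (rr i) c + om' i * of_bool (a = prime (rr i)) * A (prime (pp i)) c)"
proof -
  have "mmult ind (Ef i) A a c = (\<Sum>k\<in>ind. of_bool (k = rr i) * (e_scale i * of_bool (a = pp i) * A k c)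
      + of_bool (k = prime (pp i)) * (e_scale i * om' i * of_bool (a = prime (rr i)) * A k c))"
    unfolding mmult_def Ef_def by (intro sum.cong) (auto simp: of_bool_def algebra_simps)
  also have "\<dots> = e_scale i * of_bool (a = pp i) * A (rr i) c + e_scale i * om' i * of_bool (a = prime (rr i)) * A (prime (pp i)) c"
    unfolding sum.distrib using assms by (simp only: sum_ind_delta pp_rr_ind prime_ind)
  finally show ?thesis by (simp add: algebra_simps)
qed

lemma mmult_Ff_left:
  assumes "i \<in> {1..s}"
  shows "mmult ind (Ff i) A a c = kappa i * (-1) ^ par (pp i) * (of_bool (a = rr i) * A (pp i) c + om i * of_bool (a = prime (pp i)) * A (prime (rr i)) c)"
proof -
  let ?k = "kappa i * (-1) ^ par (pp i)"
  have "mmult ind (Ff i) A a c = (\<Sum>k\<in>ind. of_bool (k = pp i) * (?k * of_bool (a = rr i) * A k c)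
      + of_bool (k = prime (rr i)) * (?k * om i * of_bool (a = prime (pp i)) * A k c))"
    unfolding mmult_def Ff_def by (intro sum.cong) (auto simp: of_bool_def algebra_simps)
  also have "\<dots> = ?k * of_bool (a = rr i) * A (pp i) c + ?k * om i * of_bool (a = prime (pp i)) * A (prime (rr i)) c"
    unfolding sum.distrib using assms by (simp only: sum_ind_delta pp_rr_ind prime_ind)
  finally show ?thesis by (simp add: algebra_simps)
qed

text \<open>Both products vanish unless the nodes form the fork of type D, where each consists of
  one matrix unit and these units are equal.\<close>

lemma Ef_Ff_neq:
  assumes i: "i \<in> {1..s}" and j: "j \<in> {1..s}" and ij: "i \<noteq> j"
  shows "mmult ind (Ef i) (Ff j) a c = (-1) ^ (alpha_par i * alpha_par j) * mmult ind (Ff j) (Ef i) a c"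
proof -
  have ne: "rr i \<noteq> rr j" "rr i \<noteq> prime (pp j)" "prime (pp i) \<noteq> rr j" "rr j \<noteq> prime (pp i)" "prime (pp j) \<noteq> rr i"
    "pp j \<noteq> prime (rr i)" "prime (rr j) \<noteq> pp i" "prime (rr j) \<noteq> prime (rr i)"
    using rr_neq_rr[OF i j ij] rr_neq_prime_pp[OF i j ij] rr_neq_prime_pp[OF j i] ij i j prime_prime pp_rr_ind
    by (metis)+
  define C where "C = e_scale i * (kappa j * (-1) ^ par (pp j))"
  have EF: "mmult ind (Ef i) (Ff j) a c = C * (om' i * om j * of_bool (pp i = pp j) * of_bool (a = prime (rr i)) * of_bool (c = prime (rr j)))"
    unfolding mmult_Ef_left[OF i] Ff_def C_def using ne i j by (auto simp: of_bool_def)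
  have FE: "mmult ind (Ff j) (Ef i) a c = C * (of_bool (pp i = pp j) * of_bool (a = rr j) * of_bool (c = rr i))"
    unfolding mmult_Ff_left[OF j] Ef_def C_def using ne i j by (auto simp: of_bool_def)
  show ?thesis
  proof (cases "pp i = pp j")
    case False
    then show ?thesis unfolding EF FE by simp
  next
    case True
    note p = pp_eq_pp[OF i j ij True] pp_eq_pp[OF j i ij[symmetric] True[symmetric]]
    have th: "th (rr i) = 1" "th (rr j) = 1"
      using p(2,3) i j pp_rr_ind[OF i] pp_rr_ind[OF j] th_even by (auto simp: ind_def N_def)
    have "om' i * om j = (-1) ^ (alpha_par i * alpha_par j)"
      using par_cases[OF pp_rr_ind(1)[OF j]] th_cases[OF pp_rr_ind(1)[OF j]]
      unfolding om_def om'_def alpha_par_eq[OF i] alpha_par_eq[OF j] True p(2,3) th by auto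
    then show ?thesis unfolding EF FE using True p(1) p(4) by (simp only: of_bool_eq simp_thms mult_1_left mult_1_right) (simp only: mult_ac)
  qed
qed

lemma om_om':
  assumes "i \<in> {1..s}"
  shows "om i * om' i = (-1) ^ (par (pp i) + par (rr i))"
  using par_cases[of "pp i"] par_cases[of "rr i"] th_cases[of "pp i"] th_cases[of "rr i"] pp_rr_ind[OF assms]
  by (auto simp: om_def om'_def)

text \<open>Off the long root all eigenvalues of h_i are 0, 1 or -1; a quantum integer equals the
  integer there, and the relation is the classical one. At the long root the eigenvalues 2 and -2
  occur, and \<open>kappa\<close> is the factor that replaces the classical 2 by q + q^(-1).\<close>

lemma Ef_Ff_eq:
  assumes i: "i \<in> {1..s}" and a: "a \<in> ind"
  shows "mmult ind (Ef i) (Ff i) a c = (-1) ^ alpha_par i * mmult ind (Ff i) (Ef i) a c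
     + of_bool (a = c) * ((xq powi (2 * hh i a) - xq powi (- 2 * hh i a)) / qdiff)"
proof -
  let ?p = "pp i" and ?r = "rr i"
  have pr: "?p \<in> ind" "?r \<in> ind" using i by auto
  have q0: "qdiff \<noteq> 0" by (rule qdiff_nz)
  define C where "C = e_scale i * (kappa i * (-1) ^ par ?p)"
  have sw: "?p = prime ?r \<longleftrightarrow> ?r = prime ?p" "prime ?r = ?p \<longleftrightarrow> ?r = prime ?p" "prime ?p = ?r \<longleftrightarrow> ?r = prime ?p"
    using prime_swap[OF i] by auto
  have EF: "mmult ind (Ef i) (Ff i) a c = C * (of_bool (a = ?p) * (of_bool (c = ?p) + om i * of_bool (?r = prime ?p \<and> c = prime ?r))
     + om' i * of_bool (a = prime ?r) * (of_bool (?r = prime ?p \<and> c = ?p) + om i * of_bool (c = prime ?r)))"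
    unfolding mmult_Ef_left[OF i] Ff_def C_def using i sw by (simp add: algebra_simps)
  have FE: "mmult ind (Ff i) (Ef i) a c = C * (of_bool (a = ?r) * (of_bool (c = ?r) + om' i * of_bool (?r = prime ?p \<and> c = prime ?p))
     + om i * of_bool (a = prime ?p) * (of_bool (?r = prime ?p \<and> c = ?r) + om' i * of_bool (c = prime ?p)))"
    unfolding mmult_Ff_left[OF i] Ef_def C_def using i sw by (simp add: algebra_simps)
  show ?thesis
  proof (cases "?r = prime ?p")
    case True
    have om: "om i = 1" "om' i = 1" using om_self[OF i True] by auto
    have C: "?p = s" "i = s" "even m" "par s = 1" "N = 2 * s"
      using i True N_cases by (cases rule: pp_rr_cases; force simp: prime_def)+
    have p2: "prime ?r = ?p" using True pr by simp
    have ap: "alpha_par i = 0" using i True pr by (simp add: alpha_par_eq mult_2[symmetric])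
    have "(4 :: K) = 2 * 2" by simp
    then have four: "(4 :: K) \<noteq> 0" using two_neq_0_K by (simp only: mult_eq_0_iff) simp
    have quart: "4 * (1 / 2 * (t / 2 * - 1)) = - (t :: K)" for t
      using two_neq_0_K four by (simp add: field_simps)
    have Cv: "4 * C = - (xq powi 2 + xq powi (-2))"
      using C quart[of "xq powi 2 + xq powi (-2)"] by (simp add: C_def e_scale_def kappa_def qpow_1)
    have h: "hh i ?p = - 2" "hh i ?r = 2"
    proof -
      have "ee ?p ?p = - 1"
        using pp_not_self_dual(1)[OF i] C by (simp add: ee_def sgn_par_def)
      then show "hh i ?p = - 2" "hh i ?r = 2" unfolding hh_def True using pr by simp_all
    qed
    have prod: "(xq powi 2 + xq powi (-2)) * qdiff = xq powi 4 - xq powi (-4)"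
      by (simp add: qdiff_def algebra_simps powi_merge)
    then have pr4: "(xq powi 4 - xq powi (-4)) / qdiff = xq powi 2 + xq powi (-2)"
      using q0 by (simp add: field_simps)
    then have pr4': "(xq powi (-4) - xq powi 4) / qdiff = - (xq powi 2 + xq powi (-2))"
      by (metis minus_diff_eq minus_divide_left)
    have E1: "mmult ind (Ef i) (Ff i) a c = of_bool (a = ?p \<and> c = ?p) * (4 * C)"
      unfolding EF om p2 using True by (auto simp: of_bool_def)
    have E2: "mmult ind (Ff i) (Ef i) a c = of_bool (a = ?r \<and> c = ?r) * (4 * C)"
      unfolding FE om using True p2 by (auto simp: of_bool_def)
    consider "a = ?p" | "a = ?r" | "a \<noteq> ?p" "a \<noteq> ?r" by blast
    then show ?thesis
    proof cases
      case 1
      then show ?thesis unfolding E1 E2 Cv ap using i h pr4' by (auto simp: of_bool_def)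
    next
      case 2
      then show ?thesis unfolding E1 E2 Cv ap using i h pr4 by (auto simp: of_bool_def)
    next
      case 3
      then have "hh i a = 0" using True p2 pr a prime_prime by (auto simp: hh_def ee_def)
      with 3 show ?thesis unfolding E1 E2 by simp
    qed
  next
    case False
    have nC: "\<not> (even m \<and> par s = 1 \<and> i = s)"
    proof
      assume *: "even m \<and> par s = 1 \<and> i = s"
      then have "pp i = s" "rr i = s + 1" by (auto simp: pp_def rr_def)
      moreover have "N = 2 * s" using * odd_m_iff N_cases by auto
      ultimately show False using False by (simp add: prime_def)
    qed
    then have Cv: "C = (-1) ^ par ?p" by (auto simp: C_def e_scale_def kappa_def)
    have sg: "(-1) ^ par ?p * (om' i * om i) = (-1) ^ par ?r"
      using om_om'[OF i] by (simp add: mult.commute power_add)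
    have ap: "(-1) ^ alpha_par i = ((-1) ^ par ?p * (-1) ^ par ?r :: K)"
      using par_cases[OF pr(1)] par_cases[OF pr(2)] by (auto simp: alpha_par_eq[OF i])
    have s1: "(-1) ^ alpha_par i * (-1) ^ par ?p = ((-1) ^ par ?r :: K)" "(-1) ^ alpha_par i * (-1) ^ par ?r = ((-1) ^ par ?p :: K)"
      unfolding ap using par_cases[OF pr(1)] par_cases[OF pr(2)] by auto
    have E1: "mmult ind (Ef i) (Ff i) a c = of_bool (a = c) * (of_bool (a = ?p) * (-1) ^ par ?p + of_bool (a = prime ?r) * (-1) ^ par ?r)"
      unfolding EF Cv sg[symmetric] using False sw i by (auto simp: of_bool_def algebra_simps)
    have E2: "(-1) ^ alpha_par i * mmult ind (Ff i) (Ef i) a c = of_bool (a = c) * (of_bool (a = ?r) * (-1) ^ par ?r + of_bool (a = prime ?p) * (-1) ^ par ?p)"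
    proof -
      have "mmult ind (Ff i) (Ef i) a c = of_bool (a = c) * (of_bool (a = ?r) * (-1) ^ par ?p + of_bool (a = prime ?p) * (-1) ^ par ?r)"
        unfolding FE Cv sg[symmetric] using False sw i by (auto simp: of_bool_def algebra_simps)
      then show ?thesis using s1 by (simp only: distrib_left mult.left_commute[of "(-1) ^ alpha_par i"])
    qed
    have hval: "hh i a = (of_bool (a = ?p) - of_bool (a = prime ?p)) * sgn_par ?p - (of_bool (a = ?r) - of_bool (a = prime ?r)) * sgn_par ?r"
      using i by (auto simp: hh_def ee_def of_bool_def)
    have inj: "?p \<noteq> ?r" "?p \<noteq> prime ?r" "prime ?p \<noteq> ?r" "prime ?p \<noteq> prime ?r" "?p \<noteq> prime ?p"
      using False sw i pr by auto
    have qh: "(xq powi (2 * k) - xq powi (- 2 * k)) / qdiff = of_int k" if "k = 1 \<or> k = 0 \<or> k = -1" for k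
      using that q0 by (auto simp: qdiff_def field_simps)
    have hc: "hh i a = 1 \<or> hh i a = 0 \<or> hh i a = -1"
      unfolding hval using inj sgn_par_cases[OF pr(1)] sgn_par_cases[OF pr(2)] by (auto simp: of_bool_def)
    have hK: "(of_int (hh i a) :: K) = (of_bool (a = ?p) - of_bool (a = prime ?p)) * (-1) ^ par ?p - (of_bool (a = ?r) - of_bool (a = prime ?r)) * (-1) ^ par ?r"
      unfolding hval by (simp add: sgn_par_def)
    show ?thesis unfolding E1 E2 qh[OF hc] hK by (simp add: algebra_simps)
  qed
qed

end

section \<open>Splitting off one position of a permutation\<close>

definition skip :: "nat \<Rightarrow> nat \<Rightarrow> nat" where
  "skip v k = (if k < v then k else Suc k)"

definition unskip :: "nat \<Rightarrow> nat \<Rightarrow> nat" where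
  "unskip v k = (if k < v then k else k - 1)"

lemma skip_neq [simp]: "skip v k \<noteq> v" "v \<noteq> skip v k"
  by (simp_all add: skip_def)

lemma skip_less_iff [simp]: "skip v k < skip v l \<longleftrightarrow> k < l"
  by (auto simp: skip_def)

lemma skip_eq_iff [simp]: "skip v k = skip v l \<longleftrightarrow> k = l"
  by (auto simp: skip_def split: if_splits)

lemma unskip_skip [simp]: "unskip v (skip v k) = k"
  by (simp add: skip_def unskip_def)

lemma skip_unskip: "k \<noteq> v \<Longrightarrow> skip v (unskip v k) = k"
  by (auto simp: skip_def unskip_def)

lemma skip_le: "v \<le> n \<Longrightarrow> skip v k < Suc n \<longleftrightarrow> k < n"
  by (auto simp: skip_def)

text \<open>The permutation that sends position k0 to the value v and is \<tau> on the remaining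
  positions and values, renumbered in increasing order.\<close>

definition perm_ins :: "nat \<Rightarrow> nat \<Rightarrow> nat \<Rightarrow> (nat \<Rightarrow> nat) \<Rightarrow> nat \<Rightarrow> nat" where
  "perm_ins n v k0 \<tau> k = (if k = k0 then v else if k < Suc n then skip v (\<tau> (unskip k0 k)) else k)"

lemma perm_ins_k0 [simp]: "perm_ins n v k0 \<tau> k0 = v"
  by (simp add: perm_ins_def)

lemma perm_ins_skip: "k0 \<le> n \<Longrightarrow> k < n \<Longrightarrow> perm_ins n v k0 \<tau> (skip k0 k) = skip v (\<tau> k)"
  by (simp add: perm_ins_def skip_le)

lemma lessThan_Suc_skip:
  assumes v: "v \<le> n"
  shows "{..<Suc n} = insert v (skip v ` {..<n})"
proof (intro Set.set_eqI iffI)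
  fix k assume k: "k \<in> {..<Suc n}"
  show "k \<in> insert v (skip v ` {..<n})"
  proof (cases "k = v")
    case False
    then have "k = skip v (unskip v k)" by (simp add: skip_unskip)
    moreover from this have "unskip v k < n" using skip_le[OF v, of "unskip v k"] k by simp
    ultimately show ?thesis by blast
  qed simp
qed (use v in \<open>auto simp: skip_le\<close>)

lemma perm_ins_permutes:
  assumes "v \<le> n" "k0 \<le> n" "\<tau> permutes {..<n}"
  shows "perm_ins n v k0 \<tau> permutes {..<Suc n}"
proof (rule inj_imp_permutes)
  have "perm_ins n v k0 \<tau> (skip k0 k) = perm_ins n v k0 \<tau> (skip k0 l) \<Longrightarrow> k = l" if "k < n" "l < n" for k l
    using assms that permutes_inj[OF assms(3)] by (simp add: perm_ins_skip inj_eq)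
  then show "inj_on (perm_ins n v k0 \<tau>) {..<Suc n}"
    unfolding lessThan_Suc_skip[OF assms(2)] using assms(2)
    by (auto simp: inj_on_def perm_ins_skip)
next
  fix x assume "x \<in> {..<Suc n}"
  then have "x = k0 \<or> (\<exists>y<n. x = skip k0 y)"
    using lessThan_Suc_skip[OF assms(2)] by blast
  then show "perm_ins n v k0 \<tau> x \<in> {..<Suc n}"
  proof
    assume "\<exists>y<n. x = skip k0 y"
    then obtain y where y: "y < n" "x = skip k0 y" by blast
    have "\<tau> y < n" using permutes_in_image[OF assms(3), of y] y by simp
    then show ?thesis using y assms(1,2) by (simp add: perm_ins_skip skip_le)
  qed (use assms in simp)
qed (use assms in \<open>auto simp: perm_ins_def\<close>)

text \<open>A permutation is determined by the position of the value v and by its restriction to the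
  rest. Surjectivity follows by counting: (n + 1) n! = (n + 1)!.\<close>

lemma sum_permutations_split:
  assumes v: "v \<le> n"
  shows "(\<Sum>\<sigma>\<in>{\<sigma>. \<sigma> permutes {..<Suc n}}. f \<sigma>) = (\<Sum>k0<Suc n. \<Sum>\<tau>\<in>{\<tau>. \<tau> permutes {..<n}}. f (perm_ins n v k0 \<tau>))"
proof -
  let ?S = "{..<Suc n} \<times> {\<tau>. \<tau> permutes {..<n}}"
  let ?g = "\<lambda>(k0, \<tau>). perm_ins n v k0 \<tau>"
  have inj: "inj_on ?g ?S"
  proof (rule inj_onI, clarify)
    fix k0 \<tau> k1 \<tau>'
    assume k: "k0 < Suc n" "k1 < Suc n" and p: "\<tau> permutes {..<n}" "\<tau>' permutes {..<n}"
      and eq: "perm_ins n v k0 \<tau> = perm_ins n v k1 \<tau>'"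
    have "perm_ins n v k1 \<tau>' k0 = v" using eq[symmetric] by simp
    then have kk: "k0 = k1" using k by (auto simp: perm_ins_def split: if_splits)
    have "\<tau> k = \<tau>' k" for k
    proof (cases "k < n")
      case True
      then show ?thesis
        using fun_cong[OF eq, of "skip k0 k"] k kk by (simp add: perm_ins_skip)
    next
      case False
      then show ?thesis using p by (simp add: permutes_not_in)
    qed
    with kk show "k0 = k1 \<and> \<tau> = \<tau>'" by auto
  qed
  have "?g ` ?S = {\<sigma>. \<sigma> permutes {..<Suc n}}"
  proof (rule card_subset_eq)
    show "finite {\<sigma>. \<sigma> permutes {..<Suc n}}" by (simp add: finite_permutations)
    show "?g ` ?S \<subseteq> {\<sigma>. \<sigma> permutes {..<Suc n}}" using v by (auto intro: perm_ins_permutes)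
    have "card (?g ` ?S) = Suc n * fact n"
      using card_image[OF inj] card_permutations[of "{..<n}" n] by (simp add: card_cartesian_product)
    then show "card (?g ` ?S) = card {\<sigma>. \<sigma> permutes {..<Suc n}}"
      using card_permutations[of "{..<Suc n}" "Suc n"] by simp
  qed
  then have "(\<Sum>\<sigma>\<in>{\<sigma>. \<sigma> permutes {..<Suc n}}. f \<sigma>) = (\<Sum>x\<in>?S. f (?g x))"
    using sum.reindex[OF inj, of f] by simp
  then show ?thesis by (simp add: sum.cartesian_product case_prod_unfold)
qed

text \<open>\<open>skip\<close> is monotone, so inversions avoiding k0 are the inversions of \<tau>.
  In the others k0 is the right or the left member.\<close>

lemma inversions_perm_ins:
  assumes v: "v \<le> n" and k0: "k0 \<le> n" and \<tau>: "\<tau> permutes {..<n}"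
  defines "\<sigma> \<equiv> perm_ins n v k0 \<tau>"
  shows "(\<Prod>(k, l)\<in>{(k, l). k < l \<and> l < Suc n \<and> \<sigma> k > \<sigma> l}. f k l) =
    (\<Prod>(k, l)\<in>{(k, l). k < l \<and> l < n \<and> \<tau> k > \<tau> l}. f (skip k0 k) (skip k0 l))
    * (\<Prod>k\<in>{k. k < k0 \<and> \<sigma> k > v}. f k k0) * (\<Prod>l\<in>{l. k0 < l \<and> l < Suc n \<and> v > \<sigma> l}. f k0 l)"
proof -
  let ?I = "{(k, l). k < l \<and> l < n \<and> \<tau> k > \<tau> l}"
  let ?A = "(\<lambda>(k, l). (skip k0 k, skip k0 l)) ` ?I"
  let ?B = "(\<lambda>k. (k, k0)) ` {k. k < k0 \<and> \<sigma> k > v}"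
  let ?C = "(\<lambda>l. (k0, l)) ` {l. k0 < l \<and> l < Suc n \<and> v > \<sigma> l}"
  have A: "(k, l) \<in> ?A \<longleftrightarrow> k < l \<and> l < Suc n \<and> \<sigma> k > \<sigma> l" if "k \<noteq> k0" "l \<noteq> k0" for k l :: nat
  proof -
    define k' l' where "k' = unskip k0 k" and "l' = unskip k0 l"
    have kl: "k = skip k0 k'" "l = skip k0 l'" using that by (simp_all add: k'_def l'_def skip_unskip)
    have "(k, l) \<in> ?A \<longleftrightarrow> (k', l') \<in> ?I" unfolding kl by (auto simp: image_iff)
    then show ?thesis
      unfolding kl \<sigma>_def using k0 skip_le[OF k0, of l'] by (auto simp: perm_ins_skip)
  qed
  have mem: "(k, l) \<in> {(k, l). k < l \<and> l < Suc n \<and> \<sigma> k > \<sigma> l} \<longleftrightarrow> (k, l) \<in> ?A \<union> (?B \<union> ?C)" for k l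
  proof -
    have s0: "\<sigma> k0 = v" by (simp add: \<sigma>_def)
    consider "k \<noteq> k0" "l \<noteq> k0" | "l = k0" "k \<noteq> k0" | "k = k0" "l \<noteq> k0" | "k = k0" "l = k0" by blast
    then show ?thesis
    proof cases
      case 1
      then show ?thesis using A[OF 1] by auto
    qed (use k0 s0 in auto)
  qed
  have eq: "{(k, l). k < l \<and> l < Suc n \<and> \<sigma> k > \<sigma> l} = ?A \<union> (?B \<union> ?C)"
  proof (rule Set.set_eqI)
    fix x show "x \<in> {(k, l). k < l \<and> l < Suc n \<and> \<sigma> k > \<sigma> l} \<longleftrightarrow> x \<in> ?A \<union> (?B \<union> ?C)"
      using mem[of "fst x" "snd x"] by (simp only: prod.collapse)
  qed
  have fin: "finite ?I"
    by (rule finite_subset[of _ "{..<n} \<times> {..<n}"]) auto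
  have fin2: "finite ?B" "finite ?C" by auto
  have "(\<Prod>(k, l)\<in>?A \<union> (?B \<union> ?C). f k l) = (\<Prod>(k, l)\<in>?A. f k l) * ((\<Prod>(k, l)\<in>?B. f k l) * (\<Prod>(k, l)\<in>?C. f k l))"
  proof -
    have "?A \<inter> (?B \<union> ?C) = {}" by auto
    moreover have "?B \<inter> ?C = {}" by auto
    moreover have "finite ?A" using fin by (rule finite_imageI)
    ultimately show ?thesis using fin2 by (simp only: prod.union_disjoint finite_Un simp_thms)
  qed
  moreover have "(\<Prod>(k, l)\<in>?A. f k l) = (\<Prod>(k, l)\<in>?I. f (skip k0 k) (skip k0 l))"
    by (subst prod.reindex) (auto simp: inj_on_def case_prod_unfold)
  moreover have "(\<Prod>(k, l)\<in>?B. f k l) = (\<Prod>k\<in>{k. k < k0 \<and> \<sigma> k > v}. f k k0)"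
    by (subst prod.reindex) (auto simp: inj_on_def)
  moreover have "(\<Prod>(k, l)\<in>?C. f k l) = (\<Prod>l\<in>{l. k0 < l \<and> l < Suc n \<and> v > \<sigma> l}. f k0 l)"
    by (subst prod.reindex) (auto simp: inj_on_def)
  ultimately show ?thesis unfolding eq by (simp only: mult.assoc)
qed

lemma prod_lessThan_skip:
  assumes "v \<le> n"
  shows "(\<Prod>p<Suc n. g p) = g v * (\<Prod>p<n. g (skip v p))"
proof -
  have "(\<Prod>p<Suc n. g p) = g v * (\<Prod>p\<in>skip v ` {..<n}. g p)"
    unfolding lessThan_Suc_skip[OF assms] by (subst prod.insert) auto
  then show ?thesis by (subst (asm) prod.reindex) (auto simp: inj_on_def)
qed

section \<open>Sums over deletions of a letter\<close>

text \<open>The general shape of a skew derivation dual to multiplication by the letter i: one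
  occurrence of i is removed, and \<open>C\<close> is the cost of moving it to an end of the
  word.\<close>

definition rsum :: "nat \<Rightarrow> nat list \<Rightarrow> (nat list \<Rightarrow> nat list \<Rightarrow> 'b::comm_ring_1) \<Rightarrow> (nat list \<Rightarrow> 'b) \<Rightarrow> 'b" where
  "rsum i w C \<psi> = (\<Sum>p<length w. if w ! p = i
     then C (take p w) (drop (Suc p) w) * \<psi> (take p w @ drop (Suc p) w) else 0)"

lemma rsum_Nil [simp]: "rsum i [] C \<psi> = 0"
  by (simp add: rsum_def)

lemma rsum_Cons:
  "rsum i (j # w) C \<psi> = (if j = i then C [] w * \<psi> w else 0) + rsum i w (\<lambda>u v. C (j # u) v) (\<lambda>u. \<psi> (j # u))"
  unfolding rsum_def by (simp add: sum.lessThan_Suc_shift del: sum.lessThan_Suc cong: if_cong)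

lemma rsum_cong:
  assumes "\<And>u v. w = u @ i # v \<Longrightarrow> C u v * \<psi> (u @ v) = C' u v * \<psi>' (u @ v)"
  shows "rsum i w C \<psi> = rsum i w C' \<psi>'"
  unfolding rsum_def
proof (intro sum.cong refl if_cong)
  fix p assume "p \<in> {..<length w}" "w ! p = i"
  then have "w = take p w @ i # drop (Suc p) w" by (metis id_take_nth_drop lessThan_iff)
  from assms[OF this] show "C (take p w) (drop (Suc p) w) * \<psi> (take p w @ drop (Suc p) w)
     = C' (take p w) (drop (Suc p) w) * \<psi>' (take p w @ drop (Suc p) w)" .
qed

lemma rsum_scale: "rsum i w (\<lambda>u v. c * C u v) \<psi> = c * rsum i w C \<psi>"
  unfolding rsum_def sum_distrib_left by (intro sum.cong) (auto simp: mult.assoc)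

lemma rsum_sum: "rsum i w C (\<lambda>u. \<Sum>x\<in>A. f x * \<psi> x u) = (\<Sum>x\<in>A. f x * rsum i w C (\<psi> x))"
proof -
  have "rsum i w C (\<lambda>u. \<Sum>x\<in>A. f x * \<psi> x u)
     = (\<Sum>p<length w. \<Sum>x\<in>A. f x * (if w ! p = i then C (take p w) (drop (Suc p) w) * \<psi> x (take p w @ drop (Suc p) w) else 0))"
    unfolding rsum_def by (intro sum.cong) (auto simp: sum_distrib_left mult.left_commute)
  also have "\<dots> = (\<Sum>x\<in>A. \<Sum>p<length w. f x * (if w ! p = i then C (take p w) (drop (Suc p) w) * \<psi> x (take p w @ drop (Suc p) w) else 0))"
    by (rule sum.swap)
  finally show ?thesis by (simp add: rsum_def sum_distrib_left)
qed

lemma rsum_neq_0: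
  assumes "rsum i w C \<psi> \<noteq> 0"
  obtains u v where "w = u @ i # v" "C u v * \<psi> (u @ v) \<noteq> 0"
proof -
  have "\<exists>p<length w. w ! p = i \<and> C (take p w) (drop (Suc p) w) * \<psi> (take p w @ drop (Suc p) w) \<noteq> 0"
  proof (rule ccontr)
    assume "\<not> ?thesis"
    then have "rsum i w C \<psi> = 0"
      unfolding rsum_def by (intro sum.neutral ballI) simp
    with assms show False by simp
  qed
  then obtain p where "p < length w" "w ! p = i" "C (take p w) (drop (Suc p) w) * \<psi> (take p w @ drop (Suc p) w) \<noteq> 0"
    by blast
  moreover from this have "w = take p w @ i # drop (Suc p) w" by (metis id_take_nth_drop)
  ultimately show thesis using that by blast
qed

lemma nth_delete: "k0 < length w \<Longrightarrow> k < length w - 1 \<Longrightarrow> (take k0 w @ drop (Suc k0) w) ! k = w ! skip k0 k"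
  by (auto simp: nth_append skip_def min_def)

section \<open>The form defining the Serre relations\<close>

context osp
begin

definition wpar :: "nat list \<Rightarrow> nat" where "wpar w = sum_list (map alpha_par w)"

text \<open>The integer (alpha i, \<mu>) for the weight \<mu> of the word.\<close>

definition cs :: "nat \<Rightarrow> nat list \<Rightarrow> int" where "cs i w = sum_list (map (cart i) w)"

lemma wpar_simps [simp]: "wpar [] = 0" "wpar (j # w) = alpha_par j + wpar w" "wpar (u @ v) = wpar u + wpar v"
  by (simp_all add: wpar_def)

lemma cs_simps [simp]: "cs i [] = 0" "cs i (j # w) = cart i j + cs i w" "cs i (u @ v) = cs i u + cs i v"
  by (simp_all add: cs_def)

lemma word_par_map [simp]: "word_par (map Ge w) = wpar w" "word_par (map Gf w) = wpar w"
  by (simp_all add: word_par_def wpar_def o_def)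

abbreviation (input) chi :: "nat \<Rightarrow> nat \<Rightarrow> K" where
  "chi i j \<equiv> (-1) ^ (alpha_par i * alpha_par j) * qpow (- cartan i j)"

lemma qpow_cartan: "i \<in> {1..s} \<Longrightarrow> j \<in> {1..s} \<Longrightarrow> qpow (- cartan i j) = xq powi (- 2 * cart i j)"
  by (rule qpow_eq) (simp add: cartan_cart)

lemma prod_chi:
  assumes "i \<in> {1..s}" "set w \<subseteq> {1..s}"
  shows "(\<Prod>k<length w. chi (w ! k) i) = (-1) ^ (alpha_par i * wpar w) * xq powi (- 2 * cs i w)"
  using assms(2)
proof (induction w)
  case (Cons j w)
  have "(\<Prod>k<length (j # w). chi ((j # w) ! k) i) = chi j i * (\<Prod>k<length w. chi (w ! k) i)"
    by (simp add: prod.lessThan_Suc_shift del: prod.lessThan_Suc)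
  also have "\<dots> = (-1) ^ (alpha_par i * wpar (j # w)) * (xq powi (- 2 * cart i j) * xq powi (- 2 * cs i w))"
    using Cons assms(1) by (simp add: qpow_cartan cart_sym[of j i] power_add distrib_left mult_ac)
  also have "xq powi (- 2 * cart i j) * xq powi (- 2 * cs i w) = xq powi (- 2 * cs i (j # w))"
    by (simp add: powi_merge distrib_left)
  finally show ?case .
qed simp

lemma prod_chi':
  assumes "i \<in> {1..s}" "set w \<subseteq> {1..s}"
  shows "(\<Prod>k<length w. chi i (w ! k)) = (-1) ^ (alpha_par i * wpar w) * xq powi (- 2 * cs i w)"
proof -
  have "(\<Prod>k<length w. chi i (w ! k)) = (\<Prod>k<length w. chi (w ! k) i)"
    using assms by (intro prod.cong) (auto simp: qpow_cartan cart_sym mult.commute subset_iff)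
  then show ?thesis using prod_chi[OF assms] by simp
qed

text \<open>Permutations are grouped by the position k0 whose letter is matched with place v. Apart
  from the inversions that involve k0, the inner sum is the form on the words with these two letters
  deleted.\<close>

lemma serre_form_split:
  assumes v: "v \<le> d" and lw: "length w = Suc d" and iw': "\<forall>p<d. iw' ! p = iw ! skip v p"
  shows "serre_form iw w = (\<Sum>k0<Suc d. \<Sum>\<tau>\<in>{\<tau>. \<tau> permutes {..<d}}.
      (\<Prod>k\<in>{k. k < k0 \<and> perm_ins d v k0 \<tau> k > v}. chi (w ! k) (w ! k0))
      * (\<Prod>l\<in>{l. k0 < l \<and> l < Suc d \<and> v > perm_ins d v k0 \<tau> l}. chi (w ! k0) (w ! l))
      * (if iw ! v = w ! k0 then 1 else 0)
      * ((\<Prod>(k, l)\<in>{(k, l). k < l \<and> l < d \<and> \<tau> k > \<tau> l}. chi ((take k0 w @ drop (Suc k0) w) ! k) ((take k0 w @ drop (Suc k0) w) ! l))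
         * (\<Prod>p<d. if iw' ! p = (take k0 w @ drop (Suc k0) w) ! (inv_into UNIV \<tau> p) then 1 else 0)))"
  unfolding serre_form_def lw sum_permutations_split[OF v]
proof (intro sum.cong refl)
  fix k0 \<tau> assume k0: "k0 \<in> {..<Suc d}" and \<tau>: "\<tau> \<in> {\<tau>. \<tau> permutes {..<d}}"
  let ?\<sigma> = "perm_ins d v k0 \<tau>" and ?w = "take k0 w @ drop (Suc k0) w"
  have k0': "k0 \<le> d" "k0 < length w" and t: "\<tau> permutes {..<d}" using k0 \<tau> lw by auto
  have del: "?w ! k = w ! skip k0 k" if "k < d" for k
    using nth_delete[OF k0'(2), of k] that lw by simp
  have s: "?\<sigma> permutes {..<Suc d}" by (rule perm_ins_permutes[OF v k0'(1) t])
  have i0: "inv_into UNIV ?\<sigma> v = k0" using permutes_inv_eq[OF s] by simp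
  have ip: "inv_into UNIV ?\<sigma> (skip v p) = skip k0 (inv_into UNIV \<tau> p)" and ip': "inv_into UNIV \<tau> p < d" if "p < d" for p
  proof -
    show l: "inv_into UNIV \<tau> p < d"
      using that permutes_in_image[OF permutes_inv[OF t]] by simp
    have "?\<sigma> (skip k0 (inv_into UNIV \<tau> p)) = skip v p"
      using l k0' permutes_inverses(1)[OF t] by (simp add: perm_ins_skip)
    then show "inv_into UNIV ?\<sigma> (skip v p) = skip k0 (inv_into UNIV \<tau> p)"
      using permutes_inv_eq[OF s] by simp
  qed
  have P: "(\<Prod>p<Suc d. if iw ! p = w ! inv_into UNIV ?\<sigma> p then 1 else 0) =
     (if iw ! v = w ! k0 then 1 else 0) * (\<Prod>p<d. if iw' ! p = ?w ! (inv_into UNIV \<tau> p) then 1 else (0 :: K))"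
    unfolding prod_lessThan_skip[OF v] i0
    by (intro arg_cong2[where f = "(*)"] refl prod.cong) (simp add: ip ip' del iw')
  have Q: "(\<Prod>(k, l)\<in>{(k, l). k < l \<and> l < d \<and> \<tau> k > \<tau> l}. chi (w ! skip k0 k) (w ! skip k0 l))
    = (\<Prod>(k, l)\<in>{(k, l). k < l \<and> l < d \<and> \<tau> k > \<tau> l}. chi (?w ! k) (?w ! l))"
    by (intro prod.cong refl) (auto simp: del)
  show "(\<Prod>(k, l)\<in>{(k, l). k < l \<and> l < Suc d \<and> ?\<sigma> k > ?\<sigma> l}. chi (w ! k) (w ! l))
     * (\<Prod>p<Suc d. if iw ! p = w ! inv_into UNIV ?\<sigma> p then 1 else 0)
    = (\<Prod>k\<in>{k. k < k0 \<and> ?\<sigma> k > v}. chi (w ! k) (w ! k0))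
      * (\<Prod>l\<in>{l. k0 < l \<and> l < Suc d \<and> v > ?\<sigma> l}. chi (w ! k0) (w ! l))
      * (if iw ! v = w ! k0 then 1 else 0)
      * ((\<Prod>(k, l)\<in>{(k, l). k < l \<and> l < d \<and> \<tau> k > \<tau> l}. chi (?w ! k) (?w ! l))
         * (\<Prod>p<d. if iw' ! p = ?w ! (inv_into UNIV \<tau> p) then 1 else 0))"
    unfolding inversions_perm_ins[OF v k0'(1) t] P Q by (simp only: mult_ac)
qed

text \<open>The hypothesis \<open>fac\<close> holds at the ends: for v = 0 position k0 is inverted
  with all earlier positions and no later one, for v = d with all later ones and no earlier
  one.\<close>

lemma serre_form_rec:
  assumes v: "v \<le> d" and lw: "length w = Suc d" and li: "length iw' = d" and iw': "\<forall>p<d. iw' ! p = iw ! skip v p"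
    and fac: "\<And>k0 \<tau>. k0 \<le> d \<Longrightarrow> \<tau> permutes {..<d} \<Longrightarrow> w ! k0 = iw ! v \<Longrightarrow>
      (\<Prod>k\<in>{k. k < k0 \<and> perm_ins d v k0 \<tau> k > v}. chi (w ! k) (w ! k0))
      * (\<Prod>l\<in>{l. k0 < l \<and> l < Suc d \<and> v > perm_ins d v k0 \<tau> l}. chi (w ! k0) (w ! l)) = C (take k0 w) (drop (Suc k0) w)"
  shows "serre_form iw w = rsum (iw ! v) w C (serre_form iw')"
  unfolding serre_form_split[OF v lw iw'] rsum_def lw
proof (intro sum.cong refl)
  fix k0 assume k0: "k0 \<in> {..<Suc d}"
  let ?w = "take k0 w @ drop (Suc k0) w"
  have len: "length ?w = d" using k0 lw by auto
  let ?T = "\<lambda>\<tau>. (\<Prod>(k, l)\<in>{(k, l). k < l \<and> l < d \<and> \<tau> k > \<tau> l}. chi (?w ! k) (?w ! l))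
         * (\<Prod>p<d. if iw' ! p = ?w ! (inv_into UNIV \<tau> p) then 1 else (0 :: K))"
  have "(\<Sum>\<tau>\<in>{\<tau>. \<tau> permutes {..<d}}.
      (\<Prod>k\<in>{k. k < k0 \<and> perm_ins d v k0 \<tau> k > v}. chi (w ! k) (w ! k0))
      * (\<Prod>l\<in>{l. k0 < l \<and> l < Suc d \<and> v > perm_ins d v k0 \<tau> l}. chi (w ! k0) (w ! l))
      * (if iw ! v = w ! k0 then 1 else 0) * ?T \<tau>)
    = (\<Sum>\<tau>\<in>{\<tau>. \<tau> permutes {..<d}}. (if w ! k0 = iw ! v then C (take k0 w) (drop (Suc k0) w) else 0) * ?T \<tau>)"
    using k0 fac[of k0] by (intro sum.cong refl) (auto simp del: prod.lessThan_Suc)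
  also have "\<dots> = (if w ! k0 = iw ! v then C (take k0 w) (drop (Suc k0) w) else 0) * serre_form iw' ?w"
    unfolding serre_form_def len sum_distrib_left ..
  finally show "(\<Sum>\<tau>\<in>{\<tau>. \<tau> permutes {..<d}}.
      (\<Prod>k\<in>{k. k < k0 \<and> perm_ins d v k0 \<tau> k > v}. chi (w ! k) (w ! k0))
      * (\<Prod>l\<in>{l. k0 < l \<and> l < Suc d \<and> v > perm_ins d v k0 \<tau> l}. chi (w ! k0) (w ! l))
      * (if iw ! v = w ! k0 then 1 else 0) * ?T \<tau>)
    = (if w ! k0 = iw ! v then C (take k0 w) (drop (Suc k0) w) * serre_form iw' ?w else 0)"
    by simp
qed

lemma serre_form_Cons:
  assumes lw: "length w = Suc (length u)" and w: "set w \<subseteq> {1..s}" and i: "i \<in> {1..s}"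
  shows "serre_form (i # u) w = rsum i w (\<lambda>a b. (-1) ^ (alpha_par i * wpar a) * xq powi (- 2 * cs i a)) (serre_form u)"
proof -
  have "serre_form (i # u) w = rsum ((i # u) ! 0) w (\<lambda>a b. (-1) ^ (alpha_par i * wpar a) * xq powi (- 2 * cs i a)) (serre_form u)"
  proof (rule serre_form_rec[OF _ lw])
    fix k0 \<tau> assume k0: "k0 \<le> length u" and wk: "w ! k0 = (i # u) ! 0"
    have "{k. k < k0 \<and> perm_ins (length u) 0 k0 \<tau> k > 0} = {..<length (take k0 w)}"
      using k0 lw by (auto simp: perm_ins_def skip_def)
    moreover have "(\<Prod>k<length (take k0 w). chi (w ! k) (w ! k0)) = (\<Prod>k<length (take k0 w). chi (take k0 w ! k) i)"
      using wk by (intro prod.cong) auto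
    moreover have "set (take k0 w) \<subseteq> {1..s}" using w set_take_subset[of k0 w] by blast
    ultimately show "(\<Prod>k\<in>{k. k < k0 \<and> perm_ins (length u) 0 k0 \<tau> k > 0}. chi (w ! k) (w ! k0))
      * (\<Prod>l\<in>{l. k0 < l \<and> l < Suc (length u) \<and> 0 > perm_ins (length u) 0 k0 \<tau> l}. chi (w ! k0) (w ! l))
      = (-1) ^ (alpha_par i * wpar (take k0 w)) * xq powi (- 2 * cs i (take k0 w))"
      using prod_chi[OF i, of "take k0 w"] by simp
  qed (auto simp: skip_def)
  then show ?thesis by simp
qed

lemma serre_form_snoc:
  assumes lw: "length w = Suc (length u)" and w: "set w \<subseteq> {1..s}" and i: "i \<in> {1..s}"
  shows "serre_form (u @ [i]) w = rsum i w (\<lambda>a b. (-1) ^ (alpha_par i * wpar b) * xq powi (- 2 * cs i b)) (serre_form u)"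
proof -
  let ?d = "length u"
  have "serre_form (u @ [i]) w = rsum ((u @ [i]) ! ?d) w (\<lambda>a b. (-1) ^ (alpha_par i * wpar b) * xq powi (- 2 * cs i b)) (serre_form u)"
  proof (rule serre_form_rec[OF _ lw])
    fix k0 \<tau> assume k0: "k0 \<le> ?d" and t: "\<tau> permutes {..<?d}" and wk: "w ! k0 = (u @ [i]) ! ?d"
    have s: "perm_ins ?d ?d k0 \<tau> permutes {..<Suc ?d}" using k0 t by (intro perm_ins_permutes) auto
    have lt: "perm_ins ?d ?d k0 \<tau> l < ?d" if "l \<noteq> k0" "l < Suc ?d" for l
    proof -
      have "perm_ins ?d ?d k0 \<tau> l \<noteq> perm_ins ?d ?d k0 \<tau> k0"
        using permutes_inj[OF s] that by (simp only: inj_eq) simp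
      moreover have "perm_ins ?d ?d k0 \<tau> l < Suc ?d"
        using permutes_in_image[OF s, of l] that by simp
      ultimately show ?thesis by simp
    qed
    have "\<not> perm_ins ?d ?d k0 \<tau> k > ?d" if "k < k0" for k
      using lt[of k] that k0 by simp
    then have 1: "{k. k < k0 \<and> perm_ins ?d ?d k0 \<tau> k > ?d} = {}" by blast
    have "(\<Prod>l\<in>{l. k0 < l \<and> l < Suc ?d \<and> ?d > perm_ins ?d ?d k0 \<tau> l}. chi (w ! k0) (w ! l))
      = (\<Prod>l\<in>{Suc k0..<Suc ?d}. chi (w ! k0) (w ! l))"
      using lt by (intro prod.cong) auto
    also have "\<dots> = (\<Prod>l<length (drop (Suc k0) w). chi i (drop (Suc k0) w ! l))"
      using wk lw k0
      by (intro prod.reindex_bij_witness[of _ "\<lambda>l. Suc k0 + l" "\<lambda>l. l - Suc k0"]) auto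
    finally show "(\<Prod>k\<in>{k. k < k0 \<and> perm_ins ?d ?d k0 \<tau> k > ?d}. chi (w ! k) (w ! k0))
      * (\<Prod>l\<in>{l. k0 < l \<and> l < Suc ?d \<and> ?d > perm_ins ?d ?d k0 \<tau> l}. chi (w ! k0) (w ! l))
      = (-1) ^ (alpha_par i * wpar (drop (Suc k0) w)) * xq powi (- 2 * cs i (drop (Suc k0) w))"
      using prod_chi'[OF i, of "drop (Suc k0) w"] w set_drop_subset[of "Suc k0" w] unfolding 1 by simp
  qed (auto simp: skip_def nth_append)
  then show ?thesis by simp
qed

text \<open>Deleting first letters one at a time shows that the form is block diagonal with respect
  to the multiset of letters. This is what makes \<open>Rad_twist\<close> work.\<close>

lemma serre_form_mset:
  assumes "length iw = length js" "set iw \<subseteq> {1..s}" "set js \<subseteq> {1..s}" "serre_form iw js \<noteq> 0"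
  shows "mset iw = mset js"
  using assms
proof (induction "iw" arbitrary: js)
  case (Cons i u)
  then have "length js = Suc (length u)" "i \<in> {1..s}" by auto
  from serre_form_Cons[OF this(1) Cons.prems(3) this(2)] Cons.prems(4)
  have "rsum i js (\<lambda>a b. (-1) ^ (alpha_par i * wpar a) * xq powi (- 2 * cs i a)) (serre_form u) \<noteq> 0" by simp
  then obtain a b where ab: "js = a @ i # b" "serre_form u (a @ b) \<noteq> 0"
    by (auto elim: rsum_neq_0)
  with Cons show ?case using Cons.IH[of "a @ b"] by auto
qed simp

lemma serre_form_Nil: "serre_form [] [] = 1"
proof -
  have "{(k :: nat, l). k < l \<and> l < length ([] :: nat list) \<and> \<sigma> k > \<sigma> l} = {}" for \<sigma> :: "nat \<Rightarrow> nat" by auto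
  moreover have "{\<sigma>. \<sigma> permutes {..<length ([] :: nat list)}} = {id}" by auto
  ultimately show ?thesis unfolding serre_form_def by simp
qed

end

section \<open>Vanishing of the Serre relations\<close>

text \<open>The argument applies to the raising operators and, with the roles exchanged, to the lowering
  operators: \<open>A\<close> kills the basis vector \<open>k0\<close>, from which \<open>B\<close> generates the module. If \<open>c\<close> is in the
  radical of the form, then so are its two derivatives, hence by induction on the degree the element
  given by \<open>c\<close> commutes with all \<open>B i\<close> up to sign, and therefore acts by zero.\<close>

locale osp_half = osp +
  fixes A B :: "nat \<Rightarrow> (nat, K) matr" and g :: "nat \<Rightarrow> K" and t :: int and k0 :: nat and ms :: "nat \<Rightarrow> nat"
  assumes suppA: "i \<in> {1..s} \<Longrightarrow> msupp ind (A i)"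
    and AB: "i \<in> {1..s} \<Longrightarrow> j \<in> {1..s} \<Longrightarrow> a \<in> ind \<Longrightarrow> c \<in> ind \<Longrightarrow>
      mmult ind (A i) (B j) a c = (-1) ^ (alpha_par i * alpha_par j) * mmult ind (B j) (A i) a c
        + (if i = j \<and> a = c then g i * (xq powi (2 * t * hh i a) - xq powi (- 2 * t * hh i a)) else 0)"
    and hA: "i \<in> {1..s} \<Longrightarrow> j \<in> {1..s} \<Longrightarrow> A i a c \<noteq> 0 \<Longrightarrow> hh j a = hh j c + t * cart j i"
    and tt: "t * t = 1"
    and A_k0: "i \<in> {1..s} \<Longrightarrow> A i a k0 = 0"
    and k0_ind: "k0 \<in> ind"
    and reach: "c \<in> ind \<Longrightarrow> c \<noteq> k0 \<Longrightarrow>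
      \<exists>i\<in>{1..s}. \<exists>c'\<in>ind. ms c' < ms c \<and> B i c c' \<noteq> 0 \<and> (\<forall>e. e \<noteq> c \<longrightarrow> B i e c' = 0)"
begin

primrec AW :: "nat list \<Rightarrow> (nat, K) matr" where
  "AW [] = mone ind"
| "AW (j # w) = mmult ind (A j) (AW w)"

lemma msupp_AW: "set w \<subseteq> {1..s} \<Longrightarrow> msupp ind (AW w)"
proof (induction w)
  case (Cons j w)
  then show ?case using suppA[of j] by simp
qed simp

lemma hAW: "set w \<subseteq> {1..s} \<Longrightarrow> i \<in> {1..s} \<Longrightarrow> AW w a c \<noteq> 0 \<Longrightarrow> hh i a = hh i c + t * cs i w"
proof (induction w arbitrary: a)
  case Nil
  then show ?case by (simp add: mone_def split: if_splits)
next
  case (Cons j w)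
  from Cons.prems(3) have "(\<Sum>k\<in>ind. A j a k * AW w k c) \<noteq> 0" by (simp add: mmult_def)
  then obtain k where "A j a k * AW w k c \<noteq> 0" by (meson sum.not_neutral_contains_not_neutral)
  then have "hh i a = hh i k + t * cart i j" "hh i k = hh i c + t * cs i w"
    using Cons hA[of j i a k] by auto
  then show ?case by (simp add: distrib_left)
qed

lemma AW_k0: "set w \<subseteq> {1..s} \<Longrightarrow> w \<noteq> [] \<Longrightarrow> AW w a k0 = 0"
proof (induction w arbitrary: a)
  case (Cons j w)
  show ?case
  proof (cases "w = []")
    case True
    then have "AW (j # w) = A j" using Cons.prems suppA[of j] by simp
    then show ?thesis using A_k0[of j] Cons.prems by simp
  next
    case False
    then show ?thesis using Cons by (simp add: mmult_def)
  qed
qed simp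

text \<open>When B i is pulled from the right through a word u i v, it first passes v, which gives
  the sign. The letter i then yields a difference of torus elements q^(t h_i) and q^(-t h_i): moving
  the former right through v costs the power in \<open>C1\<close>, moving the latter left through u
  the power in \<open>C2\<close>.\<close>

definition C1 :: "nat \<Rightarrow> nat list \<Rightarrow> nat list \<Rightarrow> K" where
  "C1 i u v = (-1) ^ (alpha_par i * wpar v) * xq powi (2 * cs i v)"

definition C2 :: "nat \<Rightarrow> nat list \<Rightarrow> nat list \<Rightarrow> K" where
  "C2 i u v = (-1) ^ (alpha_par i * wpar v) * xq powi (2 * cs i u)"

lemma C1_Cons: "C1 i (j # u) = C1 i u"
  by (intro ext) (simp add: C1_def)

lemma C2_Cons: "(\<lambda>u v. C2 i (j # u) v) = (\<lambda>u v. xq powi (2 * cart i j) * C2 i u v)"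
  by (intro ext) (simp add: C2_def distrib_left powi_merge[symmetric] mult_ac)

text \<open>The induction adds a letter on the left, which leaves \<open>C1\<close> unchanged and
  multiplies \<open>C2\<close> by a power of q. That power is what the torus factor at row a
  requires when it passes the new letter.\<close>

lemma AW_B_commute:
  assumes i: "i \<in> {1..s}" and c: "c \<in> ind"
  shows "set w \<subseteq> {1..s} \<Longrightarrow> a \<in> ind \<Longrightarrow> mmult ind (AW w) (B i) a c =
     (-1) ^ (alpha_par i * wpar w) * mmult ind (B i) (AW w) a c
     + g i * (rsum i w (C1 i) (\<lambda>u. AW u a c) * xq powi (2 * t * hh i c)
            - xq powi (- 2 * t * hh i a) * rsum i w (C2 i) (\<lambda>u. AW u a c))"
proof (induction w arbitrary: a)
  case Nil
  have "mmult ind (mone ind) (B i) a c = B i a c" "mmult ind (B i) (mone ind) a c = B i a c"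
    using Nil c by (simp_all add: mmult_def mone_def if_distrib[of "\<lambda>x. x * _"] if_distrib[of "\<lambda>x. _ * x"] cong: if_cong)
  then show ?case by simp
next
  case (Cons j w)
  then have w: "set w \<subseteq> {1..s}" and j: "j \<in> {1..s}" by auto
  let ?h = "hh i" and ?e = "(-1 :: K) ^ (alpha_par i * wpar w)"
  let ?R1 = "\<lambda>k. rsum i w (C1 i) (\<lambda>u. AW u k c)" and ?R2 = "\<lambda>k. rsum i w (C2 i) (\<lambda>u. AW u k c)"
  have r1: "(\<Sum>k\<in>ind. A j a k * ?R1 k) = rsum i w (C1 i) (\<lambda>u. AW (j # u) a c)"
    unfolding AW.simps mmult_def rsum_sum ..
  have r2: "(\<Sum>k\<in>ind. A j a k * (xq powi (- 2 * t * ?h k) * ?R2 k))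
     = xq powi (- 2 * t * ?h a) * rsum i w (\<lambda>u v. C2 i (j # u) v) (\<lambda>u. AW (j # u) a c)"
  proof -
    have "A j a k * (xq powi (- 2 * t * ?h k) * ?R2 k) = xq powi (- 2 * t * ?h a) * xq powi (2 * cart i j) * (A j a k * ?R2 k)" for k
    proof (cases "A j a k = 0")
      case False
      have "?h a = ?h k + t * cart i j" by (rule hA[OF j i False])
      then have "- 2 * t * ?h k = - 2 * t * ?h a + 2 * (t * t) * cart i j" by (simp add: algebra_simps)
      then have "xq powi (- 2 * t * ?h k) = xq powi (- 2 * t * ?h a) * xq powi (2 * cart i j)"
        unfolding tt powi_merge[OF xq_nz] by simp
      then show ?thesis by (simp only: mult_ac)
    qed simp
    then have "(\<Sum>k\<in>ind. A j a k * (xq powi (- 2 * t * ?h k) * ?R2 k))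
      = xq powi (- 2 * t * ?h a) * (xq powi (2 * cart i j) * (\<Sum>k\<in>ind. A j a k * ?R2 k))"
      by (simp only: sum_distrib_left mult.assoc)
    then show ?thesis unfolding C2_Cons rsum_scale AW.simps mmult_def rsum_sum .
  qed
  have ab: "mmult ind (A j) (mmult ind (B i) (AW w)) a c =
     (-1) ^ (alpha_par j * alpha_par i) * mmult ind (B i) (mmult ind (A j) (AW w)) a c
     + (if j = i then g i * (xq powi (2 * t * ?h a) - xq powi (- 2 * t * ?h a)) * AW w a c else 0)"
  proof -
    have "mmult ind (A j) (mmult ind (B i) (AW w)) a c = (\<Sum>k\<in>ind. mmult ind (A j) (B i) a k * AW w k c)"
      unfolding mmult_assoc[OF finite_ind(1), symmetric] by (simp add: mmult_def[of ind "mmult ind (A j) (B i)"])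
    also have "\<dots> = (\<Sum>k\<in>ind. (-1) ^ (alpha_par j * alpha_par i) * (mmult ind (B i) (A j) a k * AW w k c)
       + (if k = a then (if j = i then g i * (xq powi (2 * t * ?h a) - xq powi (- 2 * t * ?h a)) * AW w a c else 0) else 0))"
      using AB[OF j i Cons.prems(2)] by (intro sum.cong) (auto simp: distrib_right mult.assoc)
    also have "\<dots> = (-1) ^ (alpha_par j * alpha_par i) * mmult ind (mmult ind (B i) (A j)) (AW w) a c
       + (if j = i then g i * (xq powi (2 * t * ?h a) - xq powi (- 2 * t * ?h a)) * AW w a c else 0)"
      using Cons.prems(2) by (simp add: sum.distrib mmult_def[of ind "mmult ind (B i) (A j)"] sum_distrib_left)
    finally show ?thesis by (simp add: mmult_assoc)
  qed
  \<comment> \<open>The torus element is moved from the row of \<open>AW w\<close> to its column; as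
    t * t = 1, the cost has the same form for raising and lowering words.\<close>
  have diag: "xq powi (2 * t * ?h a) * AW w a c = xq powi (2 * cs i w) * AW w a c * xq powi (2 * t * ?h c)"
  proof (cases "AW w a c = 0")
    case False
    have "?h a = ?h c + t * cs i w" by (rule hAW[OF w i False])
    then have "2 * t * ?h a = 2 * (t * t) * cs i w + 2 * t * ?h c" by (simp add: algebra_simps)
    then have "xq powi (2 * t * ?h a) = xq powi (2 * cs i w) * xq powi (2 * t * ?h c)"
      unfolding tt powi_merge[OF xq_nz] by simp
    then show ?thesis by (simp only: mult_ac)
  qed simp
  have "mmult ind (AW (j # w)) (B i) a c = (\<Sum>k\<in>ind. A j a k * mmult ind (AW w) (B i) k c)"
    unfolding AW.simps mmult_assoc[OF finite_ind(1)] by (simp add: mmult_def[of ind "A j"])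
  also have "\<dots> = (\<Sum>k\<in>ind. ?e * (A j a k * mmult ind (B i) (AW w) k c)
      + g i * (xq powi (2 * t * ?h c) * (A j a k * ?R1 k)) - g i * (A j a k * (xq powi (- 2 * t * ?h k) * ?R2 k)))"
  proof (intro sum.cong refl)
    fix k assume k: "k \<in> ind"
    show "A j a k * mmult ind (AW w) (B i) k c = ?e * (A j a k * mmult ind (B i) (AW w) k c)
      + g i * (xq powi (2 * t * ?h c) * (A j a k * ?R1 k)) - g i * (A j a k * (xq powi (- 2 * t * ?h k) * ?R2 k))"
      unfolding Cons.IH[OF w k] by (simp only: algebra_simps)
  qed
  also have "\<dots> = ?e * mmult ind (A j) (mmult ind (B i) (AW w)) a c
      + g i * (xq powi (2 * t * ?h c) * rsum i w (C1 i) (\<lambda>u. AW (j # u) a c))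
      - g i * (xq powi (- 2 * t * ?h a) * rsum i w (\<lambda>u v. C2 i (j # u) v) (\<lambda>u. AW (j # u) a c))"
    unfolding sum_subtractf sum.distrib sum_distrib_left[symmetric] r1 r2 by (simp add: mmult_def[of ind "A j"])
  also have "\<dots> = ?e * (-1) ^ (alpha_par j * alpha_par i) * mmult ind (B i) (AW (j # w)) a c
      + g i * ((if j = i then ?e * (xq powi (2 * t * ?h a) * AW w a c) else 0)
               + xq powi (2 * t * ?h c) * rsum i w (C1 i) (\<lambda>u. AW (j # u) a c))
      - g i * ((if j = i then ?e * (xq powi (- 2 * t * ?h a) * AW w a c) else 0)
               + xq powi (- 2 * t * ?h a) * rsum i w (\<lambda>u v. C2 i (j # u) v) (\<lambda>u. AW (j # u) a c))"
    unfolding ab by (auto simp: algebra_simps)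
  also have "(if j = i then ?e * (xq powi (2 * t * ?h a) * AW w a c) else 0)
               + xq powi (2 * t * ?h c) * rsum i w (C1 i) (\<lambda>u. AW (j # u) a c)
     = rsum i (j # w) (C1 i) (\<lambda>u. AW u a c) * xq powi (2 * t * ?h c)"
    unfolding diag rsum_Cons C1_Cons by (simp add: C1_def[of i "[]"] algebra_simps)
  also have "(if j = i then ?e * (xq powi (- 2 * t * ?h a) * AW w a c) else 0)
               + xq powi (- 2 * t * ?h a) * rsum i w (\<lambda>u v. C2 i (j # u) v) (\<lambda>u. AW (j # u) a c)
     = xq powi (- 2 * t * ?h a) * rsum i (j # w) (C2 i) (\<lambda>u. AW u a c)"
    unfolding rsum_Cons by (simp add: C2_def[of i "[]"] algebra_simps)
  finally show ?case by (simp add: power_add distrib_left mult.commute[of "alpha_par j"] right_diff_distrib mult_ac)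
qed

end

context osp
begin

section \<open>The radical of the form and its derivatives\<close>

definition Rad :: "nat \<Rightarrow> (nat list \<Rightarrow> K) set" where
  "Rad d = {c. \<forall>iw\<in>index_words d. (\<Sum>js\<in>index_words d. c js * serre_form iw js) = 0}"

lemma finite_index_words [simp]: "finite (index_words d)"
  using finite_lists_length_eq[of "{1..s}" d] by (simp add: index_words_def conj_commute)

text \<open>By \<open>serre_form_mset\<close> a factor depending only on the letters of the word
  multiplies the equation for \<open>iw\<close> by the constant \<open>l iw\<close>.\<close>

lemma Rad_twist:
  assumes "c \<in> Rad d" and "\<And>js js'. js \<in> index_words d \<Longrightarrow> js' \<in> index_words d \<Longrightarrow> mset js = mset js' \<Longrightarrow> l js = l js'"
  shows "(\<lambda>js. l js * c js) \<in> Rad d"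
  unfolding Rad_def
proof (intro CollectI ballI)
  fix iw assume iw: "iw \<in> index_words d"
  have "(\<Sum>js\<in>index_words d. l js * c js * serre_form iw js) = (\<Sum>js\<in>index_words d. l iw * (c js * serre_form iw js))"
  proof (intro sum.cong refl)
    fix js assume js: "js \<in> index_words d"
    show "l js * c js * serre_form iw js = l iw * (c js * serre_form iw js)"
    proof (cases "serre_form iw js = 0")
      case False
      then have "mset iw = mset js"
        using iw js by (intro serre_form_mset) (auto simp: index_words_def)
      then have "l iw = l js" by (rule assms(2)[OF iw js])
      then show ?thesis by simp
    qed simp
  qed
  also have "\<dots> = 0" using assms(1) iw unfolding Rad_def by (simp flip: sum_distrib_left)
  finally show "(\<Sum>js\<in>index_words d. l js * c js * serre_form iw js) = 0" .
qed

lemma rsum_expand: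
  assumes "js \<in> index_words (Suc d)"
  shows "rsum i js D \<psi> = (\<Sum>v\<in>index_words d. \<psi> v * rsum i js D (\<lambda>u. of_bool (u = v)))"
proof -
  have "rsum i js D \<psi> = rsum i js D (\<lambda>u. \<Sum>v\<in>index_words d. \<psi> v * of_bool (u = v))"
  proof (rule rsum_cong)
    fix u v assume "js = u @ i # v"
    then have uv: "u @ v \<in> index_words d" using assms by (auto simp: index_words_def)
    have "(\<Sum>x\<in>index_words d. \<psi> x * of_bool (u @ v = x)) = (\<Sum>x\<in>index_words d. if x = u @ v then \<psi> x else 0)"
      by (intro sum.cong) (auto simp: of_bool_def)
    then show "D u v * \<psi> (u @ v) = D u v * (\<Sum>x\<in>index_words d. \<psi> x * of_bool (u @ v = x))"
      using uv by simp
  qed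
  then show ?thesis by (simp only: rsum_sum)
qed

text \<open>The family c' is the derivative of c. The recursion \<open>S\<close> says that the
  derivative is adjoint to adding a letter by \<open>f\<close>, so c' is again in the
  radical.\<close>

lemma Rad_derivative:
  assumes c: "c \<in> Rad (Suc d)"
    and f: "\<And>u. u \<in> index_words d \<Longrightarrow> f u \<in> index_words (Suc d)"
    and S: "\<And>u js. u \<in> index_words d \<Longrightarrow> js \<in> index_words (Suc d) \<Longrightarrow> serre_form (f u) js = rsum i js D (serre_form u)"
    and IH: "\<And>c. c \<in> Rad d \<Longrightarrow> (\<Sum>v\<in>index_words d. c v * \<psi> v) = 0"
  shows "(\<Sum>js\<in>index_words (Suc d). c js * rsum i js D \<psi>) = 0"
proof -
  let ?W = "index_words d" and ?W' = "index_words (Suc d)"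
  define c' where "c' v = (\<Sum>js\<in>?W'. c js * rsum i js D (\<lambda>u. of_bool (u = v)))" for v
  have expand: "(\<Sum>js\<in>?W'. c js * rsum i js D \<phi>) = (\<Sum>v\<in>?W. c' v * \<phi> v)" for \<phi>
  proof -
    have "(\<Sum>js\<in>?W'. c js * rsum i js D \<phi>) = (\<Sum>js\<in>?W'. \<Sum>v\<in>?W. c js * rsum i js D (\<lambda>u. of_bool (u = v)) * \<phi> v)"
      by (intro sum.cong refl) (simp add: rsum_expand[of _ d i D \<phi>] sum_distrib_left mult_ac)
    also have "\<dots> = (\<Sum>v\<in>?W. \<Sum>js\<in>?W'. c js * rsum i js D (\<lambda>u. of_bool (u = v)) * \<phi> v)"
      by (rule sum.swap)
    finally show ?thesis by (simp add: c'_def sum_distrib_right)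
  qed
  have "c' \<in> Rad d"
    unfolding Rad_def
  proof (intro CollectI ballI)
    fix u assume u: "u \<in> ?W"
    have "(\<Sum>v\<in>?W. c' v * serre_form u v) = (\<Sum>js\<in>?W'. c js * serre_form (f u) js)"
      unfolding expand[symmetric] using S[OF u] by simp
    also have "\<dots> = 0" using c f[OF u] by (simp add: Rad_def)
    finally show "(\<Sum>v\<in>?W. c' v * serre_form u v) = 0" .
  qed
  then show ?thesis unfolding expand by (rule IH)
qed

lemma wpar_mset: "mset js = mset js' \<Longrightarrow> wpar js = wpar js'"
  unfolding wpar_def by (metis mset_map sum_mset_sum_list)

lemma cs_mset: "mset js = mset js' \<Longrightarrow> cs i js = cs i js'"
  unfolding cs_def by (metis mset_map sum_mset_sum_list)

end

context osp_half
begin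

theorem serre_vanish:
  "c \<in> Rad d \<Longrightarrow> (\<Sum>js\<in>index_words d. c js * AW js a b) = 0"
proof (induction d arbitrary: c a b)
  case 0
  have "index_words 0 = {[]}" by (auto simp: index_words_def)
  then show ?case using 0 by (simp add: Rad_def serre_form_Nil)
next
  case (Suc d)
  let ?W = "index_words (Suc d)"
  have W: "set js \<subseteq> {1..s}" "length js = Suc d" "js \<noteq> []" if "js \<in> ?W" for js
    using that by (auto simp: index_words_def)
  let ?E = "\<lambda>c a b. \<Sum>js\<in>?W. c js * AW js a b"
  have der1: "(\<Sum>js\<in>?W. c js * rsum i js (C1 i) (\<lambda>u. AW u a b)) = 0" if c: "c \<in> Rad (Suc d)" and i: "i \<in> {1..s}" for c i a b
  proof -
    \<comment> \<open>The recursion of the form weighs the prefix u with inverse powers,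
      \<open>C1\<close> weighs the suffix v. As u and v together are the word without i, the
      quotient depends on the letters only and is absorbed by \<open>Rad_twist\<close>.\<close>
    let ?D = "\<lambda>u v. (-1) ^ (alpha_par i * wpar u) * xq powi (- 2 * cs i u) :: K"
    let ?l = "\<lambda>js. (-1) ^ (alpha_par i * (wpar js + alpha_par i)) * xq powi (2 * (cs i js - cart i i)) :: K"
    have r: "rsum i js (C1 i) (\<lambda>u. AW u a b) = ?l js * rsum i js ?D (\<lambda>u. AW u a b)" for js
      unfolding rsum_scale[symmetric]
    proof (rule rsum_cong)
      fix u v assume js: "js = u @ i # v"
      have "alpha_par i * (wpar js + alpha_par i) + alpha_par i * wpar u = alpha_par i * wpar v + 2 * (alpha_par i * wpar u + alpha_par i * alpha_par i)"
        unfolding js by (simp add: algebra_simps)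
      then have 1: "(-1) ^ (alpha_par i * (wpar js + alpha_par i)) * (-1) ^ (alpha_par i * wpar u) = ((-1) ^ (alpha_par i * wpar v) :: K)"
        unfolding power_add[symmetric] by (simp only:) (simp add: power_add)
      have 2: "xq powi (2 * (cs i js - cart i i)) * xq powi (- 2 * cs i u) = xq powi (2 * cs i v)"
        unfolding powi_merge[OF xq_nz] js by (simp add: algebra_simps)
      show "C1 i u v * AW (u @ v) a b = ?l js * ?D u v * AW (u @ v) a b"
        unfolding C1_def 1[symmetric] 2[symmetric] by (simp only: mult_ac)
    qed
    have c': "(\<lambda>js. ?l js * c js) \<in> Rad (Suc d)"
    proof (rule Rad_twist[OF c])
      fix js js' :: "nat list" assume m: "mset js = mset js'"
      show "?l js = ?l js'" by (simp only: wpar_mset[OF m] cs_mset[OF m])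
    qed
    have "(\<Sum>js\<in>?W. (?l js * c js) * rsum i js ?D (\<lambda>u. AW u a b)) = 0"
    proof (rule Rad_derivative[OF c', where f = "\<lambda>u. i # u"])
      fix u assume u: "u \<in> index_words d"
      then show "i # u \<in> ?W" using i by (auto simp: index_words_def)
      fix js assume "js \<in> ?W"
      then show "serre_form (i # u) js = rsum i js ?D (serre_form u)"
        using u i by (intro serre_form_Cons) (auto simp: index_words_def)
    qed (rule Suc.IH)
    then show ?thesis unfolding r by (simp add: mult_ac)
  qed
  have der2: "(\<Sum>js\<in>?W. c js * rsum i js (C2 i) (\<lambda>u. AW u a b)) = 0" if c: "c \<in> Rad (Suc d)" and i: "i \<in> {1..s}" for c i a b
  proof -
    \<comment> \<open>Now the recursion at the last letter is used. Its sign is already that of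
      \<open>C2\<close>, so only the power of q is twisted.\<close>
    let ?D = "\<lambda>u v. (-1) ^ (alpha_par i * wpar v) * xq powi (- 2 * cs i v) :: K"
    let ?l = "\<lambda>js. xq powi (2 * (cs i js - cart i i)) :: K"
    have r: "rsum i js (C2 i) (\<lambda>u. AW u a b) = ?l js * rsum i js ?D (\<lambda>u. AW u a b)" for js
      unfolding rsum_scale[symmetric]
    proof (rule rsum_cong)
      fix u v assume js: "js = u @ i # v"
      have 2: "xq powi (2 * (cs i js - cart i i)) * xq powi (- 2 * cs i v) = xq powi (2 * cs i u)"
        unfolding powi_merge[OF xq_nz] js by (simp add: algebra_simps)
      show "C2 i u v * AW (u @ v) a b = ?l js * ?D u v * AW (u @ v) a b"
        unfolding C2_def 2[symmetric] by (simp only: mult_ac)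
    qed
    have c': "(\<lambda>js. ?l js * c js) \<in> Rad (Suc d)"
    proof (rule Rad_twist[OF c])
      fix js js' :: "nat list" assume m: "mset js = mset js'"
      show "?l js = ?l js'" by (simp only: wpar_mset[OF m] cs_mset[OF m])
    qed
    have "(\<Sum>js\<in>?W. (?l js * c js) * rsum i js ?D (\<lambda>u. AW u a b)) = 0"
    proof (rule Rad_derivative[OF c', where f = "\<lambda>u. u @ [i]"])
      fix u assume u: "u \<in> index_words d"
      then show "u @ [i] \<in> ?W" using i by (auto simp: index_words_def)
      fix js assume "js \<in> ?W"
      then show "serre_form (u @ [i]) js = rsum i js ?D (serre_form u)"
        using u i by (intro serre_form_snoc) (auto simp: index_words_def)
    qed (rule Suc.IH)
    then show ?thesis unfolding r by (simp add: mult_ac)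
  qed
  \<comment> \<open>Words of both parities may occur in c, so the sign stays inside the
    coefficients; the family with signs is in the radical as well.\<close>
  have comm: "(\<Sum>k\<in>ind. ?E c a k * B i k b) = (\<Sum>k\<in>ind. B i a k * ?E (\<lambda>js. (-1) ^ (alpha_par i * wpar js) * c js) k b)"
    if c: "c \<in> Rad (Suc d)" and i: "i \<in> {1..s}" and a: "a \<in> ind" and b: "b \<in> ind" for c i a b
  proof -
    have "(\<Sum>k\<in>ind. ?E c a k * B i k b) = (\<Sum>js\<in>?W. c js * mmult ind (AW js) (B i) a b)"
      unfolding sum_distrib_right mmult_def by (subst sum.swap) (simp add: sum_distrib_left mult.assoc)
    also have "\<dots> = (\<Sum>js\<in>?W. c js * ((-1) ^ (alpha_par i * wpar js) * mmult ind (B i) (AW js) a b)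
        + g i * xq powi (2 * t * hh i b) * (c js * rsum i js (C1 i) (\<lambda>u. AW u a b))
        - g i * xq powi (- 2 * t * hh i a) * (c js * rsum i js (C2 i) (\<lambda>u. AW u a b)))"
      by (intro sum.cong refl) (simp add: AW_B_commute[OF i b W(1) a] algebra_simps)
    also have "\<dots> = (\<Sum>js\<in>?W. c js * ((-1) ^ (alpha_par i * wpar js) * mmult ind (B i) (AW js) a b))"
      unfolding sum_subtractf sum.distrib sum_distrib_left[symmetric] der1[OF c i] der2[OF c i] by simp
    also have "\<dots> = (\<Sum>k\<in>ind. B i a k * ?E (\<lambda>js. (-1) ^ (alpha_par i * wpar js) * c js) k b)"
      unfolding sum_distrib_left mmult_def by (subst sum.swap) (simp add: sum_distrib_left mult_ac)
    finally show ?thesis .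
  qed
  have col: "\<forall>c\<in>Rad (Suc d). \<forall>a. ?E c a b = 0" if "b \<in> ind" for b
    using that
  proof (induction "ms b" arbitrary: b rule: less_induct)
    case less
    show ?case
    proof (cases "b = k0")
      case True
      then show ?thesis using AW_k0 W by (auto intro!: sum.neutral)
    next
      case False
      from reach[OF less.prems False] obtain i b' where i: "i \<in> {1..s}" and b': "b' \<in> ind" "ms b' < ms b"
        and B: "B i b b' \<noteq> 0" "\<And>e. e \<noteq> b \<Longrightarrow> B i e b' = 0" by blast
      show ?thesis
      proof (intro ballI allI)
        fix c a assume c: "c \<in> Rad (Suc d)"
        show "?E c a b = 0"
        proof (cases "a \<in> ind")
          case True
          have c': "(\<lambda>js. (-1) ^ (alpha_par i * wpar js) * c js) \<in> Rad (Suc d)"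
          proof (rule Rad_twist[OF c])
            fix js js' :: "nat list" assume m: "mset js = mset js'"
            show "(-1) ^ (alpha_par i * wpar js) = ((-1) ^ (alpha_par i * wpar js') :: K)" by (simp only: wpar_mset[OF m])
          qed
          have "(\<Sum>k\<in>ind. ?E c a k * B i k b') = 0"
            unfolding comm[OF c i True b'(1)] using less.hyps[OF b'(2,1)] c' by simp
          moreover have "(\<Sum>k\<in>ind. ?E c a k * B i k b') = (\<Sum>k\<in>ind. of_bool (k = b) * (?E c a k * B i k b'))"
            using B(2) by (intro sum.cong) auto
          ultimately have "?E c a b * B i b b' = 0"
            using less.prems by (simp only: sum_ind_delta)
          then show ?thesis using B(1) by simp
        next
          case False
          then show ?thesis using msuppD[OF msupp_AW] W by (auto intro!: sum.neutral)
        qed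
      qed
    qed
  qed
  show ?case
  proof (cases "b \<in> ind")
    case True
    then show ?thesis using col Suc.prems by blast
  next
    case False
    then show ?thesis using msuppD[OF msupp_AW] W by (auto intro!: sum.neutral)
  qed
qed

end

context osp
begin

section \<open>The raising and the lowering instance\<close>

lemma alpha_par_01: "alpha_par i = 0 \<or> alpha_par i = 1"
  by (auto simp: alpha_par_def)

lemma alpha_par_sq [simp]: "alpha_par i * alpha_par i = alpha_par i"
  using alpha_par_01[of i] by auto

lemma Ef_last: "i \<in> {1..s} \<Longrightarrow> Ef i a 1 = 0"
proof (rule ccontr)
  assume i: "i \<in> {1..s}" and "Ef i a 1 \<noteq> 0"
  then consider "rr i = 1" | "prime (pp i) = 1" by (auto elim: Ef_cases)
  then show False
  proof cases
    case 1
    then show ?thesis using i s_ge_1 by (auto simp: rr_def split: if_splits)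
  next
    case 2
    then show ?thesis using i N_cases by (auto simp: pp_def prime_def split: if_splits)
  qed
qed

lemma Ff_last: "i \<in> {1..s} \<Longrightarrow> Ff i a N = 0"
proof (rule ccontr)
  assume i: "i \<in> {1..s}" and "Ff i a N \<noteq> 0"
  then consider "pp i = N" | "prime (rr i) = N" by (auto elim: Ff_cases)
  then show False
  proof cases
    case 1
    then show ?thesis using i N_cases s_ge_1 by (auto simp: pp_def split: if_splits)
  next
    case 2
    then show ?thesis using i N_cases s_ge_1 by (auto simp: rr_def prime_def split: if_splits)
  qed
qed

lemma osp_half_E: "osp_half m n par th Ef Ff (\<lambda>i. 1 / qdiff) 1 1 (\<lambda>c. c)"
proof unfold_locales
  show "1 \<in> ind" using dim_gt_2 by (simp add: ind_def N_def)
  fix i j a c assume ij: "i \<in> {1..s}" "j \<in> {1..s}" "a \<in> ind" "c \<in> ind"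
  show "mmult ind (Ef i) (Ff j) a c = (-1) ^ (alpha_par i * alpha_par j) * mmult ind (Ff j) (Ef i) a c
        + (if i = j \<and> a = c then 1 / qdiff * (xq powi (2 * 1 * hh i a) - xq powi (- 2 * 1 * hh i a)) else 0)"
    using Ef_Ff_neq[OF ij(1,2)] Ef_Ff_eq[OF ij(1,3)] by (cases "i = j") auto
qed (use msupp_Ef hh_Ef Ef_last Ff_reach in auto)

text \<open>The commutation relation is solved for f_i e_i, which produces the factor
  (-1)^(alpha_par i); the reversed difference of torus elements is accounted for by t = -1. V is
  generated from v_N, so the measure decreases with the index.\<close>

lemma osp_half_F: "osp_half m n par th Ff Ef (\<lambda>i. (-1) ^ alpha_par i / qdiff) (-1) N (\<lambda>c. N - c)"
proof unfold_locales
  show "N \<in> ind" using dim_gt_2 by (simp add: ind_def N_def)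
  fix i j a c assume ij: "i \<in> {1..s}" "j \<in> {1..s}" "a \<in> ind" "c \<in> ind"
  show "mmult ind (Ff i) (Ef j) a c = (-1) ^ (alpha_par i * alpha_par j) * mmult ind (Ef j) (Ff i) a c
        + (if i = j \<and> a = c then (-1) ^ alpha_par i / qdiff * (xq powi (2 * -1 * hh i a) - xq powi (- 2 * -1 * hh i a)) else 0)"
  proof (cases "i = j")
    case True
    have "mmult ind (Ef i) (Ff i) a c = (-1) ^ alpha_par i * mmult ind (Ff i) (Ef i) a c
     + of_bool (a = c) * ((xq powi (2 * hh i a) - xq powi (- 2 * hh i a)) / qdiff)"
      by (rule Ef_Ff_eq[OF ij(1,3)])
    then show ?thesis
      using True alpha_par_01[of i] by (auto simp: diff_divide_distrib)
  next
    case False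
    then show ?thesis
      using Ef_Ff_neq[OF ij(2,1) False[symmetric], of a c]
      by (simp add: mult.commute[of "alpha_par j"])
  qed
next
  fix c assume c: "c \<in> ind" "c \<noteq> N"
  show "\<exists>i\<in>{1..s}. \<exists>c'\<in>ind. N - c' < N - c \<and> Ef i c c' \<noteq> 0 \<and> (\<forall>e. e \<noteq> c \<longrightarrow> Ef i e c' = 0)"
  proof -
    from Ef_reach[OF c] obtain i c' where "i \<in> {1..s}" "c' \<in> ind" "c < c'" "Ef i c c' \<noteq> 0" "\<forall>e. e \<noteq> c \<longrightarrow> Ef i e c' = 0"
      by blast
    moreover from this have "N - c' < N - c" by (auto simp: ind_def)
    ultimately show ?thesis by blast
  qed
qed (use msupp_Ff hh_Ff Ff_last in auto)

end

section \<open>The representation of the quotient algebra\<close>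

context osp
begin

definition gens :: "gen set" where "gens = gens_e \<union> gens_f \<union> gens_k"

lemma gens_cases:
  assumes "x \<in> gens"
  obtains i where "i \<in> {1..s}" "x = Ge i" | i where "i \<in> {1..s}" "x = Gf i"
    | i where "i \<in> {1..s}" "x = Gk i" | i where "i \<in> {1..s}" "x = Gki i"
  using assms by (auto simp: gens_def gens_e_def gens_f_def gens_k_def)

lemma gens_simps [simp]: "Ge i \<in> gens \<longleftrightarrow> i \<in> {1..s}" "Gf i \<in> gens \<longleftrightarrow> i \<in> {1..s}"
  "Gk i \<in> gens \<longleftrightarrow> i \<in> {1..s}" "Gki i \<in> gens \<longleftrightarrow> i \<in> {1..s}"
  by (auto simp: gens_def gens_e_def gens_f_def gens_k_def)

lemma msupp_rep_gen: "x \<in> gens \<Longrightarrow> msupp ind (rep_gen x)"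
  by (erule gens_cases) (simp_all only: rep_Ge rep_Gf rep_Gk msupp_Ef msupp_Ff msupp_Kd)

lemma msupp_rep_word: "set w \<subseteq> gens \<Longrightarrow> msupp ind (rep_word w)"
  by (induction w) (auto simp: msupp_rep_gen)

lemma rep_word_append:
  "set u \<subseteq> gens \<Longrightarrow> set v \<subseteq> gens \<Longrightarrow> rep_word (u @ v) = mmult ind (rep_word u) (rep_word v)"
  by (induction u) (auto simp: msupp_rep_word mmult_assoc)

lemma rep_free_entry: "rep_free a i j = lx (\<lambda>c. c) (\<lambda>w. rep_word w i j) a"
  by (simp add: rep_free_def sum_matr_apply lx_def)

lemma rep_free_add: "rep_free (a + b) = rep_free a + rep_free b"
  by (intro ext) (simp add: rep_free_entry lx_add[OF scalar_hom_id])

lemma rep_free_diff: "rep_free (a - b) = rep_free a - rep_free b"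
  by (intro ext) (simp add: rep_free_entry lx_diff[OF scalar_hom_id])

lemma rep_free_0 [simp]: "rep_free 0 = 0"
  by (intro ext) (simp add: rep_free_entry)

lemma rep_free_single: "rep_free (Poly_Mapping.single w c) = c *\<^sub>m rep_word w"
  by (intro ext) (simp add: rep_free_entry lx_single[OF scalar_hom_id])

lemma free_onD: "a \<in> free_on S \<Longrightarrow> w \<in> Poly_Mapping.keys a \<Longrightarrow> set w \<subseteq> S"
  by (auto simp: free_on_def)

lemma rep_free_mult:
  assumes "a \<in> free_on gens" "b \<in> free_on gens"
  shows "rep_free (a * b) = mmult ind (rep_free a) (rep_free b)"
proof (intro ext)
  fix i j
  have "rep_free (a * b) i j = lx (\<lambda>c. c) (\<lambda>u. lx (\<lambda>c. c) (\<lambda>v. rep_word (u @ v) i j) b) a"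
    unfolding rep_free_entry by (rule lx_mult[OF scalar_hom_id])
  also have "\<dots> = lx (\<lambda>c. c) (\<lambda>u. lx (\<lambda>c. c) (\<lambda>v. \<Sum>k\<in>ind. rep_word u i k * rep_word v k j) b) a"
    using assms by (intro lx_cong) (simp add: rep_word_append[OF free_onD free_onD] mmult_def)
  also have "\<dots> = (\<Sum>k\<in>ind. lx (\<lambda>c. c) (\<lambda>u. lx (\<lambda>c. c) (\<lambda>v. rep_word v k j) b * rep_word u i k) a)"
    by (simp add: lx_sum_fun lx_scale_fun mult.commute)
  also have "\<dots> = mmult ind (rep_free a) (rep_free b) i j"
    unfolding lx_scale_fun mmult_def rep_free_entry by (simp add: mult.commute)
  finally show "rep_free (a * b) i j = mmult ind (rep_free a) (rep_free b) i j" .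
qed

lemma msupp_rep_free: "a \<in> free_on gens \<Longrightarrow> msupp ind (rep_free a)"
  unfolding rep_free_def by (intro msupp_sum msupp_smult msupp_rep_word) (auto simp: free_on_def)

lemma free_on_0 [simp]: "0 \<in> free_on S"
  by (simp add: free_on_def)

lemma free_on_single [simp]: "set w \<subseteq> S \<Longrightarrow> Poly_Mapping.single w c \<in> free_on S"
  by (simp add: free_on_def in_lists_conv_set subset_iff)

lemma one_eq_single: "(1 :: free) = Poly_Mapping.single [] 1"
  by (simp add: zero_list_def flip: single_one)

lemma free_on_1 [simp]: "1 \<in> free_on S"
  unfolding one_eq_single by simp

lemma free_on_const [simp]: "const c \<in> free_on S"
  by (simp add: const_def)

lemma free_on_gen1 [simp]: "x \<in> S \<Longrightarrow> gen1 x \<in> free_on S"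
  by (simp add: gen1_def)

lemma free_on_add [simp]: "a \<in> free_on S \<Longrightarrow> b \<in> free_on S \<Longrightarrow> a + b \<in> free_on S"
  using Poly_Mapping.keys_add[of a b] by (auto simp: free_on_def)

lemma free_on_uminus [simp]: "a \<in> free_on S \<Longrightarrow> - a \<in> free_on S"
  by (simp add: free_on_def)

lemma free_on_diff [simp]: "a \<in> free_on S \<Longrightarrow> b \<in> free_on S \<Longrightarrow> a - b \<in> free_on S"
  using free_on_add[of a S "- b"] by simp

lemma free_on_mult [simp]: "a \<in> free_on S \<Longrightarrow> b \<in> free_on S \<Longrightarrow> a * b \<in> free_on S"
  using keys_mult[of a b] unfolding free_on_def plus_list_def by fastforce

lemma free_on_sum [simp]: "(\<And>x. x \<in> A \<Longrightarrow> f x \<in> free_on S) \<Longrightarrow> sum f A \<in> free_on S"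
  by (induction A rule: infinite_finite_induct) auto

lemma free_on_mono: "S \<subseteq> T \<Longrightarrow> a \<in> free_on S \<Longrightarrow> a \<in> free_on T"
  by (auto simp: free_on_def subset_iff in_lists_conv_set)

lemma free_ring_simps [simp]: "carrier free_ring = free_on gens" "mult free_ring = (*)"
  "one free_ring = 1" "zero free_ring = 0" "add free_ring = (+)"
  by (simp_all add: free_ring_def gens_def)

lemma ring_free_ring: "ring free_ring"
proof (intro ringI abelian_groupI monoidI)
  fix x assume "x \<in> carrier free_ring"
  then have "- x \<in> carrier free_ring" "- x \<oplus>\<^bsub>free_ring\<^esub> x = \<zero>\<^bsub>free_ring\<^esub>" by simp_all
  then show "\<exists>y\<in>carrier free_ring. y \<oplus>\<^bsub>free_ring\<^esub> x = \<zero>\<^bsub>free_ring\<^esub>" by blast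
qed (simp_all add: algebra_simps)

lemma rep_free_gen1: "x \<in> gens \<Longrightarrow> rep_free (gen1 x) = rep_gen x"
  by (simp add: gen1_def rep_free_single msupp_rep_gen) (simp add: msmult_def)

lemma rep_free_const: "rep_free (const c) = c *\<^sub>m mone ind"
  by (simp add: const_def rep_free_single)

lemma rep_free_const_mult:
  assumes "a \<in> free_on gens"
  shows "rep_free (const c * a) = c *\<^sub>m rep_free a"
  using assms by (simp add: rep_free_mult rep_free_const mmult_smult_left msupp_rep_free)

lemma rep_free_1: "rep_free 1 = mone ind"
  by (simp add: one_eq_single rep_free_single) (simp add: msmult_def)

lemma gens_k_sub: "gens_k \<subseteq> gens" "gens_e \<subseteq> gens" "gens_f \<subseteq> gens"
  by (auto simp: gens_def)

lemma serre_relations_sub: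
  assumes "\<And>i. i \<in> {1..s} \<Longrightarrow> G i \<in> gens" "r \<in> serre_relations G"
  shows "r \<in> free_on gens"
proof -
  from assms(2) obtain d c where r: "r = (\<Sum>js\<in>index_words d. Poly_Mapping.single (map G js) (c js))"
    unfolding serre_relations_def by blast
  have "set (map G js) \<subseteq> gens" if "js \<in> index_words d" for js
    using that assms(1) unfolding index_words_def set_map by blast
  then show ?thesis unfolding r by (intro free_on_sum free_on_single)
qed

lemma relations_sub: "relations \<subseteq> carrier free_ring"
proof
  fix r assume r: "r \<in> relations"
  have S: "r \<in> serre_relations Ge \<Longrightarrow> r \<in> free_on gens" "r \<in> serre_relations Gf \<Longrightarrow> r \<in> free_on gens"
    using serre_relations_sub[of Ge r] serre_relations_sub[of Gf r] by auto
  have K: "x \<in> gens_k \<Longrightarrow> gen1 x \<in> free_on gens" for x using gens_k_sub by auto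
  from r show "r \<in> carrier free_ring"
    unfolding relations_def by (elim UnE) (auto intro: S K intro!: free_on_diff free_on_mult free_on_add)
qed

section \<open>The quotient ring and its action\<close>

sublocale F: ring free_ring by (rule ring_free_ring)

sublocale I: ideal rel_ideal free_ring
  unfolding rel_ideal_def by (rule F.genideal_ideal[OF relations_sub])

lemma cls_hom: "cls \<in> ring_hom free_ring Uq"
  unfolding cls_def Uq_def by (rule I.rcos_ring_hom)

lemma ring_Uq: "ring Uq"
  unfolding Uq_def by (rule I.quotient_is_ring)

lemma cls_add: "a \<in> free_on gens \<Longrightarrow> b \<in> free_on gens \<Longrightarrow> cls a \<oplus>\<^bsub>Uq\<^esub> cls b = cls (a + b)"
  using ring_hom_add[OF cls_hom, of a b] by simp

lemma cls_mult: "a \<in> free_on gens \<Longrightarrow> b \<in> free_on gens \<Longrightarrow> cls a \<otimes>\<^bsub>Uq\<^esub> cls b = cls (a * b)"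
  using ring_hom_mult[OF cls_hom, of a b] by simp

lemma cls_one: "cls 1 = \<one>\<^bsub>Uq\<^esub>"
  using ring_hom_one[OF cls_hom] by simp

lemma cls_zero: "cls 0 = \<zero>\<^bsub>Uq\<^esub>"
  using ring_hom_zero[OF cls_hom ring_free_ring ring_Uq] by simp

lemma cls_eq_cls:
  assumes "a \<in> free_on gens" "b \<in> free_on gens" "a - b \<in> relations"
  shows "cls a = cls b"
proof -
  have r: "a - b \<in> rel_ideal"
    using assms(3) F.genideal_self[OF relations_sub] by (auto simp: rel_ideal_def)
  have "cls a = cls ((a - b) + b)" by simp
  also have "\<dots> = cls (a - b) \<oplus>\<^bsub>Uq\<^esub> cls b"
    using assms by (intro cls_add[symmetric]) auto
  also have "cls (a - b) = cls 0"
    unfolding cls_def using I.a_rcos_const[OF r] I.a_rcos_const[OF I.zero_closed] by simp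
  also have "cls 0 \<oplus>\<^bsub>Uq\<^esub> cls b = cls b" using assms cls_add[of 0 b] by simp
  finally show ?thesis .
qed

lemma rep_word_Ge: "set js \<subseteq> {1..s} \<Longrightarrow> rep_word (map Ge js) = osp_half.AW m n Ef js"
proof -
  interpret E: osp_half m n par th Ef Ff "\<lambda>i. 1 / qdiff" 1 1 "\<lambda>c. c" by (rule osp_half_E)
  assume "set js \<subseteq> {1..s}"
  then show ?thesis by (induction js) (simp_all add: rep_Ge del: rep_gen.simps)
qed

lemma rep_word_Gf: "set js \<subseteq> {1..s} \<Longrightarrow> rep_word (map Gf js) = osp_half.AW m n Ff js"
proof -
  interpret E: osp_half m n par th Ff Ef "\<lambda>i. (-1) ^ alpha_par i / qdiff" "-1" N "\<lambda>c. N - c" by (rule osp_half_F)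
  assume "set js \<subseteq> {1..s}"
  then show ?thesis by (induction js) (simp_all add: rep_Gf del: rep_gen.simps)
qed

lemma rep_serre:
  assumes r: "r \<in> serre_relations G"
    and van: "\<And>c d a b. c \<in> Rad d \<Longrightarrow> (\<Sum>js\<in>index_words d. c js * rep_word (map G js) a b) = 0"
  shows "rep_free r = 0"
proof -
  from r obtain d c where r: "r = (\<Sum>js\<in>index_words d. Poly_Mapping.single (map G js) (c js))"
    and c: "c \<in> Rad d"
    unfolding serre_relations_def Rad_def by blast
  show ?thesis
  proof (intro ext)
    fix a b
    show "rep_free r a b = 0 a b"
      unfolding r rep_free_entry lx_sum[OF scalar_hom_id] lx_single[OF scalar_hom_id] using van[OF c] by simp
  qed
qed

lemma rep_gens_k: "x \<in> gens_k \<Longrightarrow> \<exists>i k. rep_gen x = Kd i k"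
proof -
  assume "x \<in> gens_k"
  then obtain i where "i \<in> {1..s}" "x = Gk i \<or> x = Gki i" by (auto simp: gens_k_def)
  then show ?thesis using rep_Gk[of i] by blast
qed

lemma Kd_2_diff: "a \<in> ind \<Longrightarrow> (Kd i 2 - Kd i (-2)) a c = of_bool (a = c) * (xq powi (2 * hh i a) - xq powi (- 2 * hh i a))"
  by (simp add: Kd_def)

lemma rep_relations: "r \<in> relations \<Longrightarrow> rep_free r = 0"
proof -
  assume "r \<in> relations"
  then consider
      (kk) x y where "x \<in> gens_k" "y \<in> gens_k" "r = gen1 x * gen1 y - gen1 y * gen1 x"
    | (inv1) i where "i \<in> {1..s}" "r = gen1 (Gk i) * gen1 (Gki i) - 1"
    | (inv2) i where "i \<in> {1..s}" "r = gen1 (Gki i) * gen1 (Gk i) - 1"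
    | (ke) i j where "i \<in> {1..s}" "j \<in> {1..s}"
        "r = gen1 (Gk i) * gen1 (Ge j) * gen1 (Gki i) - const (qpow (cartan i j / 2)) * gen1 (Ge j)"
    | (kf) i j where "i \<in> {1..s}" "j \<in> {1..s}"
        "r = gen1 (Gk i) * gen1 (Gf j) * gen1 (Gki i) - const (qpow (- cartan i j / 2)) * gen1 (Gf j)"
    | (ef) i j where "i \<in> {1..s}" "j \<in> {1..s}"
        "r = gen1 (Ge i) * gen1 (Gf j)
        - const ((-1) ^ (alpha_par i * alpha_par j)) * gen1 (Gf j) * gen1 (Ge i)
        - (if i = j
           then const (1 / (qpow 1 - qpow (-1)))
                  * (gen1 (Gk i) * gen1 (Gk i) - gen1 (Gki i) * gen1 (Gki i))
           else 0)"
    | (E) "r \<in> serre_relations Ge" | (F) "r \<in> serre_relations Gf"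
    unfolding relations_def by blast
  then show ?thesis
  proof cases
    case kk
    then obtain i k j l where "rep_gen x = Kd i k" "rep_gen y = Kd j l" using rep_gens_k by blast
    with kk gens_k_sub show ?thesis
      by (simp add: rep_free_diff rep_free_mult rep_free_gen1 subset_iff Kd_commute[of i k])
  next
    case inv1
    then show ?thesis
      by (simp add: rep_free_diff rep_free_mult rep_free_gen1 rep_free_1 rep_Gk Kd_mult Kd_0 del: rep_gen.simps)
  next
    case inv2
    then show ?thesis
      by (simp add: rep_free_diff rep_free_mult rep_free_gen1 rep_free_1 rep_Gk Kd_mult Kd_0 del: rep_gen.simps)
  next
    case ke
    have q: "qpow (cartan i j / 2) = xq powi cart i j"
      by (rule qpow_eq) (use ke in \<open>simp add: cartan_cart\<close>)
    have "mmult ind (mmult ind (Kd i 1) (Ef j)) (Kd i (-1)) = xq powi cart i j *\<^sub>m Ef j"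
      using ke by (simp add: Kd_Ef mmult_smult_left mmult_assoc Kd_mult Kd_0 msupp_Ef)
    with ke show ?thesis
      by (simp add: rep_free_diff rep_free_mult rep_free_const mmult_smult_left msupp_Ef rep_free_gen1 rep_Gk rep_Ge q del: rep_gen.simps)
  next
    case kf
    have q: "qpow (- cartan i j / 2) = xq powi (- cart i j)"
      by (rule qpow_eq) (use kf in \<open>simp add: cartan_cart\<close>)
    have "mmult ind (mmult ind (Kd i 1) (Ff j)) (Kd i (-1)) = xq powi (- cart i j) *\<^sub>m Ff j"
      using kf Kd_Ff[of j i 1] by (simp add: mmult_smult_left mmult_assoc Kd_mult Kd_0 msupp_Ff)
    with kf q show ?thesis
      by (simp add: rep_free_diff rep_free_mult rep_free_const mmult_smult_left msupp_Ff rep_free_gen1 rep_Gk rep_Gf del: rep_gen.simps)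
  next
    case ef
    have g: "gen1 (Ge i) \<in> free_on gens" "gen1 (Gf j) \<in> free_on gens" "gen1 (Ge i) \<in> free_on gens"
      using ef by auto
    have K: "rep_free (gen1 (Gk i) * gen1 (Gk i) - gen1 (Gki i) * gen1 (Gki i)) = Kd i 2 - Kd i (-2)"
      using ef by (simp add: rep_free_diff rep_free_mult rep_free_gen1 rep_Gk Kd_mult del: rep_gen.simps)
    have L: "rep_free (if i = j then const (1 / (qpow 1 - qpow (-1))) * (gen1 (Gk i) * gen1 (Gk i) - gen1 (Gki i) * gen1 (Gki i)) else 0)
       = (if i = j then (1 / qdiff) *\<^sub>m (Kd i 2 - Kd i (-2)) else 0)"
    proof (cases "i = j")
      case True
      have "gen1 (Gk i) * gen1 (Gk i) - gen1 (Gki i) * gen1 (Gki i) \<in> free_on gens" using ef by auto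
      note * = rep_free_const_mult[OF this, unfolded K]
      show ?thesis unfolding if_P[OF True] * qpow_1 qdiff_def ..
    qed simp
    have R: "rep_free r = mmult ind (Ef i) (Ff j) - (-1) ^ (alpha_par i * alpha_par j) *\<^sub>m mmult ind (Ff j) (Ef i)
      - (if i = j then (1 / qdiff) *\<^sub>m (Kd i 2 - Kd i (-2)) else 0)"
      unfolding ef(3) rep_free_diff L mult.assoc using ef g
      by (simp add: rep_free_mult rep_free_const mmult_smult_left msupp_Ef msupp_Ff rep_free_gen1 rep_Ge rep_Gf del: rep_gen.simps)
    have sup: "msupp ind (rep_free r)" unfolding R using ef
      by (auto intro!: msupp_diff msupp_smult msupp_mmult msupp_Ef msupp_Ff msupp_Kd)
    show ?thesis
    proof (intro ext)
      fix a c
      show "rep_free r a c = 0 a c"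
      proof (cases "a \<in> ind")
        case True
        show ?thesis
        proof (cases "i = j")
          case False
          then show ?thesis unfolding R using Ef_Ff_neq[OF ef(1,2)] by simp
        next
          case True
          have "mmult ind (Ef i) (Ff i) a c = (-1) ^ (alpha_par i * alpha_par i) * mmult ind (Ff i) (Ef i) a c
             + (1 / qdiff) * (Kd i 2 - Kd i (-2)) a c"
            unfolding Ef_Ff_eq[OF ef(1) \<open>a \<in> ind\<close>] Kd_2_diff[OF \<open>a \<in> ind\<close>] by simp
          then show ?thesis unfolding R using True by simp
        qed
      next
        case False
        then show ?thesis using msuppD[OF sup] by simp
      qed
    qed
  next
    case E
    interpret E: osp_half m n par th Ef Ff "\<lambda>i. 1 / qdiff" 1 1 "\<lambda>c. c" by (rule osp_half_E)
    show ?thesis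
    proof (rule rep_serre[OF E])
      fix c d a b assume c: "c \<in> Rad d"
      have "(\<Sum>js\<in>index_words d. c js * rep_word (map Ge js) a b) = (\<Sum>js\<in>index_words d. c js * E.AW js a b)"
        by (intro sum.cong refl) (simp add: rep_word_Ge index_words_def)
      then show "(\<Sum>js\<in>index_words d. c js * rep_word (map Ge js) a b) = 0" using E.serre_vanish[OF c] by simp
    qed
  next
    case F
    interpret E: osp_half m n par th Ff Ef "\<lambda>i. (-1) ^ alpha_par i / qdiff" "-1" N "\<lambda>c. N - c" by (rule osp_half_F)
    show ?thesis
    proof (rule rep_serre[OF F])
      fix c d a b assume c: "c \<in> Rad d"
      have "(\<Sum>js\<in>index_words d. c js * rep_word (map Gf js) a b) = (\<Sum>js\<in>index_words d. c js * E.AW js a b)"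
        by (intro sum.cong refl) (simp add: rep_word_Gf index_words_def)
      then show "(\<Sum>js\<in>index_words d. c js * rep_word (map Gf js) a b) = 0" using E.serre_vanish[OF c] by simp
    qed
  qed
qed

text \<open>The kernel of \<open>rep_free\<close> among combinations of words in the generators is
  an ideal and contains the relations, hence the ideal generated by them.\<close>

lemma rep_rel_ideal: "h \<in> rel_ideal \<Longrightarrow> rep_free h = 0"
proof -
  let ?J = "{a \<in> free_on gens. rep_free a = 0}"
  have "ideal ?J free_ring"
  proof (rule idealI[OF ring_free_ring])
    show "subgroup ?J (add_monoid free_ring)"
    proof (rule subgroup.intro)
      fix x assume x: "x \<in> ?J"
      have "inv\<^bsub>add_monoid free_ring\<^esub> x = - x"
      proof -
        have "\<ominus>\<^bsub>free_ring\<^esub> x = - x"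
          using x by (intro F.minus_equality) auto
        then show ?thesis by (simp add: a_inv_def)
      qed
      then show "inv\<^bsub>add_monoid free_ring\<^esub> x \<in> ?J"
        using x rep_free_diff[of 0 x] by simp
    qed (auto simp: rep_free_add)
  qed (auto simp: rep_free_mult)
  moreover have "relations \<subseteq> ?J" using relations_sub rep_relations by auto
  ultimately have "rel_ideal \<subseteq> ?J"
    unfolding rel_ideal_def by (rule F.genideal_minimal)
  then show "h \<in> rel_ideal \<Longrightarrow> rep_free h = 0" by blast
qed

text \<open>Representatives of a class differ by elements of \<open>rel_ideal\<close>, so the choice
  made in \<open>rep\<close> is immaterial.\<close>

lemma rep_cls: "a \<in> free_on gens \<Longrightarrow> rep (cls a) = rep_free a"
proof -
  assume a: "a \<in> free_on gens"
  have "\<exists>b. b \<in> cls a"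
    unfolding cls_def using I.a_rcos_self[of a] a by auto
  then have "(SOME b. b \<in> cls a) \<in> cls a" by (rule someI_ex)
  then obtain h where "h \<in> rel_ideal" "(SOME b. b \<in> cls a) = h + a"
    unfolding cls_def a_r_coset_def' by auto
  then show ?thesis unfolding rep_def by (simp add: rep_free_add rep_rel_ideal)
qed

end

section \<open>The pairing on words\<close>

lemma two_neq_1_K: "(2 :: K) \<noteq> 1"
proof
  assume "(2 :: K) = 1"
  then have "(1 :: K) + 1 = 1 + 0" by simp
  then show False unfolding add_left_cancel by simp
qed

locale osp_pairing = osp +
  fixes P :: "free set \<Rightarrow> free set \<Rightarrow> L"
  assumes J: "J_pairing P"
begin

definition GE :: "gen set" where "GE = gens_e \<union> gens_k"
definition GF :: "gen set" where "GF = gens_f \<union> gens_k"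

lemmas JJ = J[unfolded J_pairing_def J_bilinear_def U_le_def U_ge_def, folded GE_def GF_def]

lemma GE_simps [simp]: "Ge i \<in> GE \<longleftrightarrow> i \<in> {1..s}" "Gk i \<in> GE \<longleftrightarrow> i \<in> {1..s}" "Gki i \<in> GE \<longleftrightarrow> i \<in> {1..s}" "Gf i \<notin> GE"
  by (auto simp: GE_def gens_e_def gens_k_def)

lemma GF_simps [simp]: "Gf i \<in> GF \<longleftrightarrow> i \<in> {1..s}" "Gk i \<in> GF \<longleftrightarrow> i \<in> {1..s}" "Gki i \<in> GF \<longleftrightarrow> i \<in> {1..s}" "Ge i \<notin> GF"
  by (auto simp: GF_def gens_f_def gens_k_def)

lemma GE_gens: "GE \<subseteq> gens" and GF_gens: "GF \<subseteq> gens"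
  by (auto simp: GE_def GF_def gens_def)

lemma P_add_right: "b \<in> free_on GF \<Longrightarrow> a \<in> free_on GE \<Longrightarrow> a' \<in> free_on GE \<Longrightarrow>
    P (cls b) (cls (a + a')) = P (cls b) (cls a) + P (cls b) (cls a')"
  using JJ free_on_mono[OF GE_gens] by (auto simp flip: cls_add)

lemma P_add_left: "b \<in> free_on GF \<Longrightarrow> b' \<in> free_on GF \<Longrightarrow> a \<in> free_on GE \<Longrightarrow>
    P (cls (b + b')) (cls a) = P (cls b) (cls a) + P (cls b') (cls a)"
  using JJ free_on_mono[OF GF_gens] by (auto simp flip: cls_add)

lemma P_scale_right: "b \<in> free_on GF \<Longrightarrow> a \<in> free_on GE \<Longrightarrow>
    P (cls b) (cls (const c * a)) = K_to_L c * P (cls b) (cls a)"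
  using JJ free_on_mono[OF GE_gens] by (auto simp flip: cls_mult)

lemma P_scale_left: "b \<in> free_on GF \<Longrightarrow> a \<in> free_on GE \<Longrightarrow>
    P (cls (const c * b)) (cls a) = K_to_L c * P (cls b) (cls a)"
  using JJ free_on_mono[OF GF_gens] by (auto simp flip: cls_mult)

text \<open>All values of the pairing are computed on single words, where its axioms become
  recursions.\<close>

definition Pw :: "gen list \<Rightarrow> gen list \<Rightarrow> L" where
  "Pw y x = P (cls (Poly_Mapping.single y 1)) (cls (Poly_Mapping.single x 1))"

lemma const_mult_single: "const c * Poly_Mapping.single w d = (Poly_Mapping.single w (c * d) :: free)"
  by (simp add: const_def mult_single plus_list_def)

lemma P_expand_right:
  assumes "b \<in> free_on GF" "a \<in> free_on GE"
  shows "P (cls b) (cls a) = lx K_to_L (\<lambda>x. P (cls b) (cls (Poly_Mapping.single x 1))) a"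
proof -
  have sum: "P (cls b) (cls (\<Sum>w\<in>S. Poly_Mapping.single w (c w))) = (\<Sum>w\<in>S. K_to_L (c w) * P (cls b) (cls (Poly_Mapping.single w 1)))"
    if "finite S" "S \<subseteq> lists GE" for S c
    using that
  proof (induction S)
    case empty
    show ?case using P_scale_right[OF assms(1), of 0 0] by (simp add: const_def)
  next
    case (insert w S)
    have s: "Poly_Mapping.single w (c w) = const (c w) * Poly_Mapping.single w 1" by (simp add: const_mult_single)
    have m: "Poly_Mapping.single w 1 \<in> free_on GE" "Poly_Mapping.single w (c w) \<in> free_on GE" "(\<Sum>w\<in>S. Poly_Mapping.single w (c w)) \<in> free_on GE"
      using insert.prems by (auto intro!: free_on_sum free_on_single)
    show ?case
      using insert.hyps P_add_right[OF assms(1) m(2,3)] P_scale_right[OF assms(1) m(1), of "c w"] insert.IH insert.prems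
      by (simp add: s[symmetric])
  qed
  show ?thesis
    unfolding lx_def
    by (subst sum[symmetric]) (use assms(2) in \<open>simp_all add: free_on_def sum_singles\<close>)
qed

lemma P_expand_left:
  assumes "b \<in> free_on GF" "a \<in> free_on GE"
  shows "P (cls b) (cls a) = lx K_to_L (\<lambda>y. P (cls (Poly_Mapping.single y 1)) (cls a)) b"
proof -
  have sum: "P (cls (\<Sum>w\<in>S. Poly_Mapping.single w (c w))) (cls a) = (\<Sum>w\<in>S. K_to_L (c w) * P (cls (Poly_Mapping.single w 1)) (cls a))"
    if "finite S" "S \<subseteq> lists GF" for S c
    using that
  proof (induction S)
    case empty
    show ?case using P_scale_left[OF _ assms(2), of 0 0] by (simp add: const_def)
  next
    case (insert w S)
    have s: "Poly_Mapping.single w (c w) = const (c w) * Poly_Mapping.single w 1" by (simp add: const_mult_single)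
    have m: "Poly_Mapping.single w 1 \<in> free_on GF" "Poly_Mapping.single w (c w) \<in> free_on GF" "(\<Sum>w\<in>S. Poly_Mapping.single w (c w)) \<in> free_on GF"
      using insert.prems by (auto intro!: free_on_sum free_on_single)
    show ?case
      using insert.hyps P_add_left[OF m(2,3) assms(2)] P_scale_left[OF m(1) assms(2), of "c w"] insert.IH insert.prems
      by (simp add: s[symmetric])
  qed
  show ?thesis
    unfolding lx_def
    by (subst sum[symmetric]) (use assms(1) in \<open>simp_all add: free_on_def sum_singles\<close>)
qed

text \<open>Sweedler notation: the sum of \<phi> z z' over the terms z \<otimes> z' of the coproduct
  of x, coefficients included.\<close>

definition Dl_J :: "(gen list \<Rightarrow> gen list \<Rightarrow> L) \<Rightarrow> gen list \<Rightarrow> L" where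
  "Dl_J \<phi> x = lx K_to_L (\<lambda>(z, z'). \<phi> z z') (DeltaJ_word x)"

lemma tensor_single: "tensor (Poly_Mapping.single w c) (Poly_Mapping.single z d) = Poly_Mapping.single (w, z) (c * d)"
  by (cases "c = 0"; cases "d = 0") (simp_all add: tensor_def)

lemma lx_tmult:
  "lx K_to_L \<phi> (tmult S T) = lx K_to_L (\<lambda>(w, w'). lx K_to_L (\<lambda>(z, z'). (-1) ^ (word_par w' * word_par z) * \<phi> (w @ z, w' @ z')) T) S"
  unfolding tmult_def case_prod_unfold lx_sum[OF scalar_hom_K_to_L] lx_single[OF scalar_hom_K_to_L]
  by (simp add: lx_def sum_distrib_left mult_ac)

lemma word_par_simps [simp]: "word_par [] = 0" "word_par (x # w) = gen_par x + word_par w" "word_par (u @ v) = word_par u + word_par v"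
  by (simp_all add: word_par_def)

lemma Dl_J_Nil: "Dl_J \<phi> [] = \<phi> [] []"
  by (simp add: Dl_J_def one_eq_single tensor_single lx_single[OF scalar_hom_K_to_L])

lemma gen1_mult: "gen1 x * gen1 y = Poly_Mapping.single [x, y] 1"
  by (simp add: gen1_def mult_single plus_list_def)

lemma Dl_J_Cons:
  "Dl_J \<phi> (Ge i # x) = Dl_J (\<lambda>z z'. (-1) ^ (alpha_par i * word_par z) * \<phi> (Gk i # Gk i # z) (Ge i # z')) x
     + Dl_J (\<lambda>z z'. \<phi> (Ge i # z) z') x"
  "Dl_J \<phi> (Gf i # x) = Dl_J (\<lambda>z z'. (-1) ^ (alpha_par i * word_par z) * \<phi> z (Gf i # z')) x
     + Dl_J (\<lambda>z z'. \<phi> (Gf i # z) (Gki i # Gki i # z')) x"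
  "Dl_J \<phi> (Gk i # x) = Dl_J (\<lambda>z z'. \<phi> (Gk i # z) (Gk i # z')) x"
  "Dl_J \<phi> (Gki i # x) = Dl_J (\<lambda>z z'. \<phi> (Gki i # z) (Gki i # z')) x"
  unfolding Dl_J_def DeltaJ_word.simps lx_tmult DeltaJ_gen.simps gen1_mult
  by (simp_all add: one_eq_single gen1_def tensor_single lx_add[OF scalar_hom_K_to_L] lx_single[OF scalar_hom_K_to_L])

text \<open>The coproduct of a word in one Borel half has both legs in that half, so agreement there
  suffices.\<close>

lemma Dl_J_cong:
  assumes "set x \<subseteq> S" "S = GE \<or> S = GF"
    and "\<And>z z'. set z \<subseteq> S \<Longrightarrow> set z' \<subseteq> S \<Longrightarrow> \<phi> z z' = \<psi> z z'"
  shows "Dl_J \<phi> x = Dl_J \<psi> x"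
  using assms(1,3)
proof (induction x arbitrary: \<phi> \<psi>)
  case Nil
  then show ?case by (simp add: Dl_J_Nil)
next
  case (Cons a x)
  have x: "set x \<subseteq> S" and a: "a \<in> S" using Cons.prems(1) by auto
  show ?case
  proof (cases a)
    case (Ge i)
    then have i: "Gk i \<in> S" "Ge i \<in> S" using a assms(2) by auto
    show ?thesis unfolding Ge Dl_J_Cons
      by (intro arg_cong2[where f = "(+)"] Cons.IH[OF x]) (use i Cons.prems(2) in auto)
  next
    case (Gf i)
    then have i: "Gki i \<in> S" "Gf i \<in> S" using a assms(2) by auto
    show ?thesis unfolding Gf Dl_J_Cons
      by (intro arg_cong2[where f = "(+)"] Cons.IH[OF x]) (use i Cons.prems(2) in auto)
  next
    case (Gk i)
    show ?thesis unfolding Gk Dl_J_Cons by (intro Cons.IH[OF x]) (use a Gk Cons.prems(2) in auto)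
  next
    case (Gki i)
    show ?thesis unfolding Gki Dl_J_Cons by (intro Cons.IH[OF x]) (use a Gki Cons.prems(2) in auto)
  qed
qed

lemma Dl_J_scale: "Dl_J (\<lambda>z z'. c * \<phi> z z') x = c * Dl_J \<phi> x"
  unfolding Dl_J_def by (simp add: lx_scale_fun case_prod_unfold)

lemma Dl_J_zero [simp]: "Dl_J (\<lambda>z z'. 0) x = 0"
  unfolding Dl_J_def by (simp add: case_prod_unfold)

lemma single_mult_word: "Poly_Mapping.single u 1 * Poly_Mapping.single v 1 = (Poly_Mapping.single (u @ v) 1 :: free)"
  by (simp add: mult_single plus_list_def)

lemma DeltaJ_single: "DeltaJ (Poly_Mapping.single x 1) = DeltaJ_word x"
proof -
  have "Poly_Mapping.map ((*) 1) T = T" for T :: free2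
    by (rule poly_mapping_eqI) (simp add: Poly_Mapping.map.rep_eq when_def)
  then show ?thesis by (simp add: DeltaJ_def lin_ext_def)
qed

lemma pair2_single_left:
  "pair2 P (Poly_Mapping.single (y, y') 1) T = lx K_to_L (\<lambda>(z, z'). (-1) ^ (word_par y' * word_par z) * Pw y z * Pw y' z') T"
  by (simp add: pair2_def lx_def Pw_def case_prod_unfold mult_ac)

lemma pair2_single_right:
  "pair2 P S (Poly_Mapping.single (x, x') 1) = lx K_to_L (\<lambda>(w, w'). (-1) ^ (word_par w' * word_par x) * Pw w x * Pw w' x') S"
  by (simp add: pair2_def lx_def Pw_def case_prod_unfold mult_ac)

lemma Pw_append_left:
  assumes "set y \<subseteq> GF" "set y' \<subseteq> GF" "set x \<subseteq> GE"
  shows "Pw (y @ y') x = Dl_J (\<lambda>z z'. (-1) ^ (word_par y' * word_par z) * Pw y z * Pw y' z') x"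
proof -
  have g: "set y \<subseteq> gens" "set y' \<subseteq> gens" using assms GF_gens by auto
  have "P (cls (Poly_Mapping.single y 1) \<otimes>\<^bsub>Uq\<^esub> cls (Poly_Mapping.single y' 1)) (cls (Poly_Mapping.single x 1))
    = pair2 P (tensor (Poly_Mapping.single y 1) (Poly_Mapping.single y' 1)) (DeltaJ (Poly_Mapping.single x 1))"
    using JJ assms by simp
  then show ?thesis
    using g by (simp add: cls_mult single_mult_word tensor_single DeltaJ_single pair2_single_left Dl_J_def Pw_def[of "y @ y'"])
qed

lemma Pw_append_right:
  assumes "set y \<subseteq> GF" "set x \<subseteq> GE" "set x' \<subseteq> GE"
  shows "Pw y (x @ x') = Dl_J (\<lambda>w w'. (-1) ^ (word_par w * word_par w') * (-1) ^ (word_par w * word_par x) * Pw w' x * Pw w x') y"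
proof -
  have g: "set x \<subseteq> gens" "set x' \<subseteq> gens" using assms GE_gens by auto
  have "P (cls (Poly_Mapping.single y 1)) (cls (Poly_Mapping.single x 1) \<otimes>\<^bsub>Uq\<^esub> cls (Poly_Mapping.single x' 1))
    = pair2 P (tflip (DeltaJ (Poly_Mapping.single y 1))) (tensor (Poly_Mapping.single x 1) (Poly_Mapping.single x' 1))"
    using JJ assms by simp
  then have "Pw y (x @ x') = lx K_to_L (\<lambda>(w, w'). (-1) ^ (word_par w' * word_par x) * Pw w x * Pw w' x') (tflip (DeltaJ_word y))"
    using g by (simp add: cls_mult single_mult_word tensor_single DeltaJ_single pair2_single_right Pw_def[of y])
  then show ?thesis
    unfolding tflip_def lx_lin_ext[OF scalar_hom_K_to_L] Dl_J_def
    by (simp add: case_prod_unfold lx_single[OF scalar_hom_K_to_L] mult_ac)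
qed

section \<open>Values of the pairing on generators\<close>

lemma cls_Gk_Gki:
  assumes i: "i \<in> {1..s}"
  shows "cls (Poly_Mapping.single [Gk i, Gki i] 1) = cls (Poly_Mapping.single [] 1)"
    "cls (Poly_Mapping.single [Gki i, Gk i] 1) = cls (Poly_Mapping.single [] 1)"
proof -
  have "gen1 (Gk i) * gen1 (Gki i) - 1 \<in> relations" "gen1 (Gki i) * gen1 (Gk i) - 1 \<in> relations"
    using i unfolding relations_def by blast+
  then have r: "Poly_Mapping.single [Gk i, Gki i] 1 - Poly_Mapping.single [] 1 \<in> relations"
    "Poly_Mapping.single [Gki i, Gk i] 1 - Poly_Mapping.single [] 1 \<in> relations"
    by (simp_all only: gen1_mult one_eq_single)
  show "cls (Poly_Mapping.single [Gk i, Gki i] 1) = cls (Poly_Mapping.single [] 1)"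
    using i by (intro cls_eq_cls r free_on_single) auto
  show "cls (Poly_Mapping.single [Gki i, Gk i] 1) = cls (Poly_Mapping.single [] 1)"
    using i by (intro cls_eq_cls r free_on_single) auto
qed

lemma Pw_Nil_Nil: "Pw [] [] = 1"
  using JJ by (simp add: Pw_def cls_one[symmetric] one_eq_single)

lemma Pw_gens:
  "i \<in> {1..s} \<Longrightarrow> x \<in> gens_k \<Longrightarrow> Pw [Gf i] [x] = 0" "i \<in> {1..s} \<Longrightarrow> x \<in> gens_k \<Longrightarrow> Pw [x] [Ge i] = 0"
  "i \<in> {1..s} \<Longrightarrow> j \<in> {1..s} \<Longrightarrow> Pw [Gk i] [Gk j] = xq powi (- cart i j)"
proof -
  show "i \<in> {1..s} \<Longrightarrow> x \<in> gens_k \<Longrightarrow> Pw [Gf i] [x] = 0" "i \<in> {1..s} \<Longrightarrow> x \<in> gens_k \<Longrightarrow> Pw [x] [Ge i] = 0"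
    using JJ by (auto simp: Pw_def gen1_def)
  assume ij: "i \<in> {1..s}" "j \<in> {1..s}"
  then have "Pw [Gk i] [Gk j] = qpowL (- cartan i j / 4)"
    using JJ by (auto simp: Pw_def gen1_def)
  also have "\<dots> = xq powi (- cart i j)"
    by (rule qpowL_eq) (use ij in \<open>simp add: cartan_cart\<close>)
  finally show "Pw [Gk i] [Gk j] = xq powi (- cart i j)" .
qed

definition gam :: "nat \<Rightarrow> L" where "gam i = (-1) ^ alpha_par i / (qpowL (-1) - qpowL 1)"

lemma Pw_Gf_Ge: "i \<in> {1..s} \<Longrightarrow> j \<in> {1..s} \<Longrightarrow> Pw [Gf i] [Ge j] = (if i = j then gam i else 0)"
  using JJ by (auto simp: Pw_def gen1_def gam_def)

text \<open>In \<open>L\<close> the element q is xq^4, the image of q = xq^2 in \<open>K\<close>;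
  the pairing of f_i with e_i therefore comes from \<open>K\<close>.\<close>

lemma gam_K: "gam i = K_to_L (- ((-1) ^ alpha_par i / qdiff))" "gam i \<noteq> 0"
proof -
  have q: "qpowL (-1) = xq powi (-4)" "qpowL 1 = xq powi 4"
    by (rule qpowL_eq; simp)+
  have "qpowL (-1) - qpowL 1 = K_to_L (- qdiff)"
    unfolding q qdiff_def by (simp add: K_to_L_xq_powi K_to_L_xq del: K_to_L_powi flip: power_mult)
  then have "gam i = K_to_L ((-1) ^ alpha_par i / (- qdiff))"
    unfolding gam_def by simp
  then show "gam i = K_to_L (- ((-1) ^ alpha_par i / qdiff))" by simp
  moreover have "- ((-1) ^ alpha_par i / qdiff) \<noteq> 0" using qdiff_nz by simp
  ultimately show "gam i \<noteq> 0" by (metis K_to_L_eq_0_iff)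
qed

text \<open>The counit on words in the e_i and the torus generators; by \<open>Pw_Nil\<close> it is
  the pairing with 1.\<close>

definition no_e :: "gen list \<Rightarrow> L" where "no_e z = (if set z \<inter> range Ge = {} then 1 else 0)"

lemma no_e_simps [simp]: "no_e [] = 1" "no_e (Ge i # z) = 0" "no_e (Gk i # z) = no_e z" "no_e (Gki i # z) = no_e z"
  by (auto simp: no_e_def)

lemma Pw_Nil_append: "set x \<subseteq> GE \<Longrightarrow> set x' \<subseteq> GE \<Longrightarrow> Pw [] (x @ x') = Pw [] x * Pw [] x'"
  by (simp add: Pw_append_right Dl_J_Nil)

text \<open>These values follow from 1 * 1 = 1: on a torus generator the value is idempotent, and it
  is invertible since its product with the value on the inverse is 1. On e_i the value t satisfies t
  = t + t.\<close>

lemma Pw_Nil_gen: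
  assumes i: "i \<in> {1..s}"
  shows "Pw [] [Gk i] = 1" "Pw [] [Gki i] = 1" "Pw [] [Ge i] = 0"
proof -
  have 1: "Pw [] [Gk i] * Pw [] [Gki i] = 1"
    using Pw_Nil_append[of "[Gk i]" "[Gki i]"] i Pw_Nil_Nil by (simp add: Pw_def cls_Gk_Gki[OF i])
  have "Pw [] [Gk i] = Pw [] [Gk i] * Pw [] [Gk i]"
    using Pw_append_left[of "[]" "[]" "[Gk i]"] i by (simp add: Dl_J_Cons Dl_J_Nil)
  with 1 show k: "Pw [] [Gk i] = 1" by (metis mult_cancel_left2 mult_zero_left zero_neq_one)
  with 1 show "Pw [] [Gki i] = 1" by simp
  have "Pw [] [Gk i, Gk i] = 1" using Pw_Nil_append[of "[Gk i]" "[Gk i]"] i k by simp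
  then have "Pw [] [Ge i] = Pw [] [Ge i] + Pw [] [Ge i]"
    using Pw_append_left[of "[]" "[]" "[Ge i]"] i by (simp add: Dl_J_Cons Dl_J_Nil Pw_Nil_Nil)
  then show "Pw [] [Ge i] = 0" by (simp add: two_neq_1_K)
qed

lemma Pw_Nil: "set z \<subseteq> GE \<Longrightarrow> Pw [] z = no_e z"
proof (induction z)
  case Nil
  show ?case by (simp add: Pw_Nil_Nil)
next
  case (Cons a z)
  then have "Pw [] (a # z) = Pw [] [a] * no_e z"
    using Pw_Nil_append[of "[a]" z] by simp
  moreover have "a \<in> GE" using Cons.prems by simp
  ultimately show ?case by (cases a) (simp_all add: Pw_Nil_gen)
qed

text \<open>Inverting one argument and squaring both turns the prescribed q^(-a/4), where a = (alpha
  i, alpha j), into q^a, and q is xq^4 in \<open>L\<close>.\<close>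

lemma Pw_KK:
  assumes i: "i \<in> {1..s}" and j: "j \<in> {1..s}"
  shows "Pw [Gki i, Gki i] [Gk j, Gk j] = xq powi (4 * cart i j)" "Pw [Gki i, Gki i] [Ge j] = 0"
proof -
  have "Pw [Gk i] [Gk j] * Pw [Gki i] [Gk j] = Pw [] [Gk j]"
    using Pw_append_left[of "[Gk i]" "[Gki i]" "[Gk j]"] i j by (simp add: Dl_J_Cons Dl_J_Nil Pw_def cls_Gk_Gki[OF i])
  then have "xq powi (- cart i j) * Pw [Gki i] [Gk j] = 1"
    by (simp only: Pw_gens(3)[OF i j] Pw_Nil_gen(1)[OF j])
  then have "xq powi (cart i j) * xq powi (- cart i j) * Pw [Gki i] [Gk j] = xq powi (cart i j)"
    by (simp only: mult.assoc mult_1_right)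
  then have k: "Pw [Gki i] [Gk j] = xq powi (cart i j)"
    unfolding powi_merge[OF xq_nz] by simp
  have kk: "Pw [Gki i, Gki i] [Gk j] = xq powi (2 * cart i j)"
    using Pw_append_left[of "[Gki i]" "[Gki i]" "[Gk j]"] i j by (simp add: Dl_J_Cons Dl_J_Nil k powi_merge)
  show "Pw [Gki i, Gki i] [Gk j, Gk j] = xq powi (4 * cart i j)"
    using Pw_append_right[of "[Gki i, Gki i]" "[Gk j]" "[Gk j]"] i j by (simp add: Dl_J_Cons Dl_J_Nil kk powi_merge)
  have "Gki i \<in> gens_k" using i by (simp add: gens_k_def)
  then show "Pw [Gki i, Gki i] [Ge j] = 0"
    using Pw_append_left[of "[Gki i]" "[Gki i]" "[Ge j]"] i j by (simp add: Dl_J_Cons Dl_J_Nil Pw_gens)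
qed

text \<open>f_i is skew primitive, so pairing with it is a derivation for concatenation, twisted by
  the pairing with q^(-h_i).\<close>

lemma Pw_Gf_append:
  assumes i: "i \<in> {1..s}" and "set x \<subseteq> GE" "set x' \<subseteq> GE"
  shows "Pw [Gf i] (x @ x') = Pw [Gf i] x * no_e x' + (-1) ^ (alpha_par i * word_par x) * Pw [Gki i, Gki i] x * Pw [Gf i] x'"
  using assms by (simp add: Pw_append_right Dl_J_Cons Dl_J_Nil Pw_Nil)

lemma Pw_Gf:
  assumes i: "i \<in> {1..s}"
  shows "j \<in> {1..s} \<Longrightarrow> Pw [Gf i] [Gk j, Gk j] = 0"
    "j \<in> {1..s} \<Longrightarrow> set z \<subseteq> GE \<Longrightarrow> Pw [Gf i] (Gk j # Gk j # z) = xq powi (4 * cart i j) * Pw [Gf i] z"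
    "j \<in> {1..s} \<Longrightarrow> set z \<subseteq> GE \<Longrightarrow> Pw [Gf i] (Ge j # z) = (if i = j then gam i * no_e z else 0)"
    "Pw [Gf i] [] = 0"
proof -
  show KK: "Pw [Gf i] [Gk j, Gk j] = 0" if "j \<in> {1..s}" for j
  proof -
    have "Gk j \<in> gens_k" using that by (simp add: gens_k_def)
    then show ?thesis using Pw_Gf_append[OF i, of "[Gk j]" "[Gk j]"] i that by (simp add: Pw_gens)
  qed
  show "Pw [Gf i] (Gk j # Gk j # z) = xq powi (4 * cart i j) * Pw [Gf i] z" if "j \<in> {1..s}" "set z \<subseteq> GE"
    using Pw_Gf_append[OF i, of "[Gk j, Gk j]" z] that by (simp add: KK Pw_KK[OF i])
  show "Pw [Gf i] (Ge j # z) = (if i = j then gam i * no_e z else 0)" if "j \<in> {1..s}" "set z \<subseteq> GE"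
    using Pw_Gf_append[OF i, of "[Ge j]" z] that by (simp add: Pw_Gf_Ge[OF i] Pw_KK[OF i])
  have "Pw [Gki i] [] * Pw [Gk i] [] = 1"
    using Pw_append_left[of "[Gki i]" "[Gk i]" "[]"] i Pw_Nil_Nil by (simp add: Dl_J_Nil Pw_def cls_Gk_Gki[OF i])
  moreover have "Pw [Gki i] [] = Pw [Gki i] [] * Pw [Gki i] []"
    using Pw_append_right[of "[Gki i]" "[]" "[]"] i by (simp add: Dl_J_Cons Dl_J_Nil)
  ultimately have "Pw [Gki i] [] = 1" by (metis mult_cancel_left2 mult_zero_left zero_neq_one)
  then have "Pw [Gki i, Gki i] [] = 1"
    using Pw_append_left[of "[Gki i]" "[Gki i]" "[]"] i by (simp add: Dl_J_Nil)
  then show "Pw [Gf i] [] = 0"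
    using Pw_append_right[of "[Gf i]" "[]" "[]"] i by (simp add: Dl_J_Cons Dl_J_Nil Pw_Nil_Nil two_neq_1_K)
qed

section \<open>Multiplication by a lowering generator as a skew derivation\<close>

lemma map_Ge_sub: "set w \<subseteq> {1..s} \<Longrightarrow> set (map Ge w) \<subseteq> GE"
  by auto

lemma map_Gf_sub: "set w \<subseteq> {1..s} \<Longrightarrow> set (map Gf w) \<subseteq> GF"
  by auto

text \<open>The counit axiom. The factor \<sigma> to the parity is carried along because each letter
  that is split off multiplies \<sigma> by a sign.\<close>

lemma Dl_J_no_e_left:
  "set w \<subseteq> {1..s} \<Longrightarrow> Dl_J (\<lambda>z z'. \<sigma> ^ word_par z * no_e z * \<psi> z') (map Ge w) = \<psi> (map Ge w)"
proof (induction w arbitrary: \<sigma> \<psi>)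
  case (Cons j w)
  have "Dl_J (\<lambda>z z'. \<sigma> ^ word_par z * no_e z * \<psi> z') (map Ge (j # w))
    = Dl_J (\<lambda>z z'. ((-1) ^ alpha_par j * \<sigma>) ^ word_par z * no_e z * \<psi> (Ge j # z')) (map Ge w)"
    by (simp add: Dl_J_Cons power_mult_distrib power_mult[symmetric] mult.assoc)
  also have "\<dots> = \<psi> (map Ge (j # w))"
    using Cons by simp
  finally show ?case .
qed (simp add: Dl_J_Nil)

lemma Dl_J_no_e_right:
  "set w \<subseteq> {1..s} \<Longrightarrow> Dl_J (\<lambda>z z'. \<sigma> ^ word_par z * \<chi> z * no_e z') (map Ge w) = \<sigma> ^ wpar w * \<chi> (map Ge w)"
proof (induction w arbitrary: \<chi>)
  case (Cons j w)
  have "Dl_J (\<lambda>z z'. \<sigma> ^ word_par z * \<chi> z * no_e z') (map Ge (j # w))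
    = Dl_J (\<lambda>z z'. \<sigma> ^ alpha_par j * (\<sigma> ^ word_par z * \<chi> (Ge j # z) * no_e z')) (map Ge w)"
    by (simp add: Dl_J_Cons power_add mult.assoc)
  also have "\<dots> = \<sigma> ^ wpar (j # w) * \<chi> (map Ge (j # w))"
    using Cons by (simp add: Dl_J_scale power_add)
  finally show ?case .
qed (simp add: Dl_J_Nil)

text \<open>One letter i goes to the left leg and is paired with f_i; every other letter e_j goes to
  the right leg and leaves q^(h_j) on the left. Those standing before the chosen letter contribute
  q^((alpha i, alpha j)), those after it 1.\<close>

lemma Dl_J_Gf_left:
  assumes i: "i \<in> {1..s}"
  shows "set w \<subseteq> {1..s} \<Longrightarrow> Dl_J (\<lambda>z z'. \<sigma> ^ word_par z * Pw [Gf i] z * \<psi> z') (map Ge w)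
    = \<sigma> ^ alpha_par i * gam i * rsum i w (\<lambda>u v. (-1) ^ (alpha_par i * wpar u) * xq powi (4 * cs i u)) (\<lambda>u. \<psi> (map Ge u))"
proof (induction w arbitrary: \<sigma> \<psi>)
  case Nil
  then show ?case by (simp add: Dl_J_Nil Pw_Gf(4)[OF i])
next
  case (Cons j w)
  then have w: "set w \<subseteq> {1..s}" and j: "j \<in> {1..s}" by auto
  let ?C = "\<lambda>u v. (-1) ^ (alpha_par i * wpar u) * xq powi (4 * cs i u) :: L"
  have 1: "Dl_J (\<lambda>z z'. (-1) ^ (alpha_par j * word_par z) * (\<sigma> ^ word_par (Gk j # Gk j # z) * Pw [Gf i] (Gk j # Gk j # z) * \<psi> (Ge j # z'))) (map Ge w)
    = Dl_J (\<lambda>z z'. xq powi (4 * cart i j) * (((-1) ^ alpha_par j * \<sigma>) ^ word_par z * Pw [Gf i] z * \<psi> (Ge j # z'))) (map Ge w)"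
    by (rule Dl_J_cong[OF map_Ge_sub[OF w]])
      (auto simp: Pw_Gf(2)[OF i j] power_mult_distrib power_mult[symmetric] mult_ac)
  have 2: "Dl_J (\<lambda>z z'. \<sigma> ^ word_par (Ge j # z) * Pw [Gf i] (Ge j # z) * \<psi> z') (map Ge w)
    = Dl_J (\<lambda>z z'. (if i = j then \<sigma> ^ alpha_par i * gam i else 0) * (\<sigma> ^ word_par z * no_e z * \<psi> z')) (map Ge w)"
    by (rule Dl_J_cong[OF map_Ge_sub[OF w]])
      (auto simp: Pw_Gf(3)[OF i j] power_add mult_ac)
  have C: "(\<lambda>u v. ?C (j # u) v) = (\<lambda>u v. ((-1) ^ (alpha_par i * alpha_par j) * xq powi (4 * cart i j)) * ?C u v)"
    by (intro ext) (simp add: distrib_left power_add powi_merge[symmetric] mult_ac)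
  have "Dl_J (\<lambda>z z'. \<sigma> ^ word_par z * Pw [Gf i] z * \<psi> z') (map Ge (j # w))
    = xq powi (4 * cart i j) * (((-1) ^ alpha_par j * \<sigma>) ^ alpha_par i * gam i * rsum i w ?C (\<lambda>u. \<psi> (Ge j # map Ge u)))
      + (if i = j then \<sigma> ^ alpha_par i * gam i else 0) * \<psi> (map Ge w)"
    unfolding list.map Dl_J_Cons 1 2 Dl_J_scale Cons.IH[OF w] Dl_J_no_e_left[OF w] ..
  also have "\<dots> = \<sigma> ^ alpha_par i * gam i * rsum i (j # w) ?C (\<lambda>u. \<psi> (map Ge u))"
    unfolding rsum_Cons C rsum_scale
    by (auto simp: power_mult_distrib power_mult[symmetric] algebra_simps)
  finally show ?case .
qed

lemma Pw_Gf_left: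
  assumes i: "i \<in> {1..s}" and y: "set y \<subseteq> GF" and w: "set w \<subseteq> {1..s}"
  shows "Pw (Gf i # y) (map Ge w) = (-1) ^ (alpha_par i * word_par y) * gam i
     * rsum i w (\<lambda>u v. (-1) ^ (alpha_par i * wpar u) * xq powi (4 * cs i u)) (\<lambda>u. Pw y (map Ge u))"
proof -
  have "Pw ([Gf i] @ y) (map Ge w) = Dl_J (\<lambda>z z'. ((-1) ^ word_par y) ^ word_par z * Pw [Gf i] z * Pw y z') (map Ge w)"
    using i y map_Ge_sub[OF w] by (subst Pw_append_left) (simp_all add: power_mult)
  then show ?thesis unfolding Dl_J_Gf_left[OF i w] by (simp add: power_mult[symmetric] mult.commute)
qed

text \<open>Here the letter paired with f_i goes to the right leg and leaves q^(h_i) at its place in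
  the left word. The hypothesis on \<chi> states what its removal costs.\<close>

lemma Dl_J_Gf_right:
  assumes i: "i \<in> {1..s}"
  shows "set w \<subseteq> {1..s} \<Longrightarrow>
    (\<And>u v. set u \<subseteq> {1..s} \<Longrightarrow> set v \<subseteq> {1..s} \<Longrightarrow> \<chi> (map Ge u @ Gk i # Gk i # map Ge v) = xq powi (4 * cs i v) * \<chi> (map Ge (u @ v))) \<Longrightarrow>
    Dl_J (\<lambda>z z'. ((-1) ^ alpha_par i) ^ word_par z * \<chi> z * Pw [Gf i] z') (map Ge w)
    = gam i * rsum i w (\<lambda>u v. (-1) ^ (alpha_par i * wpar u) * xq powi (4 * cs i v)) (\<lambda>u. \<chi> (map Ge u))"
proof (induction w arbitrary: \<chi>)
  case Nil
  then show ?case by (simp add: Dl_J_Nil Pw_Gf(4)[OF i])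
next
  case (Cons j w)
  then have w: "set w \<subseteq> {1..s}" and j: "j \<in> {1..s}" by auto
  let ?C = "\<lambda>u v. (-1) ^ (alpha_par i * wpar u) * xq powi (4 * cs i v) :: L"
  have 1: "Dl_J (\<lambda>z z'. (-1) ^ (alpha_par j * word_par z) * (((-1) ^ alpha_par i) ^ word_par (Gk j # Gk j # z) * \<chi> (Gk j # Gk j # z) * Pw [Gf i] (Ge j # z'))) (map Ge w)
    = Dl_J (\<lambda>z z'. (if i = j then gam i else 0) * (1 ^ word_par z * \<chi> (Gk j # Gk j # z) * no_e z')) (map Ge w)"
    by (rule Dl_J_cong[OF map_Ge_sub[OF w]])
      (auto simp: Pw_Gf(3)[OF i j] power_mult[symmetric] mult_ac simp flip: power_mult_distrib)
  have 2: "Dl_J (\<lambda>z z'. ((-1) ^ alpha_par i) ^ word_par (Ge j # z) * \<chi> (Ge j # z) * Pw [Gf i] z') (map Ge w)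
    = Dl_J (\<lambda>z z'. (-1) ^ (alpha_par i * alpha_par j) * (((-1) ^ alpha_par i) ^ word_par z * \<chi> (Ge j # z) * Pw [Gf i] z')) (map Ge w)"
    by (rule Dl_J_cong[OF map_Ge_sub[OF w]]) (auto simp: power_add power_mult mult_ac)
  have C: "(\<lambda>u v. ?C (j # u) v) = (\<lambda>u v. (-1) ^ (alpha_par i * alpha_par j) * ?C u v)"
    by (intro ext) (simp add: distrib_left power_add mult_ac)
  have IH: "Dl_J (\<lambda>z z'. ((-1) ^ alpha_par i) ^ word_par z * \<chi> (Ge j # z) * Pw [Gf i] z') (map Ge w)
    = gam i * rsum i w ?C (\<lambda>u. \<chi> (Ge j # map Ge u))"
  proof (rule Cons.IH[OF w])
    fix u v assume "set u \<subseteq> {1..s}" "set v \<subseteq> {1..s}"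
    then show "\<chi> (Ge j # map Ge u @ Gk i # Gk i # map Ge v) = xq powi (4 * cs i v) * \<chi> (Ge j # map Ge (u @ v))"
      using Cons.prems(2)[of "j # u" v] j by simp
  qed
  have K: "i = j \<Longrightarrow> \<chi> (Gk j # Gk j # map Ge w) = xq powi (4 * cs i w) * \<chi> (map Ge w)"
    using Cons.prems(2)[of "[]" w] w by simp
  have "Dl_J (\<lambda>z z'. ((-1) ^ alpha_par i) ^ word_par z * \<chi> z * Pw [Gf i] z') (map Ge (j # w))
    = (if i = j then gam i else 0) * (1 ^ wpar w * \<chi> (Gk j # Gk j # map Ge w))
      + (-1) ^ (alpha_par i * alpha_par j) * (gam i * rsum i w ?C (\<lambda>u. \<chi> (Ge j # map Ge u)))"
    unfolding list.map Dl_J_Cons 1 2 Dl_J_scale IH Dl_J_no_e_right[OF w, where \<chi> = "\<lambda>z. \<chi> (Gk j # Gk j # z)"] ..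
  also have "\<dots> = gam i * rsum i (j # w) ?C (\<lambda>u. \<chi> (map Ge u))"
    unfolding rsum_Cons C rsum_scale using K by (auto simp: algebra_simps)
  finally show ?case .
qed

text \<open>The left legs of the coproduct are words in the f_j only. The empty one occurs in a
  single term, and T kills all others.\<close>

lemma Dl_J_Gf_Nil:
  "set w \<subseteq> {1..s} \<Longrightarrow> (\<And>i z z'. i \<in> {1..s} \<Longrightarrow> set z \<subseteq> GF \<Longrightarrow> set z' \<subseteq> GF \<Longrightarrow> T (Gf i # z) z' = 0) \<Longrightarrow>
    Dl_J T (map Gf w) = T [] (map Gf w)"
proof (induction w arbitrary: T)
  case (Cons j w)
  then have w: "set w \<subseteq> {1..s}" and j: "j \<in> {1..s}" by auto
  have 0: "Dl_J (\<lambda>z z'. T (Gf j # z) (Gki j # Gki j # z')) (map Gf w) = Dl_J (\<lambda>z z'. 0) (map Gf w)"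
    by (rule Dl_J_cong[OF map_Gf_sub[OF w]]) (use j in \<open>auto intro!: Cons.prems(2)\<close>)
  have "Dl_J (\<lambda>z z'. (-1) ^ (alpha_par j * word_par z) * T z (Gf j # z')) (map Gf w) = T [] (Gf j # map Gf w)"
    using Cons.prems(2) j by (subst Cons.IH[OF w]) auto
  then show ?case by (simp add: Dl_J_Cons 0)
qed (simp add: Dl_J_Nil)

text \<open>Torus elements pair with words in the f_j through the counit, so q^(h_i) at the right
  end may be dropped.\<close>

lemma Pw_KK_right:
  assumes w: "set w \<subseteq> {1..s}" and x: "set x \<subseteq> GE" and i: "i \<in> {1..s}"
  shows "Pw (map Gf w) (x @ [Gk i, Gk i]) = Pw (map Gf w) x"
proof -
  have z: "Pw (Gf j # z) [Gk i, Gk i] = 0" if "j \<in> {1..s}" "set z \<subseteq> GF" for j z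
    using Pw_append_left[of "[Gf j]" z "[Gk i, Gk i]"] that i by (simp add: Dl_J_Cons Dl_J_Nil Pw_Gf(1))
  have "Pw (map Gf w) (x @ [Gk i, Gk i]) = Dl_J (\<lambda>z z'. (-1) ^ (word_par z * word_par z') * (-1) ^ (word_par z * word_par x) * Pw z' x * Pw z [Gk i, Gk i]) (map Gf w)"
    using map_Gf_sub[OF w] x i by (intro Pw_append_right) auto
  also have "\<dots> = Pw (map Gf w) x"
    using i by (subst Dl_J_Gf_Nil[OF w]) (auto simp: z Pw_Nil)
  finally show ?thesis .
qed

lemma cls_Gk_Ge:
  assumes i: "i \<in> {1..s}" and j: "j \<in> {1..s}"
  shows "cls (gen1 (Gk i) * gen1 (Ge j)) = cls (const (xq powi cart i j) * gen1 (Ge j) * gen1 (Gk i))"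
proof -
  have q: "qpow (cartan i j / 2) = xq powi cart i j"
    by (rule qpow_eq) (use i j in \<open>simp add: cartan_cart\<close>)
  have g: "gen1 (Gk i) \<in> free_on gens" "gen1 (Gki i) \<in> free_on gens" "gen1 (Ge j) \<in> free_on gens" using i j by auto
  have 1: "cls (gen1 (Gk i) * gen1 (Ge j) * gen1 (Gki i)) = cls (const (xq powi cart i j) * gen1 (Ge j))"
  proof (rule cls_eq_cls)
    have "gen1 (Gk i) * gen1 (Ge j) * gen1 (Gki i) - const (qpow (cartan i j / 2)) * gen1 (Ge j) \<in> relations"
      using i j unfolding relations_def by blast
    then show "gen1 (Gk i) * gen1 (Ge j) * gen1 (Gki i) - const (xq powi cart i j) * gen1 (Ge j) \<in> relations"
      by (simp only: q)
  qed (use g in auto)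
  have 2: "cls (gen1 (Gki i) * gen1 (Gk i)) = cls 1"
    using cls_Gk_Gki(2)[OF i] by (simp add: gen1_mult one_eq_single)
  have "cls (gen1 (Gk i) * gen1 (Ge j)) = cls (gen1 (Gk i) * gen1 (Ge j)) \<otimes>\<^bsub>Uq\<^esub> cls (gen1 (Gki i) * gen1 (Gk i))"
    unfolding 2 using g by (simp add: cls_mult)
  also have "\<dots> = cls (gen1 (Gk i) * gen1 (Ge j) * gen1 (Gki i)) \<otimes>\<^bsub>Uq\<^esub> cls (gen1 (Gk i))"
    using g by (simp add: cls_mult mult.assoc)
  also have "\<dots> = cls (const (xq powi cart i j) * gen1 (Ge j) * gen1 (Gk i))"
    unfolding 1 using g by (simp add: cls_mult)
  finally show ?thesis .
qed

lemma Pw_Gk_Ge: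
  assumes i: "i \<in> {1..s}" and j: "j \<in> {1..s}" and y: "set y \<subseteq> GF" and u: "set u \<subseteq> GE" and v: "set v \<subseteq> GE"
  shows "Pw y (u @ Gk i # Ge j # v) = K_to_L (xq powi cart i j) * Pw y (u @ Ge j # Gk i # v)"
proof -
  let ?u = "Poly_Mapping.single u 1 :: free" and ?v = "Poly_Mapping.single v 1 :: free" and ?c = "xq powi cart i j"
  have g: "gen1 (Gk i) \<in> free_on gens" "gen1 (Ge j) \<in> free_on gens" "?u \<in> free_on gens" "?v \<in> free_on gens"
    using i j u v GE_gens by auto
  have a: "Poly_Mapping.single (u @ Gk i # Ge j # v) 1 = ?u * (gen1 (Gk i) * gen1 (Ge j)) * ?v"
    by (simp add: gen1_mult single_mult_word)
  have b: "const ?c * Poly_Mapping.single (u @ Ge j # Gk i # v) 1 = ?u * (const ?c * gen1 (Ge j) * gen1 (Gk i)) * ?v"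
    by (simp add: const_def gen1_def mult_single plus_list_def)
  have "cls (Poly_Mapping.single (u @ Gk i # Ge j # v) 1) = cls ?u \<otimes>\<^bsub>Uq\<^esub> cls (gen1 (Gk i) * gen1 (Ge j)) \<otimes>\<^bsub>Uq\<^esub> cls ?v"
    unfolding a using g by (simp add: cls_mult)
  also have "\<dots> = cls (const ?c * Poly_Mapping.single (u @ Ge j # Gk i # v) 1)"
    unfolding cls_Gk_Ge[OF i j] b using g by (simp add: cls_mult)
  finally have "Pw y (u @ Gk i # Ge j # v) = P (cls (Poly_Mapping.single y 1)) (cls (const ?c * Poly_Mapping.single (u @ Ge j # Gk i # v) 1))"
    unfolding Pw_def by (rule arg_cong)
  also have "\<dots> = K_to_L ?c * Pw y (u @ Ge j # Gk i # v)"
    unfolding Pw_def using y u v i j by (intro P_scale_right free_on_single) auto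
  finally show ?thesis .
qed

text \<open>Moving q^(h_i/2) past e_j costs q^((alpha i, alpha j)/2), which is a square of a power
  of xq after the passage from \<open>K\<close> to \<open>L\<close>.\<close>

lemma Pw_Gk_map_Ge:
  assumes i: "i \<in> {1..s}" and y: "set y \<subseteq> GF" and x: "set x \<subseteq> GE"
  shows "set u \<subseteq> GE \<Longrightarrow> set v \<subseteq> {1..s} \<Longrightarrow>
    Pw y (u @ Gk i # map Ge v @ x) = xq powi (2 * cs i v) * Pw y (u @ map Ge v @ Gk i # x)"
proof (induction v arbitrary: u)
  case (Cons j v)
  then have j: "j \<in> {1..s}" and v: "set v \<subseteq> {1..s}" by auto
  have "Pw y (u @ Gk i # map Ge (j # v) @ x) = K_to_L (xq powi cart i j) * Pw y ((u @ [Ge j]) @ Gk i # map Ge v @ x)"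
    using Pw_Gk_Ge[OF i j y Cons.prems(1), of "map Ge v @ x"] map_Ge_sub[OF v] x by simp
  also have "\<dots> = K_to_L (xq powi cart i j) * (xq powi (2 * cs i v) * Pw y ((u @ [Ge j]) @ map Ge v @ Gk i # x))"
    using Cons.prems j by (subst Cons.IH) auto
  finally show ?case by (simp add: K_to_L_xq_powi powi_merge distrib_left mult.assoc[symmetric] del: K_to_L_powi)
qed simp

lemma Pw_Gf_right:
  assumes i: "i \<in> {1..s}" and ys: "set ys \<subseteq> {1..s}" and w: "set w \<subseteq> {1..s}"
  shows "Pw (map Gf ys @ [Gf i]) (map Ge w) = gam i
     * rsum i w (\<lambda>u v. (-1) ^ (alpha_par i * wpar u) * xq powi (4 * cs i v)) (\<lambda>u. Pw (map Gf ys) (map Ge u))"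
proof -
  let ?y = "map Gf ys"
  have y: "set ?y \<subseteq> GF" by (rule map_Gf_sub[OF ys])
  have "Pw (?y @ [Gf i]) (map Ge w) = Dl_J (\<lambda>z z'. ((-1) ^ alpha_par i) ^ word_par z * Pw ?y z * Pw [Gf i] z') (map Ge w)"
    using i y map_Ge_sub[OF w] by (subst Pw_append_left) (simp_all add: power_mult)
  also have "\<dots> = gam i * rsum i w (\<lambda>u v. (-1) ^ (alpha_par i * wpar u) * xq powi (4 * cs i v)) (\<lambda>u. Pw ?y (map Ge u))"
  proof (rule Dl_J_Gf_right[OF i w])
    fix u v assume u: "set u \<subseteq> {1..s}" and v: "set v \<subseteq> {1..s}"
    \<comment> \<open>q^(h_i) is spelled with two letters; each is moved past v to the right end,
      and there both disappear.\<close>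
    have "Pw ?y (map Ge u @ Gk i # Gk i # map Ge v) = xq powi (2 * cs i v) * Pw ?y (map Ge u @ Gk i # map Ge v @ [Gk i])"
      using Pw_Gk_map_Ge[OF i y, of "[]" "map Ge u @ [Gk i]" v] map_Ge_sub[OF u] i v by simp
    also have "Pw ?y (map Ge u @ Gk i # map Ge v @ [Gk i]) = xq powi (2 * cs i v) * Pw ?y (map Ge (u @ v) @ [Gk i, Gk i])"
      using Pw_Gk_map_Ge[OF i y, of "[Gk i]" "map Ge u" v] map_Ge_sub[OF u] i v by simp
    also have "Pw ?y (map Ge (u @ v) @ [Gk i, Gk i]) = Pw ?y (map Ge (u @ v))"
      using map_Ge_sub[of "u @ v"] u v by (intro Pw_KK_right[OF ys _ i]) auto
    finally show "Pw ?y (map Ge u @ Gk i # Gk i # map Ge v) = xq powi (4 * cs i v) * Pw ?y (map Ge (u @ v))"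
      by (simp add: powi_merge mult.assoc[symmetric])
  qed
  finally show ?thesis .
qed

end

section \<open>Tensor products of matrices\<close>

context osp
begin

lemma mtensor_sum_left: "mtensor (\<Sum>x\<in>S. A x) B = (\<Sum>x\<in>S. mtensor (A x) B)"
  by (auto simp: fun_eq_iff mtensor_def sum_matr_apply sum_distrib_left sum_distrib_right mult_ac)

lemma mtensor_sum_right: "mtensor A (\<Sum>x\<in>S. B x) = (\<Sum>x\<in>S. mtensor A (B x))"
  by (auto simp: fun_eq_iff mtensor_def sum_matr_apply sum_distrib_left sum_distrib_right mult_ac)

lemma mtensor_smult: "mtensor (c *\<^sub>m A) B = c *\<^sub>m mtensor A B" "mtensor A (c *\<^sub>m B) = c *\<^sub>m mtensor A B"
  by (auto simp: fun_eq_iff mtensor_def mult_ac)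

lemma mtensor_add_left: "mtensor (A + A') B = mtensor A B + mtensor A' B"
  by (auto simp: fun_eq_iff mtensor_def algebra_simps)

lemma mtensor_diff_left: "mtensor (A - A') B = mtensor A B - mtensor A' B"
  by (auto simp: fun_eq_iff mtensor_def algebra_simps)

definition homog :: "nat \<Rightarrow> (nat, K) matr \<Rightarrow> bool" where
  "homog \<beta> A \<longleftrightarrow> (\<forall>a c. A a c \<noteq> 0 \<longrightarrow> even (par a + par c + \<beta>))"

text \<open>On nonzero terms the homogeneity of the two inner factors removes the summation indices
  from the signs, leaving the Koszul sign of exchanging B and C.\<close>

lemma mtensor_mult:
  assumes "homog \<beta> B" "homog \<gamma> C"
  shows "mmult ind2 (mtensor A B) (mtensor C D) = (-1) ^ (\<beta> * \<gamma>) *\<^sub>m mtensor (mmult ind A C) (mmult ind B D)"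
proof (intro ext, clarify)
  fix a b c d
  have "mmult ind2 (mtensor A B) (mtensor C D) (a, b) (c, d)
    = (\<Sum>k\<in>ind. \<Sum>l\<in>ind. (-1) ^ (\<beta> * \<gamma>) * (-1) ^ ((par b + par d) * par c) * (A a k * C k c) * (B b l * D l d))"
    unfolding mmult_def sum_ind2
  proof (intro sum.cong refl)
    fix k l
    show "mtensor A B (a, b) (k, l) * mtensor C D (k, l) (c, d)
      = (-1) ^ (\<beta> * \<gamma>) * (-1) ^ ((par b + par d) * par c) * (A a k * C k c) * (B b l * D l d)"
    proof (cases "B b l = 0 \<or> C k c = 0")
      case False
      then have e: "even (par b + par l + \<beta>)" "even (par k + par c + \<gamma>)"
        using assms by (auto simp: homog_def)
      have s: "(-1 :: K) ^ ((par b + par l) * par k) * (-1) ^ ((par l + par d) * par c)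
        = (-1) ^ (\<beta> * \<gamma>) * (-1) ^ ((par b + par d) * par c)"
        using e unfolding power_add[symmetric] by (intro minus_one_power_iff[THEN trans, OF trans[OF _ minus_one_power_iff[symmetric]]]) (auto simp: even_add)
      have "mtensor A B (a, b) (k, l) * mtensor C D (k, l) (c, d)
        = ((-1) ^ ((par b + par l) * par k) * (-1) ^ ((par l + par d) * par c)) * (A a k * C k c) * (B b l * D l d)"
        by (simp add: mtensor_def mult_ac)
      then show ?thesis unfolding s .
    qed (auto simp: mtensor_def)
  qed
  also have "\<dots> = ((-1) ^ (\<beta> * \<gamma>) *\<^sub>m mtensor (mmult ind A C) (mmult ind B D)) (a, b) (c, d)"
    by (simp add: mtensor_def mmult_def sum_distrib_left sum_distrib_right sum_product mult_ac)
  finally show "mmult ind2 (mtensor A B) (mtensor C D) (a, b) (c, d)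
    = ((-1) ^ (\<beta> * \<gamma>) *\<^sub>m mtensor (mmult ind A C) (mmult ind B D)) (a, b) (c, d)" .
qed

lemma homog_mone: "homog 0 (mone ind)"
  by (auto simp: homog_def mone_def)

lemma homog_Kd: "homog 0 (Kd i k)"
  by (auto simp: homog_def Kd_def)

lemma homog_Ef: "i \<in> {1..s} \<Longrightarrow> homog (alpha_par i) (Ef i)"
  unfolding homog_def by (auto simp: alpha_par_eq elim!: Ef_cases)

lemma homog_Ff: "i \<in> {1..s} \<Longrightarrow> homog (alpha_par i) (Ff i)"
  unfolding homog_def by (auto simp: alpha_par_eq elim!: Ff_cases)

lemma homog_mmult: "homog \<beta> A \<Longrightarrow> homog \<gamma> B \<Longrightarrow> homog (\<beta> + \<gamma>) (mmult ind A B)"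
  unfolding homog_def
proof (intro allI impI)
  fix a c
  assume A: "\<forall>a c. A a c \<noteq> 0 \<longrightarrow> even (par a + par c + \<beta>)" and B: "\<forall>a c. B a c \<noteq> 0 \<longrightarrow> even (par a + par c + \<gamma>)"
    and "mmult ind A B a c \<noteq> 0"
  then have "(\<Sum>k\<in>ind. A a k * B k c) \<noteq> 0" by (simp add: mmult_def)
  then obtain k where "A a k * B k c \<noteq> 0" by (meson sum.not_neutral_contains_not_neutral)
  then have "even (par a + par k + \<beta>)" "even (par k + par c + \<gamma>)" using A B by auto
  then show "even (par a + par c + (\<beta> + \<gamma>))" by (auto simp: even_add)
qed

section \<open>Weights\<close>

lemma word_deg_simps [simp]: "word_deg [] = 0" "word_deg (x # w) = gen_deg x + word_deg w" "word_deg (u @ v) = word_deg u + word_deg v"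
  by (simp_all add: word_deg_def)

lemma eps_prime: "a \<in> ind \<Longrightarrow> eps (prime a) = - eps a"
  using N_cases by (auto simp: eps_def fun_eq_iff ind_def prime_def unit_wt_def)

lemma Ef_wt: "i \<in> {1..s} \<Longrightarrow> Ef i a c \<noteq> 0 \<Longrightarrow> eps a = eps c + alpha i"
  by (auto elim!: Ef_cases simp: alpha_eq eps_prime)

text \<open>The sum is an integer for \<open>\<mu>\<close> in the root lattice; the floor only makes it typable as one.\<close>

definition wt_par :: "weight \<Rightarrow> nat" where
  "wt_par \<mu> = (if even \<lfloor>\<Sum>k\<in>{1..s}. of_nat (par k) * \<mu> k\<rfloor> then 0 else 1)"

text \<open>The functional in \<open>wt_par\<close> is additive and integral on the weights of V,
  and its parity there is that of the basis vector. Hence the weight of a word determines its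
  parity, which is \<open>wpar_wt\<close>.\<close>

lemma eps_par: "a \<in> ind \<Longrightarrow> \<exists>l::int. (\<Sum>k\<in>{1..s}. of_nat (par k) * eps a k) = of_int l \<and> (even l \<longleftrightarrow> even (par a))"
proof -
  assume a: "a \<in> ind"
  have le: "\<exists>l::int. (\<Sum>k\<in>{1..s}. of_nat (par k) * eps a k) = of_int l \<and> (even l \<longleftrightarrow> even (par a))" if "a \<in> {1..s}" for a
  proof -
    have "(\<Sum>k\<in>{1..s}. of_nat (par k) * eps a k) = (\<Sum>k\<in>{1..s}. if k = a then of_nat (par a) else (0 :: rat))"
      using that by (intro sum.cong) (auto simp: eps_def unit_wt_def)
    also have "\<dots> = of_int (int (par a))" using that by simp
    finally show ?thesis by (intro exI[of _ "int (par a)"]) simp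
  qed
  consider "a \<in> {1..s}" | "prime a \<in> {1..s}" | "prime a = a" "\<not> a \<le> s"
    using a N_cases by (force simp: ind_def prime_def)
  then show ?thesis
  proof cases
    case 2
    from le[OF this] obtain l :: int where l: "(\<Sum>k\<in>{1..s}. of_nat (par k) * eps (prime a) k) = of_int l" "even l \<longleftrightarrow> even (par a)"
      using a by auto
    then have "(\<Sum>k\<in>{1..s}. of_nat (par k) * eps a k) = of_int (- l)"
      by (simp add: eps_prime[OF a] sum_negf)
    then show ?thesis using l(2) by (intro exI[of _ "- l"]) simp
  next
    case 3
    then have "eps a = 0" by (auto simp: eps_def)
    then show ?thesis using par_self_dual[OF a 3(1)] by (intro exI[of _ 0]) simp
  qed (rule le)
qed

lemma word_par_wt: "set js \<subseteq> {1..s} \<Longrightarrow> \<exists>l::int. (\<Sum>k\<in>{1..s}. of_nat (par k) * word_deg (map Ge js) k) = of_int l \<and> (even l \<longleftrightarrow> even (wpar js))"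
proof (induction js)
  case Nil
  show ?case by (intro exI[of _ 0]) simp
next
  case (Cons j js)
  then have j: "j \<in> {1..s}" by simp
  from Cons obtain l :: int where l: "(\<Sum>k\<in>{1..s}. of_nat (par k) * word_deg (map Ge js) k) = of_int l" "even l \<longleftrightarrow> even (wpar js)" by auto
  from eps_par[OF pp_rr_ind(1)[OF j]] obtain l1 :: int where l1: "(\<Sum>k\<in>{1..s}. of_nat (par k) * eps (pp j) k) = of_int l1" "even l1 \<longleftrightarrow> even (par (pp j))" by auto
  from eps_par[OF pp_rr_ind(2)[OF j]] obtain l2 :: int where l2: "(\<Sum>k\<in>{1..s}. of_nat (par k) * eps (rr j) k) = of_int l2" "even l2 \<longleftrightarrow> even (par (rr j))" by auto
  have "(\<Sum>k\<in>{1..s}. of_nat (par k) * word_deg (map Ge (j # js)) k)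
    = (\<Sum>k\<in>{1..s}. of_nat (par k) * eps (pp j) k) - (\<Sum>k\<in>{1..s}. of_nat (par k) * eps (rr j) k) + (\<Sum>k\<in>{1..s}. of_nat (par k) * word_deg (map Ge js) k)"
    unfolding sum_subtractf[symmetric] sum.distrib[symmetric] by (simp add: alpha_eq[OF j] algebra_simps)
  also have "\<dots> = of_int (l1 - l2 + l)" unfolding l l1 l2 by simp
  finally have s: "(\<Sum>k\<in>{1..s}. of_nat (par k) * word_deg (map Ge (j # js)) k) = of_int (l1 - l2 + l)" .
  have "even (l1 - l2 + l) \<longleftrightarrow> even (wpar (j # js))"
    using l(2) l1(2) l2(2) by (simp add: alpha_par_eq[OF j] even_add)
  with s show ?case by blast
qed

lemma wpar_wt: "set js \<subseteq> {1..s} \<Longrightarrow> even (wpar js + wt_par (word_deg (map Ge js)))"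
  using word_par_wt[of js] by (auto simp: wt_par_def)

lemma word_deg_Gf: "word_deg (map Gf js) = - word_deg (map Ge js)"
  by (induction js) (auto simp: fun_eq_iff algebra_simps)

lemma minus_one_par: "even (k + l) \<Longrightarrow> (-1 :: 'a::ring_1) ^ (p * k) = (-1) ^ (p * l)"
  by (auto simp: minus_one_power_iff even_add)

section \<open>Homogeneous elements and their derivatives\<close>

definition EWt :: "weight \<Rightarrow> free set" where
  "EWt \<mu> = {a \<in> free_on gens_e. \<forall>w\<in>Poly_Mapping.keys a. word_deg w = \<mu>}"

text \<open>Indexed by the negative of the degree, so that \<open>FWt \<mu>\<close> is paired with
  \<open>EWt \<mu>\<close>.\<close>

definition FWt :: "weight \<Rightarrow> free set" where
  "FWt \<mu> = {a \<in> free_on gens_f. \<forall>w\<in>Poly_Mapping.keys a. word_deg w = - \<mu>}"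

primrec letter :: "gen \<Rightarrow> nat" where
  "letter (Ge i) = i" | "letter (Gf i) = i" | "letter (Gk i) = i" | "letter (Gki i) = i"

lemma EWt_keys:
  assumes "A \<in> EWt \<mu>" "w \<in> Poly_Mapping.keys A"
  shows "map Ge (map letter w) = w" "set (map letter w) \<subseteq> {1..s}" "word_deg w = \<mu>"
proof -
  have w: "set w \<subseteq> gens_e" "word_deg w = \<mu>" using assms by (auto simp: EWt_def free_on_def)
  then show "word_deg w = \<mu>" by simp
  have "Ge (letter x) = x" "letter x \<in> {1..s}" if "x \<in> set w" for x
    using that w(1) by (auto simp: gens_e_def)
  then show "map Ge (map letter w) = w" "set (map letter w) \<subseteq> {1..s}"
    by (auto simp: map_idI o_def)
qed

lemma FWt_keys:
  assumes "A \<in> FWt \<mu>" "w \<in> Poly_Mapping.keys A"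
  shows "map Gf (map letter w) = w" "set (map letter w) \<subseteq> {1..s}" "word_deg w = - \<mu>"
proof -
  have w: "set w \<subseteq> gens_f" "word_deg w = - \<mu>" using assms by (auto simp: FWt_def free_on_def)
  then show "word_deg w = - \<mu>" by simp
  have "Gf (letter x) = x" "letter x \<in> {1..s}" if "x \<in> set w" for x
    using that w(1) by (auto simp: gens_f_def)
  then show "map Gf (map letter w) = w" "set (map letter w) \<subseteq> {1..s}"
    by (auto simp: map_idI o_def)
qed

lemma EWt_sum: "(\<And>x. x \<in> S \<Longrightarrow> f x \<in> EWt \<mu>) \<Longrightarrow> sum f S \<in> EWt \<mu>"
proof (induction S rule: infinite_finite_induct)
  case (insert x S)
  then have "f x \<in> EWt \<mu>" "sum f S \<in> EWt \<mu>" by auto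
  then have "f x + sum f S \<in> EWt \<mu>"
    using Poly_Mapping.keys_add[of "f x" "sum f S"] by (auto simp: EWt_def)
  with insert.hyps show ?case by simp
qed (simp_all add: EWt_def)

lemma EWt_single: "set u \<subseteq> {1..s} \<Longrightarrow> word_deg (map Ge u) = \<mu> \<Longrightarrow> Poly_Mapping.single (map Ge u) c \<in> EWt \<mu>"
proof -
  assume u: "set u \<subseteq> {1..s}" and d: "word_deg (map Ge u) = \<mu>"
  have "set (map Ge u) \<subseteq> gens_e" unfolding gens_e_def set_map using u by (rule image_mono)
  then show ?thesis using d by (simp add: EWt_def)
qed

lemma EWt_free: "A \<in> EWt \<mu> \<Longrightarrow> A \<in> free_on gens" "A \<in> FWt \<mu> \<Longrightarrow> A \<in> free_on gens"
  using free_on_mono[OF gens_k_sub(2)] free_on_mono[OF gens_k_sub(3)] by (auto simp: EWt_def FWt_def)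

text \<open>A skew derivation on words in the e_i, applied to representatives. Its class enters
  through its pairings and through its action on V.\<close>

definition deriv :: "nat \<Rightarrow> (nat list \<Rightarrow> nat list \<Rightarrow> K) \<Rightarrow> free \<Rightarrow> free" where
  "deriv i C A = (\<Sum>w\<in>Poly_Mapping.keys A. \<Sum>p<length w. if letter (w ! p) = i
      then Poly_Mapping.single (map Ge (take p (map letter w) @ drop (Suc p) (map letter w)))
             (Poly_Mapping.lookup A w * C (take p (map letter w)) (drop (Suc p) (map letter w)))
      else 0)"

lemma lx_deriv:
  assumes h: "scalar_hom h"
  shows "lx h \<phi> (deriv i C A) = lx h (\<lambda>w. rsum i (map letter w) (\<lambda>u v. h (C u v)) (\<lambda>u. \<phi> (map Ge u))) A"
proof -
  have hm: "h (a * b) = h a * h b" for a b using h by (simp add: scalar_hom_def)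
  show ?thesis
    unfolding deriv_def lx_sum[OF h] lx_def[of h _ A] rsum_def sum_distrib_left
    by (intro sum.cong) (auto simp: lx_single[OF h] hm mult.assoc)
qed

lemma deriv_EWt:
  assumes A: "A \<in> EWt \<mu>"
  shows "deriv i C A \<in> EWt (\<mu> - alpha i)"
  unfolding deriv_def
proof (intro EWt_sum)
  fix w p assume w: "w \<in> Poly_Mapping.keys A" and p: "p \<in> {..<length w}"
  let ?js = "map letter w"
  show "(if letter (w ! p) = i then Poly_Mapping.single (map Ge (take p ?js @ drop (Suc p) ?js))
     (Poly_Mapping.lookup A w * C (take p ?js) (drop (Suc p) ?js)) else 0) \<in> EWt (\<mu> - alpha i)"
  proof (cases "letter (w ! p) = i")
    case True
    have "?js = take p ?js @ i # drop (Suc p) ?js"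
      using True p id_take_nth_drop[of p ?js] by simp
    then have "word_deg (map Ge ?js) = word_deg (map Ge (take p ?js @ i # drop (Suc p) ?js))" by metis
    then have "word_deg (map Ge (take p ?js @ drop (Suc p) ?js)) = \<mu> - alpha i"
      using EWt_keys[OF A w] by (simp add: algebra_simps)
    moreover have "set (take p ?js @ drop (Suc p) ?js) \<subseteq> {1..s}"
      using EWt_keys(2)[OF A w] set_take_subset[of p ?js] set_drop_subset[of "Suc p" ?js] unfolding set_append by blast
    ultimately show ?thesis unfolding if_P[OF True] by (intro EWt_single)
  next
    case False
    then show ?thesis by (simp add: EWt_def)
  qed
qed

text \<open>\<open>cR\<close> and \<open>cL\<close> are the twists \<open>C1\<close> and
  \<open>C2\<close> of the raising instance: \<open>cR\<close> belongs to the derivative that is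
  followed by q^(h_i) on its right, \<open>cL\<close> to the one preceded by q^(-h_i).\<close>

definition cR :: "nat \<Rightarrow> nat list \<Rightarrow> nat list \<Rightarrow> K" where
  "cR i u v = (-1) ^ (alpha_par i * wpar v) * xq powi (2 * cs i v)"

definition cL :: "nat \<Rightarrow> nat list \<Rightarrow> nat list \<Rightarrow> K" where
  "cL i u v = (-1) ^ (alpha_par i * wpar v) * xq powi (2 * cs i u)"

lemma rep_word_commute:
  assumes js: "set js \<subseteq> {1..s}" and i: "i \<in> {1..s}" and a: "a \<in> ind" and c: "c \<in> ind"
  shows "mmult ind (rep_word (map Ge js)) (Ff i) a c = (-1) ^ (alpha_par i * wpar js) * mmult ind (Ff i) (rep_word (map Ge js)) a c
     + 1 / qdiff * (rsum i js (cR i) (\<lambda>u. rep_word (map Ge u) a c) * xq powi (2 * hh i c)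
            - xq powi (- 2 * hh i a) * rsum i js (cL i) (\<lambda>u. rep_word (map Ge u) a c))"
proof -
  interpret E: osp_half m n par th Ef Ff "\<lambda>i. 1 / qdiff" 1 1 "\<lambda>c. c" by (rule osp_half_E)
  have C: "E.C1 i = cR i" "E.C2 i = cL i"
    by (intro ext; simp add: E.C1_def E.C2_def cR_def cL_def)+
  have r: "rsum i js D (\<lambda>u. rep_word (map Ge u) a c) = rsum i js D (\<lambda>u. E.AW u a c)" for D
  proof (rule rsum_cong)
    fix u v assume "js = u @ i # v"
    then have "set (u @ v) \<subseteq> {1..s}" using js by auto
    then show "D u v * rep_word (map Ge (u @ v)) a c = D u v * E.AW (u @ v) a c"
      by (simp only: rep_word_Ge)
  qed
  show ?thesis
    unfolding r rep_word_Ge[OF js] using E.AW_B_commute[OF i c js a] by (simp add: C)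
qed

text \<open>\<open>rep_word_commute\<close> extended linearly. One sign serves for all words, since
  their common weight fixes the parity.\<close>

lemma rep_commute:
  assumes A: "A \<in> EWt \<mu>" and i: "i \<in> {1..s}"
  shows "mmult ind (rep_free A) (Ff i) = (-1) ^ (alpha_par i * wt_par \<mu>) *\<^sub>m mmult ind (Ff i) (rep_free A)
     + (1 / qdiff) *\<^sub>m (mmult ind (rep_free (deriv i (cR i) A)) (Kd i 2) - mmult ind (Kd i (-2)) (rep_free (deriv i (cL i) A)))"
    (is "?L = ?R")
proof (intro ext)
  fix a c
  have s: "msupp ind (rep_free A)" "msupp ind (rep_free (deriv i (cR i) A))" "msupp ind (rep_free (deriv i (cL i) A))"
    using EWt_free(1)[OF A] EWt_free(1)[OF deriv_EWt[OF A]] by (auto intro: msupp_rep_free)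
  show "?L a c = ?R a c"
  proof (cases "a \<in> ind \<and> c \<in> ind")
    case False
    have "msupp ind ?L" "msupp ind ?R"
      using s msupp_Ff[OF i] msupp_Kd by (auto intro!: msupp_add msupp_smult msupp_diff msupp_mmult)
    then show ?thesis using False msuppD[of ind ?L a c] msuppD[of ind ?R a c] by auto
  next
    case True
    then have ac: "a \<in> ind" "c \<in> ind" by auto
    let ?lx = "lx (\<lambda>c. c)"
    have 1: "mmult ind (rep_free A) (Ff i) a c = ?lx (\<lambda>w. mmult ind (rep_word w) (Ff i) a c) A"
      unfolding mmult_def rep_free_entry lx_sum_fun by (simp add: lx_scale_fun mult.commute[of _ "Ff i _ c"])
    have 2: "mmult ind (Ff i) (rep_free A) a c = ?lx (\<lambda>w. mmult ind (Ff i) (rep_word w) a c) A"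
      unfolding mmult_def rep_free_entry lx_sum_fun by (simp add: lx_scale_fun)
    have "?L a c = ?lx (\<lambda>w. (-1) ^ (alpha_par i * wt_par \<mu>) * mmult ind (Ff i) (rep_word w) a c
       + 1 / qdiff * (xq powi (2 * hh i c) * rsum i (map letter w) (cR i) (\<lambda>u. rep_word (map Ge u) a c)
            - xq powi (- 2 * hh i a) * rsum i (map letter w) (cL i) (\<lambda>u. rep_word (map Ge u) a c))) A"
      unfolding 1
    proof (rule lx_cong)
      fix w assume w: "w \<in> Poly_Mapping.keys A"
      note k = EWt_keys[OF A w]
      have "(-1) ^ (alpha_par i * wpar (map letter w)) = ((-1) ^ (alpha_par i * wt_par \<mu>) :: K)"
        using wpar_wt[OF k(2)] unfolding k(1,3) by (rule minus_one_par)
      with rep_word_commute[OF k(2) i ac] show "mmult ind (rep_word w) (Ff i) a c = (-1) ^ (alpha_par i * wt_par \<mu>) * mmult ind (Ff i) (rep_word w) a c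
       + 1 / qdiff * (xq powi (2 * hh i c) * rsum i (map letter w) (cR i) (\<lambda>u. rep_word (map Ge u) a c)
            - xq powi (- 2 * hh i a) * rsum i (map letter w) (cL i) (\<lambda>u. rep_word (map Ge u) a c))"
        unfolding k(1) by (simp add: mult.commute)
    qed
    also have "\<dots> = ?R a c"
      unfolding lx_add_fun lx_scale_fun lx_diff_fun using ac
      by (simp add: 2 mmult_Kd_left mmult_Kd_right rep_free_entry[of "deriv _ _ _"] lx_deriv[OF scalar_hom_id] mult.commute)
    finally show ?thesis .
  qed
qed

lemma homog_rep:
  assumes A: "A \<in> EWt \<mu>"
  shows "homog (wt_par \<mu>) (rep_free A)"
proof -
  have w: "set js \<subseteq> {1..s} \<Longrightarrow> homog (wpar js) (rep_word (map Ge js))" for js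
  proof (induction js)
    case (Cons j js)
    then show ?case using homog_mmult[OF homog_Ef[of j], of "wpar js"] by (simp add: rep_Ge del: rep_gen.simps)
  qed (simp add: homog_mone)
  show ?thesis
    unfolding homog_def
  proof (intro allI impI)
    fix a c assume "rep_free A a c \<noteq> 0"
    then obtain v where v: "v \<in> Poly_Mapping.keys A" "rep_word v a c \<noteq> 0"
      unfolding rep_free_entry lx_def by (metis (no_types, lifting) mult_zero_right sum.neutral)
    note k = EWt_keys[OF A v(1)]
    have "even (par a + par c + wpar (map letter v))"
      using w[OF k(2)] v(2) unfolding k(1) homog_def by blast
    then show "even (par a + par c + wt_par \<mu>)"
      using wpar_wt[OF k(2)] unfolding k(1,3) by (auto simp: even_add)
  qed
qed

lemma homog_rep_F:
  assumes A: "A \<in> FWt \<mu>"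
  shows "homog (wt_par \<mu>) (rep_free A)"
proof -
  have w: "set js \<subseteq> {1..s} \<Longrightarrow> homog (wpar js) (rep_word (map Gf js))" for js
  proof (induction js)
    case (Cons j js)
    then show ?case using homog_mmult[OF homog_Ff[of j], of "wpar js"] by (simp add: rep_Gf del: rep_gen.simps)
  qed (simp add: homog_mone)
  show ?thesis
    unfolding homog_def
  proof (intro allI impI)
    fix a c assume "rep_free A a c \<noteq> 0"
    then obtain v where v: "v \<in> Poly_Mapping.keys A" "rep_word v a c \<noteq> 0"
      unfolding rep_free_entry lx_def by (metis (no_types, lifting) mult_zero_right sum.neutral)
    note k = FWt_keys[OF A v(1)]
    have d: "word_deg (map Ge (map letter v)) = \<mu>"
      using k(1,3) word_deg_Gf[of "map letter v"] by simp
    have "even (par a + par c + wpar (map letter v))"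
      using w[OF k(2)] v(2) unfolding k(1) homog_def by blast
    then show "even (par a + par c + wt_par \<mu>)"
      using wpar_wt[OF k(2)] unfolding d by (auto simp: even_add)
  qed
qed

lemma rep_wt:
  assumes A: "A \<in> EWt \<mu>" and "rep_free A a c \<noteq> 0"
  shows "eps a = eps c + \<mu>"
proof -
  have w: "set js \<subseteq> {1..s} \<Longrightarrow> rep_word (map Ge js) a c \<noteq> 0 \<Longrightarrow> eps a = eps c + word_deg (map Ge js)" for js a
  proof (induction js arbitrary: a)
    case Nil
    then show ?case by (simp add: mone_def split: if_splits)
  next
    case (Cons j js)
    then have j: "j \<in> {1..s}" by simp
    have "(\<Sum>k\<in>ind. Ef j a k * rep_word (map Ge js) k c) \<noteq> 0"
      using Cons.prems(2) rep_Ge[OF j] by (simp add: mmult_def del: rep_gen.simps)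
    then obtain k where "Ef j a k * rep_word (map Ge js) k c \<noteq> 0" by (meson sum.not_neutral_contains_not_neutral)
    then show ?case using Cons.IH[of k] Cons.prems(1) Ef_wt[OF j, of a k] by (simp add: algebra_simps)
  qed
  obtain v where v: "v \<in> Poly_Mapping.keys A" "rep_word v a c \<noteq> 0"
    using assms(2) unfolding rep_free_entry lx_def by (metis (no_types, lifting) mult_zero_right sum.neutral)
  note k = EWt_keys[OF A v(1)]
  show ?thesis using w[OF k(2), unfolded k(1)] v(2) k(3) by simp
qed

text \<open>v_1 is a highest weight vector, and words of nonzero degree are nonempty.\<close>

lemma rep_first_col:
  assumes A: "A \<in> EWt \<mu>" and "\<mu> \<noteq> 0"
  shows "rep_free A a 1 = 0"
proof -
  interpret E: osp_half m n par th Ef Ff "\<lambda>i. 1 / qdiff" 1 1 "\<lambda>c. c" by (rule osp_half_E)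
  have "rep_word w a 1 = 0" if w: "w \<in> Poly_Mapping.keys A" for w
  proof -
    note k = EWt_keys[OF A w]
    have "map letter w \<noteq> []" using k(3) assms(2) by auto
    then show ?thesis using E.AW_k0[OF k(2)] rep_word_Ge[OF k(2)] unfolding k(1) by simp
  qed
  then show ?thesis unfolding rep_free_entry lx_def by simp
qed

end

section \<open>The root lattice and spans\<close>

context osp
begin

lemma word_deg_concat:
  "word_deg (map Ge (concat (map (\<lambda>i. replicate (c i) i) l))) k = (\<Sum>i\<leftarrow>l. of_nat (c i) * alpha i k)"
proof (induction l)
  case (Cons j l)
  have "word_deg (map Ge (replicate q j)) k = of_nat q * alpha j k" for q
    by (induction q) (simp_all add: algebra_simps)
  then show ?case using Cons by simp
qed simp

text \<open>Coefficients and words correspond: a word repeats each i as often as its coefficient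
  says, and conversely the coefficients count letters.\<close>

lemma pos_root_lattice_iff: "\<mu> \<in> pos_root_lattice \<longleftrightarrow> (\<exists>js. set js \<subseteq> {1..s} \<and> word_deg (map Ge js) = \<mu>)"
proof
  assume "\<mu> \<in> pos_root_lattice"
  then obtain c :: "nat \<Rightarrow> nat" where c: "\<mu> = (\<lambda>k. \<Sum>i=1..s. of_nat (c i) * alpha i k)"
    unfolding pos_root_lattice_def by blast
  let ?js = "concat (map (\<lambda>i. replicate (c i) i) [1..<Suc s])"
  have "word_deg (map Ge ?js) = \<mu>"
    unfolding c by (intro ext) (simp only: word_deg_concat interv_sum_list_conv_sum_set_nat atLeastLessThanSuc_atLeastAtMost set_upt)
  moreover have "set ?js \<subseteq> {1..s}" by auto
  ultimately show "\<exists>js. set js \<subseteq> {1..s} \<and> word_deg (map Ge js) = \<mu>" by blast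
next
  assume "\<exists>js. set js \<subseteq> {1..s} \<and> word_deg (map Ge js) = \<mu>"
  then obtain js where js: "set js \<subseteq> {1..s}" "word_deg (map Ge js) = \<mu>" by blast
  have "word_deg (map Ge js) k = (\<Sum>i=1..s. of_nat (count_list js i) * alpha i k)" for k
    using js(1)
  proof (induction js)
    case (Cons j js)
    have "(\<Sum>i=1..s. of_nat (count_list (j # js) i) * alpha i k)
      = (\<Sum>i=1..s. (if i = j then alpha j k else 0) + of_nat (count_list js i) * alpha i k)"
      by (intro sum.cong) (auto simp: algebra_simps)
    then show ?case using Cons by (simp add: sum.distrib)
  qed simp
  then show "\<mu> \<in> pos_root_lattice"
    unfolding pos_root_lattice_def using js(2) by blast
qed

lemma pos_root_lattice_step:
  assumes "i \<in> {1..s}" "\<mu> - alpha i \<in> pos_root_lattice"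
  shows "\<mu> \<in> pos_root_lattice" "even (alpha_par i + wt_par (\<mu> - alpha i) + wt_par \<mu>)"
proof -
  obtain js where js: "set js \<subseteq> {1..s}" "word_deg (map Ge js) = \<mu> - alpha i"
    using assms(2) unfolding pos_root_lattice_iff by blast
  then have d: "set (i # js) \<subseteq> {1..s}" "word_deg (map Ge (i # js)) = \<mu>"
    using assms(1) by simp_all
  then show "\<mu> \<in> pos_root_lattice" unfolding pos_root_lattice_iff by blast
  show "even (alpha_par i + wt_par (\<mu> - alpha i) + wt_par \<mu>)"
    using wpar_wt[OF js(1)] wpar_wt[OF d(1)] unfolding js(2) d(2) by (auto simp: even_add)
qed

lemma pos_root_lattice_0: "0 \<in> pos_root_lattice"
  unfolding pos_root_lattice_iff by (intro exI[of _ "[]"]) simp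

text \<open>The height with value s + 1 - k on eps k is positive on every simple root: it is 1 on a
  chain node, 3 on the last node of type D and 2 on that of type C.\<close>

lemma word_deg_eq_0:
  assumes "set js \<subseteq> {1..s}" "word_deg (map Ge js) = 0"
  shows "js = []"
proof -
  define ht :: "weight \<Rightarrow> rat" where "ht \<mu> = (\<Sum>k\<in>{1..s}. of_nat (s + 1 - k) * \<mu> k)" for \<mu>
  have hadd: "ht (x + y) = ht x + ht y" and diff: "ht (x - y) = ht x - ht y" and neg: "ht (- x) = - ht x" for x y
    by (simp_all add: ht_def algebra_simps sum.distrib sum_subtractf sum_negf)
  have e: "ht (eps a) = of_nat (s + 1 - a)" if "a \<in> {1..s}" for a
  proof -
    have "ht (eps a) = (\<Sum>k\<in>{1..s}. if k = a then of_nat (s + 1 - a) else 0)"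
      unfolding ht_def using that by (intro sum.cong) (auto simp: eps_def unit_wt_def)
    then show ?thesis using that by simp
  qed
  have pos: "ht (alpha i) > 0" if i: "i \<in> {1..s}" for i
    using i
  proof (cases rule: pp_rr_cases)
    case chain
    show ?thesis
    proof (cases "i < s")
      case True
      then have "i + 1 \<in> {1..s}" by auto
      then show ?thesis using e[OF i] e[of "i + 1"] chain i by (simp add: alpha_eq diff of_nat_diff)
    next
      case False
      then have "eps (i + 1) = 0" using chain by (auto simp: eps_def prime_def)
      then show ?thesis using e[OF i] chain i by (simp add: alpha_eq)
    qed
  next
    case D
    then have s: "s \<in> {1..s}" "s - 1 \<in> {1..s}" by auto
    have "eps (s + 1) = - eps s"
      using eps_prime[OF le_s_ind[OF s(1)]] D by (simp add: prime_def)
    then show ?thesis using e[OF s(1)] e[OF s(2)] D i by (simp add: alpha_eq diff neg hadd)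
  next
    case C
    then have s: "s \<in> {1..s}" by auto
    have "eps (s + 1) = - eps s"
      using eps_prime[OF le_s_ind[OF s]] C by (simp add: prime_def)
    then have "alpha i = eps s + eps s" using C i by (simp add: alpha_eq)
    then show ?thesis using e[OF s] C by (simp only: hadd)
  qed
  have "js \<noteq> [] \<Longrightarrow> set js \<subseteq> {1..s} \<Longrightarrow> ht (word_deg (map Ge js)) > 0" for js
  proof (induction js)
    case (Cons j js)
    have "ht (word_deg (map Ge js)) \<ge> 0"
      using Cons by (cases "js = []") (auto simp: ht_def less_imp_le)
    then have "ht (alpha j + word_deg (map Ge js)) > 0"
      unfolding hadd using pos[of j] Cons.prems by simp
    then show ?case by (simp only: list.map word_deg_simps gen_deg.simps)
  qed simp
  from this[of js] assms show ?thesis by (auto simp: ht_def)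
qed

lemma const_0: "const 0 = 0" and const_1: "const 1 = 1"
  by (simp_all add: const_def one_eq_single)

text \<open>Coefficients taken from \<open>scalars\<close> are classes of constants, so a
  combination in the quotient lifts to one in the free algebra.\<close>

lemma span_cls:
  assumes "\<forall>a<length Us. Us ! a = cls (Z a) \<and> Z a \<in> free_on gens" "u \<in> ring.Span Uq scalars Us"
  shows "\<exists>c. u = cls (\<Sum>a<length Us. const (c a) * Z a)"
  using assms
proof (induction Us arbitrary: Z u)
  case Nil
  interpret Q: ring Uq by (rule ring_Uq)
  from Nil show ?case by (simp add: cls_zero)
next
  case (Cons u0 Us)
  interpret Q: ring Uq by (rule ring_Uq)
  from Cons.prems(2) obtain k0 v where v: "u = cls (const k0) \<otimes>\<^bsub>Uq\<^esub> u0 \<oplus>\<^bsub>Uq\<^esub> v" "v \<in> Q.Span scalars Us"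
    by (auto simp: Q.line_extension_mem_iff scalars_def)
  have Z: "\<forall>a<length Us. Us ! a = cls (Z (Suc a)) \<and> Z (Suc a) \<in> free_on gens"
    using Cons.prems(1) by auto
  from Cons.IH[OF this v(2)] obtain c where c: "v = cls (\<Sum>a<length Us. const (c a) * Z (Suc a))" by blast
  have u0: "u0 = cls (Z 0)" "Z 0 \<in> free_on gens" using Cons.prems(1) by auto
  have fr: "(\<Sum>a<length Us. const (c a) * Z (Suc a)) \<in> free_on gens" using Z by (intro free_on_sum free_on_mult) auto
  have "u = cls (const k0 * Z 0 + (\<Sum>a<length Us. const (c a) * Z (Suc a)))"
    unfolding v(1) c u0(1) using u0(2) fr by (simp add: cls_mult cls_add)
  also have "const k0 * Z 0 + (\<Sum>a<length Us. const (c a) * Z (Suc a)) = (\<Sum>a<length (u0 # Us). const (case_nat k0 c a) * Z a)"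
    by (simp add: sum.lessThan_Suc_shift del: sum.lessThan_Suc)
  finally show ?case by blast
qed

lemma cls_carrier: "a \<in> free_on gens \<Longrightarrow> cls a \<in> carrier Uq"
  using ring_hom_closed[OF cls_hom, of a] by simp

text \<open>Independence puts the members into the carrier, and \<open>scalars\<close> contains 0
  and 1.\<close>

lemma span_member:
  assumes "ring.independent Uq scalars Us" "u \<in> set Us"
  shows "u \<in> ring.Span Uq scalars Us"
proof -
  interpret Q: ring Uq by (rule ring_Uq)
  have s: "\<zero>\<^bsub>Uq\<^esub> \<in> scalars" "\<one>\<^bsub>Uq\<^esub> \<in> scalars"
    unfolding scalars_def cls_zero[symmetric] cls_one[symmetric] by (metis const_0 rangeI, metis const_1 rangeI)
  have car: "scalars \<subseteq> carrier Uq" unfolding scalars_def by (auto intro: cls_carrier)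
  have "\<zero>\<^bsub>Uq\<^esub> \<in> Q.Span scalars Us \<and> Q.Span scalars Us \<subseteq> carrier Uq \<and> (\<forall>u\<in>set Us. u \<in> Q.Span scalars Us)"
    using assms(1)
  proof (induction Us rule: list.induct)
    case Nil
    show ?case by simp
  next
    case (Cons u Us)
    from Cons.prems have u: "u \<in> carrier Uq" and ind: "Q.independent scalars Us"
      by (auto elim: Q.independent.cases)
    note IH = Cons.IH[OF ind]
    have Sp: "x \<in> Q.Span scalars (u # Us) \<longleftrightarrow> (\<exists>k\<in>scalars. \<exists>v\<in>Q.Span scalars Us. x = k \<otimes>\<^bsub>Uq\<^esub> u \<oplus>\<^bsub>Uq\<^esub> v)" for x
      by (simp add: Q.line_extension_mem_iff)
    have v: "v \<in> Q.Span scalars (u # Us)" if "v \<in> Q.Span scalars Us" for v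
    proof -
      have "v \<in> carrier Uq" using that IH by blast
      then have "v = \<zero>\<^bsub>Uq\<^esub> \<otimes>\<^bsub>Uq\<^esub> u \<oplus>\<^bsub>Uq\<^esub> v" using u by simp
      then show ?thesis unfolding Sp using s(1) that by blast
    qed
    have "u = \<one>\<^bsub>Uq\<^esub> \<otimes>\<^bsub>Uq\<^esub> u \<oplus>\<^bsub>Uq\<^esub> \<zero>\<^bsub>Uq\<^esub>" using u by simp
    then have 1: "u \<in> Q.Span scalars (u # Us)" unfolding Sp using s(2) IH by blast
    have 2: "Q.Span scalars (u # Us) \<subseteq> carrier Uq"
    proof
      fix x assume "x \<in> Q.Span scalars (u # Us)"
      then obtain k v where kv: "k \<in> scalars" "v \<in> Q.Span scalars Us" "x = k \<otimes>\<^bsub>Uq\<^esub> u \<oplus>\<^bsub>Uq\<^esub> v"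
        unfolding Sp by blast
      have "k \<in> carrier Uq" "v \<in> carrier Uq" using kv car IH by blast+
      then show "x \<in> carrier Uq" unfolding kv(3) using u by simp
    qed
    show ?case using 1 2 v IH by auto
  qed
  then show ?thesis using assms(2) by blast
qed

end

section \<open>The quasi R-matrix\<close>

context osp_pairing
begin

lemma EWt_GE: "A \<in> EWt \<mu> \<Longrightarrow> A \<in> free_on GE" "A \<in> FWt \<mu> \<Longrightarrow> A \<in> free_on GF"
  using free_on_mono[of gens_e GE A] free_on_mono[of gens_f GF A] by (auto simp: EWt_def FWt_def GE_def GF_def)

lemma P_word_expand:
  assumes "b \<in> free_on GF" "a \<in> free_on GE"
  shows "P (cls b) (cls a) = lx K_to_L (\<lambda>y. lx K_to_L (Pw y) a) b"
  unfolding P_expand_left[OF assms] Pw_def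
  using free_onD[OF assms(1)] by (intro lx_cong P_expand_right assms(2)) simp

lemma K_to_L_sign: "K_to_L ((-1) ^ k) = (-1) ^ k"
  by simp

text \<open>The parities of u and v add up to that of \<nu>, so the sign of the prefix may be
  exchanged for that of the suffix at the price of a fixed sign. \<open>xq powi (4 * cs i v)\<close>
  in \<open>L\<close> is the image of the power in \<open>cR\<close>.\<close>

lemma Pw_cR:
  assumes i: "i \<in> {1..s}" and ys: "set ys \<subseteq> {1..s}" and js: "set js \<subseteq> {1..s}" and d: "word_deg (map Ge js) = \<nu> + alpha i"
  shows "Pw (map Gf ys @ [Gf i]) (map Ge js)
    = gam i * (-1) ^ (alpha_par i * wt_par \<nu>) * rsum i js (\<lambda>u v. K_to_L (cR i u v)) (\<lambda>u. Pw (map Gf ys) (map Ge u))"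
proof -
  have "rsum i js (\<lambda>u v. (-1) ^ (alpha_par i * wpar u) * xq powi (4 * cs i v)) (\<lambda>u. Pw (map Gf ys) (map Ge u))
    = rsum i js (\<lambda>u v. (-1) ^ (alpha_par i * wt_par \<nu>) * K_to_L (cR i u v)) (\<lambda>u. Pw (map Gf ys) (map Ge u))"
  proof (rule rsum_cong)
    fix u v assume w: "js = u @ i # v"
    have "set (u @ v) \<subseteq> {1..s}" "word_deg (map Ge (u @ v)) = \<nu>"
      using js d unfolding w by (auto simp: algebra_simps)
    from wpar_wt[OF this(1)] this(2) have "even (wpar u + (wt_par \<nu> + wpar v))"
      by (auto simp: even_add)
    note s = minus_one_par[OF this, of "alpha_par i", where 'a=L]
    have "(-1) ^ (alpha_par i * wpar u) * xq powi (4 * cs i v) = (-1) ^ (alpha_par i * wt_par \<nu>) * K_to_L (cR i u v)"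
      unfolding s cR_def K_to_L_mult K_to_L_sign K_to_L_xq_powi by (simp add: distrib_left power_add mult.assoc)
    then show "(-1) ^ (alpha_par i * wpar u) * xq powi (4 * cs i v) * Pw (map Gf ys) (map Ge (u @ v))
        = (-1) ^ (alpha_par i * wt_par \<nu>) * K_to_L (cR i u v) * Pw (map Gf ys) (map Ge (u @ v))"
      by (rule arg_cong)
  qed
  then show ?thesis unfolding Pw_Gf_right[OF i ys js] rsum_scale mult.assoc by (rule arg_cong)
qed

lemma Pw_cL:
  assumes i: "i \<in> {1..s}" and ys: "set ys \<subseteq> {1..s}" and js: "set js \<subseteq> {1..s}"
    and d: "word_deg (map Ge js) = word_deg (map Ge ys) + alpha i"
  shows "Pw (Gf i # map Gf ys) (map Ge js) = gam i * rsum i js (\<lambda>u v. K_to_L (cL i u v)) (\<lambda>u. Pw (map Gf ys) (map Ge u))"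
proof -
  let ?e = "(-1) ^ (alpha_par i * wpar ys) :: L"
  have "?e * rsum i js (\<lambda>u v. (-1) ^ (alpha_par i * wpar u) * xq powi (4 * cs i u)) (\<lambda>u. Pw (map Gf ys) (map Ge u))
    = rsum i js (\<lambda>u v. K_to_L (cL i u v)) (\<lambda>u. Pw (map Gf ys) (map Ge u))"
    unfolding rsum_scale[symmetric]
  proof (rule rsum_cong)
    fix u v assume w: "js = u @ i # v"
    have "set (u @ v) \<subseteq> {1..s}" "word_deg (map Ge (u @ v)) = word_deg (map Ge ys)"
      using js d unfolding w by (auto simp: algebra_simps)
    from wpar_wt[OF this(1)] this(2) wpar_wt[OF ys] have "even (wpar ys + wpar u + wpar v)"
      by (auto simp: even_add)
    note s = minus_one_par[OF this, of "alpha_par i", where 'a=L, symmetric]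
    have "?e * ((-1) ^ (alpha_par i * wpar u) * xq powi (4 * cs i u)) = K_to_L (cL i u v)"
      unfolding cL_def K_to_L_mult K_to_L_sign K_to_L_xq_powi s by (simp add: distrib_left power_add mult.assoc)
    then show "?e * ((-1) ^ (alpha_par i * wpar u) * xq powi (4 * cs i u)) * Pw (map Gf ys) (map Ge (u @ v))
      = K_to_L (cL i u v) * Pw (map Gf ys) (map Ge (u @ v))"
      by (rule arg_cong)
  qed
  then show ?thesis
    unfolding Pw_Gf_left[OF i map_Gf_sub[OF ys] js] word_par_map mult.left_commute[of _ "gam i"] mult.assoc
    by (rule arg_cong)
qed

lemma FWt_mult_gen1:
  assumes i: "i \<in> {1..s}" and Y: "Y \<in> FWt (\<mu> - alpha i)"
  shows "Y * gen1 (Gf i) \<in> FWt \<mu>" "gen1 (Gf i) * Y \<in> FWt \<mu>"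
proof -
  have g: "gen1 (Gf i) \<in> free_on gens_f" using i by (simp add: gens_f_def)
  have Y': "Y \<in> free_on gens_f" "\<And>w. w \<in> Poly_Mapping.keys Y \<Longrightarrow> word_deg w = alpha i - \<mu>"
    using Y by (auto simp: FWt_def)
  show "Y * gen1 (Gf i) \<in> FWt \<mu>" "gen1 (Gf i) * Y \<in> FWt \<mu>"
    using keys_mult[of Y "gen1 (Gf i)"] keys_mult[of "gen1 (Gf i)" Y] Y' g
    by (auto simp: FWt_def gen1_def plus_list_def dest!: subsetD)
qed

text \<open>Adjointness of multiplication by f_i and the two derivatives, reduced to single words.
  Both scalars come from \<open>K\<close>, by \<open>gam_K\<close>.\<close>

lemma P_deriv:
  assumes i: "i \<in> {1..s}" and Y: "Y \<in> FWt (\<mu> - alpha i)" and A: "A \<in> EWt \<mu>"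
  shows "P (cls (Y * gen1 (Gf i))) (cls A)
      = gam i * (-1) ^ (alpha_par i * wt_par (\<mu> - alpha i)) * P (cls Y) (cls (deriv i (cR i) A))"
    "P (cls (gen1 (Gf i) * Y)) (cls A) = gam i * P (cls Y) (cls (deriv i (cL i) A))"
proof -
  note g = EWt_GE(2)[OF FWt_mult_gen1(1)[OF i Y]] EWt_GE(2)[OF FWt_mult_gen1(2)[OF i Y]]
  note h = scalar_hom_K_to_L
  have y: "Pw (y @ [Gf i]) w = gam i * (-1) ^ (alpha_par i * wt_par (\<mu> - alpha i)) * rsum i (map letter w) (\<lambda>u v. K_to_L (cR i u v)) (\<lambda>u. Pw y (map Ge u))"
    "Pw (Gf i # y) w = gam i * rsum i (map letter w) (\<lambda>u v. K_to_L (cL i u v)) (\<lambda>u. Pw y (map Ge u))"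
    if yw: "y \<in> Poly_Mapping.keys Y" "w \<in> Poly_Mapping.keys A" for y w
  proof -
    note a = EWt_keys[OF A yw(2)] and b = FWt_keys[OF Y yw(1)]
    have "word_deg (map Gf (map letter y)) = - (\<mu> - alpha i)" unfolding b(1) by (rule b(3))
    then have "word_deg (map Ge (map letter y)) = \<mu> - alpha i"
      unfolding word_deg_Gf by (simp only: neg_equal_iff_equal)
    then have d: "word_deg (map Ge (map letter w)) = word_deg (map Ge (map letter y)) + alpha i"
      "word_deg (map Ge (map letter w)) = (\<mu> - alpha i) + alpha i"
      unfolding a(1) a(3) by simp_all
    show "Pw (y @ [Gf i]) w = gam i * (-1) ^ (alpha_par i * wt_par (\<mu> - alpha i)) * rsum i (map letter w) (\<lambda>u v. K_to_L (cR i u v)) (\<lambda>u. Pw y (map Ge u))"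
      using Pw_cR[OF i b(2) a(2) d(2)] unfolding a(1) b(1) .
    show "Pw (Gf i # y) w = gam i * rsum i (map letter w) (\<lambda>u v. K_to_L (cL i u v)) (\<lambda>u. Pw y (map Ge u))"
      using Pw_cL[OF i b(2) a(2) d(1)] unfolding a(1) b(1) .
  qed
  note dE = EWt_GE(1)[OF deriv_EWt[OF A]]
  show "P (cls (Y * gen1 (Gf i))) (cls A)
      = gam i * (-1) ^ (alpha_par i * wt_par (\<mu> - alpha i)) * P (cls Y) (cls (deriv i (cR i) A))"
    unfolding P_word_expand[OF g(1) EWt_GE(1)[OF A]] P_word_expand[OF EWt_GE(2)[OF Y] dE]
    unfolding lx_mult[OF h] gen1_def lx_single[OF h] lx_deriv[OF h] lx_scale_fun[symmetric] K_to_L_1 mult_1_left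
    by (intro lx_cong y)
  show "P (cls (gen1 (Gf i) * Y)) (cls A) = gam i * P (cls Y) (cls (deriv i (cL i) A))"
    unfolding P_word_expand[OF g(2) EWt_GE(1)[OF A]] P_word_expand[OF EWt_GE(2)[OF Y] dE]
    unfolding lx_mult[OF h] gen1_def lx_single[OF h] lx_deriv[OF h] lx_scale_fun[symmetric] K_to_L_1 mult_1_left append.simps
    by (intro lx_cong y)
qed

lemma P_sum_right: "b \<in> free_on GF \<Longrightarrow> (\<And>a. a < k \<Longrightarrow> A a \<in> free_on GE) \<Longrightarrow>
    P (cls b) (cls (\<Sum>a<k. const (c a) * A a)) = (\<Sum>a<k. K_to_L (c a) * P (cls b) (cls (A a)))" for k :: nat
proof (induction k)
  case 0
  then show ?case by (simp add: P_expand_right)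
next
  case (Suc k)
  have "(\<Sum>a<k. const (c a) * A a) \<in> free_on GE"
    by (intro free_on_sum free_on_mult free_on_const Suc.prems) simp
  with Suc show ?case by (simp add: P_add_right P_scale_right)
qed

lemma P_sum_left: "b \<in> free_on GE \<Longrightarrow> (\<And>a. a < k \<Longrightarrow> A a \<in> free_on GF) \<Longrightarrow>
    P (cls (\<Sum>a<k. const (c a) * A a)) (cls b) = (\<Sum>a<k. K_to_L (c a) * P (cls (A a)) (cls b))" for k :: nat
proof (induction k)
  case 0
  then show ?case by (simp add: P_expand_left)
next
  case (Suc k)
  have "(\<Sum>a<k. const (c a) * A a) \<in> free_on GF"
    by (intro free_on_sum free_on_mult free_on_const Suc.prems) simp
  with Suc show ?case by (simp add: P_add_left P_scale_left)
qed

lemma rep_free_sum: "(\<And>a. a < k \<Longrightarrow> A a \<in> free_on gens) \<Longrightarrow>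
    rep_free (\<Sum>a<k. const (c a) * A a) = (\<Sum>a<k. c a *\<^sub>m rep_free (A a))" for k :: nat
  by (induction k) (simp_all add: rep_free_add rep_free_const_mult rep_free_def[of 0])

section \<open>Expansion in dual bases\<close>

definition dual_reps :: "weight \<Rightarrow> nat \<Rightarrow> (nat \<Rightarrow> free) \<Rightarrow> (nat \<Rightarrow> free) \<Rightarrow> bool" where
  "dual_reps \<mu> k A B \<longleftrightarrow> (\<forall>a<k. A a \<in> EWt \<mu> \<and> B a \<in> FWt \<mu>)
     \<and> (\<forall>a<k. \<forall>b<k. P (cls (B a)) (cls (A b)) = (if a = b then 1 else 0))
     \<and> (\<forall>Z\<in>EWt \<mu>. \<exists>c. cls Z = cls (\<Sum>a<k. const (c a) * A a))
     \<and> (\<forall>Z\<in>FWt \<mu>. \<exists>c. cls Z = cls (\<Sum>a<k. const (c a) * B a))"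

text \<open>The pairing of elements of \<open>U\<^sup>-\<close> and \<open>U\<^sup>+\<close> takes values in the smaller field \<open>K\<close>.\<close>

definition pc :: "free \<Rightarrow> free \<Rightarrow> K" where
  "pc Y A = (THE c. K_to_L c = P (cls Y) (cls A))"

lemma pcI: "P (cls Y) (cls A) = K_to_L c \<Longrightarrow> pc Y A = c"
  unfolding pc_def by (rule the_equality) simp_all

text \<open>Pairing an expansion with the dual basis identifies its coefficients with pairings; as
  the span is taken over \<open>K\<close>, these values lie in \<open>K\<close>. Equality holds for
  classes, hence for the action on V.\<close>

lemma dual_reps_expand:
  assumes D: "dual_reps \<mu> k A B"
  shows "Z \<in> EWt \<mu> \<Longrightarrow> rep_free Z = (\<Sum>a<k. pc (B a) Z *\<^sub>m rep_free (A a))"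
    "Z \<in> EWt \<mu> \<Longrightarrow> a < k \<Longrightarrow> P (cls (B a)) (cls Z) = K_to_L (pc (B a) Z)"
    "Z \<in> FWt \<mu> \<Longrightarrow> rep_free Z = (\<Sum>a<k. pc Z (A a) *\<^sub>m rep_free (B a))"
proof -
  have AB: "A a \<in> free_on GE" "B a \<in> free_on GF" "A a \<in> free_on gens" "B a \<in> free_on gens" if "a < k" for a
    using D that EWt_GE EWt_free unfolding dual_reps_def by blast+
  have \<delta>: "P (cls (B a)) (cls (A b)) = (if a = b then 1 else 0)" if "a < k" "b < k" for a b
    using D that unfolding dual_reps_def by blast
  have E: "rep_free Z = (\<Sum>a<k. pc (B a) Z *\<^sub>m rep_free (A a)) \<and> (\<forall>a<k. P (cls (B a)) (cls Z) = K_to_L (pc (B a) Z))"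
    if Z: "Z \<in> EWt \<mu>"
  proof -
    obtain c where c: "cls Z = cls (\<Sum>a<k. const (c a) * A a)" using D Z unfolding dual_reps_def by blast
    have P: "P (cls (B b)) (cls Z) = K_to_L (c b)" if "b < k" for b
    proof -
      have "P (cls (B b)) (cls Z) = (\<Sum>a<k. K_to_L (c a) * P (cls (B b)) (cls (A a)))"
        unfolding c by (rule P_sum_right) (use AB that in auto)
      also have "\<dots> = (\<Sum>a<k. if a = b then K_to_L (c b) else 0)"
        using that by (intro sum.cong) (auto simp: \<delta>)
      finally show ?thesis using that by simp
    qed
    have "rep_free Z = rep_free (\<Sum>a<k. const (c a) * A a)"
      unfolding rep_cls[OF EWt_free(1)[OF Z], symmetric] c
      by (intro rep_cls free_on_sum free_on_mult free_on_const AB(3)) simp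
    also have "\<dots> = (\<Sum>a<k. c a *\<^sub>m rep_free (A a))" using AB by (intro rep_free_sum)
    also have "\<dots> = (\<Sum>a<k. pc (B a) Z *\<^sub>m rep_free (A a))"
      by (intro sum.cong refl) (simp add: pcI[OF P])
    finally show ?thesis using P pcI[OF P] by simp
  qed
  then show "Z \<in> EWt \<mu> \<Longrightarrow> rep_free Z = (\<Sum>a<k. pc (B a) Z *\<^sub>m rep_free (A a))"
    "Z \<in> EWt \<mu> \<Longrightarrow> a < k \<Longrightarrow> P (cls (B a)) (cls Z) = K_to_L (pc (B a) Z)" by blast+
  show "rep_free Z = (\<Sum>a<k. pc Z (A a) *\<^sub>m rep_free (B a))" if Z: "Z \<in> FWt \<mu>"
  proof -
    obtain c where c: "cls Z = cls (\<Sum>a<k. const (c a) * B a)" using D Z unfolding dual_reps_def by blast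
    have P: "P (cls Z) (cls (A b)) = K_to_L (c b)" if "b < k" for b
    proof -
      have "P (cls Z) (cls (A b)) = (\<Sum>a<k. K_to_L (c a) * P (cls (B a)) (cls (A b)))"
        unfolding c by (rule P_sum_left) (use AB that in auto)
      also have "\<dots> = (\<Sum>a<k. if a = b then K_to_L (c b) else 0)"
        using that by (intro sum.cong) (auto simp: \<delta>)
      finally show ?thesis using that by simp
    qed
    have "rep_free Z = rep_free (\<Sum>a<k. const (c a) * B a)"
      unfolding rep_cls[OF EWt_free(2)[OF Z], symmetric] c
      by (intro rep_cls free_on_sum free_on_mult free_on_const AB(4)) simp
    also have "\<dots> = (\<Sum>a<k. c a *\<^sub>m rep_free (B a))" using AB by (intro rep_free_sum)
    also have "\<dots> = (\<Sum>a<k. pc Z (A a) *\<^sub>m rep_free (B a))"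
      by (intro sum.cong refl) (simp add: pcI[OF P])
    finally show ?thesis .
  qed
qed

end

lemma smult_sum: "c *\<^sub>m (\<Sum>x\<in>S. f x) = (\<Sum>x\<in>S. c *\<^sub>m f x)" for f :: "'b \<Rightarrow> ('i, K) matr"
  by (intro ext) (simp add: sum_matr_apply sum_distrib_left)

lemma smult_smult: "c *\<^sub>m (d *\<^sub>m A) = (c * d) *\<^sub>m A" for A :: "('i, K) matr"
  by (intro ext) (simp add: mult.assoc)

context osp_pairing
begin

text \<open>By \<open>word_deg_eq_0\<close> only constants have degree 0. The summand 1 of \<Theta>
  thus becomes the term of degree 0.\<close>

lemma dual_reps_0: "dual_reps 0 1 (\<lambda>_. 1) (\<lambda>_. 1)"
proof -
  have c: "Z = const (Poly_Mapping.lookup Z [])" if k: "\<And>w. w \<in> Poly_Mapping.keys Z \<Longrightarrow> w = []" for Z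
  proof (rule poly_mapping_eqI)
    fix w show "Poly_Mapping.lookup Z w = Poly_Mapping.lookup (const (Poly_Mapping.lookup Z [])) w"
      using k[of w] by (cases "w = []") (auto simp: const_def lookup_single when_def in_keys_iff)
  qed
  have E: "w = []" if "Z \<in> EWt 0" "w \<in> Poly_Mapping.keys Z" for Z w
    using EWt_keys[OF that] word_deg_eq_0[of "map letter w"] by simp
  have F: "w = []" if Z: "Z \<in> FWt 0" "w \<in> Poly_Mapping.keys Z" for Z w
  proof -
    note k = FWt_keys[OF Z]
    have "word_deg (map Gf (map letter w)) = - 0" unfolding k(1) by (rule k(3))
    then have "word_deg (map Ge (map letter w)) = 0" unfolding word_deg_Gf by (simp only: neg_equal_iff_equal)
    then show ?thesis using word_deg_eq_0[OF k(2)] by simp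
  qed
  have "(1 :: free) \<in> EWt 0" "(1 :: free) \<in> FWt 0"
    by (simp_all add: EWt_def FWt_def one_eq_single)
  moreover have "P (cls 1) (cls 1) = 1" using Pw_Nil_Nil unfolding Pw_def one_eq_single .
  moreover have "\<exists>c. cls Z = cls (\<Sum>a<1::nat. const (c a) * 1)" if "\<And>w. w \<in> Poly_Mapping.keys Z \<Longrightarrow> w = []" for Z
    using c[OF that] by (intro exI[of _ "\<lambda>_. Poly_Mapping.lookup Z []"]) simp
  ultimately show ?thesis unfolding dual_reps_def using E F by auto
qed

lemma mtensor_mone: "mtensor (mone ind) (mone ind) = mone ind2"
  by (auto simp: fun_eq_iff mtensor_def mone_def ind2_def power_mult simp flip: mult_2)

end

locale osp_theta = osp_pairing +
  fixes xs ys :: "weight \<Rightarrow> free set list"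
  assumes D: "dual_bases P xs ys"
begin

text \<open>The term of degree \<mu>, extended by 0 outside the positive lattice so that the
  recursion \<open>Tw_relation\<close> can be stated for every \<mu>.\<close>

definition Tw :: "weight \<Rightarrow> (nat \<times> nat, K) matr" where
  "Tw \<mu> = (if \<mu> \<notin> pos_root_lattice then 0 else if \<mu> = 0 then mone ind2 else Theta_wt xs ys \<mu>)"

lemma Tw_reps:
  assumes \<mu>: "\<mu> \<in> pos_root_lattice"
  shows "\<exists>k A B. dual_reps \<mu> k A B \<and> Tw \<mu> = (\<Sum>a<k. mtensor (rep_free (A a)) (rep_free (B a)))"
proof (cases "\<mu> = 0")
  case True
  have "Tw \<mu> = (\<Sum>a<1::nat. mtensor (rep_free 1) (rep_free 1))"
    using \<mu> True by (simp add: Tw_def rep_free_1 mtensor_mone)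
  then show ?thesis using dual_reps_0 unfolding True by blast
next
  case False
  then have d: "ring.independent Uq scalars (xs \<mu>)" "ring.Span Uq scalars (xs \<mu>) = cls ` EWt \<mu>"
    "ring.independent Uq scalars (ys \<mu>)" "ring.Span Uq scalars (ys \<mu>) = cls ` FWt \<mu>"
    "length (xs \<mu>) = length (ys \<mu>)"
    and \<delta>: "\<forall>a<length (ys \<mu>). \<forall>b<length (xs \<mu>). P (ys \<mu> ! a) (xs \<mu> ! b) = (if a = b then 1 else 0)"
    using D \<mu> unfolding dual_bases_def U_plus_wt_def U_minus_wt_def EWt_def FWt_def by blast+
  define k where "k = length (ys \<mu>)"
  have "\<forall>a. \<exists>x. a < k \<longrightarrow> x \<in> EWt \<mu> \<and> xs \<mu> ! a = cls x"
    using span_member[OF d(1)] d(2) d(5) unfolding k_def by (metis imageE nth_mem)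
  from choice[OF this] obtain A where A: "\<And>a. a < k \<Longrightarrow> A a \<in> EWt \<mu> \<and> xs \<mu> ! a = cls (A a)" by blast
  have "\<forall>a. \<exists>x. a < k \<longrightarrow> x \<in> FWt \<mu> \<and> ys \<mu> ! a = cls x"
    using span_member[OF d(3)] d(4) unfolding k_def by (metis imageE nth_mem)
  from choice[OF this] obtain B where B: "\<And>a. a < k \<Longrightarrow> B a \<in> FWt \<mu> \<and> ys \<mu> ! a = cls (B a)" by blast
  have l: "length (xs \<mu>) = k" "length (ys \<mu>) = k" using d(5) by (simp_all add: k_def)
  have sx: "\<forall>a<length (xs \<mu>). xs \<mu> ! a = cls (A a) \<and> A a \<in> free_on gens"
    and sy: "\<forall>a<length (ys \<mu>). ys \<mu> ! a = cls (B a) \<and> B a \<in> free_on gens"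
    using A B EWt_free unfolding l by blast+
  have "dual_reps \<mu> k A B"
    unfolding dual_reps_def
  proof (intro conjI)
    show "\<forall>a<k. \<forall>b<k. P (cls (B a)) (cls (A b)) = (if a = b then 1 else 0)"
    proof (intro allI impI)
      fix a b assume ab: "a < k" "b < k"
      then have "P (ys \<mu> ! a) (xs \<mu> ! b) = (if a = b then 1 else 0)" using \<delta> unfolding l by blast
      then show "P (cls (B a)) (cls (A b)) = (if a = b then 1 else 0)"
        using A[OF ab(2)] B[OF ab(1)] by metis
    qed
    show "\<forall>Z\<in>EWt \<mu>. \<exists>c. cls Z = cls (\<Sum>a<k. const (c a) * A a)"
      using span_cls[OF sx] unfolding d(2) l by blast
    show "\<forall>Z\<in>FWt \<mu>. \<exists>c. cls Z = cls (\<Sum>a<k. const (c a) * B a)"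
      using span_cls[OF sy] unfolding d(4) l by blast
  qed (use A B in blast)
  moreover have "Tw \<mu> = (\<Sum>a<k. mtensor (rep_free (A a)) (rep_free (B a)))"
  proof -
    have "mtensor (rep (xs \<mu> ! a)) (rep (ys \<mu> ! a)) = mtensor (rep_free (A a)) (rep_free (B a))" if "a < k" for a
      using A[OF that] B[OF that] EWt_free rep_cls by metis
    then show ?thesis using \<mu> False unfolding Tw_def Theta_wt_def l by simp
  qed
  ultimately show ?thesis by blast
qed

text \<open>Commuting f_i with x_a produces derivatives r(x_a). By adjointness, the sum of r(x_a)
  \<otimes> y_a over degree \<mu> is a multiple of the sum of x'_b \<otimes> y'_b f_i over degree
  \<mu> - alpha i: the coefficients are the pairings of y'_b with r(x_a) and of y'_b f_i with x_a.
  The other derivative gives f_i y'_b in the same way.\<close>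

lemma Tw_relation:
  assumes i: "i \<in> {1..s}"
  shows "mmult ind2 (Tw \<mu>) (mtensor (Ff i) (mone ind)) + mmult ind2 (Tw (\<mu> - alpha i)) (mtensor (Kd i 2) (Ff i))
    = mmult ind2 (mtensor (Ff i) (mone ind)) (Tw \<mu>) + mmult ind2 (mtensor (Kd i (-2)) (Ff i)) (Tw (\<mu> - alpha i))"
proof (cases "\<mu> \<in> pos_root_lattice")
  case False
  then have "Tw \<mu> = 0" "Tw (\<mu> - alpha i) = 0"
    using pos_root_lattice_step(1)[OF i] by (auto simp: Tw_def)
  then show ?thesis by simp
next
  case True
  define \<nu> where "\<nu> = \<mu> - alpha i"
  obtain k A B where AB: "dual_reps \<mu> k A B" "Tw \<mu> = (\<Sum>a<k. mtensor (rep_free (A a)) (rep_free (B a)))"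
    using Tw_reps[OF True] by blast
  have A: "A a \<in> EWt \<mu>" and B: "B a \<in> FWt \<mu>" if "a < k" for a
    using AB(1) that unfolding dual_reps_def by blast+
  define R1 R2 where "R1 a = rep_free (deriv i (cR i) (A a))" and "R2 a = rep_free (deriv i (cL i) (A a))" for a
  define M0 M1 M2 where "M0 a = mtensor (mmult ind (Ff i) (rep_free (A a))) (rep_free (B a))"
    and "M1 a = mtensor (mmult ind (R1 a) (Kd i 2)) (rep_free (B a))"
    and "M2 a = mtensor (mmult ind (Kd i (-2)) (R2 a)) (rep_free (B a))" for a
  define \<sigma> :: K where "\<sigma> = (-1) ^ (alpha_par i * wt_par \<mu>)"
  have \<sigma>: "\<sigma> * \<sigma> = 1" by (simp add: \<sigma>_def minus_one_power_iff)
  have L1: "mmult ind2 (Tw \<mu>) (mtensor (Ff i) (mone ind)) = (\<Sum>a<k. M0 a + (\<sigma> / qdiff) *\<^sub>m (M1 a - M2 a))"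
    unfolding AB(2) mmult_sum_left
  proof (intro sum.cong refl)
    fix a assume "a \<in> {..<k}"
    then have a: "a < k" by simp
    have s: "msupp ind (rep_free (B a))" by (rule msupp_rep_free[OF EWt_free(2)[OF B[OF a]]])
    have "mmult ind2 (mtensor (rep_free (A a)) (rep_free (B a))) (mtensor (Ff i) (mone ind))
      = \<sigma> *\<^sub>m mtensor (mmult ind (rep_free (A a)) (Ff i)) (rep_free (B a))"
      unfolding mtensor_mult[OF homog_rep_F[OF B[OF a]] homog_Ff[OF i]] mmult_mone_right[OF finite_ind(1) s] \<sigma>_def
      by (simp only: mult.commute)
    also have "mtensor (mmult ind (rep_free (A a)) (Ff i)) (rep_free (B a)) = \<sigma> *\<^sub>m M0 a + (1 / qdiff) *\<^sub>m (M1 a - M2 a)"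
      unfolding rep_commute[OF A[OF a] i] mtensor_add_left mtensor_smult mtensor_diff_left M0_def M1_def M2_def R1_def R2_def \<sigma>_def ..
    also have "\<sigma> *\<^sub>m (\<sigma> *\<^sub>m M0 a + (1 / qdiff) *\<^sub>m (M1 a - M2 a)) = M0 a + (\<sigma> / qdiff) *\<^sub>m (M1 a - M2 a)"
    proof (intro ext)
      fix p q
      have "\<sigma> * (\<sigma> * x + 1 / qdiff * y) = x + \<sigma> / qdiff * y" for x y
      proof -
        have "\<sigma> * (\<sigma> * x + 1 / qdiff * y) = (\<sigma> * \<sigma>) * x + \<sigma> / qdiff * y" by (simp add: algebra_simps)
        then show ?thesis unfolding \<sigma> by simp
      qed
      then show "(\<sigma> *\<^sub>m (\<sigma> *\<^sub>m M0 a + (1 / qdiff) *\<^sub>m (M1 a - M2 a))) p q = (M0 a + (\<sigma> / qdiff) *\<^sub>m (M1 a - M2 a)) p q"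
        by (simp only: plus_fun_apply msmult_apply)
    qed
    finally show "mmult ind2 (mtensor (rep_free (A a)) (rep_free (B a))) (mtensor (Ff i) (mone ind))
      = M0 a + (\<sigma> / qdiff) *\<^sub>m (M1 a - M2 a)" .
  qed
  have L2: "mmult ind2 (mtensor (Ff i) (mone ind)) (Tw \<mu>) = (\<Sum>a<k. M0 a)"
    unfolding AB(2) mmult_sum_right
  proof (intro sum.cong refl)
    fix a assume "a \<in> {..<k}"
    then have a: "a < k" by simp
    have s: "msupp ind (rep_free (B a))" by (rule msupp_rep_free[OF EWt_free(2)[OF B[OF a]]])
    show "mmult ind2 (mtensor (Ff i) (mone ind)) (mtensor (rep_free (A a)) (rep_free (B a))) = M0 a"
      unfolding mtensor_mult[OF homog_mone homog_rep[OF A[OF a]]] mmult_mone_left[OF finite_ind(1) s] M0_def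
      by (intro ext) simp
  qed
  \<comment> \<open>If \<nu> is outside the lattice, then no word has degree \<nu>, and both the
    derivatives and \<open>Tw \<nu>\<close> vanish. Otherwise t is \<gamma> * e.\<close>
  have "\<exists>t. t = - (\<sigma> / qdiff) \<and> mmult ind2 (Tw \<nu>) (mtensor (Kd i 2) (Ff i)) = (\<Sum>a<k. t *\<^sub>m M1 a)
    \<and> mmult ind2 (mtensor (Kd i (-2)) (Ff i)) (Tw \<nu>) = (\<Sum>a<k. t *\<^sub>m M2 a)"
  proof (cases "\<nu> \<in> pos_root_lattice")
    case False
    have "Z = 0" if Z: "Z \<in> EWt \<nu>" for Z
    proof (rule ccontr)
      assume "Z \<noteq> 0"
      then obtain w where w: "w \<in> Poly_Mapping.keys Z" by (metis keys_eq_empty all_not_in_conv)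
      note k = EWt_keys[OF Z w]
      have "word_deg (map Ge (map letter w)) = \<nu>" unfolding k(1) by (rule k(3))
      then show False using False k(2) unfolding pos_root_lattice_iff by blast
    qed
    then have d: "deriv i C (A a) = 0" if "a < k" for a C
      using deriv_EWt[OF A[OF that]] unfolding \<nu>_def by blast
    have "mtensor 0 Z = 0" for Z by (auto simp: mtensor_def fun_eq_iff)
    then have "M1 a = 0" "M2 a = 0" if "a < k" for a
      unfolding M1_def M2_def R1_def R2_def d[OF that] by simp_all
    moreover have "Tw \<nu> = 0" using False by (simp add: Tw_def)
    moreover have "t *\<^sub>m 0 = (0 :: (nat \<times> nat, K) matr)" for t by (intro ext) simp
    ultimately show ?thesis by simp
  next
    case True
    obtain k' A' B' where AB': "dual_reps \<nu> k' A' B'" "Tw \<nu> = (\<Sum>a<k'. mtensor (rep_free (A' a)) (rep_free (B' a)))"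
      using Tw_reps[OF True] by blast
    have A': "A' a \<in> EWt \<nu>" and B': "B' a \<in> FWt (\<mu> - alpha i)" if "a < k'" for a
      using AB'(1) that unfolding dual_reps_def \<nu>_def by blast+
    define e :: K where "e = (-1) ^ (alpha_par i * wt_par \<nu>)"
    define \<gamma> :: K where "\<gamma> = - ((-1) ^ alpha_par i / qdiff)"
    have \<gamma>: "gam i = K_to_L \<gamma>" unfolding \<gamma>_def by (rule gam_K(1))
    have dE: "deriv i C (A a) \<in> EWt \<nu>" if "a < k" for a C unfolding \<nu>_def by (rule deriv_EWt[OF A[OF that]])
    have c1: "pc (B' b * gen1 (Gf i)) (A a) = \<gamma> * e * pc (B' b) (deriv i (cR i) (A a))"
      and c2: "pc (gen1 (Gf i) * B' b) (A a) = \<gamma> * pc (B' b) (deriv i (cL i) (A a))" if "a < k" "b < k'" for a b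
    proof -
      note d = dual_reps_expand(2)[OF AB'(1) dE[OF that(1)] that(2)]
      show "pc (B' b * gen1 (Gf i)) (A a) = \<gamma> * e * pc (B' b) (deriv i (cR i) (A a))"
        unfolding e_def by (rule pcI) (simp only: P_deriv(1)[OF i B'[OF that(2)] A[OF that(1)]] d K_to_L_mult \<gamma> \<nu>_def K_to_L_sign)
      show "pc (gen1 (Gf i) * B' b) (A a) = \<gamma> * pc (B' b) (deriv i (cL i) (A a))"
        by (rule pcI) (simp only: P_deriv(2)[OF i B'[OF that(2)] A[OF that(1)]] d K_to_L_mult \<gamma>)
    qed
    have ggi: "Gf i \<in> gens" using gens_k_sub i by (auto simp: gens_f_def)
    have FfG: "rep_free (gen1 (Gf i)) = Ff i"
    by (rule rep_free_gen1[OF ggi, THEN trans, OF rep_Gf[OF i]])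
    have gi: "gen1 (Gf i) \<in> free_on gens" using ggi by (rule free_on_gen1)
    have BF: "mmult ind (rep_free (B' b)) (Ff i) = (\<Sum>a<k. (\<gamma> * e * pc (B' b) (deriv i (cR i) (A a))) *\<^sub>m rep_free (B a))"
      "mmult ind (Ff i) (rep_free (B' b)) = (\<Sum>a<k. (\<gamma> * pc (B' b) (deriv i (cL i) (A a))) *\<^sub>m rep_free (B a))" if b: "b < k'" for b
    proof -
      note f = EWt_free(2)[OF B'[OF b]]
      show "mmult ind (rep_free (B' b)) (Ff i) = (\<Sum>a<k. (\<gamma> * e * pc (B' b) (deriv i (cR i) (A a))) *\<^sub>m rep_free (B a))"
        unfolding FfG[symmetric] rep_free_mult[OF f gi, symmetric] dual_reps_expand(3)[OF AB(1) FWt_mult_gen1(1)[OF i B'[OF b]]]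
        using b by (intro sum.cong refl) (simp add: c1)
      show "mmult ind (Ff i) (rep_free (B' b)) = (\<Sum>a<k. (\<gamma> * pc (B' b) (deriv i (cL i) (A a))) *\<^sub>m rep_free (B a))"
        unfolding FfG[symmetric] rep_free_mult[OF gi f, symmetric] dual_reps_expand(3)[OF AB(1) FWt_mult_gen1(2)[OF i B'[OF b]]]
        using b by (intro sum.cong refl) (simp add: c2)
    qed
    have R: "R1 a = (\<Sum>b<k'. pc (B' b) (deriv i (cR i) (A a)) *\<^sub>m rep_free (A' b))"
      "R2 a = (\<Sum>b<k'. pc (B' b) (deriv i (cL i) (A a)) *\<^sub>m rep_free (A' b))" if "a < k" for a
      unfolding R1_def R2_def by (rule dual_reps_expand(1)[OF AB'(1) dE[OF that]])+
    have "mmult ind2 (Tw \<nu>) (mtensor (Kd i 2) (Ff i)) = (\<Sum>b<k'. mtensor (mmult ind (rep_free (A' b)) (Kd i 2)) (mmult ind (rep_free (B' b)) (Ff i)))"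
      unfolding AB'(2) mmult_sum_left
    proof (intro sum.cong refl)
      fix b assume "b \<in> {..<k'}"
      then have b: "b < k'" by simp
      show "mmult ind2 (mtensor (rep_free (A' b)) (rep_free (B' b))) (mtensor (Kd i 2) (Ff i))
          = mtensor (mmult ind (rep_free (A' b)) (Kd i 2)) (mmult ind (rep_free (B' b)) (Ff i))"
        unfolding mtensor_mult[OF homog_rep_F[OF B'[OF b]] homog_Kd] by (intro ext) simp
    qed
    also have "\<dots> = (\<Sum>b<k'. \<Sum>a<k. (\<gamma> * e * pc (B' b) (deriv i (cR i) (A a))) *\<^sub>m mtensor (mmult ind (rep_free (A' b)) (Kd i 2)) (rep_free (B a)))"
      by (intro sum.cong refl) (simp only: BF lessThan_iff mtensor_sum_right mtensor_smult)
    also have "\<dots> = (\<Sum>a<k. \<Sum>b<k'. (\<gamma> * e * pc (B' b) (deriv i (cR i) (A a))) *\<^sub>m mtensor (mmult ind (rep_free (A' b)) (Kd i 2)) (rep_free (B a)))"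
      by (rule sum.swap)
    also have "\<dots> = (\<Sum>a<k. (\<gamma> * e) *\<^sub>m M1 a)"
      unfolding M1_def by (intro sum.cong refl)
        (simp only: R lessThan_iff mmult_sum_left mmult_smult_left mtensor_sum_left mtensor_smult smult_sum smult_smult mult.assoc)
    finally have N1: "mmult ind2 (Tw \<nu>) (mtensor (Kd i 2) (Ff i)) = (\<Sum>a<k. (\<gamma> * e) *\<^sub>m M1 a)" .
    have "mmult ind2 (mtensor (Kd i (-2)) (Ff i)) (Tw \<nu>) = (\<Sum>b<k'. e *\<^sub>m mtensor (mmult ind (Kd i (-2)) (rep_free (A' b))) (mmult ind (Ff i) (rep_free (B' b))))"
      unfolding AB'(2) mmult_sum_right e_def
    proof (intro sum.cong refl)
      fix b assume "b \<in> {..<k'}"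
      then have b: "b < k'" by simp
      show "mmult ind2 (mtensor (Kd i (-2)) (Ff i)) (mtensor (rep_free (A' b)) (rep_free (B' b)))
          = (-1) ^ (alpha_par i * wt_par \<nu>) *\<^sub>m mtensor (mmult ind (Kd i (-2)) (rep_free (A' b))) (mmult ind (Ff i) (rep_free (B' b)))"
        by (rule mtensor_mult[OF homog_Ff[OF i] homog_rep[OF A'[OF b]]])
    qed
    also have "\<dots> = (\<Sum>b<k'. \<Sum>a<k. (e * \<gamma> * pc (B' b) (deriv i (cL i) (A a))) *\<^sub>m mtensor (mmult ind (Kd i (-2)) (rep_free (A' b))) (rep_free (B a)))"
      by (intro sum.cong refl) (simp only: BF lessThan_iff mtensor_sum_right mtensor_smult smult_sum smult_smult mult.assoc)
    also have "\<dots> = (\<Sum>a<k. \<Sum>b<k'. (e * \<gamma> * pc (B' b) (deriv i (cL i) (A a))) *\<^sub>m mtensor (mmult ind (Kd i (-2)) (rep_free (A' b))) (rep_free (B a)))"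
      by (rule sum.swap)
    also have "\<dots> = (\<Sum>a<k. (e * \<gamma>) *\<^sub>m M2 a)"
      unfolding M2_def by (intro sum.cong refl)
        (simp only: R lessThan_iff mmult_sum_right mmult_smult_right mtensor_sum_left mtensor_smult smult_sum smult_smult mult.assoc)
    finally have N2: "mmult ind2 (mtensor (Kd i (-2)) (Ff i)) (Tw \<nu>) = (\<Sum>a<k. (\<gamma> * e) *\<^sub>m M2 a)"
      by (simp only: mult.commute)
    \<comment> \<open>The parities of \<mu> and \<nu> differ by that of f_i. This makes the scalar
      of both sums cancel the derivative terms of \<open>L1\<close>.\<close>
    have "even (alpha_par i + wt_par \<nu> + wt_par \<mu>)"
      unfolding \<nu>_def by (rule pos_root_lattice_step(2)[OF i True[unfolded \<nu>_def]])
    then have "even (wt_par \<mu> + (alpha_par i + wt_par \<nu>))" by (simp add: add_ac)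
    from minus_one_par[OF this, of "alpha_par i", where 'a=K]
    have "\<sigma> = (-1) ^ alpha_par i * e"
      unfolding \<sigma>_def e_def distrib_left power_add alpha_par_sq .
    then have "\<gamma> * e = - (\<sigma> / qdiff)" by (simp add: \<gamma>_def)
    with N1 N2 show ?thesis by metis
  qed
  then obtain t where t: "t = - (\<sigma> / qdiff)" "mmult ind2 (Tw \<nu>) (mtensor (Kd i 2) (Ff i)) = (\<Sum>a<k. t *\<^sub>m M1 a)"
    "mmult ind2 (mtensor (Kd i (-2)) (Ff i)) (Tw \<nu>) = (\<Sum>a<k. t *\<^sub>m M2 a)" by blast
  have "(M0 a + (\<sigma> / qdiff) *\<^sub>m (M1 a - M2 a)) + t *\<^sub>m M1 a = M0 a + t *\<^sub>m M2 a" for a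
  proof (intro ext)
    fix p q
    have "(x + \<sigma> / qdiff * (y - z)) + t * y = x + t * z" for x y z
      unfolding t(1) by (simp add: algebra_simps diff_divide_distrib)
    then show "((M0 a + (\<sigma> / qdiff) *\<^sub>m (M1 a - M2 a)) + t *\<^sub>m M1 a) p q = (M0 a + t *\<^sub>m M2 a) p q"
      by (simp only: plus_fun_apply msmult_apply minus_apply)
  qed
  note E = this
  show ?thesis
    unfolding \<nu>_def[symmetric] L1 L2 t(2,3) sum.distrib[symmetric] by (simp only: E)
qed

end

section \<open>The intertwining property\<close>

context osp_theta
begin

lemma Tw_msupp: "msupp ind2 (Tw \<mu>)"
proof (cases "\<mu> \<in> pos_root_lattice")
  case True
  then obtain k A B where AB: "dual_reps \<mu> k A B" "Tw \<mu> = (\<Sum>a<k. mtensor (rep_free (A a)) (rep_free (B a)))"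
    using Tw_reps by blast
  then have "A a \<in> free_on gens" "B a \<in> free_on gens" if "a < k" for a
    using EWt_free that unfolding dual_reps_def by blast+
  then show ?thesis unfolding AB(2) by (intro msupp_sum msupp_mtensor msupp_rep_free) simp_all
qed (simp add: Tw_def msupp_zero)

lemma Tw_entry:
  assumes "Tw \<mu> (a, b) (c, d) \<noteq> 0"
  shows "eps a = eps c + \<mu>" "c = 1 \<Longrightarrow> \<mu> = 0"
proof -
  have \<mu>: "\<mu> \<in> pos_root_lattice" using assms by (auto simp: Tw_def split: if_splits)
  then obtain k A B where AB: "dual_reps \<mu> k A B" "Tw \<mu> = (\<Sum>a<k. mtensor (rep_free (A a)) (rep_free (B a)))"
    using Tw_reps by blast
  have "\<exists>j\<in>{..<k}. mtensor (rep_free (A j)) (rep_free (B j)) (a, b) (c, d) \<noteq> 0"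
    using assms unfolding AB(2) sum_matr_apply by (rule contrapos_np) (auto intro: sum.neutral)
  then obtain j where j: "j < k" "mtensor (rep_free (A j)) (rep_free (B j)) (a, b) (c, d) \<noteq> 0" by blast
  then have n: "rep_free (A j) a c \<noteq> 0" by (simp add: mtensor_def)
  have A: "A j \<in> EWt \<mu>" using AB(1) j unfolding dual_reps_def by blast
  show "eps a = eps c + \<mu>" by (rule rep_wt[OF A n])
  show "\<mu> = 0" if "c = 1" using rep_first_col[OF A] n that by blast
qed

definition S0 :: "weight set" where "S0 = insert 0 {\<mu>. Tw \<mu> \<noteq> 0}"

text \<open>A nonzero entry moves some v_c to some v_a in the first leg, so \<mu> is a difference of
  two weights of V.\<close>

lemma finite_S0: "finite S0"
proof -
  have "\<mu> \<in> (\<lambda>(a, c). eps a - eps c) ` (ind \<times> ind)" if n: "Tw \<mu> \<noteq> 0" for \<mu>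
  proof -
    obtain p q where pq: "Tw \<mu> p q \<noteq> 0" using n by (auto simp: fun_eq_iff)
    obtain a b c d where e: "p = (a, b)" "q = (c, d)" by (metis surj_pair)
    have "p \<in> ind2" "q \<in> ind2" using msuppD[OF Tw_msupp[of \<mu>], of p q] pq by blast+
    then have "a \<in> ind" "c \<in> ind" by (auto simp: e ind2_def)
    moreover have "\<mu> = eps a - eps c" using Tw_entry(1)[OF pq[unfolded e]] by simp
    ultimately show ?thesis by (intro image_eqI[of _ _ "(a, c)"]) simp_all
  qed
  then have "{\<mu>. Tw \<mu> \<noteq> 0} \<subseteq> (\<lambda>(a, c). eps a - eps c) ` (ind \<times> ind)" by blast
  moreover have "finite ((\<lambda>(a, c). eps a - eps c) ` (ind \<times> ind))" using finite_ind(1) by blast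
  ultimately show ?thesis unfolding S0_def using finite_subset by blast
qed

text \<open>The index set may be any finite superset, so that \<Theta> can be summed over \<mu> and
  over \<mu> - alpha i at once.\<close>

lemma Theta_eq:
  assumes "finite S" "S0 \<subseteq> S"
  shows "Theta xs ys = (\<Sum>\<mu>\<in>S. Tw \<mu>)"
proof -
  let ?M = "{\<mu> \<in> pos_root_lattice - {0}. Theta_wt xs ys \<mu> \<noteq> 0}"
  have M: "?M \<subseteq> S0" by (auto simp: S0_def Tw_def)
  then have fM: "finite ?M" using finite_S0 finite_subset by blast
  have T0: "Tw 0 = mone ind2" by (simp add: Tw_def pos_root_lattice_0)
  have "Theta xs ys = Tw 0 + (\<Sum>\<mu>\<in>?M. Tw \<mu>)"
    unfolding Theta_def T0 by (intro arg_cong2[of _ _ _ _ "(+)"] refl sum.cong) (auto simp: Tw_def)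
  also have "\<dots> = (\<Sum>\<mu>\<in>insert 0 ?M. Tw \<mu>)" using fM by simp
  also have "\<dots> = (\<Sum>\<mu>\<in>S. Tw \<mu>)"
  proof (rule sum.mono_neutral_left[OF assms(1)])
    show "insert 0 ?M \<subseteq> S" using M assms(2) by (auto simp: S0_def)
    show "\<forall>\<mu>\<in>S - insert 0 ?M. Tw \<mu> = 0" by (auto simp: Tw_def)
  qed
  finally show ?thesis .
qed

lemma msupp_Theta: "msupp ind2 (Theta xs ys)"
  unfolding Theta_eq[OF finite_S0 order_refl] by (intro msupp_sum Tw_msupp)

lemma Theta_first_col: "Theta xs ys p (1, w) = mone ind2 p (1, w)"
proof -
  have "Tw \<mu> p (1, w) = 0" if "\<mu> \<noteq> 0" for \<mu>
    using Tw_entry(2)[of \<mu> "fst p" "snd p" 1 w] that by auto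
  then have "(\<Sum>\<mu>\<in>S0. Tw \<mu> p (1, w)) = (\<Sum>\<mu>\<in>{0}. Tw \<mu> p (1, w))"
    using finite_S0 by (intro sum.mono_neutral_right) (auto simp: S0_def)
  then show ?thesis
    unfolding Theta_eq[OF finite_S0 order_refl] sum_matr_apply by (simp add: Tw_def pos_root_lattice_0)
qed

text \<open>The form f_i \<otimes> 1 + q^(k h_i/2) \<otimes> f_i taken by the coproduct, for k = 2,
  and by its opposite, for k = -2, after conjugation with \<open>f_half\<close>.\<close>

definition Mk :: "nat \<Rightarrow> int \<Rightarrow> (nat \<times> nat, K) matr" where
  "Mk i k = mtensor (Ff i) (mone ind) + mtensor (Kd i k) (Ff i)"

lemma Theta_relation:
  assumes i: "i \<in> {1..s}"
  shows "mmult ind2 (Theta xs ys) (Mk i 2) = mmult ind2 (Mk i (-2)) (Theta xs ys)"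
proof -
  \<comment> \<open>Large enough that both \<open>?S\<close> and its translate by - alpha i contain
    \<open>S0\<close>.\<close>
  let ?S = "S0 \<union> (\<lambda>\<mu>. \<mu> + alpha i) ` S0"
  have S: "finite ?S" "S0 \<subseteq> ?S" using finite_S0 by auto
  have "S0 \<subseteq> (\<lambda>\<mu>. \<mu> - alpha i) ` ?S"
  proof
    fix \<mu> assume "\<mu> \<in> S0"
    then have "\<mu> + alpha i \<in> ?S" by blast
    then have "(\<mu> + alpha i) - alpha i \<in> (\<lambda>\<mu>. \<mu> - alpha i) ` ?S" by (rule imageI)
    then show "\<mu> \<in> (\<lambda>\<mu>. \<mu> - alpha i) ` ?S" by (simp only: add_diff_cancel_right')
  qed
  moreover have "finite ((\<lambda>\<mu>. \<mu> - alpha i) ` ?S)" using S(1) by (rule finite_imageI)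
  ultimately have "Theta xs ys = (\<Sum>\<mu>\<in>(\<lambda>\<mu>. \<mu> - alpha i) ` ?S. Tw \<mu>)" using Theta_eq by blast
  also have "\<dots> = (\<Sum>\<mu>\<in>?S. Tw (\<mu> - alpha i))"
    by (subst sum.reindex) (auto simp: inj_on_def)
  finally have 2: "Theta xs ys = (\<Sum>\<mu>\<in>?S. Tw (\<mu> - alpha i))" .
  note 1 = Theta_eq[OF S]
  have "mmult ind2 (Theta xs ys) (Mk i 2)
    = mmult ind2 (Theta xs ys) (mtensor (Ff i) (mone ind)) + mmult ind2 (Theta xs ys) (mtensor (Kd i 2) (Ff i))"
    unfolding Mk_def mmult_add_right ..
  also have "\<dots> = mmult ind2 (\<Sum>\<mu>\<in>?S. Tw \<mu>) (mtensor (Ff i) (mone ind))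
    + mmult ind2 (\<Sum>\<mu>\<in>?S. Tw (\<mu> - alpha i)) (mtensor (Kd i 2) (Ff i))"
    by (simp only: 1[symmetric] 2[symmetric])
  also have "\<dots> = mmult ind2 (mtensor (Ff i) (mone ind)) (\<Sum>\<mu>\<in>?S. Tw \<mu>)
    + mmult ind2 (mtensor (Kd i (-2)) (Ff i)) (\<Sum>\<mu>\<in>?S. Tw (\<mu> - alpha i))"
    unfolding mmult_sum_left mmult_sum_right sum.distrib[symmetric] by (intro sum.cong refl Tw_relation i)
  also have "\<dots> = mmult ind2 (mtensor (Ff i) (mone ind)) (Theta xs ys) + mmult ind2 (mtensor (Kd i (-2)) (Ff i)) (Theta xs ys)"
    by (simp only: 1[symmetric] 2[symmetric])
  also have "\<dots> = mmult ind2 (Mk i (-2)) (Theta xs ys)"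
    unfolding Mk_def mmult_add_left ..
  finally show ?thesis .
qed

lemma matr2_eqI:
  assumes "msupp ind2 A" "msupp ind2 B"
    and "\<And>a b c d. a \<in> ind \<Longrightarrow> b \<in> ind \<Longrightarrow> c \<in> ind \<Longrightarrow> d \<in> ind \<Longrightarrow> A (a, b) (c, d) = B (a, b) (c, d)"
  shows "A = B"
proof (intro ext)
  fix p q
  show "A p q = B p q"
  proof (cases "p \<in> ind2 \<and> q \<in> ind2")
    case True
    then show ?thesis using assms(3) by (cases p; cases q) (auto simp: ind2_def)
  next
    case False
    then show ?thesis using msuppD[OF assms(1), of p q] msuppD[OF assms(2), of p q] by auto
  qed
qed

section \<open>Conjugation by the weight factor\<close>

lemma f_half_entry: "f_half (a, b) (c, d) = (if c \<in> ind \<and> d \<in> ind \<and> a = c \<and> b = d then xq powi (- ee c d) else 0)"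
proof -
  have "qpow (- form (eps c) (eps d) / 2) = xq powi (- ee c d)" if "c \<in> ind" "d \<in> ind"
    using that by (intro qpow_eq) (simp add: form_eps)
  then show ?thesis by (auto simp: f_half_def ind2_def)
qed

lemma msupp_f_half: "msupp ind2 f_half"
  by (auto simp: msupp_def f_half_entry ind2_def)

lemma mmult_f_half_left:
  assumes "a \<in> ind" "b \<in> ind"
  shows "mmult ind2 f_half A (a, b) q = xq powi (- ee a b) * A (a, b) q"
proof -
  have "mmult ind2 f_half A (a, b) q = (\<Sum>k\<in>ind2. if k = (a, b) then xq powi (- ee a b) * A (a, b) q else 0)"
    unfolding mmult_def using assms by (intro sum.cong) (auto simp: f_half_entry ind2_def split: if_splits)
  then show ?thesis using assms finite_ind by (simp add: ind2_def)
qed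

lemma mmult_f_half_right:
  assumes "c \<in> ind" "d \<in> ind"
  shows "mmult ind2 A f_half p (c, d) = A p (c, d) * xq powi (- ee c d)"
proof -
  have "mmult ind2 A f_half p (c, d) = (\<Sum>k\<in>ind2. if k = (c, d) then A p (c, d) * xq powi (- ee c d) else 0)"
    unfolding mmult_def using assms by (intro sum.cong) (auto simp: f_half_entry ind2_def split: if_splits)
  then show ?thesis using assms finite_ind by (simp add: ind2_def)
qed

lemma Mk_entry:
  assumes "a \<in> ind" "b \<in> ind" "c \<in> ind" "d \<in> ind"
  shows "Mk i k (a, b) (c, d) = of_bool (b = d) * Ff i a c
    + of_bool (a = c) * xq powi (k * hh i c) * (-1) ^ ((par b + par d) * par c) * Ff i b d"
  using assms by (auto simp: Mk_def mtensor_def mone_def Kd_def power_mult simp flip: mult_2)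

lemma Dl_entry:
  assumes "a \<in> ind" "b \<in> ind" "c \<in> ind" "d \<in> ind"
  shows "Dl i x (a, b) (c, d) = of_bool (b = d) * Ff i a c * x powi (- hh i d)
    + of_bool (a = c) * x powi hh i c * (-1) ^ ((par b + par d) * par c) * Ff i b d"
  using assms by (simp add: Dl_def ind2_def)

lemma msupp_Mk: "i \<in> {1..s} \<Longrightarrow> msupp ind2 (Mk i k)"
  unfolding Mk_def by (intro msupp_add msupp_mtensor msupp_Ff msupp_mone msupp_Kd)

lemma f_half_conj_alg:
  fixes u :: K
  assumes "x1 * f1 * (u * v1) = x1 * f1 * w" "x2 * f2 * (u * v2) = x2 * f2 * (v3 * w)"
  shows "u * (x1 * f1 * v1 + x2 * v2 * t * f2) = (x1 * f1 + x2 * v3 * t * f2) * w"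
proof -
  have "u * (x1 * f1 * v1 + x2 * v2 * t * f2) = x1 * f1 * (u * v1) + t * (x2 * f2 * (u * v2))"
    by (simp add: algebra_simps)
  then show ?thesis unfolding assms by (simp add: algebra_simps)
qed

lemma f_half_conj_alg':
  fixes u :: K
  assumes "x1 * f1 * u = x1 * f1 * (v1 * w)" "x2 * f2 * (u * v2) = x2 * f2 * (v3 * w)"
  shows "u * (x1 * f1 + x2 * v2 * t * f2) = (x1 * f1 * v1 + x2 * v3 * t * f2) * w"
proof -
  have "u * (x1 * f1 + x2 * v2 * t * f2) = x1 * f1 * u + t * (x2 * f2 * (u * v2))"
    by (simp add: algebra_simps)
  then show ?thesis unfolding assms by (simp add: algebra_simps)
qed

text \<open>f_i in one leg changes the exponent of \<open>f_half\<close> by the eigenvalue of h_i on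
  the other leg. This cancels the torus factor of f_i \<otimes> q^(-h_i/2) and doubles that of
  q^(h_i/2) \<otimes> f_i; the second equation is the same effect read backwards for the opposite
  coproduct.\<close>

lemma f_half_Dl:
  assumes i: "i \<in> {1..s}"
  shows "mmult ind2 f_half (Dl i xq) = mmult ind2 (Mk i 2) f_half"
    and "mmult ind2 f_half (Mk i (-2)) = mmult ind2 (Dl i (inverse xq)) f_half"
proof -
  have inv: "inverse xq powi k = xq powi (- k)" for k by (simp add: power_int_minus power_int_inverse)
  have e1: "ee a b = ee c d - hh i d" if "b = d" "Ff i a c \<noteq> 0" "a \<in> ind" "c \<in> ind" "d \<in> ind" for a b c d
    using ee_Ff[OF i that(2) that(5)] ee_sym[OF that(3,5)] ee_sym[OF that(4,5)] that(1) by simp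
  have e2: "ee a b = ee c d - hh i c" if "a = c" "Ff i b d \<noteq> 0" "a \<in> ind" for a b c d
    using ee_Ff[OF i that(2,3)] that(1) by simp
  show "mmult ind2 f_half (Dl i xq) = mmult ind2 (Mk i 2) f_half"
  proof (intro matr2_eqI msupp_mmult msupp_f_half msupp_Dl msupp_Mk i)
    fix a b c d assume I: "a \<in> ind" "b \<in> ind" "c \<in> ind" "d \<in> ind"
    show "mmult ind2 f_half (Dl i xq) (a, b) (c, d) = mmult ind2 (Mk i 2) f_half (a, b) (c, d)"
      unfolding mmult_f_half_left[OF I(1,2)] mmult_f_half_right[OF I(3,4)] Mk_entry[OF I] Dl_entry[OF I]
    proof (rule f_half_conj_alg)
      show "of_bool (b = d) * Ff i a c * (xq powi (- ee a b) * xq powi (- hh i d)) = of_bool (b = d) * Ff i a c * xq powi (- ee c d)"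
      proof (cases "b = d \<and> Ff i a c \<noteq> 0")
        case True
        then show ?thesis unfolding power_int_add[OF disjI1[OF xq_nz], symmetric] using e1[of b d a c] I by simp
      qed auto
      show "of_bool (a = c) * Ff i b d * (xq powi (- ee a b) * xq powi hh i c) = of_bool (a = c) * Ff i b d * (xq powi (2 * hh i c) * xq powi (- ee c d))"
      proof (cases "a = c \<and> Ff i b d \<noteq> 0")
        case True
        then show ?thesis unfolding power_int_add[OF disjI1[OF xq_nz], symmetric] using e2[of a c b d] I by simp
      qed auto
    qed
  qed
  show "mmult ind2 f_half (Mk i (-2)) = mmult ind2 (Dl i (inverse xq)) f_half"
  proof (intro matr2_eqI msupp_mmult msupp_f_half msupp_Dl msupp_Mk i)
    fix a b c d assume I: "a \<in> ind" "b \<in> ind" "c \<in> ind" "d \<in> ind"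
    show "mmult ind2 f_half (Mk i (-2)) (a, b) (c, d) = mmult ind2 (Dl i (inverse xq)) f_half (a, b) (c, d)"
      unfolding mmult_f_half_left[OF I(1,2)] mmult_f_half_right[OF I(3,4)] Mk_entry[OF I] Dl_entry[OF I] inv minus_minus
    proof (rule f_half_conj_alg')
      show "of_bool (b = d) * Ff i a c * xq powi (- ee a b) = of_bool (b = d) * Ff i a c * (xq powi (hh i d) * xq powi (- ee c d))"
      proof (cases "b = d \<and> Ff i a c \<noteq> 0")
        case True
        then show ?thesis unfolding power_int_add[OF disjI1[OF xq_nz], symmetric] using e1[of b d a c] I by simp
      qed auto
      show "of_bool (a = c) * Ff i b d * (xq powi (- ee a b) * xq powi (-2 * hh i c)) = of_bool (a = c) * Ff i b d * (xq powi (- hh i c) * xq powi (- ee c d))"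
      proof (cases "a = c \<and> Ff i b d \<noteq> 0")
        case True
        then show ?thesis unfolding power_int_add[OF disjI1[OF xq_nz], symmetric] using e2[of a c b d] I by simp
      qed auto
    qed
  qed
qed

lemma f_half_Theta_f_half: "mmult ind2 f_half (mmult ind2 (Theta xs ys) f_half) = R_zero"
proof -
  let ?W = "mmult ind2 f_half (mmult ind2 (Theta xs ys) f_half)"
  note as = mmult_assoc[OF finite_ind(2)]
  have W: "msupp ind2 ?W" by (intro msupp_mmult msupp_f_half msupp_Theta)
  have "mmult ind2 (?W - Rx xq) (Dl i xq) = mmult ind2 (Dl i (inverse xq)) (?W - Rx xq)" if i: "i \<in> {1..s}" for i
  proof -
    have "mmult ind2 ?W (Dl i xq) = mmult ind2 f_half (mmult ind2 (mmult ind2 (Theta xs ys) (Mk i 2)) f_half)"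
      unfolding as f_half_Dl(1)[OF i] ..
    also have "\<dots> = mmult ind2 (mmult ind2 f_half (Mk i (-2))) (mmult ind2 (Theta xs ys) f_half)"
      unfolding Theta_relation[OF i] as ..
    also have "\<dots> = mmult ind2 (Dl i (inverse xq)) ?W"
      unfolding f_half_Dl(2)[OF i] as ..
    finally show ?thesis unfolding mmult_diff_left mmult_diff_right Rx_comm[OF xq_nz i] by simp
  qed
  moreover have "(?W - Rx xq) p (1, w) = 0" if w: "w \<in> ind" for p w
  proof (cases "p \<in> ind2")
    case True
    then obtain a b where p: "p = (a, b)" "a \<in> ind" "b \<in> ind" by (auto simp: ind2_def)
    have 1: "1 \<in> ind" using w by (auto simp: ind_def)
    \<comment> \<open>\<Theta> fixes v_1 \<otimes> v_w, and each of the two factors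
      \<open>f_half\<close> contributes \<open>xq powi (- ee 1 w)\<close>.\<close>
    have "?W p (1, w) = xq powi (- ee a b) * (mone ind2 p (1, w) * xq powi (- ee 1 w))"
      unfolding p(1) mmult_f_half_left[OF p(2,3)] mmult_f_half_right[OF 1 w] Theta_first_col ..
    also have "\<dots> = of_bool (p = (1, w)) * xq powi (- 2 * ee 1 w)"
      using p 1 w by (auto simp: mone_def ind2_def simp flip: power_int_add)
    finally show ?thesis by (simp only: minus_apply Rx_first_col[OF w] diff_self)
  next
    case False
    then show ?thesis using msuppD[OF W, of p "(1, w)"] msuppD[OF msupp_Rx, of p "(1, w)"] by simp
  qed
  ultimately have "?W - Rx xq = 0"
    by (intro intertwiner_eq_0[OF xq_nz, where G = "\<lambda>i. Dl i (inverse xq)"] msupp_diff W msupp_Rx)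
  then show ?thesis unfolding R_zero_eq by simp
qed

lemma R_hat_eq: "R_hat xs ys = comp2 tau R_zero"
  unfolding R_hat_def comp2_def f_half_Theta_f_half ..

end

theorem theorem4p6:
  fixes m n :: nat
    and par :: "nat \<Rightarrow> nat"
    and th :: "nat \<Rightarrow> int"
    and P :: "free set \<Rightarrow> free set \<Rightarrow> L"
    and xs ys :: "(nat \<Rightarrow> rat) \<Rightarrow> free set list"
  assumes "osp m n par th"
    and "osp.J_pairing m n par P"
    and "osp.dual_bases m n par P xs ys"
  shows "osp.R_hat m n par th xs ys = osp.comp2 m n (osp.tau m n par) (osp.R_zero m n par th)
    \<and> osp.comp2 m n (osp.R_hat m n par th xs ys)
          (osp.comp2 m n (osp.tau m n par) (osp.R_infinity m n par th)) = mone (osp.ind2 m n)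
    \<and> osp.comp2 m n (osp.comp2 m n (osp.tau m n par) (osp.R_infinity m n par th))
          (osp.R_hat m n par th xs ys) = mone (osp.ind2 m n)"
proof -
  interpret osp_theta m n par th P xs ys
    by (intro osp_theta.intro osp_pairing.intro osp_pairing_axioms.intro osp_theta_axioms.intro assms)
  show ?thesis
    unfolding R_hat_eq comp2_def using tau_R_inverse by blast
qed

end
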